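(* An abelian group $A$ is strong if and only if there is only a finite number of primes $p$ such that $A/pA$ is infinite and for all primes $p$ the group $(p^nA)[p]/(p^{n+1}A)[p]$ is infinite only for finitely many $n$. Furthermore, strong abelian groups are precisely those which are elementarily equivalent to a group of the form $$\bigoplus_p\left(\bigoplus_{n>0}\mathbb Z(p^n)^{(\alpha_{p,n})}\oplus(\mathbb Z_{(p)})^{(\beta_p)}\oplus\mathbb Z(p^\infty)^{(\gamma_p)}\right)\oplus\mathbb Q^{(\delta)}$$ (each $\alpha_{p,n},\beta_p,\gamma_p,\delta$ finite or $\omega$) with $\beta_p=\omega$ only for finitely many primes $p$, only a finite number of pairs $(p,n)$ such that $\alpha_{p,n}=\omega$, and only finitely many primes $p$ with $\alpha_{p,n}\ne0$ for infinitely many $n$.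
   Context: Abelian groups are written additively and viewed as structures in the pure language of abelian groups; their theories are stable. For a group $B$, $B[p]=\{b\in B:pb=0\}$, and $B^{(\alpha)}$ is the direct sum of $\alpha$ copies of $B$. $p$ ranges over primes; $\mathbb Z(p^n)$ is the cyclic group of order $p^n$, $\mathbb Z_{(p)}$ is the additive group of rationals with denominator not divisible by $p$, $\mathbb Z(p^\infty)$ is the Prüfer $p$-group. An inp-pattern of depth $\kappa$ for a partial type $\pi(x)$ is a sequence of formulas $(\varphi^\alpha(x,y^\alpha))_{\alpha<\kappa}$ together with natural numbers $(k^\alpha)_{\alpha<\kappa}$ such that there is an array of tuples $(b_i^\alpha)_{\alpha<\kappa,i<\omega}$ in a sufficiently saturated model for which each row $\{\varphi^\alpha(x,b_i^\alpha)\}_{i<\omega}$ is $k^\alpha$-inconsistent, while for every $\eta:\kappa\to\omega$ the path $\pi(x)\cup\{\varphi^\alpha(x,b^\alpha_{\eta(\alpha)})\}_{\alpha<\kappa}$ is consistent. A stable theory (or structure) is strong if there is no inp-pattern of infinite depth for $\{x=x\}$. *)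

theory Defs
  imports
    "HOL-Algebra.Product_Groups"
    "HOL-Algebra.Coset"
    "HOL-Computational_Algebra.Primes"
    "HOL-Library.Extended_Nat"
    "HOL-Library.Countable_Set"
begin

text \<open>
  Abelian groups are the commutative groups of HOL-Algebra, whose notation is multiplicative: the
  sum, zero, the negative and the multiple \<open>n x\<close> of additive notation are \<open>\<otimes>\<close>, \<open>\<one>\<close>, \<open>inv\<close> and
  \<open>x [^] n\<close>.
\<close>

section \<open>First-order logic of abelian groups\<close>

text \<open>
  Formulas use de Bruijn indices: under \<^term>\<open>Exists\<close>, index 0 is the bound variable, and the
  outer variables are shifted by one.
\<close>

datatype ag_term = Var nat | Zero | Plus ag_term ag_term | Minus ag_term

datatype ag_form =
    Equal ag_term ag_term
  | Negation ag_form
  | Conj ag_form ag_form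
  | Exists ag_form

primrec term_val :: "('m, 'e) monoid_scheme \<Rightarrow> (nat \<Rightarrow> 'm) \<Rightarrow> ag_term \<Rightarrow> 'm" where
  "term_val M v (Var i) = v i"
| "term_val M v Zero = \<one>\<^bsub>M\<^esub>"
| "term_val M v (Plus s t) = term_val M v s \<otimes>\<^bsub>M\<^esub> term_val M v t"
| "term_val M v (Minus t) = inv\<^bsub>M\<^esub> (term_val M v t)"

primrec sat :: "('m, 'e) monoid_scheme \<Rightarrow> (nat \<Rightarrow> 'm) \<Rightarrow> ag_form \<Rightarrow> bool" where
  "sat M v (Equal s t) \<longleftrightarrow> term_val M v s = term_val M v t"
| "sat M v (Negation \<phi>) \<longleftrightarrow> \<not> sat M v \<phi>"
| "sat M v (Conj \<phi> \<psi>) \<longleftrightarrow> sat M v \<phi> \<and> sat M v \<psi>"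
| "sat M v (Exists \<phi>) \<longleftrightarrow> (\<exists>a\<in>carrier M. sat M (case_nat a v) \<phi>)"

primrec term_below :: "nat \<Rightarrow> ag_term \<Rightarrow> bool" where
  "term_below n (Var i) \<longleftrightarrow> i < n"
| "term_below n Zero \<longleftrightarrow> True"
| "term_below n (Plus s t) \<longleftrightarrow> term_below n s \<and> term_below n t"
| "term_below n (Minus t) \<longleftrightarrow> term_below n t"

text \<open>All free variables of the formula have index less than \<open>n\<close>.\<close>

primrec form_below :: "nat \<Rightarrow> ag_form \<Rightarrow> bool" where
  "form_below n (Equal s t) \<longleftrightarrow> term_below n s \<and> term_below n t"
| "form_below n (Negation \<phi>) \<longleftrightarrow> form_below n \<phi>"
| "form_below n (Conj \<phi> \<psi>) \<longleftrightarrow> form_below n \<phi> \<and> form_below n \<psi>"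
| "form_below n (Exists \<phi>) \<longleftrightarrow> form_below (Suc n) \<phi>"

abbreviation sentence :: "ag_form \<Rightarrow> bool" where
  "sentence \<equiv> form_below 0"

text \<open>The truth of a sentence does not depend on the assignment chosen here.\<close>

definition models :: "('m, 'e) monoid_scheme \<Rightarrow> ag_form \<Rightarrow> bool" where
  "models M \<phi> \<longleftrightarrow> sat M (\<lambda>_. \<one>\<^bsub>M\<^esub>) \<phi>"

definition elem_equiv :: "('m, 'e) monoid_scheme \<Rightarrow> ('n, 'f) monoid_scheme \<Rightarrow> bool" where
  "elem_equiv M N \<longleftrightarrow> (\<forall>\<phi>. sentence \<phi> \<longrightarrow> (models M \<phi> \<longleftrightarrow> models N \<phi>))"


section \<open>Partial types, saturation and strong groups\<close>

text \<open>
  A formula \<open>\<phi>(x, b)\<close> with parameters is a pair \<open>(\<phi>, b)\<close>: index 0 of \<open>\<phi>\<close> is the variable \<open>x\<close>, and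
  index \<open>i + 1\<close> is the parameter \<open>b i\<close>. Only the finitely many \<open>b i\<close> whose variables occur in \<open>\<phi>\<close>
  matter, so the infinite sequence \<open>b\<close> stands for a finite tuple of parameters.
\<close>

type_synonym 'm pform = "ag_form \<times> (nat \<Rightarrow> 'm)"

definition holds_at :: "('m, 'e) monoid_scheme \<Rightarrow> 'm \<Rightarrow> 'm pform \<Rightarrow> bool" where
  "holds_at M x \<theta> \<longleftrightarrow> sat M (case_nat x (snd \<theta>)) (fst \<theta>)"

definition realized :: "('m, 'e) monoid_scheme \<Rightarrow> 'm pform set \<Rightarrow> bool" where
  "realized M \<Gamma> \<longleftrightarrow> (\<exists>x\<in>carrier M. \<forall>\<theta>\<in>\<Gamma>. holds_at M x \<theta>)"

text \<open>Consistency with the elementary diagram of \<open>M\<close>, i.e. finite satisfiability in \<open>M\<close>.\<close>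

definition consistent :: "('m, 'e) monoid_scheme \<Rightarrow> 'm pform set \<Rightarrow> bool" where
  "consistent M \<Gamma> \<longleftrightarrow> (\<forall>\<Delta>\<subseteq>\<Gamma>. finite \<Delta> \<longrightarrow> realized M \<Delta>)"

definition aleph1_saturated :: "('m, 'e) monoid_scheme \<Rightarrow> bool" where
  "aleph1_saturated M \<longleftrightarrow>
    (\<forall>C \<Gamma>. C \<subseteq> carrier M \<and> countable C \<and> (\<forall>\<theta>\<in>\<Gamma>. range (snd \<theta>) \<subseteq> C) \<and> consistent M \<Gamma>
      \<longrightarrow> realized M \<Gamma>)"

text \<open>
  As usual, inconsistency of a row refers to \<open>k\<close> distinct positions in the row, not to \<open>k\<close> distinct
  formulas.
\<close>

definition k_inconsistent :: "('m, 'e) monoid_scheme \<Rightarrow> nat \<Rightarrow> (nat \<Rightarrow> 'm pform) \<Rightarrow> bool" where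
  "k_inconsistent M k r \<longleftrightarrow>
    (\<forall>S. finite S \<and> card S = k \<longrightarrow> \<not> consistent M (r ` S))"

text \<open>
  The depth of the pattern is the cardinality of the index set \<open>I\<close>; the array \<open>b\<close> is taken in the
  given model \<open>M\<close>, which is meant to be sufficiently saturated.
\<close>

definition inp_pattern ::
  "('m, 'e) monoid_scheme \<Rightarrow> 'm pform set \<Rightarrow> 'i set \<Rightarrow> ('i \<Rightarrow> ag_form) \<Rightarrow> ('i \<Rightarrow> nat) \<Rightarrow> bool" where
  "inp_pattern M \<pi> I \<phi> k \<longleftrightarrow>
    (\<exists>b. (\<forall>\<alpha>\<in>I. \<forall>i. range (b \<alpha> i) \<subseteq> carrier M) \<and>
         (\<forall>\<alpha>\<in>I. k_inconsistent M (k \<alpha>) (\<lambda>i::nat. (\<phi> \<alpha>, b \<alpha> i))) \<and>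
         (\<forall>\<eta>. consistent M (\<pi> \<union> (\<lambda>\<alpha>. (\<phi> \<alpha>, b \<alpha> (\<eta> \<alpha>))) ` I)))"

definition x_eq_x :: "('m, 'e) monoid_scheme \<Rightarrow> 'm pform set" where
  "x_eq_x M = {(Equal (Var 0) (Var 0), \<lambda>_. \<one>\<^bsub>M\<^esub>)}"

text \<open>
  The theory of an abelian group is stable, so stability is not repeated here. The rows are indexed
  by sets of natural numbers because every inp-pattern of infinite depth restricts to one of depth
  \<open>\<omega>\<close>; for such depths \<open>\<aleph>\<^sub>1\<close>-saturation is sufficient, since formulas are countable in number. HOL
  cannot quantify over all carrier types; the type \<^typ>\<open>(nat \<Rightarrow> 'a) set\<close> holds an
  \<open>\<aleph>\<^sub>1\<close>-saturated model of the theory of \<open>A\<close>, namely the ultrapower of \<open>A\<close> over a nonprincipal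
  ultrafilter on the natural numbers, a quotient of the power of \<open>A\<close> with exponent \<open>\<omega>\<close>.
\<close>

definition strong :: "'a monoid \<Rightarrow> bool" where
  "strong A \<longleftrightarrow>
    \<not> (\<exists>(M :: (nat \<Rightarrow> 'a) set monoid) (I :: nat set) \<phi> k.
          comm_group M \<and> elem_equiv A M \<and> aleph1_saturated M \<and>
          infinite I \<and> inp_pattern M (x_eq_x M) I \<phi> k)"


section \<open>Multiples and torsion\<close>

definition multiples :: "('a, 'e) monoid_scheme \<Rightarrow> nat \<Rightarrow> 'a set" where
  "multiples A n = (\<lambda>x. x [^]\<^bsub>A\<^esub> n) ` carrier A"

text \<open>\<open>B[p]\<close> for a subgroup \<open>B\<close> of \<open>A\<close>.\<close>

definition torsion_part :: "('a, 'e) monoid_scheme \<Rightarrow> 'a set \<Rightarrow> nat \<Rightarrow> 'a set" where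
  "torsion_part A B p = {b \<in> B. b [^]\<^bsub>A\<^esub> p = \<one>\<^bsub>A\<^esub>}"

definition ulm_quotient :: "('a, 'e) monoid_scheme \<Rightarrow> nat \<Rightarrow> nat \<Rightarrow> 'a set monoid" where
  "ulm_quotient A p n =
    (A\<lparr>carrier := torsion_part A (multiples A (p ^ n)) p\<rparr>)
      Mod (torsion_part A (multiples A (p ^ (n + 1))) p)"


section \<open>The standard groups\<close>

definition rat_group :: "rat monoid" where
  "rat_group = \<lparr>carrier = UNIV, monoid.mult = (+), one = 0\<rparr>"

definition Z_localized :: "nat \<Rightarrow> rat monoid" where
  "Z_localized p =
    \<lparr>carrier = {q. \<not> int p dvd snd (quotient_of q)}, monoid.mult = (+), one = 0\<rparr>"

text \<open>The Pruefer group as the group of complex roots of unity of \<open>p\<close>-power order.\<close>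

definition pruefer_group :: "nat \<Rightarrow> complex monoid" where
  "pruefer_group p = \<lparr>carrier = {z. \<exists>n. z ^ (p ^ n) = 1}, monoid.mult = (*), one = 1\<rparr>"

text \<open>The direct sum of \<open>\<alpha>\<close> copies, where \<^term>\<open>\<infinity> :: enat\<close> stands for \<open>\<omega>\<close>.\<close>

definition copies :: "('a, 'e) monoid_scheme \<Rightarrow> enat \<Rightarrow> (nat \<Rightarrow> 'a) monoid" where
  "copies G \<alpha> = sum_group {i. enat i < \<alpha>} (\<lambda>_. G)"

definition szmielew_group ::
  "(nat \<Rightarrow> nat \<Rightarrow> enat) \<Rightarrow> (nat \<Rightarrow> enat) \<Rightarrow> (nat \<Rightarrow> enat) \<Rightarrow> enat \<Rightarrow>
   ((nat \<Rightarrow> (nat \<Rightarrow> nat \<Rightarrow> int) \<times> (nat \<Rightarrow> rat) \<times> (nat \<Rightarrow> complex)) \<times> (nat \<Rightarrow> rat)) monoid" where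
  "szmielew_group \<alpha> \<beta> \<gamma> \<delta> =
    sum_group {p. prime p}
      (\<lambda>p. sum_group {n. n > 0} (\<lambda>n. copies (integer_mod_group (p ^ n)) (\<alpha> p n))
             \<times>\<times> copies (Z_localized p) (\<beta> p)
             \<times>\<times> copies (pruefer_group p) (\<gamma> p))
    \<times>\<times> copies rat_group \<delta>"

end

theory Submission
  imports Defs "HOL-Algebra.FiniteProduct" "HOL-Algebra.Multiplicative_Group"
begin

text \<open>
  A positive primitive formula asserts the solvability of a system of linear equations. With one
  free variable and all parameters zero it defines a subgroup, and with arbitrary parameters a coset
  of this subgroup or nothing. Over the integers such a system can be brought to diagonal form, as
  for the Smith normal form, and what remains of it are conditions \<open>n | t\<close> on its right-hand sides
  (\<open>elim_exists\<close>, \<open>elim_sound\<close>). The subgroups in question are therefore the groups \<open>sol G L\<close> of all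
  \<open>x\<close> such that \<open>n\<close> divides \<open>a x\<close>, for finitely many pairs \<open>(n, a)\<close> in \<open>L\<close>. The proof is about the
  indices among these subgroups.

  First, the indices determine the complete theory. Finitely many cosets of subgroups of infinite
  index never cover a group (\<open>neumann\<close>), while cosets of subgroups of finite index can be counted;
  together this gives the back-and-forth argument of Baur and Monk (\<open>baur_monk\<close>). Conversely, every
  index is expressed by first-order sentences (\<open>elem_equiv_idx\<close>). All indices can in turn be computed
  from Szmielew's invariants: the sizes of \<open>(p^k G)[p]/(p^(k+1) G)[p]\<close>, of \<open>p^k G/p^(k+1) G\<close> and of
  \<open>(p^k G)[p]\<close>, and the boundedness of the exponent (\<open>same_invariants.elem_equiv\<close>).

  Second, an inp-pattern amounts to a family of such subgroups in which each has infinite index over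
  the intersection of the others. A pattern restricted to a large finite box on which all
  realisations of paths behave alike yields such a family (\<open>inp_pattern_independent\<close>), since otherwise
  the lemma of Neumann would merge the realisations of many formulas of one row. Each member of the
  family can be enlarged to the solution group of a single condition \<open>p^k | p^j x\<close> or \<open>d x = 0\<close>. If
  \<open>G/pG\<close> is infinite for finitely many \<open>p\<close> only and, for every \<open>p\<close>, almost all Ulm quotients are
  finite, then too many such groups cannot be pairwise incomparable up to finite index
  (\<open>finite_width_no_inp_pattern\<close>). Conversely, infinitely many primes with infinite \<open>G/pG\<close> give a
  pattern of congruences \<open>x \<equiv> e\<close> modulo \<open>p\<close>, by the Chinese remainder theorem, and infinitely many
  infinite Ulm quotients for one prime give a pattern of conditions \<open>p^(n+1) | p^(n-l) (x - e)\<close>. All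
  these conditions are properties of the theory, and an ultrapower provides a saturated model of it
  in which the patterns can be placed. This is \<open>strong_iff_finite_conditions\<close>.

  Third, every abelian group shares its invariants, hence its theory, with a direct sum of the
  standard groups (\<open>szmielew\<close>). The \<open>k\<close>-th Ulm quotient of this sum has size \<open>p^\<alpha>(p,k+1)\<close>, and
  \<open>p^k G/p^(k+1) G\<close> has size \<open>p^\<beta>(p)\<close> for large \<open>k\<close> if the Ulm quotients vanish eventually. Since
  multiplication by \<open>p\<close> maps \<open>p^k G/p^(k+1) G\<close> onto \<open>p^(k+1) G/p^(k+2) G\<close> with the Ulm quotient as
  kernel, \<open>G/pG\<close> is finite exactly when \<open>\<beta>(p)\<close> and all \<open>\<alpha>(p,n)\<close> are finite and only finitely many
  of the \<open>\<alpha>(p,n)\<close> are nonzero. This turns the two finiteness conditions into the three conditions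
  on \<open>\<alpha>\<close> and \<open>\<beta>\<close>.
\<close>

section \<open>Counting cosets\<close>

definition ecard :: "'a set \<Rightarrow> enat" where
  "ecard X = (if finite X then enat (card X) else \<infinity>)"

lemma ecard_infinite_iff: "ecard X = \<infinity> \<longleftrightarrow> infinite X"
  by (simp add: ecard_def)

lemma ecard_mono: "X \<subseteq> Y \<Longrightarrow> ecard X \<le> ecard Y"
  by (auto simp: ecard_def finite_subset card_mono)

lemma ecard_image_le: "ecard (f ` X) \<le> ecard X"
  by (auto simp: ecard_def card_image_le)

lemma ecard_bij_betw: "bij_betw f X Y \<Longrightarrow> ecard X = ecard Y"
  by (simp add: ecard_def bij_betw_finite bij_betw_same_card)

lemma ecard_Times: "A \<noteq> {} \<Longrightarrow> B \<noteq> {} \<Longrightarrow> ecard (A \<times> B) = ecard A * ecard B"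
  by (auto simp: ecard_def card_cartesian_product finite_cartesian_product_iff times_enat_simps
        zero_enat_def[symmetric])

lemma ecard_image_refine:
  assumes "\<And>x y. x \<in> H \<Longrightarrow> y \<in> H \<Longrightarrow> g x = g y \<Longrightarrow> f x = f y"
  shows "ecard (f ` H) \<le> ecard (g ` H)"
proof -
  have "f ` H = (\<lambda>z. f (inv_into H g z)) ` (g ` H)"
    unfolding image_image using assms
    by (intro image_cong refl) (metis f_inv_into_f image_eqI inv_into_into)
  thus ?thesis by (metis ecard_image_le)
qed

lemma ecard_image_cong:
  assumes "\<And>x y. x \<in> H \<Longrightarrow> y \<in> H \<Longrightarrow> f x = f y \<longleftrightarrow> g x = g y"
  shows "ecard (f ` H) = ecard (g ` H)"
  using ecard_image_refine[of H g f] ecard_image_refine[of H f g] assms by (metis order_antisym)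

text \<open>
  Counting the cosets of \<open>K\<close> that meet \<open>H\<close> does not require
  \<open>K\<close> to be contained in \<open>H\<close>; the value is the index of \<open>H
  \<inter> K\<close> in \<open>H\<close>, which saves forming the intersection.
\<close>

definition idx :: "('a, 'b) monoid_scheme \<Rightarrow> 'a set \<Rightarrow> 'a set \<Rightarrow> enat" where
  "idx G H K = ecard ((\<lambda>x. K #>\<^bsub>G\<^esub> x) ` H)"

text \<open>
  A pair \<open>(n, a)\<close> is the condition that \<open>n\<close> divides \<open>a x\<close>
  in additive notation. As only zero is divisible by zero, \<open>n = 0\<close> gives the equation
  \<open>a x = 0\<close>.
\<close>

definition sol :: "('a, 'b) monoid_scheme \<Rightarrow> (nat \<times> int) set \<Rightarrow> 'a set" where
  "sol G L = {x \<in> carrier G. \<forall>(n, a) \<in> L. x [^]\<^bsub>G\<^esub> a \<in> multiples G n}"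

abbreviation sidx :: "('a, 'b) monoid_scheme \<Rightarrow> (nat \<times> int) set \<Rightarrow> (nat \<times> int) set \<Rightarrow> enat" where
  "sidx G L K \<equiv> idx G (sol G L) (sol G K)"

context comm_group begin

lemma rcos_eq_iff:
  assumes "subgroup K G" "x \<in> carrier G" "y \<in> carrier G"
  shows "K #> x = K #> y \<longleftrightarrow> x \<otimes> inv y \<in> K"
proof
  assume "K #> x = K #> y"
  hence "x \<in> K #> y" using rcos_self assms by blast
  then obtain k where "k \<in> K" "x = k \<otimes> y" by (auto simp: r_coset_def)
  thus "x \<otimes> inv y \<in> K" using assms subgroup.mem_carrier[OF assms(1)] by (simp add: m_assoc)
next
  assume "x \<otimes> inv y \<in> K"
  moreover have "x = (x \<otimes> inv y) \<otimes> y" using assms by (simp add: m_assoc)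
  ultimately have "x \<in> K #> y" unfolding r_coset_def by blast
  thus "K #> x = K #> y" using repr_independence[OF _ assms(3,1)] by simp
qed

lemma idx_cong:
  assumes "subgroup K G" "subgroup K' G" "H \<subseteq> carrier G" "f ` H \<subseteq> carrier G"
    "\<And>x y. x \<in> H \<Longrightarrow> y \<in> H \<Longrightarrow> f x \<otimes> inv (f y) \<in> K \<longleftrightarrow> x \<otimes> inv y \<in> K'"
  shows "idx G (f ` H) K = idx G H K'"
  unfolding idx_def image_image
proof (rule ecard_image_cong)
  fix x y assume h: "x \<in> H" "y \<in> H"
  hence c: "x \<in> carrier G" "y \<in> carrier G" "f x \<in> carrier G" "f y \<in> carrier G" using assms by auto
  show "(K #> f x = K #> f y) = (K' #> x = K' #> y)"
    using rcos_eq_iff[OF assms(1) c(3,4)] rcos_eq_iff[OF assms(2) c(1,2)] assms(5)[OF h] by simp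
qed

lemma diff_diff:
  assumes "x \<in> carrier G" "w \<in> carrier G" shows "x \<otimes> inv (x \<otimes> inv w) = w"
proof -
  have "inv (x \<otimes> inv w) = w \<otimes> inv x" using assms by (simp add: inv_mult_group)
  hence "x \<otimes> inv (x \<otimes> inv w) = (x \<otimes> inv x) \<otimes> w" using assms by (simp only: m_ac m_closed inv_closed)
  thus ?thesis using assms by simp
qed

lemma int_pow_diff_distrib:
  assumes "x \<in> carrier G" "y \<in> carrier G"
  shows "(x \<otimes> inv y) [^] (a::int) = x [^] a \<otimes> inv (y [^] a)"
  using assms by (simp add: int_pow_distrib int_pow_inv)

lemma subgroup_pow_vimage:
  assumes "subgroup K G" shows "subgroup {x \<in> carrier G. x [^] (a::int) \<in> K} G"
proof -
  interpret K: subgroup K G by fact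
  show ?thesis
    by (rule subgroupI) (auto simp: int_pow_distrib int_pow_inv intro!: exI[of _ "\<one>"])
qed

lemma idx_pow:
  assumes "H \<subseteq> carrier G" "subgroup K G"
  shows "idx G ((\<lambda>x. x [^] (a::int)) ` H) K = idx G H {x \<in> carrier G. x [^] a \<in> K}"
  by (rule idx_cong) (use assms in \<open>auto simp: subgroup_pow_vimage subset_iff int_pow_diff_distrib\<close>)

lemma idx_left_mono: "H \<subseteq> H' \<Longrightarrow> idx G H K \<le> idx G H' K"
  unfolding idx_def by (intro ecard_mono image_mono)

lemma idx_right_antimono:
  assumes "H \<subseteq> carrier G" "subgroup K G" "subgroup K' G" "K \<subseteq> K'"
  shows "idx G H K' \<le> idx G H K"
  unfolding idx_def
  by (rule ecard_image_refine) (use assms rcos_eq_iff in blast)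

lemma idx_eq_1:
  assumes "H \<subseteq> K" "subgroup K G" "H \<noteq> {}" shows "idx G H K = 1"
proof -
  have "(\<lambda>x. K #> x) ` H = {K}"
    using assms coset_join2 subgroup.mem_carrier[OF assms(2)] by (auto simp: subset_iff image_iff)
  thus ?thesis by (simp add: idx_def ecard_def one_enat_def)
qed

lemma idx_eq_1_iff:
  assumes "subgroup H G" "subgroup K G" shows "idx G H K = 1 \<longleftrightarrow> H \<subseteq> K"
proof
  assume "idx G H K = 1"
  hence "card ((\<lambda>x. K #> x) ` H) = 1" by (auto simp: idx_def ecard_def one_enat_def split: if_splits)
  then obtain c where c: "(\<lambda>x. K #> x) ` H = {c}" by (auto simp: card_1_singleton_iff)
  show "H \<subseteq> K"
  proof
    fix x assume x: "x \<in> H"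
    have "K #> x = K #> \<one>" using c x subgroup.one_closed[OF assms(1)] by blast
    thus "x \<in> K" using rcos_eq_iff[OF assms(2), of x \<one>] subgroup.mem_carrier[OF assms(1) x] by simp
  qed
qed (use assms idx_eq_1 subgroup.one_closed in blast)

lemma idx_ge_1: assumes "H \<noteq> {}" shows "idx G H K \<ge> 1"
  using assms by (auto simp: idx_def ecard_def one_enat_def Suc_le_eq card_gt_0_iff)

text \<open>
  Enlarging \<open>H\<close> within \<open>H K\<close> does not add cosets of \<open>K\<close>.
\<close>

lemma idx_absorb:
  assumes "subgroup K G" "H \<subseteq> H'" "H' \<subseteq> carrier G"
    "\<And>x. x \<in> H' \<Longrightarrow> \<exists>h\<in>H. x \<otimes> inv h \<in> K"
  shows "idx G H' K = idx G H K"
proof -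
  have "(\<lambda>x. K #> x) ` H' \<subseteq> (\<lambda>x. K #> x) ` H"
  proof
    fix c assume "c \<in> (\<lambda>x. K #> x) ` H'"
    then obtain x where x: "x \<in> H'" "c = K #> x" by auto
    then obtain h where h: "h \<in> H" "x \<otimes> inv h \<in> K" using assms(4) by blast
    hence "K #> x = K #> h" using rcos_eq_iff[OF assms(1)] x assms(2,3) by blast
    thus "c \<in> (\<lambda>x. K #> x) ` H" using x h by blast
  qed
  hence "(\<lambda>x. K #> x) ` H' = (\<lambda>x. K #> x) ` H" using assms(2) by blast
  thus ?thesis by (simp add: idx_def)
qed

text \<open>
  A choice of representatives for the cosets of \<open>L\<close> splits a coset of
  \<open>K\<close> in \<open>H\<close> into a coset of \<open>L\<close> in \<open>H\<close> and a
  coset of \<open>K\<close> in \<open>L\<close>. The indices may be infinite.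
\<close>

lemma idx_tower:
  assumes H: "subgroup H G" and K: "subgroup K G" and L: "subgroup L G" and KL: "K \<subseteq> L" and LH: "L \<subseteq> H"
  shows "idx G H K = idx G H L * idx G L K"
proof -
  interpret H: subgroup H G by fact
  interpret K: subgroup K G by fact
  interpret L: subgroup L G by fact
  define Q where "Q = (\<lambda>x. L #> x) ` H"
  define r where "r = (\<lambda>q. SOME h. h \<in> H \<and> L #> h = q)"
  have r: "r q \<in> H" "L #> r q = q" if "q \<in> Q" for q
  proof -
    have "\<exists>h. h \<in> H \<and> L #> h = q" using that by (auto simp: Q_def)
    thus "r q \<in> H" "L #> r q = q" unfolding r_def using someI_ex[OF \<open>\<exists>h. h \<in> H \<and> L #> h = q\<close>] by blast+
  qed
  have KK: "(K #> x) #> y = K #> (x \<otimes> y)" if "x \<in> carrier G" "y \<in> carrier G" for x y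
    using coset_mult_assoc[OF K.subset] that by simp
  have "bij_betw (\<lambda>(q, C). C #> r q) (Q \<times> (\<lambda>x. K #> x) ` L) ((\<lambda>x. K #> x) ` H)"
  proof (rule bij_betw_imageI)
    show "inj_on (\<lambda>(q, C). C #> r q) (Q \<times> (\<lambda>x. K #> x) ` L)"
    proof (rule inj_onI, clarify)
      fix q q' l l' assume h: "q \<in> Q" "q' \<in> Q" "l \<in> L" "l' \<in> L" "(K #> l) #> r q = (K #> l') #> r q'"
      note rr = r[OF h(1)] r[OF h(2)]
      have c: "l \<in> carrier G" "l' \<in> carrier G" "r q \<in> carrier G" "r q' \<in> carrier G"
        using h rr by auto
      have e: "(l \<otimes> r q) \<otimes> inv (l' \<otimes> r q') \<in> K"
        using h(5) c rcos_eq_iff[OF K] KK by simp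
      have e2: "(l \<otimes> r q) \<otimes> inv (l' \<otimes> r q') = (l \<otimes> inv l') \<otimes> (r q \<otimes> inv (r q'))"
        using c by (simp add: inv_mult m_ac)
      have "(l \<otimes> inv l') \<otimes> (r q \<otimes> inv (r q')) \<in> L" using e e2 KL by auto
      hence "inv (l \<otimes> inv l') \<otimes> ((l \<otimes> inv l') \<otimes> (r q \<otimes> inv (r q'))) \<in> L" using h by simp
      moreover have "inv (l \<otimes> inv l') \<otimes> ((l \<otimes> inv l') \<otimes> (r q \<otimes> inv (r q'))) = r q \<otimes> inv (r q')"
        using c inv_solve_left' by auto
      ultimately have "r q \<otimes> inv (r q') \<in> L" by simp
      hence qq: "q = q'" using rcos_eq_iff[OF L c(3,4)] rr by simp
      moreover have "l \<otimes> inv l' \<in> K" using e e2 qq c by simp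
      ultimately show "q = q' \<and> K #> l = K #> l'" using rcos_eq_iff[OF K c(1,2)] by simp
    qed
    show "(\<lambda>(q, C). C #> r q) ` (Q \<times> (\<lambda>x. K #> x) ` L) = (\<lambda>x. K #> x) ` H"
    proof (rule subset_antisym; rule subsetI)
      fix c assume "c \<in> (\<lambda>(q, C). C #> r q) ` (Q \<times> (\<lambda>x. K #> x) ` L)"
      then obtain q l where q: "q \<in> Q" "l \<in> L" "c = (K #> l) #> r q" by auto
      have "c = K #> (l \<otimes> r q)" using q r[OF q(1)] KK by auto
      moreover have "l \<otimes> r q \<in> H" using q r[OF q(1)] LH by auto
      ultimately show "c \<in> (\<lambda>x. K #> x) ` H" by blast
    next
      fix c assume "c \<in> (\<lambda>x. K #> x) ` H"
      then obtain h where h: "h \<in> H" "c = K #> h" by auto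
      define q where "q = L #> h"
      have q: "q \<in> Q" using h by (auto simp: Q_def q_def)
      have c: "h \<in> carrier G" "r q \<in> carrier G" using h r[OF q] by auto
      have l: "h \<otimes> inv (r q) \<in> L" using rcos_eq_iff[OF L c] r[OF q] q_def by simp
      have "(K #> (h \<otimes> inv (r q))) #> r q = c" using h c by (simp add: KK m_assoc)
      thus "c \<in> (\<lambda>(q, C). C #> r q) ` (Q \<times> (\<lambda>x. K #> x) ` L)" using q l by force
    qed
  qed
  hence "idx G H K = ecard (Q \<times> (\<lambda>x. K #> x) ` L)" by (simp add: idx_def ecard_bij_betw)
  also have "\<dots> = ecard Q * ecard ((\<lambda>x. K #> x) ` L)"
    unfolding Q_def by (rule ecard_Times; use H.one_closed L.one_closed in blast)
  finally show ?thesis by (simp add: idx_def Q_def)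
qed

lemma idx_Int_left:
  assumes "subgroup H G" "subgroup K G" shows "idx G H (H \<inter> K) = idx G H K"
  unfolding idx_def
proof (rule ecard_image_cong)
  fix x y assume h: "x \<in> H" "y \<in> H"
  have c: "x \<in> carrier G" "y \<in> carrier G" using h subgroup.mem_carrier[OF assms(1)] by auto
  have "x \<otimes> inv y \<in> H" using h assms(1) by (simp add: subgroup.m_closed subgroup.m_inv_closed)
  thus "(H \<inter> K #> x = H \<inter> K #> y) = (K #> x = K #> y)"
    using rcos_eq_iff[OF subgroup_Int[OF assms] c] rcos_eq_iff[OF assms(2) c] by simp
qed

text \<open>
  The tower from \<open>H\<close> over \<open>H \<inter> K\<close> to \<open>H \<inter> K \<inter>
  L\<close>. Nearly all indices below are computed by choosing \<open>K\<close> such that both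
  factors are known.
\<close>

lemma idx_Int:
  assumes "subgroup H G" "subgroup K G" "subgroup L G"
  shows "idx G H (K \<inter> L) = idx G H K * idx G (H \<inter> K) L"
proof -
  have "idx G H (K \<inter> L) = idx G H (H \<inter> (K \<inter> L))" using assms by (simp add: idx_Int_left subgroup_Int)
  also have "\<dots> = idx G H (H \<inter> K) * idx G (H \<inter> K) (H \<inter> (K \<inter> L))"
    using assms by (intro idx_tower) (auto simp: subgroup_Int)
  also have "H \<inter> (K \<inter> L) = (H \<inter> K) \<inter> L" by auto
  finally show ?thesis using assms by (simp add: idx_Int_left subgroup_Int)
qed

lemma idx_Int_finite:
  assumes "subgroup H G" "subgroup K G" "subgroup L G" "idx G H K \<noteq> \<infinity>" "idx G H L \<noteq> \<infinity>"
  shows "idx G H (K \<inter> L) \<noteq> \<infinity>"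
proof -
  have "idx G (H \<inter> K) L \<noteq> \<infinity>" using idx_left_mono[of "H \<inter> K" H L] assms(5) by (metis inf_le1 enat_ord_simps(5) )
  thus ?thesis using assms by (simp add: idx_Int imult_is_infinity)
qed

lemma idx_Inter_finite:
  assumes "finite A" "subgroup H G" "\<And>a. a \<in> A \<Longrightarrow> subgroup (f a) G \<and> idx G H (f a) \<noteq> \<infinity>"
  shows "subgroup (carrier G \<inter> \<Inter>(f ` A)) G \<and> idx G H (carrier G \<inter> \<Inter>(f ` A)) \<noteq> \<infinity>"
  using assms(1,3)
proof (induction A rule: finite_induct)
  case empty
  have "idx G H (carrier G) = 1" using assms(2) subgroup_self
    by (simp add: idx_eq_1_iff subgroup.subset)
  thus ?case using subgroup_self by simp
next
  case (insert a A)
  have e: "carrier G \<inter> \<Inter>(f ` insert a A) = (carrier G \<inter> \<Inter>(f ` A)) \<inter> f a" by auto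
  show ?case unfolding e using insert assms(2) by (auto intro!: subgroup_Int simp: idx_Int_finite)
qed

subsection \<open>Multiples and solution sets\<close>

lemma multiples_iff: "x \<in> multiples G n \<longleftrightarrow> (\<exists>y\<in>carrier G. x = y [^] int n)"
  by (auto simp: multiples_def int_pow_int)

lemma multiples_subgroup [simp, intro]: "subgroup (multiples G n) G"
proof (rule subgroupI)
  show "multiples G n \<subseteq> carrier G" by (auto simp: multiples_def)
  show "multiples G n \<noteq> {}" by (auto simp: multiples_def)
next
  fix a assume "a \<in> multiples G n"
  then obtain y where "y \<in> carrier G" "a = y [^] int n" by (auto simp: multiples_iff)
  thus "inv a \<in> multiples G n" unfolding multiples_iff by (intro bexI[of _ "inv y"]) (auto simp: int_pow_inv)
next
  fix a b assume "a \<in> multiples G n" "b \<in> multiples G n"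
  then obtain y z where "y \<in> carrier G" "a = y [^] int n" "z \<in> carrier G" "b = z [^] int n"
    by (auto simp: multiples_iff)
  thus "a \<otimes> b \<in> multiples G n" unfolding multiples_iff
    by (intro bexI[of _ "y \<otimes> z"]) (auto simp: int_pow_distrib)
qed

lemma one_multiples: "\<one> \<in> multiples G n"
  by (rule subgroup.one_closed[OF multiples_subgroup])

lemma multiples_0 [simp]: "multiples G 0 = {\<one>}"
  by (auto simp: multiples_def)

lemma multiples_1 [simp]: "multiples G 1 = carrier G" "multiples G (Suc 0) = carrier G"
  by (auto simp: multiples_def)

lemma multiples_carrier: "multiples G n \<subseteq> carrier G"
  by (auto simp: multiples_def)

lemma multiples_dvd: assumes "m dvd n" shows "multiples G n \<subseteq> multiples G m"
proof
  fix x assume "x \<in> multiples G n"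
  then obtain y where y: "y \<in> carrier G" "x = y [^] int n" by (auto simp: multiples_iff)
  obtain k where "n = k * m" using assms by (metis dvd_def mult.commute)
  hence "x = (y [^] int k) [^] int m" using y by (simp add: int_pow_pow)
  thus "x \<in> multiples G m" using y unfolding multiples_iff by blast
qed

lemma pow_in_multiples:
  assumes "x \<in> multiples G n" shows "x [^] (a::int) \<in> multiples G n"
  using assms by (auto simp: multiples_iff int_pow_pow mult.commute intro!: bexI[of _ "_ [^] a"])

lemma pow_mult_in_multiples:
  assumes "x \<in> carrier G" "int n dvd a" shows "x [^] (a::int) \<in> multiples G n"
proof -
  obtain k where "a = k * int n" using assms by (metis dvd_def mult.commute)
  thus ?thesis using assms by (auto simp: multiples_iff int_pow_pow intro!: bexI[of _ "x [^] k"])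
qed

lemma sol_subgroup [simp, intro]: "subgroup (sol G L) G"
proof (rule subgroupI)
  fix x y assume "x \<in> sol G L" "y \<in> sol G L"
  thus "x \<otimes> y \<in> sol G L"
    by (auto simp: sol_def int_pow_distrib dest!: bspec intro: subgroup.m_closed[OF multiples_subgroup])
next
  fix x assume "x \<in> sol G L"
  thus "inv x \<in> sol G L"
    by (auto simp: sol_def int_pow_inv dest!: bspec intro: subgroup.m_inv_closed[OF multiples_subgroup])
next
  have "\<one> \<in> sol G L" by (auto simp: sol_def subgroup.one_closed[OF multiples_subgroup])
  thus "sol G L \<noteq> {}" by auto
qed (auto simp: sol_def)

lemma sol_carrier: "sol G L \<subseteq> carrier G" by (auto simp: sol_def)

lemma sol_empty [simp]: "sol G {} = carrier G" by (auto simp: sol_def)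

end

section \<open>Linear terms\<close>

primrec coef :: "nat \<Rightarrow> ag_term \<Rightarrow> int" where
  "coef i (Var j) = (if i = j then 1 else 0)"
| "coef i Zero = 0"
| "coef i (Plus s t) = coef i s + coef i t"
| "coef i (Minus t) = - coef i t"

text \<open>The summands other than those with variable 0, renumbered so that they refer to the assignment outside the quantifier.\<close>

primrec rest :: "ag_term \<Rightarrow> ag_term" where
  "rest (Var j) = (case j of 0 \<Rightarrow> Zero | Suc i \<Rightarrow> Var i)"
| "rest Zero = Zero"
| "rest (Plus s t) = Plus (rest s) (rest t)"
| "rest (Minus t) = Minus (rest t)"

definition smul :: "int \<Rightarrow> ag_term \<Rightarrow> ag_term" where
  "smul a t = (if a \<ge> 0 then (Plus t ^^ nat a) Zero else Minus ((Plus t ^^ nat (- a)) Zero))"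

lemma term_below_smul [simp]: "term_below n t \<Longrightarrow> term_below n (smul a t)"
proof -
  assume t: "term_below n t"
  have "term_below n ((Plus t ^^ k) Zero)" for k using t by (induction k) auto
  thus ?thesis by (simp add: smul_def)
qed

text \<open>
  The quantifier-free form of a positive primitive formula: \<open>(n, t)\<close> is the condition
  that \<open>n\<close> divides \<open>t\<close>.
\<close>

definition csat :: "('m, 'e) monoid_scheme \<Rightarrow> (nat \<Rightarrow> 'm) \<Rightarrow> (nat \<times> ag_term) set \<Rightarrow> bool" where
  "csat M v D \<longleftrightarrow> (\<forall>(n, t) \<in> D. term_val M v t \<in> multiples M n)"

definition lin :: "('m, 'e) monoid_scheme \<Rightarrow> nat set \<Rightarrow> (nat \<Rightarrow> int) \<Rightarrow> (nat \<Rightarrow> 'm) \<Rightarrow> 'm" where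
  "lin M J c u = finprod M (\<lambda>j. u j [^]\<^bsub>M\<^esub> c j) J"

text \<open>
  Elimination of the unknowns \<open>u j\<close> with \<open>j\<close> in \<open>J\<close> from
  the system that has one equation \<open>\<Sum>j. c j * u j = s\<close> for each pair \<open>(c,
  s)\<close> in \<open>R\<close>, in the manner of the Smith normal form. The rule
  \<open>row\<close> subtracts a multiple of one equation from another, and \<open>col\<close>
  substitutes \<open>u j - q * u k\<close> for \<open>u j\<close>. Once a coefficient divides its
  row and its column, \<open>pivot\<close> solves the equation of its row for its unknown, which
  is possible if and only if the coefficient divides the right-hand side. No group is involved, so
  the resulting conditions \<open>D\<close> are the same in all groups; this makes indices in
  different groups comparable.
\<close>

inductive elim :: "nat set \<Rightarrow> ((nat \<Rightarrow> int) \<times> ag_term) set \<Rightarrow> (nat \<times> ag_term) set \<Rightarrow> bool" where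
  base: "\<forall>(c, s) \<in> R. \<forall>j\<in>J. c j = 0 \<Longrightarrow> elim J R ((\<lambda>(c, s). (0, s)) ` R)"
| row: "(r, s) \<in> R \<Longrightarrow> (r', s') \<in> R \<Longrightarrow> (r, s) \<noteq> (r', s') \<Longrightarrow>
    elim J (insert (\<lambda>j. r' j - q * r j, Plus s' (smul (- q) s)) (R - {(r', s')})) D \<Longrightarrow> elim J R D"
| col: "j \<in> J \<Longrightarrow> k \<in> J \<Longrightarrow> j \<noteq> k \<Longrightarrow>
    elim J ((\<lambda>(c, s). (c(k := c k - q * c j), s)) ` R) D \<Longrightarrow> elim J R D"
| pivot: "(r, s) \<in> R \<Longrightarrow> j \<in> J \<Longrightarrow> r j \<noteq> 0 \<Longrightarrow> \<forall>k\<in>J. r j dvd r k \<Longrightarrow> \<forall>(c, t) \<in> R. r j dvd c j \<Longrightarrow>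
    elim (J - {j}) ((\<lambda>(c, t). (\<lambda>k. c k - (c j div r j) * r k, Plus t (smul (- (c j div r j)) s))) ` (R - {(r, s)})) D \<Longrightarrow>
    elim J R (insert (nat \<bar>r j\<bar>, s) D)"

lemma elim_finite: "elim J R D \<Longrightarrow> finite R \<Longrightarrow> finite D"
  by (induction rule: elim.induct) auto

text \<open>
  Induction on the number of unknowns and, for a fixed number, on the size of a nonzero
  coefficient. If this coefficient fails to divide an entry of its column or of its row, division
  with remainder in the form of a \<open>row\<close> or \<open>col\<close> step produces a smaller
  nonzero coefficient; otherwise it is a pivot.
\<close>

lemma elim_exists:
  assumes "finite J" shows "\<exists>D. elim J R D"
  using assms
proof (induction "card J" arbitrary: J R rule: less_induct)
  case (less J R)
  have main: "\<exists>D. elim J R D" if "(r, s) \<in> R" "j \<in> J" "r j \<noteq> 0" "nat \<bar>r j\<bar> = e" for e r s j R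
    using that
  proof (induction e arbitrary: r s j R rule: less_induct)
    case (less e r s j R)
    show ?case
    proof (cases "\<forall>(c, t) \<in> R. r j dvd c j")
      case False
      then obtain c t where c: "(c, t) \<in> R" "\<not> r j dvd c j" by auto
      define q where "q = c j div r j"
      let ?c = "\<lambda>k. c k - q * r k"
      have q: "?c j = c j mod r j" by (simp add: q_def minus_div_mult_eq_mod)
      hence "?c j \<noteq> 0" using c(2) by auto
      moreover have "nat \<bar>?c j\<bar> < e"
        unfolding q using less.prems abs_mod_less[of "r j" "c j"] by simp
      ultimately have "\<exists>D. elim J (insert (?c, Plus t (smul (- q) s)) (R - {(c, t)})) D"
        using less.IH[of "nat \<bar>?c j\<bar>" ?c] less.prems(2) by blast
      thus ?thesis using elim.row[OF less.prems(1) c(1)] c(2) by (metis Pair_inject dvd_refl)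
    next
      case col: True
      show ?thesis
      proof (cases "\<forall>k\<in>J. r j dvd r k")
        case False
        then obtain k where k: "k \<in> J" "\<not> r j dvd r k" by auto
        define q where "q = r k div r j"
        let ?f = "\<lambda>(c, s). (c(k := c k - q * c j), s)"
        have q: "r k - q * r j = r k mod r j" by (simp add: q_def minus_div_mult_eq_mod)
        have lt: "nat \<bar>r k - q * r j\<bar> < e"
          unfolding q using less.prems abs_mod_less[of "r j" "r k"] by simp
        have nz: "r k - q * r j \<noteq> 0" using k q by auto
        have "?f (r, s) \<in> ?f ` R" using less.prems(1) by (rule imageI)
        hence mem: "(r(k := r k - q * r j), s) \<in> ?f ` R" unfolding prod.case .
        have "\<exists>D. elim J (?f ` R) D"
          by (rule less.IH[OF lt mem k(1)]) (use nz in simp_all)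
        moreover have "j \<noteq> k" using k by auto
        ultimately show ?thesis using elim.col[OF less.prems(2) k(1)] by blast
      next
        case True
        have "card (J - {j}) < card J" using less.prems \<open>finite J\<close> by (intro psubset_card_mono) auto
        then obtain D where "elim (J - {j}) ((\<lambda>(c, t). (\<lambda>k. c k - (c j div r j) * r k, Plus t (smul (- (c j div r j)) s))) ` (R - {(r, s)})) D"
          using \<open>\<And>J' R. card J' < card J \<Longrightarrow> finite J' \<Longrightarrow> \<exists>D. elim J' R D\<close>[of "J - {j}"] \<open>finite J\<close> by blast
        thus ?thesis using elim.pivot[OF less.prems(1-3) True col] by blast
      qed
    qed
  qed
  show ?case
  proof (cases "\<forall>(c, s) \<in> R. \<forall>j\<in>J. c j = 0")
    case True thus ?thesis using elim.base by blast
  next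
    case False thus ?thesis using main by fast
  qed
qed

context comm_group begin

lemma term_val_closed [simp, intro]: "range v \<subseteq> carrier G \<Longrightarrow> term_val G v t \<in> carrier G"
  by (induction t) auto

lemma term_val_smul [simp]:
  assumes "range v \<subseteq> carrier G" shows "term_val G v (smul a t) = term_val G v t [^] a"
proof -
  have c: "term_val G v t \<in> carrier G" using assms by blast
  have "term_val G v ((Plus t ^^ n) Zero) = term_val G v t [^] int n" for n
    using c by (induction n) (auto simp: int_pow_mult)
  thus ?thesis using c by (auto simp: smul_def int_pow_neg[symmetric])
qed

lemma range_case_nat: "x \<in> carrier G \<Longrightarrow> range v \<subseteq> carrier G \<Longrightarrow> range (case_nat x v) \<subseteq> carrier G"
  by (auto split: nat.splits simp: image_subset_iff)

lemma term_val_case_nat: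
  assumes "x \<in> carrier G" "range v \<subseteq> carrier G"
  shows "term_val G (case_nat x v) t = x [^] coef 0 t \<otimes> term_val G v (rest t)"
proof (induction t)
  case (Var i) thus ?case using assms by (cases i) (auto simp: image_subset_iff)
next
  case (Plus s t)
  have "term_val G v (rest s) \<in> carrier G" "term_val G v (rest t) \<in> carrier G" using assms by auto
  thus ?case using Plus assms by (simp add: int_pow_mult m_ac)
next
  case (Minus t)
  have "term_val G v (rest t) \<in> carrier G" using assms by auto
  thus ?case using Minus assms by (simp add: int_pow_neg inv_mult)
qed (use assms in auto)

lemma term_val_one [simp]: "term_val G (\<lambda>_. \<one>) t = \<one>"
  by (induction t) auto

lemma lin_closed [simp, intro]: "(\<And>j. j \<in> J \<Longrightarrow> u j \<in> carrier G) \<Longrightarrow> lin G J c u \<in> carrier G"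
  unfolding lin_def by (rule finprod_closed) auto

lemma lin_cong: "(\<And>j. j \<in> J \<Longrightarrow> u j \<in> carrier G \<and> u j [^] c j = u' j [^] c' j) \<Longrightarrow> lin G J c u = lin G J c' u'"
  unfolding lin_def by (rule finprod_cong) (auto simp: simp_implies_def Pi_def, metis int_pow_closed)

lemma lin_zero: "(\<And>j. j \<in> J \<Longrightarrow> c j = 0) \<Longrightarrow> lin G J c u = \<one>"
  unfolding lin_def by (rule finprod_one_eqI) auto

lemma lin_add:
  assumes "\<And>j. j \<in> J \<Longrightarrow> u j \<in> carrier G"
  shows "lin G J (\<lambda>j. c j + c' j) u = lin G J c u \<otimes> lin G J c' u"
proof -
  have "lin G J (\<lambda>j. c j + c' j) u = finprod G (\<lambda>j. u j [^] c j \<otimes> u j [^] c' j) J"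
    unfolding lin_def using assms by (intro finprod_cong) (auto simp: int_pow_mult simp_implies_def)
  thus ?thesis unfolding lin_def using assms by (simp add: finprod_multf Pi_def)
qed

lemma lin_remove:
  assumes "\<And>j. j \<in> J \<Longrightarrow> u j \<in> carrier G" "finite J" "j \<in> J"
  shows "lin G J c u = u j [^] c j \<otimes> lin G (J - {j}) c u"
proof -
  have "J = insert j (J - {j})" using assms by auto
  hence "lin G J c u = lin G (insert j (J - {j})) c u" by simp
  also have "\<dots> = u j [^] c j \<otimes> lin G (J - {j}) c u"
    unfolding lin_def using assms by (intro finprod_insert) auto
  finally show ?thesis .
qed

lemma lin_scale:
  assumes "finite J" "\<And>j. j \<in> J \<Longrightarrow> u j \<in> carrier G"
  shows "lin G J (\<lambda>j. q * c j) u = lin G J c u [^] q"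
  using assms
proof (induction J rule: finite_induct)
  case empty thus ?case by (simp add: lin_def)
next
  case (insert j J)
  have "lin G (insert j J) c u = u j [^] c j \<otimes> lin G J c u" for c
    using lin_remove[of "insert j J" u j c] insert by simp
  moreover have "lin G J c u \<in> carrier G" using insert by auto
  ultimately show ?case using insert by (simp add: int_pow_distrib int_pow_pow mult.commute)
qed

lemma lin_combine:
  assumes "finite J" "\<And>j. j \<in> J \<Longrightarrow> u j \<in> carrier G"
  shows "lin G J (\<lambda>j. c j - q * c' j) u = lin G J c u \<otimes> lin G J c' u [^] (- q)"
  using lin_add[of J u c "\<lambda>j. (- q) * c' j"] lin_scale[of J u "- q" c'] assms
  by simp

lemma pow_nat_abs_multiples:
  assumes "x \<in> carrier G" shows "x [^] (d::int) \<in> multiples G (nat \<bar>d\<bar>)"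
  using assms by (intro pow_mult_in_multiples) auto

lemma multiples_nat_absE:
  assumes "s \<in> multiples G (nat \<bar>d\<bar>)" obtains z where "z \<in> carrier G" "s = z [^] d"
proof -
  obtain y where y: "y \<in> carrier G" "s = y [^] \<bar>d\<bar>" using assms by (auto simp: multiples_iff)
  show ?thesis
  proof (cases "d \<ge> 0")
    case True thus ?thesis using y that by auto
  next
    case False thus ?thesis using y that[of "inv y"] by (auto simp: int_pow_inv int_pow_neg)
  qed
qed

text \<open>
  Row operations keep the solutions, and a column operation transforms them by an invertible
  substitution. At a pivot \<open>d\<close> the row reads \<open>d (u j + l) = s\<close>, where
  \<open>l\<close> is a combination of the other unknowns. It can be solved for \<open>u
  j\<close>, whatever the other unknowns are, as soon as \<open>d\<close> divides
  \<open>s\<close>; multiples of this row clear \<open>u j\<close> from the other equations.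
\<close>

lemma elim_sound:
  assumes "elim J R D" "finite J" "range v \<subseteq> carrier G"
  shows "(\<exists>u. (\<forall>j\<in>J. u j \<in> carrier G) \<and> (\<forall>(c, s) \<in> R. lin G J c u = term_val G v s)) \<longleftrightarrow> csat G v D"
  using assms
proof (induction rule: elim.induct)
  case (base R J)
  have "lin G J c u = \<one>" if "(c, s) \<in> R" for c s u using that base by (intro lin_zero) auto
  thus ?case unfolding csat_def by (fastforce intro!: exI[of _ "\<lambda>_. \<one>"])
next
  case (row r s R r' s' J q D)
  have v: "term_val G v s \<in> carrier G" "term_val G v s' \<in> carrier G" using row by auto
  have eq: "(\<forall>(c, s)\<in>R. lin G J c u = term_val G v s) \<longleftrightarrow>
      (\<forall>(c, s)\<in>insert (\<lambda>j. r' j - q * r j, Plus s' (smul (- q) s)) (R - {(r', s')}). lin G J c u = term_val G v s)"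
    if u: "\<forall>j\<in>J. u j \<in> carrier G" for u
  proof -
    have l: "lin G J (\<lambda>j. r' j - q * r j) u = lin G J r' u \<otimes> lin G J r u [^] (- q)"
      using u row by (intro lin_combine) auto
    have c: "lin G J r' u \<in> carrier G" using u by auto
    have "lin G J r u = term_val G v s \<Longrightarrow>
      lin G J r' u = term_val G v s' \<longleftrightarrow> lin G J (\<lambda>j. r' j - q * r j) u = term_val G v (Plus s' (smul (- q) s))"
      unfolding l using v c row.prems by simp
    thus ?thesis using row.hyps(1-3) by auto
  qed
  show ?case using row.IH[OF row.prems] eq by blast
next
  case (col j J k q R D)
  let ?f = "\<lambda>(c, s). (c(k := c k - q * c j), s :: ag_term)"
  have l: "lin G J c (w(j := w j \<otimes> w k [^] (- q))) = lin G J (c(k := c k - q * c j)) w"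
    if w: "\<forall>j\<in>J. w j \<in> carrier G" for w c
  proof -
    let ?w = "w(j := w j \<otimes> w k [^] (- q))"
    let ?c = "c(k := c k - q * c j)"
    let ?J = "J - {j} - {k}"
    have w': "\<forall>j\<in>J. ?w j \<in> carrier G" using w col.hyps by auto
    have spl: "lin G J c u = u j [^] c j \<otimes> (u k [^] c k \<otimes> lin G ?J c u)" if "\<forall>j\<in>J. u j \<in> carrier G" for c u
      using lin_remove[of J u j c] lin_remove[of "J - {j}" u k c] col that by auto
    have e: "lin G ?J c ?w = lin G ?J ?c w" using w' by (intro lin_cong) auto
    have cl: "lin G ?J ?c w \<in> carrier G" "w j \<in> carrier G" "w k \<in> carrier G" using w col.hyps by auto
    have "(w j \<otimes> w k [^] (- q)) [^] c j \<otimes> w k [^] c k = w j [^] c j \<otimes> w k [^] (c k - q * c j)"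
      using cl by (simp add: int_pow_distrib int_pow_pow int_pow_mult[symmetric] m_assoc algebra_simps)
    moreover have "?w j = w j \<otimes> w k [^] (- q)" "?w k = w k" "?c j = c j" "?c k = c k - q * c j"
      using col.hyps by auto
    ultimately show ?thesis
      unfolding spl[OF w, of ?c] spl[OF w', of c] e using cl by (simp add: m_assoc[symmetric] del: fun_upd_apply)
  qed
  have "(\<exists>u. (\<forall>j\<in>J. u j \<in> carrier G) \<and> (\<forall>(c, s)\<in>R. lin G J c u = term_val G v s)) \<longleftrightarrow>
     (\<exists>w. (\<forall>j\<in>J. w j \<in> carrier G) \<and> (\<forall>(c, s)\<in>?f ` R. lin G J c w = term_val G v s))"
  proof
    assume "\<exists>u. (\<forall>j\<in>J. u j \<in> carrier G) \<and> (\<forall>(c, s)\<in>R. lin G J c u = term_val G v s)"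
    then obtain u where u: "\<forall>j\<in>J. u j \<in> carrier G" "\<forall>(c, s)\<in>R. lin G J c u = term_val G v s" by blast
    let ?w = "u(j := u j \<otimes> u k [^] q)"
    have w: "\<forall>j\<in>J. ?w j \<in> carrier G" using u col.hyps by auto
    have eq: "?w(j := ?w j \<otimes> ?w k [^] (- q)) = u"
      using u(1) col.hyps by (auto simp: m_assoc int_pow_mult[symmetric])
    have "lin G J (c(k := c k - q * c j)) ?w = lin G J c u" for c
      using l[OF w, of c] unfolding eq by (rule sym)
    thus "\<exists>w. (\<forall>j\<in>J. w j \<in> carrier G) \<and> (\<forall>(c, s)\<in>?f ` R. lin G J c w = term_val G v s)"
      using u(2) w by (intro exI[of _ ?w]) fastforce
  next
    assume "\<exists>w. (\<forall>j\<in>J. w j \<in> carrier G) \<and> (\<forall>(c, s)\<in>?f ` R. lin G J c w = term_val G v s)"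
    then obtain w where w: "\<forall>j\<in>J. w j \<in> carrier G" "\<forall>(c, s)\<in>?f ` R. lin G J c w = term_val G v s" by blast
    let ?u = "w(j := w j \<otimes> w k [^] (- q))"
    have "\<forall>j\<in>J. ?u j \<in> carrier G" using w col.hyps by auto
    moreover have "\<forall>(c, s)\<in>R. lin G J c ?u = term_val G v s" using w(2) l[OF w(1)] by fastforce
    ultimately show "\<exists>u. (\<forall>j\<in>J. u j \<in> carrier G) \<and> (\<forall>(c, s)\<in>R. lin G J c u = term_val G v s)" by blast
  qed
  thus ?case using col.IH[OF col.prems] by simp
next
  case (pivot r s R j J D)
  let ?d = "r j"
  let ?f = "\<lambda>(c, t). (\<lambda>k. c k - (c j div ?d) * r k, Plus t (smul (- (c j div ?d)) s))"
  let ?S = "\<lambda>u. (\<forall>j\<in>J. u j \<in> carrier G) \<and> (\<forall>(c, s)\<in>R. lin G J c u = term_val G v s)"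
  let ?S' = "\<lambda>u. (\<forall>j\<in>J-{j}. u j \<in> carrier G) \<and> (\<forall>(c, s)\<in>?f ` (R - {(r, s)}). lin G (J - {j}) c u = term_val G v s)"
  have s: "term_val G v s \<in> carrier G" using pivot by auto
  have rd: "lin G I r u = lin G I (\<lambda>k. r k div ?d) u [^] ?d"
    if "finite I" "I \<subseteq> J" "\<forall>j\<in>I. u j \<in> carrier G" for I u
  proof -
    have "lin G I r u = lin G I (\<lambda>k. ?d * (r k div ?d)) u"
      using pivot.hyps that by (intro lin_cong) auto
    thus ?thesis using lin_scale[of I u ?d] that by simp
  qed
  have cd: "lin G (J - {j}) (\<lambda>k. c k - (c j div ?d) * r k) u = lin G J c u \<otimes> lin G J r u [^] (- (c j div ?d))"
    if "\<forall>j\<in>J. u j \<in> carrier G" "(c, t) \<in> R" for c t u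
  proof -
    have "c j - (c j div ?d) * r j = 0" using pivot.hyps that by auto
    moreover have "lin G (J - {j}) (\<lambda>k. c k - (c j div ?d) * r k) u \<in> carrier G" using that by auto
    ultimately have "lin G J (\<lambda>k. c k - (c j div ?d) * r k) u = lin G (J - {j}) (\<lambda>k. c k - (c j div ?d) * r k) u"
      using lin_remove[of J u j "\<lambda>k. c k - (c j div ?d) * r k"] that pivot by simp
    thus ?thesis using lin_combine[of J u c "c j div ?d" r] that pivot by simp
  qed
  have "(\<exists>u. ?S u) \<longleftrightarrow> (\<exists>u. ?S' u) \<and> term_val G v s \<in> multiples G (nat \<bar>?d\<bar>)"
  proof
    assume "\<exists>u. ?S u"
    then obtain u where u: "?S u" by blast
    have ru: "lin G J r u = term_val G v s" using u pivot.hyps by auto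
    moreover have "lin G J r u = lin G J (\<lambda>k. r k div ?d) u [^] ?d" using u pivot by (intro rd) auto
    ultimately have "term_val G v s \<in> multiples G (nat \<bar>?d\<bar>)"
      using pow_nat_abs_multiples[of "lin G J (\<lambda>k. r k div ?d) u" ?d] u by auto
    moreover have "?S' u"
    proof (intro conjI ballI)
      fix e assume "e \<in> ?f ` (R - {(r, s)})"
      then obtain z where z: "z \<in> R - {(r, s)}" "e = ?f z" by (rule imageE)
      obtain c t where "z = (c, t)" by (cases z)
      hence ct: "(c, t) \<in> R" "e = ?f (c, t)" using z(1) by (simp, simp only: z(2))
      have "lin G J c u = term_val G v t" using u ct(1) by blast
      hence "lin G (J - {j}) (\<lambda>k. c k - (c j div ?d) * r k) u = term_val G v t \<otimes> term_val G v s [^] (- (c j div ?d))"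
        using cd[of u c t] u ct(1) ru by simp
      thus "case e of (c, s) \<Rightarrow> lin G (J - {j}) c u = term_val G v s"
        using ct(2) pivot.prems by simp
    qed (use u in blast)
    ultimately show "(\<exists>u. ?S' u) \<and> term_val G v s \<in> multiples G (nat \<bar>?d\<bar>)" by blast
  next
    assume A: "(\<exists>u. ?S' u) \<and> term_val G v s \<in> multiples G (nat \<bar>?d\<bar>)"
    obtain u where u: "?S' u" using conjunct1[OF A] by (rule exE)
    obtain z where z: "z \<in> carrier G" "term_val G v s = z [^] ?d"
      using multiples_nat_absE[OF conjunct2[OF A]] .
    let ?l = "lin G (J - {j}) (\<lambda>k. r k div ?d) u"
    let ?u = "u(j := z \<otimes> inv ?l)"
    have l: "?l \<in> carrier G" using u by auto
    have uc: "\<forall>j\<in>J. ?u j \<in> carrier G" using u z l by auto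
    have same: "lin G (J - {j}) c ?u = lin G (J - {j}) c u" for c using u by (intro lin_cong) auto
    have "lin G J r ?u = (z \<otimes> inv ?l) [^] ?d \<otimes> lin G (J - {j}) r u"
      using lin_remove[of J ?u j r] uc pivot same by simp
    also have "lin G (J - {j}) r u = ?l [^] ?d" using u pivot by (intro rd) auto
    also have "(z \<otimes> inv ?l) [^] ?d \<otimes> ?l [^] ?d = z [^] ?d"
      using z l by (simp add: int_pow_distrib int_pow_inv m_assoc)
    finally have ru: "lin G J r ?u = term_val G v s" unfolding z(2) .
    have "lin G J c ?u = term_val G v t" if "(c, t) \<in> R" for c t
    proof (cases "(c, t) = (r, s)")
      case True thus ?thesis using ru by simp
    next
      case False
      let ?q = "c j div ?d"
      have t: "term_val G v t \<in> carrier G" "lin G J c ?u \<in> carrier G" using pivot uc by auto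
      have "?f (c, t) \<in> ?f ` (R - {(r, s)})" using that False by (intro imageI) auto
      hence "case ?f (c, t) of (c, s) \<Rightarrow> lin G (J - {j}) c u = term_val G v s"
        by (rule bspec[OF conjunct2[OF u]])
      hence "lin G (J - {j}) (\<lambda>k. c k - ?q * r k) u = term_val G v t \<otimes> term_val G v s [^] (- ?q)"
        using pivot.prems by simp
      hence "lin G J c ?u \<otimes> lin G J r ?u [^] (- ?q) = term_val G v t \<otimes> term_val G v s [^] (- ?q)"
        using cd[OF uc that] same[of "\<lambda>k. c k - ?q * r k"] by (simp only:)
      thus ?thesis using ru t s by (simp del: fun_upd_apply)
    qed
    hence "?S ?u" using uc by blast
    thus "\<exists>u. ?S u" by (rule exI[of ?S ?u])
  qed
  also have "(\<exists>u. ?S' u) \<longleftrightarrow> csat G v D" by (rule pivot.IH) (use pivot.prems in auto)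
  finally show ?case by (simp add: csat_def conj_commute)
qed

end

section \<open>Positive primitive formulas\<close>

text \<open>
  The condition that \<open>n\<close> divides \<open>a x + r\<close> becomes the equation \<open>n
  y - a x = r\<close>. Unknown 0 is \<open>x\<close>, and unknown \<open>i + 1\<close> is the
  witness \<open>y\<close> of the \<open>i\<close>-th condition.
\<close>

definition rows :: "(nat \<times> ag_term) list \<Rightarrow> ((nat \<Rightarrow> int) \<times> ag_term) set" where
  "rows ts = (\<lambda>i. (\<lambda>j. if j = 0 then - coef 0 (snd (ts ! i)) else if j = Suc i then int (fst (ts ! i)) else 0,
                  rest (snd (ts ! i)))) ` {..<length ts}"

text \<open>
  A relation between formulas and conditions, because the elimination admits several outcomes. It
  does not mention a group.
\<close>

inductive ppnf :: "ag_form \<Rightarrow> (nat \<times> ag_term) set \<Rightarrow> bool" where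
  ppnf_Equal: "ppnf (Equal s t) {(0, Plus s (Minus t))}"
| ppnf_Conj: "ppnf \<phi> D \<Longrightarrow> ppnf \<psi> E \<Longrightarrow> ppnf (Conj \<phi> \<psi>) (D \<union> E)"
| ppnf_Exists: "ppnf \<phi> (set ts) \<Longrightarrow> elim {..length ts} (rows ts) D \<Longrightarrow> ppnf (Exists \<phi>) D"

inductive pp :: "ag_form \<Rightarrow> bool" where
  pp_Equal [intro, simp]: "pp (Equal s t)"
| pp_Conj [intro]: "pp \<phi> \<Longrightarrow> pp \<psi> \<Longrightarrow> pp (Conj \<phi> \<psi>)"
| pp_Exists [intro]: "pp \<phi> \<Longrightarrow> pp (Exists \<phi>)"

lemma ppnf_finite: "ppnf \<phi> D \<Longrightarrow> finite D"
  by (induction rule: ppnf.induct) (auto simp: rows_def intro: elim_finite)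

lemma ppnf_exists: "pp \<phi> \<Longrightarrow> \<exists>D. ppnf \<phi> D"
proof (induction rule: pp.induct)
  case (pp_Exists \<phi>)
  then obtain D where D: "ppnf \<phi> D" by blast
  obtain ts where "set ts = D" using ppnf_finite[OF D] finite_list by blast
  thus ?case using D elim_exists[of "{..length ts}" "rows ts"] by (metis finite_atMost ppnf_Exists)
qed (blast intro: ppnf.intros)+

context comm_group begin

lemma rows_sound:
  assumes v: "range v \<subseteq> carrier G"
  shows "(\<exists>x\<in>carrier G. csat G (case_nat x v) (set ts)) \<longleftrightarrow>
    (\<exists>u. (\<forall>j\<in>{..length ts}. u j \<in> carrier G) \<and>
         (\<forall>(c, s) \<in> rows ts. lin G {..length ts} c u = term_val G v s))"
proof -
  let ?n = "\<lambda>i. fst (ts ! i)" and ?t = "\<lambda>i. snd (ts ! i)"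
  let ?a = "\<lambda>i. coef 0 (snd (ts ! i))" and ?r = "\<lambda>i. term_val G v (rest (snd (ts ! i)))"
  let ?c = "\<lambda>i j. if j = 0 then - ?a i else if j = Suc i then int (?n i) else 0"
  have r: "?r i \<in> carrier G" for i using v by auto
  have lin: "lin G {..length ts} (?c i) u = u 0 [^] (- ?a i) \<otimes> u (Suc i) [^] int (?n i)"
    if "\<forall>j\<in>{..length ts}. u j \<in> carrier G" "i < length ts" for u i
  proof -
    have "lin G {..length ts} (?c i) u =
        u 0 [^] (- ?a i) \<otimes> (u (Suc i) [^] int (?n i) \<otimes> lin G ({..length ts} - {0} - {Suc i}) (?c i) u)"
      using lin_remove[of "{..length ts}" u 0 "?c i"] lin_remove[of "{..length ts} - {0}" u "Suc i" "?c i"] that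
      by auto
    also have "lin G ({..length ts} - {0} - {Suc i}) (?c i) u = \<one>" by (rule lin_zero) auto
    finally show ?thesis using that by simp
  qed
  have key: "y [^] int (?n i) = x [^] ?a i \<otimes> ?r i \<longleftrightarrow> x [^] (- ?a i) \<otimes> y [^] int (?n i) = ?r i"
    if "x \<in> carrier G" "y \<in> carrier G" for x y i
    using that r[of i] by (simp add: int_pow_neg) (metis int_pow_closed inv_solve_left)
  have rowsb: "(\<forall>(c, s) \<in> rows ts. P c s) \<longleftrightarrow> (\<forall>i<length ts. P (?c i) (rest (?t i)))" for P
    by (auto simp: rows_def)
  have csat: "csat G (case_nat x v) (set ts) \<longleftrightarrow>
      (\<forall>i<length ts. \<exists>y\<in>carrier G. x [^] (- ?a i) \<otimes> y [^] int (?n i) = ?r i)" if "x \<in> carrier G" for x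
  proof -
    have "csat G (case_nat x v) (set ts) \<longleftrightarrow>
        (\<forall>i<length ts. term_val G (case_nat x v) (?t i) \<in> multiples G (?n i))"
      unfolding csat_def all_set_conv_all_nth by (simp add: case_prod_beta)
    thus ?thesis unfolding term_val_case_nat[OF that v] multiples_iff using key[OF that] by metis
  qed
  show ?thesis
  proof
    assume "\<exists>x\<in>carrier G. csat G (case_nat x v) (set ts)"
    then obtain x y where x: "x \<in> carrier G"
      and y: "\<forall>i<length ts. y i \<in> carrier G \<and> x [^] (- ?a i) \<otimes> y i [^] int (?n i) = ?r i"
      using csat by metis
    let ?u = "case_nat x y"
    have "\<forall>j\<in>{..length ts}. ?u j \<in> carrier G" using x y by (auto split: nat.splits)
    moreover from this have "\<forall>i<length ts. lin G {..length ts} (?c i) ?u = ?r i"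
      using y lin by simp
    ultimately show "\<exists>u. (\<forall>j\<in>{..length ts}. u j \<in> carrier G) \<and>
         (\<forall>(c, s) \<in> rows ts. lin G {..length ts} c u = term_val G v s)"
      unfolding rowsb by blast
  next
    assume "\<exists>u. (\<forall>j\<in>{..length ts}. u j \<in> carrier G) \<and>
         (\<forall>(c, s) \<in> rows ts. lin G {..length ts} c u = term_val G v s)"
    then obtain u where u: "\<forall>j\<in>{..length ts}. u j \<in> carrier G"
      "\<forall>i<length ts. lin G {..length ts} (?c i) u = ?r i" unfolding rowsb by blast
    hence "csat G (case_nat (u 0) v) (set ts)"
      by (subst csat) (auto simp: lin intro!: bexI[of _ "u (Suc _)"])
    thus "\<exists>x\<in>carrier G. csat G (case_nat x v) (set ts)" using u by auto
  qed
qed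

lemma ppnf_sound:
  "ppnf \<phi> D \<Longrightarrow> range v \<subseteq> carrier G \<Longrightarrow> sat G v \<phi> \<longleftrightarrow> csat G v D"
proof (induction arbitrary: v rule: ppnf.induct)
  case (ppnf_Equal s t)
  have "term_val G v s \<in> carrier G" "term_val G v t \<in> carrier G" using ppnf_Equal by auto
  thus ?case by (auto simp: csat_def) (metis inv_equality inv_inv inv_closed)
next
  case (ppnf_Conj \<phi> D \<psi> E)
  have "csat G v (D \<union> E) \<longleftrightarrow> csat G v D \<and> csat G v E" by (auto simp: csat_def)
  thus ?case using ppnf_Conj by simp
next
  case (ppnf_Exists \<phi> ts D)
  have "sat G v (Exists \<phi>) \<longleftrightarrow> (\<exists>x\<in>carrier G. csat G (case_nat x v) (set ts))"
    using ppnf_Exists.IH range_case_nat[OF _ ppnf_Exists.prems] by auto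
  thus ?case using rows_sound[OF ppnf_Exists.prems] elim_sound[OF ppnf_Exists.hyps(2) _ ppnf_Exists.prems] by simp
qed

end

definition ppsub :: "('m, 'e) monoid_scheme \<Rightarrow> ag_form \<Rightarrow> 'm set" where
  "ppsub M \<phi> = {x \<in> carrier M. sat M (case_nat x (\<lambda>_. \<one>\<^bsub>M\<^esub>)) \<phi>}"

text \<open>With all parameters zero, a term reduces to its coefficient at variable 0.\<close>

definition conds1 :: "(nat \<times> ag_term) set \<Rightarrow> (nat \<times> int) set" where
  "conds1 D = (\<lambda>(n, t). (n, coef 0 t)) ` D"

context comm_group begin

lemma ppsub_eq_sol:
  assumes "ppnf \<phi> D" shows "ppsub G \<phi> = sol G (conds1 D)"
proof -
  have "sat G (case_nat x (\<lambda>_. \<one>)) \<phi> \<longleftrightarrow> (\<forall>(n, a) \<in> conds1 D. x [^] a \<in> multiples G n)" if "x \<in> carrier G" for x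
  proof -
    have "range (case_nat x (\<lambda>_. \<one>)) \<subseteq> carrier G" using that by (intro range_case_nat) auto
    hence "sat G (case_nat x (\<lambda>_. \<one>)) \<phi> \<longleftrightarrow> csat G (case_nat x (\<lambda>_. \<one>)) D" by (rule ppnf_sound[OF assms])
    moreover have "term_val G (case_nat x (\<lambda>_. \<one>)) t = x [^] coef 0 t" for t
      using that term_val_case_nat[of x "\<lambda>_. \<one>" t] by simp
    ultimately show ?thesis by (auto simp: csat_def conds1_def)
  qed
  thus ?thesis by (auto simp: ppsub_def sol_def)
qed

lemma ppsub_subgroup: "pp \<phi> \<Longrightarrow> subgroup (ppsub G \<phi>) G"
  using ppnf_exists ppsub_eq_sol sol_subgroup by metis

text \<open>The conditions of the normal form are additive, so the parameters cancel in the difference of two solutions.\<close>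

lemma pp_coset:
  assumes "pp \<phi>" "range v \<subseteq> carrier G" "x \<in> carrier G" "y \<in> carrier G" "sat G (case_nat x v) \<phi>"
  shows "sat G (case_nat y v) \<phi> \<longleftrightarrow> y \<otimes> inv x \<in> ppsub G \<phi>"
proof -
  obtain D where D: "ppnf \<phi> D" using assms ppnf_exists by blast
  have "term_val G (case_nat y v) t \<in> multiples G n \<longleftrightarrow> (y \<otimes> inv x) [^] coef 0 t \<in> multiples G n"
    if "(n, t) \<in> D" for n t
  proof -
    have m: "subgroup (multiples G n) G" by simp
    have r: "term_val G v (rest t) \<in> carrier G" using assms by auto
    have "term_val G (case_nat x v) t \<in> multiples G n"
      using assms ppnf_sound[OF D range_case_nat] that by (auto simp: csat_def)
    hence h: "x [^] coef 0 t \<otimes> term_val G v (rest t) \<in> multiples G n"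
      using assms term_val_case_nat by simp
    let ?w = "x [^] coef 0 t \<otimes> term_val G v (rest t)"
    have e: "y [^] coef 0 t \<otimes> term_val G v (rest t) = (y \<otimes> inv x) [^] coef 0 t \<otimes> ?w"
    proof -
      have "(y \<otimes> inv x) [^] coef 0 t \<otimes> x [^] coef 0 t = y [^] coef 0 t"
        using assms by (simp add: int_pow_distrib[symmetric] m_assoc)
      thus ?thesis using assms r by (simp add: m_assoc[symmetric])
    qed
    have c: "(y \<otimes> inv x) [^] coef 0 t \<in> carrier G" "?w \<in> carrier G" using assms r by auto
    have e2: "(y \<otimes> inv x) [^] coef 0 t = ((y \<otimes> inv x) [^] coef 0 t \<otimes> ?w) \<otimes> inv ?w"
      using c by (simp add: m_assoc)
    show ?thesis unfolding term_val_case_nat[OF assms(4,2)] e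
      using h e2 subgroup.m_closed[OF m] subgroup.m_inv_closed[OF m] by metis
  qed
  hence "(\<forall>(n, t) \<in> D. term_val G (case_nat y v) t \<in> multiples G n) \<longleftrightarrow>
      (\<forall>(n, t) \<in> D. (y \<otimes> inv x) [^] coef 0 t \<in> multiples G n)" by blast
  moreover have "sat G (case_nat y v) \<phi> \<longleftrightarrow> (\<forall>(n, t) \<in> D. term_val G (case_nat y v) t \<in> multiples G n)"
    using ppnf_sound[OF D range_case_nat[OF assms(4,2)]] by (simp only: csat_def)
  moreover have "y \<otimes> inv x \<in> ppsub G \<phi> \<longleftrightarrow> (\<forall>(n, t) \<in> D. (y \<otimes> inv x) [^] coef 0 t \<in> multiples G n)"
    unfolding ppsub_eq_sol[OF D] sol_def conds1_def using assms(3,4) by (simp add: case_prod_beta)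
  ultimately show ?thesis by simp
qed

end

section \<open>Coverings by cosets\<close>

context comm_group begin

text \<open>
  The lemma of B. H. Neumann, by induction on the number of subgroups involved. As
  \<open>K\<close> has infinite index, some coset \<open>K h\<close> is not among the given cosets
  of \<open>K\<close>. Were \<open>H\<close> covered, then cosets of the other subgroups would
  cover \<open>K h\<close>, and translates of these would cover the given cosets of
  \<open>K\<close>. Hence finitely many cosets of the other subgroups would cover
  \<open>H\<close>.
\<close>

lemma neumann:
  assumes "finite Ks" "subgroup H G"
    "\<And>K. K \<in> Ks \<Longrightarrow> subgroup K G \<and> idx G H K = \<infinity> \<and> finite (A K) \<and> A K \<subseteq> carrier G"
  shows "\<exists>h\<in>H. \<forall>K\<in>Ks. \<forall>a\<in>A K. h \<otimes> inv a \<notin> K"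
  using assms(1,3)
proof (induction Ks arbitrary: A rule: finite_induct)
  case empty thus ?case using subgroup.one_closed[OF assms(2)] by auto
next
  case (insert K Ks A)
  note K = insert.prems[of K, simplified]
  have H: "x \<in> carrier G" if "x \<in> H" for x using subgroup.mem_carrier[OF assms(2)] that by blast
  have "infinite ((\<lambda>x. K #> x) ` H)" using K by (simp add: idx_def ecard_infinite_iff)
  hence "\<not> (\<lambda>x. K #> x) ` H \<subseteq> (\<lambda>x. K #> x) ` A K" using K finite_subset by blast
  then obtain h where h: "h \<in> H" "K #> h \<notin> (\<lambda>x. K #> x) ` A K" by blast
  \<comment> \<open>\<open>r a\<close> represents the coset of \<open>a\<close> within \<open>H\<close>, if \<open>H\<close> meets it.\<close>
  define r where "r = (\<lambda>a. if \<exists>x. x \<in> H \<and> x \<otimes> inv a \<in> K then SOME x. x \<in> H \<and> x \<otimes> inv a \<in> K else \<one>)"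
  have r: "r a \<in> H \<and> r a \<otimes> inv a \<in> K" if "x \<in> H" "x \<otimes> inv a \<in> K" for a x
  proof -
    have ex: "\<exists>x. x \<in> H \<and> x \<otimes> inv a \<in> K" using that by blast
    have "(SOME x. x \<in> H \<and> x \<otimes> inv a \<in> K) \<in> H \<and> (SOME x. x \<in> H \<and> x \<otimes> inv a \<in> K) \<otimes> inv a \<in> K"
      by (rule someI_ex[OF ex])
    thus ?thesis using ex unfolding r_def by presburger
  qed
  have rH: "r a \<in> H" for a
  proof (cases "\<exists>x. x \<in> H \<and> x \<otimes> inv a \<in> K")
    case True thus ?thesis using r by blast
  next
    case False
    hence "r a = \<one>" unfolding r_def by (rule if_not_P)
    thus ?thesis using subgroup.one_closed[OF assms(2)] by simp
  qed
  \<comment> \<open>The given cosets of the other subgroups, and their translates that move \<open>K h\<close> to the cosets of \<open>K\<close>.\<close>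
  define A' where "A' = (\<lambda>K'. A K' \<union> (\<lambda>(a', a). a' \<otimes> (inv h \<otimes> r a)) ` (A K' \<times> A K))"
  have "\<exists>x\<in>H. \<forall>K'\<in>Ks. \<forall>a\<in>A' K'. x \<otimes> inv a \<notin> K'"
  proof (rule insert.IH)
    fix K' assume K': "K' \<in> Ks"
    note p = insert.prems[of K', simplified, OF disjI2[OF K']]
    have "A' K' \<subseteq> carrier G"
    proof
      fix z assume "z \<in> A' K'"
      then consider "z \<in> A K'" | a' a where "a' \<in> A K'" "a \<in> A K" "z = a' \<otimes> (inv h \<otimes> r a)"
        unfolding A'_def by auto
      thus "z \<in> carrier G"
      proof cases
        case 1 thus ?thesis using p by blast
      next
        case 2
        hence "a' \<in> carrier G" using p by blast
        thus ?thesis using 2 H[OF h(1)] H[OF rH] by simp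
      qed
    qed
    thus "subgroup K' G \<and> idx G H K' = \<infinity> \<and> finite (A' K') \<and> A' K' \<subseteq> carrier G"
      using p K unfolding A'_def by blast
  qed
  then obtain x where x: "x \<in> H" "\<And>K' a. K' \<in> Ks \<Longrightarrow> a \<in> A' K' \<Longrightarrow> x \<otimes> inv a \<notin> K'" by blast
  show ?case
  proof (cases "\<exists>a\<in>A K. x \<otimes> inv a \<in> K")
    case False
    thus ?thesis using x unfolding A'_def by blast
  next
    case True
    \<comment> \<open>The coset of \<open>x\<close> is moved to the coset of \<open>h\<close>, which none of the given cosets of \<open>K\<close> meets.\<close>
    then obtain a where a: "a \<in> A K" "x \<otimes> inv a \<in> K" by blast
    let ?y = "x \<otimes> inv (r a) \<otimes> h"
    have ra: "r a \<in> H" "r a \<otimes> inv a \<in> K" using r[OF x(1) a(2)] by auto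
    have ac: "a \<in> carrier G" using a K by blast
    note c = H[OF x(1)] H[OF ra(1)] H[OF h(1)] ac
    have xr: "x \<otimes> inv (r a) \<in> K"
    proof -
      have "(x \<otimes> inv a) \<otimes> inv (r a \<otimes> inv a) \<in> K"
        using a ra K by (meson subgroup.m_closed subgroup.m_inv_closed)
      moreover have "(x \<otimes> inv a) \<otimes> inv (r a \<otimes> inv a) = x \<otimes> inv (r a)"
        using c by (simp add: inv_mult_group m_assoc) (simp add: m_assoc[symmetric])
      ultimately show ?thesis by simp
    qed
    have y: "?y \<in> H" using x ra h assms(2) by (meson subgroup.m_closed subgroup.m_inv_closed)
    have yh: "K #> ?y = K #> h" using rcos_eq_iff[of K ?y h] K xr c by (simp add: m_assoc)
    have "?y \<otimes> inv b \<notin> K" if "b \<in> A K" for b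
    proof
      assume "?y \<otimes> inv b \<in> K"
      hence "K #> ?y = K #> b" using rcos_eq_iff[of K ?y b] K that c by blast
      thus False using yh h(2) that by auto
    qed
    moreover have "?y \<otimes> inv b \<notin> K'" if "K' \<in> Ks" "b \<in> A K'" for K' b
    proof
      assume "?y \<otimes> inv b \<in> K'"
      moreover have "b \<in> carrier G" using insert.prems[of K'] that by blast
      hence "?y \<otimes> inv b = x \<otimes> inv (b \<otimes> (inv h \<otimes> r a))"
        using c by (simp add: inv_mult m_ac)
      moreover have "b \<otimes> (inv h \<otimes> r a) \<in> A' K'" unfolding A'_def using that a(1) by force
      ultimately show False using x(2)[OF that(1)] by metis
    qed
    ultimately show ?thesis using y by blast
  qed
qed

end

text \<open>
  Inclusion and exclusion: the size of a union is a function of the sizes of the intersections.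
\<close>

lemma card_UN_cong_Int:
  assumes "finite J"
    "\<And>i. i \<in> J \<Longrightarrow> finite (A i) \<and> finite (B i)"
    "\<And>S. S \<subseteq> J \<Longrightarrow> S \<noteq> {} \<Longrightarrow> card (\<Inter>i\<in>S. A i) = card (\<Inter>i\<in>S. B i)"
  shows "card (\<Union>i\<in>J. A i) = card (\<Union>i\<in>J. B i)"
  using assms
proof (induction J arbitrary: A B rule: finite_induct)
  case (insert j J)
  have S: "card (\<Union>i\<in>insert j J. C i) + card (\<Union>i\<in>J. C i \<inter> C j) = card (C j) + card (\<Union>i\<in>J. C i)"
    if "\<And>i. i \<in> insert j J \<Longrightarrow> finite (C i)" for C :: "_ \<Rightarrow> 'z set"
  proof -
    have "C j \<inter> (\<Union>i\<in>J. C i) = (\<Union>i\<in>J. C i \<inter> C j)" by auto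
    thus ?thesis using card_Un_Int[of "C j" "\<Union>i\<in>J. C i"] that insert.hyps by simp
  qed
  have "card (\<Union>i\<in>J. A i \<inter> A j) = card (\<Union>i\<in>J. B i \<inter> B j)"
  proof (rule insert.IH)
    fix S assume h: "S \<subseteq> J" "S \<noteq> {}"
    hence "(\<Inter>i\<in>S. A i \<inter> A j) = (\<Inter>i\<in>insert j S. A i)" "(\<Inter>i\<in>S. B i \<inter> B j) = (\<Inter>i\<in>insert j S. B i)" by auto
    moreover have "card (\<Inter>i\<in>insert j S. A i) = card (\<Inter>i\<in>insert j S. B i)"
      by (rule insert.prems(2)) (use h in auto)
    ultimately show "card (\<Inter>i\<in>S. A i \<inter> A j) = card (\<Inter>i\<in>S. B i \<inter> B j)"
      by (simp only:)
  qed (use insert.prems in auto)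
  moreover have "card (\<Union>i\<in>J. A i) = card (\<Union>i\<in>J. B i)"
    by (rule insert.IH) (use insert.prems in auto)
  moreover have "card (A j) = card (B j)" using insert.prems(2)[of "{j}"] by simp
  ultimately show ?case using S[of A] S[of B] insert.prems(1) by simp
qed simp

section \<open>Reduction to positive primitive formulas\<close>

text \<open>The conjunction of a finite set of formulas, in some order.\<close>

definition cj :: "ag_form set \<Rightarrow> ag_form" where
  "cj S = foldr Conj (SOME xs. set xs = S) (Equal Zero Zero)"

lemma set_some_list: "finite S \<Longrightarrow> set (SOME xs. set xs = S) = S"
  using finite_list by (metis (mono_tags, lifting) someI_ex)

lemma sat_cj [simp]: "finite S \<Longrightarrow> sat M v (cj S) \<longleftrightarrow> (\<forall>\<psi>\<in>S. sat M v \<psi>)"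
proof -
  assume "finite S"
  have "sat M v (foldr Conj xs (Equal Zero Zero)) \<longleftrightarrow> (\<forall>\<psi>\<in>set xs. sat M v \<psi>)" for xs by (induction xs) auto
  thus ?thesis unfolding cj_def using set_some_list[OF \<open>finite S\<close>] by simp
qed

lemma pp_cj: assumes "finite S" "\<And>\<psi>. \<psi> \<in> S \<Longrightarrow> pp \<psi>" shows "pp (cj S)"
proof -
  have "(\<forall>\<psi>\<in>set xs. pp \<psi>) \<Longrightarrow> pp (foldr Conj xs (Equal Zero Zero))" for xs by (induction xs) auto
  thus ?thesis unfolding cj_def using set_some_list assms by blast
qed

lemma ppsub_cj: "finite S \<Longrightarrow> ppsub M (cj S) = carrier M \<inter> (\<Inter>\<psi>\<in>S. ppsub M \<psi>)"
  by (auto simp: ppsub_def)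

lemma ppsub_cj_Un: "finite S \<Longrightarrow> finite T \<Longrightarrow> ppsub M (cj (S \<union> T)) = ppsub M (cj S) \<inter> ppsub M (cj T)"
  by (auto simp: ppsub_def)

lemma ppsub_carrier: "ppsub M \<phi> \<subseteq> carrier M" by (auto simp: ppsub_def)

context comm_group begin

text \<open>
  Every instance of a formula in \<open>E\<close> defines a coset of a subgroup of infinite index,
  so the translate of \<open>H\<close> by \<open>y\<close> is not covered by the instances.
\<close>

lemma pp_avoid:
  assumes "finite E" "subgroup H G" "y \<in> carrier G"
    "\<And>\<psi> v. (\<psi>, v) \<in> E \<Longrightarrow> pp \<psi> \<and> range v \<subseteq> carrier G \<and> idx G H (ppsub G \<psi>) = \<infinity>"
  shows "\<exists>h\<in>H. \<forall>(\<psi>, v) \<in> E. \<not> sat G (case_nat (h \<otimes> y) v) \<psi>"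
proof -
  define a where "a = (\<lambda>(\<psi>, v). if \<exists>h\<in>H. sat G (case_nat (h \<otimes> y) v) \<psi>
      then SOME h. h \<in> H \<and> sat G (case_nat (h \<otimes> y) v) \<psi> else \<one>)"
  have a: "a (\<psi>, v) \<in> H \<and> sat G (case_nat (a (\<psi>, v) \<otimes> y) v) \<psi>" if "h \<in> H" "sat G (case_nat (h \<otimes> y) v) \<psi>" for h \<psi> v
  proof -
    have ex: "\<exists>h. h \<in> H \<and> sat G (case_nat (h \<otimes> y) v) \<psi>" using that by blast
    hence "a (\<psi>, v) = (SOME h. h \<in> H \<and> sat G (case_nat (h \<otimes> y) v) \<psi>)" unfolding a_def by auto
    thus ?thesis using someI_ex[OF ex] by simp
  qed
  have aH: "a e \<in> H" for e
  proof (cases e)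
    case (Pair \<psi> v)
    show ?thesis
    proof (cases "\<exists>h\<in>H. sat G (case_nat (h \<otimes> y) v) \<psi>")
      case True thus ?thesis using a Pair by blast
    next
      case False
      hence "a e = \<one>" unfolding a_def Pair by simp
      thus ?thesis using subgroup.one_closed[OF assms(2)] by simp
    qed
  qed
  have Hc: "x \<in> carrier G" if "x \<in> H" for x using subgroup.mem_carrier[OF assms(2)] that by blast
  have "\<exists>h\<in>H. \<forall>K\<in>(\<lambda>(\<psi>, v). ppsub G \<psi>) ` E. \<forall>b\<in>a ` E. h \<otimes> inv b \<notin> K"
    by (rule neumann) (use assms aH Hc ppsub_subgroup in \<open>auto simp: image_subset_iff\<close>)
  then obtain h where h: "h \<in> H" "\<forall>K\<in>(\<lambda>(\<psi>, v). ppsub G \<psi>) ` E. \<forall>b\<in>a ` E. h \<otimes> inv b \<notin> K" by blast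
  have "\<not> sat G (case_nat (h \<otimes> y) v) \<psi>" if e: "(\<psi>, v) \<in> E" for \<psi> v
  proof
    assume s: "sat G (case_nat (h \<otimes> y) v) \<psi>"
    let ?b = "a (\<psi>, v)"
    have b: "?b \<in> H" "sat G (case_nat (?b \<otimes> y) v) \<psi>" using a[OF h(1) s] by auto
    have c: "h \<in> carrier G" "?b \<in> carrier G" using h b Hc by auto
    have "(h \<otimes> y) \<otimes> inv (?b \<otimes> y) \<in> ppsub G \<psi>"
      using pp_coset[of \<psi> v "?b \<otimes> y" "h \<otimes> y"] assms(3,4) e b s c by auto
    moreover have "(h \<otimes> y) \<otimes> inv (?b \<otimes> y) = h \<otimes> inv ?b"
      using c assms(3) by (simp add: inv_mult m_ac) (simp add: m_assoc[symmetric])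
    ultimately show False using h(2) e by force
  qed
  thus ?thesis using h(1) by blast
qed

end

context comm_group begin

lemma pp_saturated:
  assumes "pp \<phi>" "range v \<subseteq> carrier G" "subgroup K G" "K \<subseteq> ppsub G \<phi>" "x \<in> carrier G" "y \<in> carrier G"
    "K #> x = K #> y" "sat G (case_nat x v) \<phi>"
  shows "sat G (case_nat y v) \<phi>"
  using pp_coset[OF assms(1,2,5,6,8)] rcos_eq_iff[OF assms(3,6,5)] assms(4,7) by auto

text \<open>The solution set is a translate of the subgroup, because it is nonempty.\<close>

lemma pp_solutions_ecard:
  assumes "pp \<phi>" "range v \<subseteq> carrier G" "subgroup K G" "K \<subseteq> ppsub G \<phi>"
    "x \<in> carrier G" "sat G (case_nat x v) \<phi>"
  shows "ecard ((\<lambda>x. K #> x) ` {x \<in> carrier G. sat G (case_nat x v) \<phi>}) = idx G (ppsub G \<phi>) K"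
proof -
  have "{x \<in> carrier G. sat G (case_nat x v) \<phi>} = (\<lambda>h. h \<otimes> x) ` ppsub G \<phi>" (is "?A = ?B")
  proof
    show "?A \<subseteq> ?B"
    proof
      fix y assume y: "y \<in> ?A"
      hence "y \<otimes> inv x \<in> ppsub G \<phi>" using pp_coset[OF assms(1,2,5) _ assms(6)] by blast
      moreover have "y = (y \<otimes> inv x) \<otimes> x" using y assms(5) by (simp add: m_assoc)
      ultimately show "y \<in> ?B" by blast
    qed
    show "?B \<subseteq> ?A"
    proof
      fix y assume "y \<in> ?B"
      then obtain h where h: "h \<in> ppsub G \<phi>" "y = h \<otimes> x" by blast
      hence c: "h \<in> carrier G" using ppsub_carrier[of G \<phi>] by blast
      hence "y \<otimes> inv x \<in> ppsub G \<phi>" using h assms(5) by (simp add: m_assoc)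
      thus "y \<in> ?A" using pp_coset[OF assms(1,2,5) _ assms(6)] c h assms(5) by auto
    qed
  qed
  moreover have "ecard ((\<lambda>z. K #> (z \<otimes> x)) ` ppsub G \<phi>) = ecard ((\<lambda>z. K #> z) ` ppsub G \<phi>)"
  proof (rule ecard_image_cong)
    fix a b assume "a \<in> ppsub G \<phi>" "b \<in> ppsub G \<phi>"
    hence c: "a \<in> carrier G" "b \<in> carrier G" using ppsub_carrier[of G \<phi>] by blast+
    have "(a \<otimes> x) \<otimes> inv (b \<otimes> x) = a \<otimes> (x \<otimes> inv x) \<otimes> inv b"
      using c assms(5) by (simp only: inv_mult m_ac m_closed inv_closed)
    hence "(a \<otimes> x) \<otimes> inv (b \<otimes> x) = a \<otimes> inv b" using c assms(5) by simp
    thus "(K #> (a \<otimes> x) = K #> (b \<otimes> x)) = (K #> a = K #> b)"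
      using rcos_eq_iff[OF assms(3)] c assms(5) by simp
  qed
  ultimately show ?thesis by (simp add: idx_def image_image)
qed

end

text \<open>On sets that are unions of fibres, taking images commutes with intersections.\<close>

lemma image_INT_saturated:
  assumes "S \<noteq> {}" "\<And>i. i \<in> S \<Longrightarrow> Z i \<subseteq> C"
    "\<And>i x y. i \<in> S \<Longrightarrow> x \<in> Z i \<Longrightarrow> y \<in> C \<Longrightarrow> f x = f y \<Longrightarrow> y \<in> Z i"
  shows "(\<Inter>i\<in>S. f ` Z i) = f ` (\<Inter>i\<in>S. Z i)"
proof (rule subset_antisym; rule subsetI)
  fix c assume c: "c \<in> (\<Inter>i\<in>S. f ` Z i)"
  obtain i where i: "i \<in> S" using assms(1) by blast
  obtain x where x: "c = f x" "x \<in> Z i" using INT_D[OF c i] by (rule imageE)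
  have "x \<in> Z j" if j: "j \<in> S" for j
  proof -
    obtain y where y: "c = f y" "y \<in> Z j" using INT_D[OF c j] by (rule imageE)
    show ?thesis
      by (rule assms(3)[OF j y(2) _ trans[OF y(1)[symmetric] x(1)]]) (rule subsetD[OF assms(2)[OF i] x(2)])
  qed
  thus "c \<in> f ` (\<Inter>i\<in>S. Z i)" unfolding x(1) by (intro imageI INT_I)
next
  fix c assume "c \<in> f ` (\<Inter>i\<in>S. Z i)"
  thus "c \<in> (\<Inter>i\<in>S. f ` Z i)" by auto
qed

context comm_group begin

text \<open>The solution sets are unions of cosets of \<open>K\<close>, so passing to cosets commutes with conjunction.\<close>

lemma pp_quotient_INT:
  assumes pp: "\<And>\<psi>. \<psi> \<in> S \<Longrightarrow> pp (cj (P \<union> {\<psi>})) \<and> K \<subseteq> ppsub G (cj (P \<union> {\<psi>}))"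
    and fin: "finite P" "finite S" and S: "S \<noteq> {}" and v: "range v \<subseteq> carrier G" and K: "subgroup K G"
  shows "(\<Inter>\<psi>\<in>S. (\<lambda>x. K #> x) ` {x \<in> carrier G. sat G (case_nat x v) (cj (P \<union> {\<psi>}))}) =
    (\<lambda>x. K #> x) ` {x \<in> carrier G. sat G (case_nat x v) (cj (P \<union> S))}"
proof -
  let ?Z = "\<lambda>S. {x \<in> carrier G. sat G (case_nat x v) (cj (P \<union> S))}"
  have "(\<Inter>\<psi>\<in>S. (\<lambda>x. K #> x) ` ?Z {\<psi>}) = (\<lambda>x. K #> x) ` (\<Inter>\<psi>\<in>S. ?Z {\<psi>})"
  proof (rule image_INT_saturated[OF S])
    show "?Z {\<psi>} \<subseteq> carrier G" for \<psi> by blast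
    fix \<psi> x y assume \<psi>: "\<psi> \<in> S" and x: "x \<in> ?Z {\<psi>}" and y: "y \<in> carrier G" "K #> x = K #> y"
    have x': "x \<in> carrier G" "sat G (case_nat x v) (cj (P \<union> {\<psi>}))" using x by blast+
    have "sat G (case_nat y v) (cj (P \<union> {\<psi>}))"
      by (rule pp_saturated[OF conjunct1[OF pp[OF \<psi>]] v K conjunct2[OF pp[OF \<psi>]] x'(1) y x'(2)])
    thus "y \<in> ?Z {\<psi>}" using y(1) by blast
  qed
  also have "(\<Inter>\<psi>\<in>S. ?Z {\<psi>}) = ?Z S"
  proof -
    have f: "finite (P \<union> S)" "\<And>\<psi>. finite (P \<union> {\<psi>})" using fin by auto
    show ?thesis unfolding sat_cj[OF f(1)] sat_cj[OF f(2)] using S by auto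
  qed
  finally show ?thesis .
qed

end

lemma ecard_eq_card: "finite A \<Longrightarrow> finite B \<Longrightarrow> ecard A = ecard B \<Longrightarrow> card A = card B"
  by (simp add: ecard_def)

definition same_idx :: "('m, 'e) monoid_scheme \<Rightarrow> ('n, 'f) monoid_scheme \<Rightarrow> bool" where
  "same_idx M N \<longleftrightarrow> (\<forall>\<phi> \<psi>. pp \<phi> \<longrightarrow> pp \<psi> \<longrightarrow>
     idx M (ppsub M \<phi>) (ppsub M \<psi>) = idx N (ppsub N \<phi>) (ppsub N \<psi>))"

text \<open>
  The part of the back-and-forth step that concerns finite indices. Modulo the subgroup defined by
  all formulas of \<open>P\<close> and \<open>J\<close>, the solutions of \<open>P\<close> form finitely many cosets. Conjunctions of these
  formulas have the same number of solution cosets in both groups, since they are solvable in both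
  or in neither and their indices agree. If in \<open>N\<close> every solution of \<open>P\<close> satisfied a formula of \<open>J\<close>,
  then inclusion and exclusion would give the same in \<open>M\<close>, contradicting the choice of \<open>x\<close>.
\<close>

lemma same_card_union:
  fixes M :: "('m, 'e) monoid_scheme" and N :: "('n, 'f) monoid_scheme"
  assumes M: "comm_group M" and N: "comm_group N" and idx: "same_idx M N"
    and fin: "finite P" "finite J" and ppP: "\<And>\<psi>. \<psi> \<in> P \<union> J \<Longrightarrow> pp \<psi>"
    and v: "range v \<subseteq> carrier M" and w: "range w \<subseteq> carrier N"
    and agree: "\<And>S. S \<subseteq> P \<union> J \<Longrightarrow> (\<exists>x\<in>carrier M. \<forall>\<psi>\<in>S. sat M (case_nat x v) \<psi>) \<longleftrightarrow>
                              (\<exists>y\<in>carrier N. \<forall>\<psi>\<in>S. sat N (case_nat y w) \<psi>)"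
    and fidx: "idx N (ppsub N (cj P)) (ppsub N (cj (P \<union> J))) \<noteq> \<infinity>"
    and x: "x \<in> carrier M" "\<And>\<psi>. \<psi> \<in> P \<Longrightarrow> sat M (case_nat x v) \<psi>" "\<And>\<psi>. \<psi> \<in> J \<Longrightarrow> \<not> sat M (case_nat x v) \<psi>"
  shows "\<exists>y\<in>carrier N. (\<forall>\<psi>\<in>P. sat N (case_nat y w) \<psi>) \<and> (\<forall>\<psi>\<in>J. \<not> sat N (case_nat y w) \<psi>)"
proof (rule ccontr)
  assume neg: "\<not> ?thesis"
  define KM where "KM = ppsub M (cj (P \<union> J))"
  define KN where "KN = ppsub N (cj (P \<union> J))"
  define ZM where "ZM = (\<lambda>S. {x \<in> carrier M. sat M (case_nat x v) (cj (P \<union> S))})"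
  define ZN where "ZN = (\<lambda>S. {x \<in> carrier N. sat N (case_nat x w) (cj (P \<union> S))})"
  define QM where "QM = (\<lambda>S. (\<lambda>x. KM #>\<^bsub>M\<^esub> x) ` ZM S)"
  define QN where "QN = (\<lambda>S. (\<lambda>x. KN #>\<^bsub>N\<^esub> x) ` ZN S)"
  have fS: "finite S" if "S \<subseteq> J" for S using that fin finite_subset by blast
  have ppS: "pp (cj (P \<union> S))" if "S \<subseteq> J" for S using that fS fin ppP by (intro pp_cj) auto
  have sKM: "subgroup KM M" unfolding KM_def using comm_group.ppsub_subgroup[OF M] ppS by blast
  have sKN: "subgroup KN N" unfolding KN_def using comm_group.ppsub_subgroup[OF N] ppS by blast
  have KMS: "KM \<subseteq> ppsub M (cj (P \<union> S))" if "S \<subseteq> J" for S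
    unfolding KM_def ppsub_def using that fS[OF that] fin by auto
  have KNS: "KN \<subseteq> ppsub N (cj (P \<union> S))" if "S \<subseteq> J" for S
    unfolding KN_def ppsub_def using that fS[OF that] fin by auto
  have ecM: "ecard (QM S) = idx M (ppsub M (cj (P \<union> S))) KM" if "S \<subseteq> J" "x \<in> ZM S" for S x
    unfolding QM_def ZM_def
    by (rule comm_group.pp_solutions_ecard[OF M ppS[OF that(1)] v sKM KMS[OF that(1)]]) (use that in \<open>auto simp: ZM_def\<close>)
  have ecN: "ecard (QN S) = idx N (ppsub N (cj (P \<union> S))) KN" if "S \<subseteq> J" "x \<in> ZN S" for S x
    unfolding QN_def ZN_def
    by (rule comm_group.pp_solutions_ecard[OF N ppS[OF that(1)] w sKN KNS[OF that(1)]]) (use that in \<open>auto simp: ZN_def\<close>)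
  have agPS: "(\<exists>x. x \<in> ZM S) \<longleftrightarrow> (\<exists>y. y \<in> ZN S)" if "S \<subseteq> J" for S
  proof -
    have "finite (P \<union> S)" and "P \<union> S \<subseteq> P \<union> J" using that fS[OF that] fin by auto
    thus ?thesis using agree[of "P \<union> S"] unfolding ZM_def ZN_def by (simp only: mem_Collect_eq sat_cj Bex_def)
  qed
  have ec: "ecard (QM S) = ecard (QN S)" if S: "S \<subseteq> J" for S
  proof (cases "ZM S = {}")
    case True
    moreover have "ZN S = {}" using True agPS[OF S] by blast
    ultimately show ?thesis by (simp add: QM_def QN_def ecard_def)
  next
    case False
    then obtain x y where xy: "x \<in> ZM S" "y \<in> ZN S" using agPS[OF S] by blast
    have "idx M (ppsub M (cj (P \<union> S))) KM = idx N (ppsub N (cj (P \<union> S))) KN"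
      using idx ppS[OF S] ppS[of J] unfolding same_idx_def KM_def KN_def by blast
    thus ?thesis using ecM[OF S xy(1)] ecN[OF S xy(2)] by simp
  qed
  have "idx M (ppsub M (cj P)) KM = idx N (ppsub N (cj P)) KN"
    using idx ppS[of "{}"] ppS[of J] unfolding same_idx_def KM_def KN_def by simp
  hence fM: "idx M (ppsub M (cj P)) KM \<noteq> \<infinity>" using fidx by (simp add: KN_def)
  have x0: "x \<in> ZM {}" using x fin by (simp add: ZM_def)
  have finM: "finite (QM {})" using ecM[OF _ x0] fM by (metis Un_empty_right ecard_infinite_iff empty_subsetI)
  hence finN: "finite (QN {})" using ec[of "{}"] by (metis ecard_infinite_iff empty_subsetI)
  have subM: "QM S \<subseteq> QM {}" if "S \<subseteq> J" for S
    unfolding QM_def ZM_def using fS[OF that] fin by auto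
  have subN: "QN S \<subseteq> QN {}" if "S \<subseteq> J" for S
    unfolding QN_def ZN_def using fS[OF that] fin by auto
  have satM: "y \<in> ZM {\<psi>}" if "\<psi> \<in> J" "x \<in> ZM {\<psi>}" "y \<in> carrier M" "KM #>\<^bsub>M\<^esub> x = KM #>\<^bsub>M\<^esub> y" for \<psi> x y
  proof -
    have \<psi>: "{\<psi>} \<subseteq> J" using that(1) by simp
    have c: "x \<in> carrier M" "sat M (case_nat x v) (cj (P \<union> {\<psi>}))" using that(2) unfolding ZM_def by blast+
    have "sat M (case_nat y v) (cj (P \<union> {\<psi>}))"
      by (rule comm_group.pp_saturated[OF M ppS[OF \<psi>] v sKM KMS[OF \<psi>] c(1) that(3,4) c(2)])
    thus ?thesis using that(3) unfolding ZM_def by blast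
  qed
  have InterM: "(\<Inter>\<psi>\<in>S. QM {\<psi>}) = QM S" if S: "S \<subseteq> J" "S \<noteq> {}" for S
    unfolding QM_def ZM_def
  proof (rule comm_group.pp_quotient_INT[OF M _ fin(1) fS[OF S(1)] S(2) v sKM])
    fix \<psi> assume "\<psi> \<in> S"
    hence "{\<psi>} \<subseteq> J" using S(1) by blast
    thus "pp (cj (P \<union> {\<psi>})) \<and> KM \<subseteq> ppsub M (cj (P \<union> {\<psi>}))" by (intro conjI ppS KMS)
  qed
  have InterN: "(\<Inter>\<psi>\<in>S. QN {\<psi>}) = QN S" if S: "S \<subseteq> J" "S \<noteq> {}" for S
    unfolding QN_def ZN_def
  proof (rule comm_group.pp_quotient_INT[OF N _ fin(1) fS[OF S(1)] S(2) w sKN])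
    fix \<psi> assume "\<psi> \<in> S"
    hence "{\<psi>} \<subseteq> J" using S(1) by blast
    thus "pp (cj (P \<union> {\<psi>})) \<and> KN \<subseteq> ppsub N (cj (P \<union> {\<psi>}))" by (intro conjI ppS KNS)
  qed
  have fins: "finite (QM S) \<and> finite (QN S)" if "S \<subseteq> J" for S
    using finite_subset[OF subM[OF that] finM] finite_subset[OF subN[OF that] finN] by blast
  have cards: "card (QM S) = card (QN S)" if "S \<subseteq> J" for S
    using ecard_eq_card fins[OF that] ec[OF that] by blast
  have "card (\<Union>\<psi>\<in>J. QM {\<psi>}) = card (\<Union>\<psi>\<in>J. QN {\<psi>})"
  proof (rule card_UN_cong_Int)
    fix S assume "S \<subseteq> J" "S \<noteq> {}"
    thus "card (\<Inter>\<psi>\<in>S. QM {\<psi>}) = card (\<Inter>\<psi>\<in>S. QN {\<psi>})" using InterM InterN cards by simp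
  qed (use fin fins in auto)
  moreover have "(\<Union>\<psi>\<in>J. QN {\<psi>}) = QN {}"
  proof
    show "(\<Union>\<psi>\<in>J. QN {\<psi>}) \<subseteq> QN {}" using subN by blast
    show "QN {} \<subseteq> (\<Union>\<psi>\<in>J. QN {\<psi>})"
    proof
      fix C assume "C \<in> QN {}"
      then obtain z where z: "C = KN #>\<^bsub>N\<^esub> z" "z \<in> ZN {}" unfolding QN_def by (rule imageE)
      then obtain \<psi> where "\<psi> \<in> J" "sat N (case_nat z w) \<psi>" using neg fin unfolding ZN_def by auto
      hence "\<psi> \<in> J" "z \<in> ZN {\<psi>}" using z(2) fin unfolding ZN_def by auto
      thus "C \<in> (\<Union>\<psi>\<in>J. QN {\<psi>})" unfolding z(1) QN_def by blast
    qed
  qed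
  ultimately have "card (\<Union>\<psi>\<in>J. QM {\<psi>}) = card (QM {})" using cards[of "{}"] by simp
  moreover have "(\<Union>\<psi>\<in>J. QM {\<psi>}) \<subseteq> QM {}" using subM by blast
  ultimately have "(\<Union>\<psi>\<in>J. QM {\<psi>}) = QM {}" using finM card_subset_eq by blast
  moreover have "KM #>\<^bsub>M\<^esub> x \<in> QM {}" using x0 unfolding QM_def by blast
  ultimately have "KM #>\<^bsub>M\<^esub> x \<in> (\<Union>\<psi>\<in>J. QM {\<psi>})" by (simp only:)
  then obtain \<psi> where \<psi>: "\<psi> \<in> J" "KM #>\<^bsub>M\<^esub> x \<in> QM {\<psi>}" by (rule UN_E)
  obtain z where z: "KM #>\<^bsub>M\<^esub> x = KM #>\<^bsub>M\<^esub> z" "z \<in> ZM {\<psi>}" using \<psi>(2) unfolding QM_def by (rule imageE)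
  have "x \<in> ZM {\<psi>}" by (rule satM[OF \<psi>(1) z(2) x(1) z(1)[symmetric]])
  hence "sat M (case_nat x v) (cj (P \<union> {\<psi>}))" unfolding ZM_def by blast
  thus False using x(3) \<psi>(1) fin by simp
qed

text \<open>
  Let \<open>H\<close> be the subgroup defined by the formulas that are true at \<open>x\<close>.
  The false formulas whose subgroups have finite index over \<open>H\<close> are treated by
  \<open>same_card_union\<close>. Together with the true ones they define a subgroup
  \<open>K\<close> of finite index in \<open>H\<close>, over which the remaining formulas still
  have infinite index. Translation by an element of \<open>K\<close> does not affect the former
  and avoids all of the latter.
\<close>

lemma pp_back_and_forth:
  fixes M :: "('m, 'e) monoid_scheme" and N :: "('n, 'f) monoid_scheme"
  assumes M: "comm_group M" and N: "comm_group N" and idx: "same_idx M N"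
    and fin: "finite D" and ppD: "\<And>\<psi>. \<psi> \<in> D \<Longrightarrow> pp \<psi>"
    and v: "range v \<subseteq> carrier M" and w: "range w \<subseteq> carrier N"
    and agree: "\<And>S. S \<subseteq> D \<Longrightarrow> (\<exists>x\<in>carrier M. \<forall>\<psi>\<in>S. sat M (case_nat x v) \<psi>) \<longleftrightarrow>
                              (\<exists>y\<in>carrier N. \<forall>\<psi>\<in>S. sat N (case_nat y w) \<psi>)"
    and x: "x \<in> carrier M"
  shows "\<exists>y\<in>carrier N. \<forall>\<psi>\<in>D. sat M (case_nat x v) \<psi> \<longleftrightarrow> sat N (case_nat y w) \<psi>"
proof -
  interpret N: comm_group N by fact
  define P where "P = {\<psi> \<in> D. sat M (case_nat x v) \<psi>}"
  define H where "H = ppsub N (cj P)"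
  define J where "J = {\<psi> \<in> D - P. idx N H (ppsub N \<psi>) \<noteq> \<infinity>}"
  define K where "K = ppsub N (cj (P \<union> J))"
  have PD: "P \<subseteq> D" "J \<subseteq> D" "finite P" "finite J" using fin by (auto simp: P_def J_def)
  have sH: "subgroup H N" unfolding H_def using PD ppD by (intro N.ppsub_subgroup pp_cj) auto
  have sK: "subgroup K N" unfolding K_def using PD ppD by (intro N.ppsub_subgroup pp_cj) auto
  have sJ: "subgroup (ppsub N (cj J)) N" using PD ppD by (intro N.ppsub_subgroup pp_cj) auto
  have KH: "K = H \<inter> ppsub N (cj J)" unfolding K_def H_def using PD by (simp add: ppsub_cj_Un)
  have "idx N H (ppsub N (cj J)) \<noteq> \<infinity>"
    unfolding ppsub_cj[OF PD(4)]
    using N.idx_Inter_finite[OF PD(4) sH, of "ppsub N"] N.ppsub_subgroup ppD by (auto simp: J_def)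
  hence fK: "idx N H K \<noteq> \<infinity>" unfolding KH using N.idx_Int_left[OF sH sJ] by simp
  have "\<exists>y\<in>carrier N. (\<forall>\<psi>\<in>P. sat N (case_nat y w) \<psi>) \<and> (\<forall>\<psi>\<in>J. \<not> sat N (case_nat y w) \<psi>)"
  proof (rule same_card_union[OF M N idx PD(3,4) _ v w _ _ x])
    show "idx N (ppsub N (cj P)) (ppsub N (cj (P \<union> J))) \<noteq> \<infinity>" using fK by (simp add: H_def K_def)
    show "pp \<psi>" if "\<psi> \<in> P \<union> J" for \<psi> using that PD ppD by blast
    show "(\<exists>x\<in>carrier M. \<forall>\<psi>\<in>S. sat M (case_nat x v) \<psi>) \<longleftrightarrow>
          (\<exists>y\<in>carrier N. \<forall>\<psi>\<in>S. sat N (case_nat y w) \<psi>)" if "S \<subseteq> P \<union> J" for S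
      using that PD by (intro agree) blast
    show "sat M (case_nat x v) \<psi>" if "\<psi> \<in> P" for \<psi> using that by (simp add: P_def)
    show "\<not> sat M (case_nat x v) \<psi>" if "\<psi> \<in> J" for \<psi> using that by (simp add: P_def J_def)
  qed
  then obtain y where y: "y \<in> carrier N" "\<And>\<psi>. \<psi> \<in> P \<Longrightarrow> sat N (case_nat y w) \<psi>"
    "\<And>\<psi>. \<psi> \<in> J \<Longrightarrow> \<not> sat N (case_nat y w) \<psi>" by blast
  define E where "E = D - P - J"
  have E: "idx N K (ppsub N \<psi>) = \<infinity>" if "\<psi> \<in> E" for \<psi>
  proof (rule ccontr)
    assume "idx N K (ppsub N \<psi>) \<noteq> \<infinity>"
    have s: "subgroup (ppsub N \<psi>) N" using that ppD by (auto simp: E_def intro: N.ppsub_subgroup)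
    have "H \<inter> K = K" using KH by blast
    hence "idx N H (K \<inter> ppsub N \<psi>) \<noteq> \<infinity>"
      using N.idx_Int[OF sH sK s] fK \<open>idx N K (ppsub N \<psi>) \<noteq> \<infinity>\<close> by (simp add: imult_is_infinity)
    moreover have "idx N H (ppsub N \<psi>) \<le> idx N H (K \<inter> ppsub N \<psi>)"
      by (intro N.idx_right_antimono subgroup.subset[OF sH] subgroup_Int sK s) auto
    ultimately have "idx N H (ppsub N \<psi>) \<noteq> \<infinity>" by (metis enat_ord_simps(5))
    hence "\<psi> \<in> J" using that unfolding J_def E_def by simp
    thus False using that unfolding E_def by simp
  qed
  have "\<exists>h\<in>K. \<forall>(\<psi>, v) \<in> (\<lambda>\<psi>. (\<psi>, w)) ` E. \<not> sat N (case_nat (h \<otimes>\<^bsub>N\<^esub> y) v) \<psi>"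
  proof (rule N.pp_avoid[OF _ sK y(1)])
    show "finite ((\<lambda>\<psi>. (\<psi>, w)) ` E)" using fin by (simp add: E_def)
    fix \<psi> v assume "(\<psi>, v) \<in> (\<lambda>\<psi>. (\<psi>, w)) ` E"
    hence e: "\<psi> \<in> E" "v = w" by auto
    hence "pp \<psi>" using ppD unfolding E_def by simp
    thus "pp \<psi> \<and> range v \<subseteq> carrier N \<and> idx N K (ppsub N \<psi>) = \<infinity>" using E[OF e(1)] e(2) w by simp
  qed
  then obtain h where h: "h \<in> K"
    and h': "\<forall>(\<psi>, v) \<in> (\<lambda>\<psi>. (\<psi>, w)) ` E. \<not> sat N (case_nat (h \<otimes>\<^bsub>N\<^esub> y) v) \<psi>" by (rule bexE)
  have hE: "\<not> sat N (case_nat (h \<otimes>\<^bsub>N\<^esub> y) w) \<psi>" if "\<psi> \<in> E" for \<psi>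
    using bspec[OF h' imageI[OF that]] by simp
  have hc: "h \<in> carrier N" by (rule subgroup.mem_carrier[OF sK h])
  have same: "sat N (case_nat (h \<otimes>\<^bsub>N\<^esub> y) w) \<psi> \<longleftrightarrow> sat N (case_nat y w) \<psi>" if "\<psi> \<in> P \<union> J" for \<psi>
  proof -
    have p: "pp \<psi>" using that PD ppD by blast
    have "K \<subseteq> ppsub N \<psi>" unfolding K_def ppsub_def using that PD by auto
    hence hp: "h \<in> ppsub N \<psi>" using h by blast
    have e1: "(h \<otimes>\<^bsub>N\<^esub> y) \<otimes>\<^bsub>N\<^esub> inv\<^bsub>N\<^esub> y = h"
      using hc y(1) by (simp add: N.m_assoc)
    have "y \<otimes>\<^bsub>N\<^esub> inv\<^bsub>N\<^esub> (h \<otimes>\<^bsub>N\<^esub> y) = inv\<^bsub>N\<^esub> ((h \<otimes>\<^bsub>N\<^esub> y) \<otimes>\<^bsub>N\<^esub> inv\<^bsub>N\<^esub> y)"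
      using hc y(1) by (simp add: N.inv_mult_group)
    hence e: "(h \<otimes>\<^bsub>N\<^esub> y) \<otimes>\<^bsub>N\<^esub> inv\<^bsub>N\<^esub> y = h" "y \<otimes>\<^bsub>N\<^esub> inv\<^bsub>N\<^esub> (h \<otimes>\<^bsub>N\<^esub> y) = inv\<^bsub>N\<^esub> h"
      unfolding e1 by simp_all
    have hp': "inv\<^bsub>N\<^esub> h \<in> ppsub N \<psi>" by (rule subgroup.m_inv_closed[OF N.ppsub_subgroup[OF p] hp])
    have yc: "h \<otimes>\<^bsub>N\<^esub> y \<in> carrier N" using hc y by simp
    show ?thesis
      using N.pp_coset[OF p w y(1) yc] N.pp_coset[OF p w yc y(1)] e hp hp' by auto
  qed
  show ?thesis
  proof (intro bexI[of _ "h \<otimes>\<^bsub>N\<^esub> y"] ballI)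
    show "h \<otimes>\<^bsub>N\<^esub> y \<in> carrier N" using hc y by simp
    fix \<psi> assume "\<psi> \<in> D"
    then consider "\<psi> \<in> P" | "\<psi> \<in> J" | "\<psi> \<in> E" by (auto simp: E_def)
    thus "sat M (case_nat x v) \<psi> \<longleftrightarrow> sat N (case_nat (h \<otimes>\<^bsub>N\<^esub> y) w) \<psi>"
    proof cases
      case 1 thus ?thesis using same y(2) by (simp add: P_def)
    next
      case 2 thus ?thesis using same y(3) by (auto simp: P_def J_def)
    next
      case 3 thus ?thesis using hE \<open>\<psi> \<in> D\<close> by (auto simp: E_def P_def)
    qed
  qed
qed

text \<open>
  Finitely many positive primitive formulas whose truth values determine the truth value of the
  given formula in all groups with the same indices. For a quantified formula they tell which sets
  of determining formulas of its body can be realized together.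
\<close>

primrec det :: "ag_form \<Rightarrow> ag_form set" where
  "det (Equal s t) = {Equal s t}"
| "det (Negation \<phi>) = det \<phi>"
| "det (Conj \<phi> \<psi>) = det \<phi> \<union> det \<psi>"
| "det (Exists \<phi>) = (\<lambda>S. Exists (cj S)) ` Pow (det \<phi>)"

lemma det_finite: "finite (det \<phi>)"
  by (induction \<phi>) auto

lemma det_pp: "\<psi> \<in> det \<phi> \<Longrightarrow> pp \<psi>"
proof (induction \<phi> arbitrary: \<psi>)
  case (Exists \<phi>)
  then obtain S where S: "S \<subseteq> det \<phi>" "\<psi> = Exists (cj S)" by auto
  thus ?case using Exists.IH det_finite[of \<phi>] by (auto intro!: pp_cj pp_Exists intro: finite_subset)
qed auto

text \<open>
  Elimination of quantifiers down to positive primitive formulas, stated as a comparison of two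
  groups; an existential quantifier is one back-and-forth step.
\<close>

theorem baur_monk:
  assumes M: "comm_group M" and N: "comm_group N" and idx: "same_idx M N"
    and v: "range v \<subseteq> carrier M" and w: "range w \<subseteq> carrier N"
    and "\<And>\<psi>. \<psi> \<in> det \<phi> \<Longrightarrow> sat M v \<psi> \<longleftrightarrow> sat N w \<psi>"
  shows "sat M v \<phi> \<longleftrightarrow> sat N w \<phi>"
  using v w assms(6)
proof (induction \<phi> arbitrary: v w)
  case (Exists \<phi> v w)
  have fS: "finite S" if "S \<subseteq> det \<phi>" for S using that det_finite finite_subset by blast
  have agree: "(\<exists>x\<in>carrier M. \<forall>\<psi>\<in>S. sat M (case_nat x v) \<psi>) \<longleftrightarrow>
      (\<exists>y\<in>carrier N. \<forall>\<psi>\<in>S. sat N (case_nat y w) \<psi>)" if "S \<subseteq> det \<phi>" for S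
    using Exists.prems(3)[of "Exists (cj S)"] that fS[OF that] by simp
  have idx': "same_idx N M" using idx unfolding same_idx_def by simp
  show ?case
  proof
    assume "sat M v (Exists \<phi>)"
    then obtain x where x: "x \<in> carrier M" "sat M (case_nat x v) \<phi>" by auto
    obtain y where y: "y \<in> carrier N" "\<And>\<psi>. \<psi> \<in> det \<phi> \<Longrightarrow> sat M (case_nat x v) \<psi> \<longleftrightarrow> sat N (case_nat y w) \<psi>"
      using pp_back_and_forth[OF M N idx det_finite[of \<phi>] det_pp[of _ \<phi>] Exists.prems(1,2) agree x(1)] by blast
    hence "sat N (case_nat y w) \<phi>"
      using Exists.IH[OF comm_group.range_case_nat[OF M x(1) Exists.prems(1)]
        comm_group.range_case_nat[OF N y(1) Exists.prems(2)] y(2)] x by blast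
    thus "sat N w (Exists \<phi>)" using y by auto
  next
    assume "sat N w (Exists \<phi>)"
    then obtain y where y: "y \<in> carrier N" "sat N (case_nat y w) \<phi>" by auto
    obtain x where x: "x \<in> carrier M" "\<And>\<psi>. \<psi> \<in> det \<phi> \<Longrightarrow> sat N (case_nat y w) \<psi> \<longleftrightarrow> sat M (case_nat x v) \<psi>"
      using pp_back_and_forth[OF N M idx' det_finite[of \<phi>] det_pp[of _ \<phi>] Exists.prems(2,1) agree[symmetric] y(1)] by blast
    hence "sat M (case_nat x v) \<phi>"
      using Exists.IH[OF comm_group.range_case_nat[OF M x(1) Exists.prems(1)]
        comm_group.range_case_nat[OF N y(1) Exists.prems(2)] x(2)[symmetric]] y by blast
    thus "sat M v (Exists \<phi>)" using x by auto
  qed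
next
  case (Equal s t) thus ?case by (simp del: sat.simps)
next
  case (Negation \<phi>) thus ?case by simp
next
  case (Conj \<phi> \<psi>)
  have "sat M v \<phi> \<longleftrightarrow> sat N w \<phi>" using Conj.prems by (intro Conj.IH) auto
  moreover have "sat M v \<psi> \<longleftrightarrow> sat N w \<psi>" using Conj.prems by (intro Conj.IH) auto
  ultimately show ?case by simp
qed

text \<open>
  Homogeneous linear equations have the zero solution; for sentences this means that the indices
  alone decide.
\<close>

lemma (in comm_group) pp_zero: "pp \<phi> \<Longrightarrow> sat G (\<lambda>_. \<one>) \<phi>"
proof (induction rule: pp.induct)
  case (pp_Exists \<phi>)
  have "case_nat \<one> (\<lambda>_. \<one>) = (\<lambda>_::nat. \<one>)" by (auto split: nat.splits)
  thus ?case using pp_Exists by (auto intro!: bexI[of _ \<one>])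
qed auto

corollary same_idx_elem_equiv:
  assumes "comm_group M" "comm_group N" "same_idx M N" shows "elem_equiv M N"
proof -
  interpret M: comm_group M by fact
  interpret N: comm_group N by fact
  have "sat M (\<lambda>_. \<one>\<^bsub>M\<^esub>) \<phi> \<longleftrightarrow> sat N (\<lambda>_. \<one>\<^bsub>N\<^esub>) \<phi>" for \<phi>
    by (rule baur_monk[OF assms]) (use det_pp M.pp_zero N.pp_zero in auto)
  thus ?thesis by (simp add: elem_equiv_def models_def)
qed

section \<open>The Szmielew invariants\<close>

text \<open>
  The orders of \<open>(p^k G)[p]/(p^(k+1) G)[p]\<close>, of \<open>p^k G/p^(k+1) G\<close> and of
  \<open>(p^k G)[p]\<close>. In a direct sum of standard groups the first counts the cyclic
  summands of order \<open>p^(k+1)\<close>. If the orders of the cyclic \<open>p\<close>-summands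
  are bounded, then for large \<open>k\<close> the other two count the copies of the localized
  integers and of the Pruefer group.
\<close>

definition ulm :: "('a, 'b) monoid_scheme \<Rightarrow> nat \<Rightarrow> nat \<Rightarrow> enat" where
  "ulm G p k = idx G (torsion_part G (multiples G (p ^ k)) p) (multiples G (p ^ (k + 1)))"

definition tfree :: "('a, 'b) monoid_scheme \<Rightarrow> nat \<Rightarrow> nat \<Rightarrow> enat" where
  "tfree G p k = idx G (multiples G (p ^ k)) (multiples G (p ^ (k + 1)))"

definition tsize :: "('a, 'b) monoid_scheme \<Rightarrow> nat \<Rightarrow> nat \<Rightarrow> enat" where
  "tsize G p k = idx G (torsion_part G (multiples G (p ^ k)) p) {\<one>\<^bsub>G\<^esub>}"

definition bounded_exp :: "('a, 'b) monoid_scheme \<Rightarrow> bool" where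
  "bounded_exp G \<longleftrightarrow> (\<exists>e>0. \<forall>x\<in>carrier G. x [^]\<^bsub>G\<^esub> (e::nat) = \<one>\<^bsub>G\<^esub>)"

abbreviation tors :: "('a, 'b) monoid_scheme \<Rightarrow> nat \<Rightarrow> 'a set" where
  "tors G n \<equiv> torsion_part G (carrier G) n"

text \<open>
  The exponents \<open>b = v(a)\<close> of the conditions with \<open>v(a) < v(n)\<close>, where
  \<open>v\<close> is the \<open>p\<close>-adic valuation; these are the conditions that are
  nontrivial at \<open>p\<close>. The case \<open>n = 0\<close> counts as \<open>v(n) =
  \<infinity>\<close>.
\<close>

definition crit :: "(nat \<times> int) set \<Rightarrow> nat \<Rightarrow> nat set" where
  "crit L p = {b. \<exists>(n, a) \<in> L. int p ^ b dvd a \<and> \<not> int p ^ Suc b dvd a \<and> p ^ Suc b dvd n}"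

lemma bezout_prime:
  assumes "prime p" "\<not> int p dvd a" obtains u v :: int where "u * a + v * int p = 1"
proof -
  have "coprime a (int p)" using assms prime_imp_coprime[of "int p" a] by (simp add: coprime_commute)
  thus ?thesis using that bezout_int[of a "int p"] by (metis coprime_imp_gcd_eq_1)
qed

lemma prime_power_exact:
  assumes "\<not> int p ^ d dvd a" obtains c where "c < d" "int p ^ c dvd a" "\<not> int p ^ Suc c dvd a"
proof -
  define c where "c = (LEAST i. \<not> int p ^ Suc i dvd a)"
  obtain d' where d': "d = Suc d'" using assms by (cases d) auto
  hence ex: "\<not> int p ^ Suc d' dvd a" using assms by simp
  have 1: "\<not> int p ^ Suc c dvd a" unfolding c_def by (rule LeastI[of _ d']) (rule ex)
  have "c \<le> d'" unfolding c_def by (rule Least_le) (rule ex)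
  moreover have "int p ^ c dvd a"
  proof (cases c)
    case (Suc c') thus ?thesis using not_less_Least[of c' "\<lambda>i. \<not> int p ^ Suc i dvd a"] c_def by auto
  qed simp
  ultimately show ?thesis using that[of c] 1 d' by simp
qed

lemma prime_dvd_coprime_part:
  fixes n :: nat assumes "prime p" "n > 0"
  obtains k n' where "n = p ^ k * n'" "\<not> p dvd n'"
  using assms by (metis multiplicity_decompose' not_prime_unit gr_implies_not0)

context comm_group begin

lemma tors_iff: "x \<in> tors G n \<longleftrightarrow> x \<in> carrier G \<and> x [^] int n = \<one>"
  by (simp add: torsion_part_def int_pow_int)

lemma torsion_part_iff: "x \<in> torsion_part G B n \<longleftrightarrow> x \<in> B \<and> x [^] int n = \<one>"
  by (simp add: torsion_part_def int_pow_int)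

lemma torsion_part_subgroup:
  assumes "subgroup B G" shows "subgroup (torsion_part G B n) G"
proof -
  have "torsion_part G B n = B \<inter> {x \<in> carrier G. x [^] int n \<in> {\<one>}}"
    using subgroup.mem_carrier[OF assms] by (auto simp: torsion_part_iff)
  thus ?thesis using assms by (simp only: subgroup_Int subgroup_pow_vimage triv_subgroup)
qed

lemma tors_subgroup [simp]: "subgroup (tors G n) G"
  by (rule torsion_part_subgroup) (rule subgroup_self)

lemma torsion_part_multiples_subgroup [simp]: "subgroup (torsion_part G (multiples G m) n) G"
  by (rule torsion_part_subgroup) (rule multiples_subgroup)

lemma tors_dvd: "m dvd n \<Longrightarrow> tors G m \<subseteq> tors G n"
  by (auto simp: tors_iff dvd_def int_pow_pow[symmetric])

lemma tors_pow_dvd: "x \<in> tors G n \<Longrightarrow> int n dvd a \<Longrightarrow> x [^] a = \<one>"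
  by (auto simp: tors_iff dvd_def int_pow_pow[symmetric])

text \<open>The preimage of \<open>p n G\<close> under multiplication by \<open>n\<close>; it equals \<open>p G + G[n]\<close>.\<close>

definition pre :: "nat \<Rightarrow> nat \<Rightarrow> 'a set" where
  "pre p n = {x \<in> carrier G. x [^] int n \<in> multiples G (n * p)}"

lemma pre_subgroup [simp]: "subgroup (pre p n) G"
  unfolding pre_def by (rule subgroup_pow_vimage) simp

lemma multiples_pre: "multiples G p \<subseteq> pre p n"
proof
  fix x assume "x \<in> multiples G p"
  then obtain y where y: "y \<in> carrier G" "x = y [^] int p" unfolding multiples_iff by (rule bexE)
  have "x [^] int n = y [^] int (n * p)" using y by (simp add: int_pow_pow mult.commute)
  thus "x \<in> pre p n" using y unfolding pre_def multiples_iff by blast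
qed

lemma tors_pre: "tors G n \<subseteq> pre p n"
  by (auto simp: pre_def tors_iff one_multiples)

lemma pre_mult: "x \<in> pre p n \<Longrightarrow> x \<in> pre p (n * m)"
proof -
  assume "x \<in> pre p n"
  then obtain z where z: "x \<in> carrier G" "z \<in> carrier G" "x [^] int n = z [^] int (n * p)"
    by (auto simp: pre_def multiples_iff)
  have "x [^] int (n * m) = (x [^] int n) [^] int m" using z(1) by (simp add: int_pow_pow)
  also have "\<dots> = (z [^] int (n * p)) [^] int m" by (simp only: z(3))
  also have "\<dots> = z [^] int (n * m * p)" using z(2) by (simp add: int_pow_pow ac_simps)
  finally show ?thesis using z by (auto simp: pre_def multiples_iff)
qed

lemma preE:
  assumes "x \<in> pre p n" obtains z y where "z \<in> carrier G" "y \<in> tors G n" "x = y \<otimes> z [^] int p"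
proof -
  obtain z where z: "x \<in> carrier G" "z \<in> carrier G" "x [^] int n = z [^] int (n * p)"
    using assms by (auto simp: pre_def multiples_iff)
  let ?y = "x \<otimes> inv (z [^] int p)"
  have "?y [^] int n = \<one>"
    using z by (simp add: int_pow_diff_distrib int_pow_pow mult.commute)
  hence "?y \<in> tors G n" using z by (simp add: tors_iff)
  moreover have "x = ?y \<otimes> z [^] int p" using z by (simp add: m_assoc)
  ultimately show ?thesis using that z by blast
qed

text \<open>A factor prime to \<open>p\<close> acts invertibly modulo \<open>p\<close>.\<close>

lemma pre_coprime_part:
  assumes "prime p" "\<not> p dvd n'" shows "pre p (p ^ k * n') = pre p (p ^ k)"
proof
  show "pre p (p ^ k) \<subseteq> pre p (p ^ k * n')" using pre_mult by blast
  show "pre p (p ^ k * n') \<subseteq> pre p (p ^ k)"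
  proof
    fix x assume "x \<in> pre p (p ^ k * n')"
    then obtain z y where zy: "z \<in> carrier G" "y \<in> tors G (p ^ k * n')" "x = y \<otimes> z [^] int p" by (rule preE)
    obtain u v where uv: "u * int n' + v * int p = 1" using bezout_prime[of p "int n'"] assms by auto
    have yc: "y \<in> carrier G" using zy by (simp add: tors_iff)
    have "y [^] (u * int n' + v * int p) = y [^] (u * int n') \<otimes> (y [^] v) [^] int p"
      using yc by (simp add: int_pow_mult int_pow_pow)
    hence y: "y = y [^] (u * int n') \<otimes> (y [^] v) [^] int p" using uv yc by simp
    have "(y [^] (u * int n')) [^] int (p ^ k) = y [^] (u * int n' * int (p ^ k))" using yc by (rule int_pow_pow)
    also have "\<dots> = \<one>" by (rule tors_pow_dvd[OF zy(2)]) (simp add: ac_simps)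
    finally have 1: "y [^] (u * int n') \<in> tors G (p ^ k)" using yc by (simp add: tors_iff)
    have 2: "(y [^] v) [^] int p \<in> multiples G p" "z [^] int p \<in> multiples G p"
      using yc zy by (auto simp: multiples_iff)
    have "y [^] (u * int n') \<otimes> (y [^] v) [^] int p \<in> pre p (p ^ k)"
      by (rule subgroup.m_closed[OF pre_subgroup subsetD[OF tors_pre 1] subsetD[OF multiples_pre 2(1)]])
    hence "y \<in> pre p (p ^ k)" by (simp only: y[symmetric])
    thus "x \<in> pre p (p ^ k)" using zy(3) 2 multiples_pre subgroup.m_closed[OF pre_subgroup] by blast
  qed
qed

lemma pow_image_carrier: "(\<lambda>x. x [^] int n) ` carrier G = multiples G n"
  by (auto simp: multiples_iff)

lemma idx_carrier_pre: "idx G (carrier G) (pre p (p ^ k)) = tfree G p k"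
proof -
  have "idx G (carrier G) (pre p (p ^ k)) = idx G ((\<lambda>x. x [^] int (p ^ k)) ` carrier G) (multiples G (p ^ k * p))"
    unfolding pre_def by (rule idx_pow[symmetric]) auto
  thus ?thesis unfolding pow_image_carrier tfree_def by (simp add: mult.commute)
qed

lemma idx_tors_pre_le: assumes "b \<le> k" shows "idx G (tors G (p ^ b)) (pre p (p ^ k)) = 1"
proof (rule idx_eq_1)
  show "tors G (p ^ b) \<subseteq> pre p (p ^ k)" using tors_dvd[of "p ^ b" "p ^ k"] assms tors_pre[of "p ^ k" p] by (auto simp: le_imp_power_dvd)
  show "tors G (p ^ b) \<noteq> {}" using subgroup.one_closed[OF tors_subgroup] by blast
qed simp

lemma tors_pow_image: "(\<lambda>x. x [^] int m) ` tors G (m * n) = torsion_part G (multiples G m) n"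
proof
  show "(\<lambda>x. x [^] int m) ` tors G (m * n) \<subseteq> torsion_part G (multiples G m) n"
    by (auto simp: tors_iff torsion_part_iff multiples_iff int_pow_pow)
  show "torsion_part G (multiples G m) n \<subseteq> (\<lambda>x. x [^] int m) ` tors G (m * n)"
    by (auto simp: tors_iff torsion_part_iff multiples_iff int_pow_pow)
qed

text \<open>
  Multiplication by \<open>p^b\<close> maps \<open>G[p^(b+1)]\<close> onto \<open>(p^b
  G)[p]\<close>, which splits off an Ulm quotient. What remains lies in \<open>p G +
  G[p^b]\<close>, and the part in \<open>p G\<close> is absorbed.
\<close>

lemma idx_tors_pre_Suc:
  assumes "k \<le> b"
  shows "idx G (tors G (p ^ Suc b)) (pre p (p ^ k)) = ulm G p b * idx G (tors G (p ^ b)) (pre p (p ^ k))"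
proof -
  have sub: "pre p (p ^ k) \<subseteq> pre p (p ^ b)"
    using pre_mult[of _ p "p ^ k" "p ^ (b - k)"] assms by (auto simp: power_add[symmetric])
  hence "idx G (tors G (p ^ Suc b)) (pre p (p ^ k)) = idx G (tors G (p ^ Suc b)) (pre p (p ^ b) \<inter> pre p (p ^ k))"
    by (simp add: Int_absorb1)
  also have "\<dots> = idx G (tors G (p ^ Suc b)) (pre p (p ^ b)) * idx G (tors G (p ^ Suc b) \<inter> pre p (p ^ b)) (pre p (p ^ k))"
    by (rule idx_Int) auto
  also have "idx G (tors G (p ^ Suc b)) (pre p (p ^ b)) = idx G ((\<lambda>x. x [^] int (p ^ b)) ` tors G (p ^ Suc b)) (multiples G (p ^ b * p))"
    unfolding pre_def by (rule idx_pow[symmetric]) (auto simp: tors_iff)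
  also have "\<dots> = ulm G p b"
    using tors_pow_image[of "p ^ b" p] by (simp add: ulm_def mult.commute)
  also have "idx G (tors G (p ^ Suc b) \<inter> pre p (p ^ b)) (pre p (p ^ k)) = idx G (tors G (p ^ b)) (pre p (p ^ k))"
  proof (rule idx_absorb)
    show "tors G (p ^ b) \<subseteq> tors G (p ^ Suc b) \<inter> pre p (p ^ b)" using tors_dvd[of "p ^ b" "p ^ Suc b"] tors_pre by auto
    show "tors G (p ^ Suc b) \<inter> pre p (p ^ b) \<subseteq> carrier G" by (auto simp: tors_iff)
    fix x assume "x \<in> tors G (p ^ Suc b) \<inter> pre p (p ^ b)"
    then obtain z y where zy: "z \<in> carrier G" "y \<in> tors G (p ^ b)" "x = y \<otimes> z [^] int p" by (auto elim: preE)
    have "x \<otimes> inv y = z [^] int p" using zy by (auto simp: tors_iff m_ac) (simp add: m_assoc[symmetric])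
    also have "\<dots> \<in> pre p (p ^ k)" using multiples_pre zy(1) by (force simp: multiples_iff)
    finally show "\<exists>h\<in>tors G (p ^ b). x \<otimes> inv h \<in> pre p (p ^ k)" using zy(2) by blast
  qed simp
  finally show ?thesis .
qed

text \<open>
  Write \<open>a = p^b a'\<close> for a critical exponent \<open>b\<close>. If \<open>n\<close> divides \<open>a x\<close>, then \<open>a' x\<close> differs from a
  multiple of \<open>p\<close> by an element of \<open>G[p^b]\<close>, and \<open>a'\<close> is invertible modulo \<open>p\<close>. For the least
  critical exponent the group \<open>G[p^b]\<close> also consists of solutions, so modulo \<open>p G\<close> a solution set
  looks like \<open>G[p^b]\<close>, or like \<open>G\<close> itself if no exponent is critical.
\<close>

lemma sol_mod_p:
  assumes "prime p" "b \<in> crit L p" "x \<in> sol G L"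
  shows "\<exists>y\<in>tors G (p ^ b). x \<otimes> inv y \<in> multiples G p"
proof -
  obtain n a where na: "(n, a) \<in> L" "int p ^ b dvd a" "\<not> int p ^ Suc b dvd a" "p ^ Suc b dvd n"
    using assms(2) by (auto simp: crit_def)
  obtain a' where a': "a = int p ^ b * a'" using na(2) by (auto simp: dvd_def)
  have pa: "\<not> int p dvd a'"
  proof
    assume "int p dvd a'"
    hence "int p ^ b * int p dvd a" unfolding a' by (rule mult_dvd_mono[OF dvd_refl])
    thus False using na(3) by (simp add: mult.commute)
  qed
  obtain n' where n': "n = p ^ Suc b * n'" using na(4) by (auto simp: dvd_def)
  have xc: "x \<in> carrier G" using assms(3) by (simp add: sol_def)
  have "x [^] a \<in> multiples G n" using assms(3) na(1) by (auto simp: sol_def)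
  then obtain z where z: "z \<in> carrier G" "x [^] a = z [^] int n" by (auto simp: multiples_iff)
  obtain u v where uv: "u * a' + v * int p = 1" using bezout_prime[OF assms(1) pa] .
  let ?t = "z [^] (int p * int n')"
  let ?w = "x [^] a' \<otimes> inv ?t"
  have e1: "(x [^] a') [^] int (p ^ b) = x [^] a" using xc a' by (simp add: int_pow_pow mult.commute)
  have e2: "?t [^] int (p ^ b) = z [^] int n" using z n' by (simp add: int_pow_pow algebra_simps)
  have "?w [^] int (p ^ b) = (x [^] a') [^] int (p ^ b) \<otimes> inv (?t [^] int (p ^ b))"
    using xc z by (intro int_pow_diff_distrib) auto
  hence "?w [^] int (p ^ b) = \<one>" unfolding e1 e2 using z by simp
  hence w: "?w \<in> tors G (p ^ b)" using xc z by (simp add: tors_iff)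
  have wc: "?w \<in> carrier G" using xc z by simp
  have "(?w [^] u) [^] int (p ^ b) = \<one>" using w by (simp add: tors_iff) (metis int_pow_pow int_pow_one mult.commute of_nat_power)
  hence wu: "?w [^] u \<in> tors G (p ^ b)" using wc by (simp add: tors_iff)
  have wue: "?w [^] u = x [^] (u * a') \<otimes> inv (?t [^] u)"
    using xc z by (simp add: int_pow_diff_distrib int_pow_pow mult.commute)
  have "x = x [^] (u * a' + v * int p)" using uv xc by simp
  also have "\<dots> = x [^] (u * a') \<otimes> (x [^] v) [^] int p" using xc by (simp add: int_pow_mult int_pow_pow)
  finally have x: "x = x [^] (u * a') \<otimes> (x [^] v) [^] int p" .
  have tu: "?t [^] u = (z [^] (int n' * u)) [^] int p" using z by (simp add: int_pow_pow algebra_simps)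
  have gen: "(A \<otimes> B) \<otimes> inv (A \<otimes> inv C) = B \<otimes> C" if "A \<in> carrier G" "B \<in> carrier G" "C \<in> carrier G" for A B C
  proof -
    have "inv (A \<otimes> inv C) = C \<otimes> inv A" using that by (simp add: inv_mult_group)
    moreover have "(A \<otimes> B) \<otimes> (C \<otimes> inv A) = (B \<otimes> C) \<otimes> (A \<otimes> inv A)"
      using that by (simp only: m_ac m_closed inv_closed)
    ultimately show ?thesis using that by simp
  qed
  have "x \<otimes> inv (?w [^] u) = (x [^] v) [^] int p \<otimes> ?t [^] u"
    unfolding wue using gen[of "x [^] (u * a')" "(x [^] v) [^] int p" "?t [^] u"] x xc z by simp
  also have "\<dots> = (x [^] v \<otimes> z [^] (int n' * u)) [^] int p"
    unfolding tu using xc z by (simp add: int_pow_distrib)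
  also have "\<dots> \<in> multiples G p" using xc z by (auto simp: multiples_iff)
  finally show ?thesis using wu by blast
qed

text \<open>
  The common \<open>p\<close>-part of \<open>n\<close> and \<open>p^b\<close> divides
  \<open>a\<close>, as otherwise \<open>v(a)\<close> would be a critical exponent below
  \<open>b\<close>. Therefore \<open>a x\<close> is a combination of \<open>n x\<close> and
  \<open>p^b x\<close>, the latter being zero.
\<close>

lemma tors_sub_sol:
  assumes "prime p" "\<And>c. c \<in> crit L p \<Longrightarrow> b \<le> c"
  shows "tors G (p ^ b) \<subseteq> sol G L"
proof
  fix x assume x: "x \<in> tors G (p ^ b)"
  have xc: "x \<in> carrier G" using x by (simp add: tors_iff)
  have "x [^] a \<in> multiples G n" if na: "(n, a) \<in> L" for n a
  proof -
    have "gcd n (p ^ b) dvd p ^ b" by simp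
    then obtain d where d: "d \<le> b" "gcd n (p ^ b) = p ^ d"
      using divides_primepow_nat[OF assms(1)] by blast
    have dn: "p ^ d dvd n" using d(2) by (metis gcd_dvd1)
    have "int p ^ d dvd a"
    proof (rule ccontr)
      assume "\<not> int p ^ d dvd a"
      then obtain c where c: "c < d" "int p ^ c dvd a" "\<not> int p ^ Suc c dvd a" by (rule prime_power_exact)
      have "p ^ Suc c dvd n" using c(1) dn by (meson Suc_leI dvd_trans le_imp_power_dvd)
      hence "c \<in> crit L p" using na c unfolding crit_def by blast
      thus False using assms(2) c(1) d(1) by fastforce
    qed
    then obtain a' where a': "a = int p ^ d * a'" by (auto simp: dvd_def)
    obtain u v where "u * int n + v * int (p ^ b) = gcd (int n) (int (p ^ b))" using bezout_int by blast
    also have "\<dots> = int (p ^ d)" using d(2) by (metis gcd_int_int_eq)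
    finally have uv: "int p ^ d = u * int n + v * int (p ^ b)" by simp
    have "x [^] a = x [^] (int n * (u * a') + int (p ^ b) * (v * a'))"
      unfolding a' uv by (simp add: algebra_simps)
    also have "\<dots> = x [^] (int n * (u * a')) \<otimes> x [^] (int (p ^ b) * (v * a'))" using xc by (simp only: int_pow_mult)
    also have "x [^] (int (p ^ b) * (v * a')) = \<one>" by (rule tors_pow_dvd[OF x]) simp
    also have "x [^] (int n * (u * a')) \<otimes> \<one> = x [^] (int n * (u * a'))" using xc by simp
    also have "\<dots> \<in> multiples G n" using xc by (rule pow_mult_in_multiples) simp
    finally show ?thesis .
  qed
  thus "x \<in> sol G L" using xc by (auto simp: sol_def)
qed

text \<open>
  Without critical exponents \<open>v(n) \<le> v(a)\<close> holds for all conditions, so that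
  factors prime to \<open>p\<close> suffice to make them trivial.
\<close>

lemma coprime_multiplier:
  assumes "finite L" "prime p" "crit L p = {}"
  shows "\<exists>N::nat. \<not> p dvd N \<and> (\<forall>(n, a) \<in> L. int n dvd a * int N)"
  using assms(1,3)
proof (induction L rule: finite_induct)
  case empty
  have "\<not> p dvd 1" using assms(2) by (metis not_prime_unit)
  thus ?case by (intro exI[of _ 1]) simp
next
  case (insert na L)
  obtain n a where na: "na = (n, a)" by (cases na)
  have "crit L p = {}" using insert.prems by (auto simp: crit_def)
  then obtain N where N: "\<not> p dvd N" "\<forall>(n, a) \<in> L. int n dvd a * int N" using insert.IH by blast
  have nc: "\<not> (int p ^ c dvd a \<and> \<not> int p ^ Suc c dvd a \<and> p ^ Suc c dvd n)" for c
    using insert.prems na by (auto simp: crit_def)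
  have "\<exists>n'::nat. \<not> p dvd n' \<and> int n dvd a * int n'"
  proof (cases "n = 0")
    case True
    have "a = 0"
    proof (rule ccontr)
      assume a: "a \<noteq> 0"
      have "\<not> int p ^ (nat \<bar>a\<bar>) dvd a"
      proof
        assume "int p ^ (nat \<bar>a\<bar>) dvd a"
        hence "int p ^ (nat \<bar>a\<bar>) \<le> \<bar>a\<bar>" using a by (metis dvd_abs_iff zdvd_imp_le abs_ge_zero zero_less_abs_iff)
        moreover have "nat \<bar>a\<bar> < p ^ (nat \<bar>a\<bar>)" using power_gt_expt[of p] prime_gt_1_nat[OF assms(2)] by simp
        hence "int (nat \<bar>a\<bar>) < int (p ^ (nat \<bar>a\<bar>))" by (simp only: of_nat_less_iff)
        ultimately show False by simp
      qed
      then obtain c where "int p ^ c dvd a" "\<not> int p ^ Suc c dvd a" by (rule prime_power_exact)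
      thus False using nc[of c] True by simp
    qed
    moreover have "\<not> p dvd 1" using assms(2) by (metis not_prime_unit)
    ultimately show ?thesis by (intro exI[of _ 1]) simp
  next
    case False
    then obtain k n' where n': "n = p ^ k * n'" "\<not> p dvd n'" using prime_dvd_coprime_part[OF assms(2)] by (metis neq0_conv)
    have "int p ^ k dvd a"
    proof (rule ccontr)
      assume "\<not> int p ^ k dvd a"
      then obtain c where c: "c < k" "int p ^ c dvd a" "\<not> int p ^ Suc c dvd a" by (rule prime_power_exact)
      have "p ^ Suc c dvd n" unfolding n'(1) using c(1) by (simp add: Suc_leI dvd_mult2 le_imp_power_dvd del: power_Suc)
      thus False using nc[of c] c by simp
    qed
    hence "int n dvd a * int n'" unfolding n'(1) by (simp add: mult_dvd_mono)
    thus ?thesis using n'(2) by blast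
  qed
  then obtain n' where n': "\<not> p dvd n'" "int n dvd a * int n'" by blast
  have "\<not> p dvd N * n'" using N n' assms(2) by (simp add: prime_dvd_mult_iff)
  moreover have "int m dvd c * int (N * n')" if "(m, c) \<in> insert na L" for m c
  proof (cases "(m, c) = na")
    case True
    have "int n dvd (a * int n') * int N" using n'(2) by (rule dvd_mult2)
    thus ?thesis using True na by (simp add: ac_simps)
  next
    case False
    hence "int m dvd c * int N" using that N(2) by auto
    hence "int m dvd (c * int N) * int n'" by (rule dvd_mult2)
    thus ?thesis by (simp add: ac_simps)
  qed
  ultimately show ?case by blast
qed

lemma idx_sol_pre:
  assumes "finite L" "prime p"
  shows "idx G (sol G L) (pre p n) =
    (if crit L p = {} then idx G (carrier G) (pre p n) else idx G (tors G (p ^ (LEAST b. b \<in> crit L p))) (pre p n))"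
proof (cases "crit L p = {}")
  case True
  obtain N where N: "\<not> p dvd N" "\<forall>(n, a) \<in> L. int n dvd a * int N" using coprime_multiplier[OF assms True] by blast
  obtain u v where uv: "u * int N + v * int p = 1" using bezout_prime[of p "int N"] assms N by auto
  have "idx G (carrier G) (pre p n) = idx G (sol G L) (pre p n)"
  proof (rule idx_absorb)
    fix x assume x: "x \<in> carrier G"
    have h: "x [^] (u * int N) \<in> sol G L"
    proof -
      have "(x [^] (u * int N)) [^] a \<in> multiples G m" if "(m, a) \<in> L" for m a
      proof -
        have "int m dvd a * int N" using N(2) that by blast
        hence "int m dvd u * int N * a" by (metis dvd_mult mult.assoc mult.commute)
        hence "x [^] (u * int N * a) \<in> multiples G m" using x by (intro pow_mult_in_multiples)
        thus ?thesis using x by (simp add: int_pow_pow)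
      qed
      thus ?thesis using x by (auto simp: sol_def)
    qed
    have "x = x [^] (u * int N + v * int p)" using uv x by simp
    also have "\<dots> = x [^] (u * int N) \<otimes> (x [^] v) [^] int p" using x by (simp add: int_pow_mult int_pow_pow)
    finally have xe: "x = (x [^] v) [^] int p \<otimes> x [^] (u * int N)" using x by (simp add: m_comm)
    have "x \<otimes> inv (x [^] (u * int N)) = (x [^] v) [^] int p"
    proof -
      have "((x [^] v) [^] int p \<otimes> x [^] (u * int N)) \<otimes> inv (x [^] (u * int N)) = (x [^] v) [^] int p"
        using x by (simp add: m_assoc)
      thus ?thesis using xe by simp
    qed
    also have "\<dots> \<in> pre p n" using multiples_pre x by (force simp: multiples_iff)
    finally show "\<exists>h\<in>sol G L. x \<otimes> inv h \<in> pre p n" using h by blast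
  qed (auto simp: sol_def)
  thus ?thesis using True by simp
next
  case False
  define b where "b = (LEAST b. b \<in> crit L p)"
  have b: "b \<in> crit L p" unfolding b_def using False by (metis LeastI ex_in_conv)
  have le: "b \<le> c" if "c \<in> crit L p" for c unfolding b_def using that by (rule Least_le)
  have "idx G (sol G L) (pre p n) = idx G (tors G (p ^ b)) (pre p n)"
  proof (rule idx_absorb)
    show "tors G (p ^ b) \<subseteq> sol G L" using tors_sub_sol[OF assms(2)] le by blast
    fix x assume "x \<in> sol G L"
    thus "\<exists>h\<in>tors G (p ^ b). x \<otimes> inv h \<in> pre p n" using sol_mod_p[OF assms(2) b] multiples_pre by blast
  qed (auto simp: sol_def)
  thus ?thesis using False b_def by simp
qed

end

primrec lift :: "ag_term \<Rightarrow> ag_term" where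
  "lift (Var i) = Var (Suc i)"
| "lift Zero = Zero"
| "lift (Plus s t) = Plus (lift s) (lift t)"
| "lift (Minus t) = Minus (lift t)"

lemma term_val_lift [simp]: "term_val M (case_nat x v) (lift t) = term_val M v t"
  by (induction t) auto

definition fdivt :: "nat \<Rightarrow> ag_term \<Rightarrow> ag_form" where
  "fdivt n t = Exists (Equal (smul (int n) (Var 0)) (lift t))"

lemma (in comm_group) sat_fdivt:
  assumes "range v \<subseteq> carrier G" shows "sat G v (fdivt n t) \<longleftrightarrow> term_val G v t \<in> multiples G n"
proof -
  have "term_val G (case_nat y v) (smul (int n) (Var 0)) = y [^] int n" if "y \<in> carrier G" for y
    using range_case_nat[OF that assms] by simp
  hence "sat G v (fdivt n t) \<longleftrightarrow> (\<exists>y\<in>carrier G. y [^] int n = term_val G v t)"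
    unfolding fdivt_def sat.simps by (intro bex_cong refl) simp
  also have "\<dots> \<longleftrightarrow> term_val G v t \<in> multiples G n"
    unfolding multiples_iff by (rule bex_cong[OF refl]) (rule eq_commute)
  finally show ?thesis .
qed

text \<open>
  The image of a solution set under multiplication by \<open>c\<close> is defined by a positive
  primitive formula, so it is a solution set again. Eliminating the quantifier of this formula
  gives conditions that do not depend on the group.
\<close>

definition img_form :: "(nat \<times> int) set \<Rightarrow> int \<Rightarrow> ag_form" where
  "img_form L c = Exists (Conj (Equal (Var 1) (smul c (Var 0))) (cj ((\<lambda>(n, a). fdivt n (smul a (Var 0))) ` L)))"

definition img_conds :: "(nat \<times> int) set \<Rightarrow> int \<Rightarrow> (nat \<times> int) set" where
  "img_conds L c = conds1 (SOME D. ppnf (img_form L c) D)"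

lemma pp_fdivt: "pp (fdivt n t)"
  unfolding fdivt_def by (intro pp.intros)

lemma img_form_nf: "finite L \<Longrightarrow> ppnf (img_form L c) (SOME D. ppnf (img_form L c) D)"
proof -
  assume "finite L"
  hence "pp (img_form L c)" unfolding img_form_def
    by (intro pp.intros pp_cj) (auto intro: pp_fdivt)
  thus ?thesis using ppnf_exists by (metis someI_ex)
qed

lemma finite_img_conds: "finite L \<Longrightarrow> finite (img_conds L c)"
  unfolding img_conds_def conds1_def using ppnf_finite[OF img_form_nf] by blast

context comm_group begin

lemma img_conds_sol:
  assumes "finite L" shows "sol G (img_conds L c) = (\<lambda>x. x [^] c) ` sol G L"
proof -
  have "sol G (img_conds L c) = ppsub G (img_form L c)"
    unfolding img_conds_def using ppsub_eq_sol[OF img_form_nf[OF assms]] by simp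
  also have "\<dots> = (\<lambda>x. x [^] c) ` sol G L"
  proof -
    have "sat G (case_nat y (\<lambda>_. \<one>)) (img_form L c) \<longleftrightarrow> (\<exists>x\<in>sol G L. y = x [^] c)" if y: "y \<in> carrier G" for y
    proof -
      have r: "range (case_nat x (case_nat y (\<lambda>_. \<one>))) \<subseteq> carrier G" if "x \<in> carrier G" for x
        using that y by (intro range_case_nat) auto
      have "sat G (case_nat y (\<lambda>_. \<one>)) (img_form L c) \<longleftrightarrow>
         (\<exists>x\<in>carrier G. y = x [^] c \<and> (\<forall>(n, a) \<in> L. sat G (case_nat x (case_nat y (\<lambda>_. \<one>))) (fdivt n (smul a (Var 0)))))"
      proof -
        have "term_val G (case_nat x (case_nat y (\<lambda>_. \<one>))) (smul c (Var 0)) = x [^] c" if "x \<in> carrier G" for x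
          using r[OF that] by simp
        thus ?thesis unfolding img_form_def using assms by (simp add: case_prod_beta)
      qed
      also have "\<dots> \<longleftrightarrow> (\<exists>x\<in>carrier G. y = x [^] c \<and> (\<forall>(n, a) \<in> L. x [^] a \<in> multiples G n))"
        by (intro bex_cong refl) (simp add: sat_fdivt[OF r] r)
      finally show ?thesis by (auto simp: sol_def)
    qed
    thus ?thesis by (auto simp: ppsub_def sol_def)
  qed
  finally show ?thesis .
qed

lemma idx_sol_pow:
  assumes "finite L"
  shows "sidx G L {(n, a)} = idx G (sol G (img_conds L a)) (multiples G n)"
proof -
  have "sol G {(n, a)} = {x \<in> carrier G. x [^] a \<in> multiples G n}" by (simp add: sol_def)
  thus ?thesis using idx_pow[OF sol_carrier[of L] multiples_subgroup[of n], of a] by (simp add: img_conds_sol[OF assms])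
qed

lemma sol_scale:
  "sol G L \<inter> multiples G n = (\<lambda>x. x [^] int n) ` sol G ((\<lambda>(m, a). (m, a * int n)) ` L)"
proof -
  have "(x [^] int n) [^] a = x [^] (a * int n)" if "x \<in> carrier G" for x a
    using that by (simp add: int_pow_pow mult.commute)
  hence e: "y [^] int n \<in> sol G L \<longleftrightarrow> y \<in> sol G ((\<lambda>(m, a). (m, a * int n)) ` L)" if "y \<in> carrier G" for y
    using that by (simp add: sol_def case_prod_beta)
  show ?thesis
  proof (rule subset_antisym; rule subsetI)
    fix x assume x: "x \<in> sol G L \<inter> multiples G n"
    obtain y where y: "y \<in> carrier G" "x = y [^] int n" using IntD2[OF x] unfolding multiples_iff by (rule bexE)
    thus "x \<in> (\<lambda>x. x [^] int n) ` sol G ((\<lambda>(m, a). (m, a * int n)) ` L)" using e[OF y(1)] x by blast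
  next
    fix x assume "x \<in> (\<lambda>x. x [^] int n) ` sol G ((\<lambda>(m, a). (m, a * int n)) ` L)"
    then obtain y where y: "x = y [^] int n" "y \<in> sol G ((\<lambda>(m, a). (m, a * int n)) ` L)" by (rule imageE)
    have yc: "y \<in> carrier G" using y(2) sol_carrier by blast
    thus "x \<in> sol G L \<inter> multiples G n" using e[OF yc] y by (auto simp: multiples_iff)
  qed
qed

text \<open>The tower over \<open>n G\<close>, followed by division by \<open>n\<close>.\<close>

lemma idx_sol_multiples_Suc:
  "idx G (sol G L) (multiples G (n * p)) =
   idx G (sol G L) (multiples G n) * idx G (sol G ((\<lambda>(m, a). (m, a * int n)) ` L)) (pre p n)"
proof -
  have "multiples G (n * p) = multiples G n \<inter> multiples G (n * p)" using multiples_dvd[of n "n * p"] by auto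
  hence "idx G (sol G L) (multiples G (n * p)) = idx G (sol G L) (multiples G n \<inter> multiples G (n * p))" by simp
  also have "\<dots> = idx G (sol G L) (multiples G n) * idx G (sol G L \<inter> multiples G n) (multiples G (n * p))"
    by (rule idx_Int) auto
  also have "idx G (sol G L \<inter> multiples G n) (multiples G (n * p)) = idx G (sol G ((\<lambda>(m, a). (m, a * int n)) ` L)) (pre p n)"
    unfolding sol_scale pre_def by (rule idx_pow) (auto simp: sol_carrier)
  finally show ?thesis .
qed

text \<open>Inside \<open>G[p]\<close>, a solution set is trivial or one of the groups \<open>(p^s G)[p]\<close>.\<close>

definition ptor :: "nat \<Rightarrow> nat option \<Rightarrow> 'a set" where
  "ptor p d = (case d of None \<Rightarrow> {\<one>} | Some s \<Rightarrow> torsion_part G (multiples G (p ^ s)) p)"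

definition ptor_step :: "nat \<Rightarrow> nat \<Rightarrow> int \<Rightarrow> nat option \<Rightarrow> nat option" where
  "ptor_step p n a d = (if int p dvd a then d else if n = 0 then None
     else map_option (max (multiplicity p n)) d)"

text \<open>
  On \<open>G[p]\<close>, an integer divisible by \<open>p\<close> acts as zero and any other
  integer acts invertibly. Hence a nontrivial condition with \<open>n > 0\<close> says that
  \<open>x\<close> is divisible by the \<open>p\<close>-part of \<open>n\<close>.
\<close>

lemma ptor_step:
  assumes p: "prime p" shows "ptor p d \<inter> sol G {(n, a)} = ptor p (ptor_step p n a d)"
proof (cases d)
  case None
  have "\<one> \<in> sol G {(n, a)}" using subgroup.one_closed[OF sol_subgroup] .
  thus ?thesis using None by (auto simp: ptor_def ptor_step_def)
next
  case (Some s)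
  have dc: "ptor p d \<subseteq> tors G p" using Some multiples_carrier[of "p ^ s"] by (auto simp: ptor_def torsion_part_iff)
  show ?thesis
  proof (cases "int p dvd a")
    case True
    have "x [^] a \<in> multiples G n" if "x \<in> ptor p d" for x
      using tors_pow_dvd[of x p a] dc that True one_multiples by auto
    hence "ptor p d \<subseteq> sol G {(n, a)}" using dc by (auto simp: sol_def tors_iff)
    thus ?thesis using True by (auto simp: ptor_step_def)
  next
    case False
    obtain u v where uv: "u * a + v * int p = 1" using bezout_prime[OF p False] .
    have eq: "x [^] a \<in> multiples G n \<longleftrightarrow> x \<in> multiples G n" if x: "x \<in> tors G p" for x
    proof
      assume h: "x [^] a \<in> multiples G n"
      have xc: "x \<in> carrier G" using x by (simp add: tors_iff)
      have "x = x [^] (u * a + v * int p)" using uv xc by simp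
      also have "\<dots> = x [^] (a * u) \<otimes> x [^] (v * int p)" using xc by (simp add: int_pow_mult mult.commute)
      also have "x [^] (v * int p) = \<one>" by (rule tors_pow_dvd[OF x]) simp
      also have "x [^] (a * u) \<otimes> \<one> = (x [^] a) [^] u" using xc by (simp add: int_pow_pow)
      finally show "x \<in> multiples G n" using pow_in_multiples[OF h, of u] by simp
    qed (rule pow_in_multiples)
    have sol: "ptor p d \<inter> sol G {(n, a)} = ptor p d \<inter> multiples G n"
      using eq dc multiples_carrier by (auto simp: sol_def)
    show ?thesis
    proof (cases "n = 0")
      case True
      have "\<one> \<in> ptor p d" using Some by (simp add: ptor_def subgroup.one_closed[OF torsion_part_multiples_subgroup])
      thus ?thesis unfolding sol using True False by (auto simp: ptor_step_def ptor_def)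
    next
      case n: False
      then obtain n' where n': "n = p ^ multiplicity p n * n'" "\<not> p dvd n'"
        using p by (metis multiplicity_decompose' not_prime_unit)
      define k where "k = multiplicity p n"
      obtain u v where uv: "u * int n' + v * int p = 1" using bezout_prime[of p "int n'"] p n' by auto
      have eq: "x \<in> multiples G n \<longleftrightarrow> x \<in> multiples G (p ^ k)" if x: "x \<in> tors G p" for x
      proof
        assume "x \<in> multiples G n"
        thus "x \<in> multiples G (p ^ k)" using multiples_dvd[of "p ^ k" n] n'(1) k_def by (metis dvd_triv_left subsetD)
      next
        assume "x \<in> multiples G (p ^ k)"
        then obtain y where y: "y \<in> carrier G" "x = y [^] int (p ^ k)" by (auto simp: multiples_iff)
        have xc: "x \<in> carrier G" using x by (simp add: tors_iff)
        have "x = x [^] (u * int n' + v * int p)" using uv xc by simp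
        also have "\<dots> = x [^] (u * int n') \<otimes> x [^] (v * int p)" using xc by (simp add: int_pow_mult)
        also have "x [^] (v * int p) = \<one>" by (rule tors_pow_dvd[OF x]) simp
        also have "x [^] (u * int n') \<otimes> \<one> = y [^] (int (p ^ k) * (u * int n'))"
          using xc y by (simp add: int_pow_pow)
        also have "int (p ^ k) * (u * int n') = u * int n"
        proof -
          have "int n = int (p ^ k) * int n'" using n'(1) unfolding k_def by (metis of_nat_mult)
          thus ?thesis by (simp add: ac_simps)
        qed
        also have "y [^] (u * int n) \<in> multiples G n" using y(1) by (rule pow_mult_in_multiples) simp
        finally show "x \<in> multiples G n" .
      qed
      have mm: "multiples G (p ^ s) \<inter> multiples G (p ^ k) = multiples G (p ^ max k s)"
      proof (cases "k \<le> s")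
        case True
        thus ?thesis using multiples_dvd[of "p ^ k" "p ^ s"] by (auto simp: max_def le_imp_power_dvd)
      next
        case False
        thus ?thesis using multiples_dvd[of "p ^ s" "p ^ k"] by (auto simp: max_def le_imp_power_dvd)
      qed
      have "ptor p d \<inter> multiples G n = ptor p d \<inter> multiples G (p ^ k)" using eq dc by auto
      also have "\<dots> = ptor p (Some (max k s))"
      proof -
        have e: "x \<in> multiples G (p ^ s) \<and> x \<in> multiples G (p ^ k) \<longleftrightarrow> x \<in> multiples G (p ^ max k s)" for x
          using mm by blast
        show ?thesis unfolding Some ptor_def option.case
          by (rule Set.set_eqI) (simp only: Int_iff torsion_part_iff e[symmetric], blast)
      qed
      finally show ?thesis unfolding sol using Some False n by (simp add: ptor_step_def k_def)
    qed
  qed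
qed

end

section \<open>The invariants determine the theory\<close>

context comm_group begin

text \<open>
  The order of a finite group \<open>n G\<close> times \<open>n\<close> is an exponent of
  \<open>G\<close>.
\<close>

lemma unbounded_multiples_infinite:
  assumes "\<not> bounded_exp G" "n > 0" shows "infinite (multiples G n)"
proof
  assume fin: "finite (multiples G n)"
  let ?H = "G\<lparr>carrier := multiples G n\<rparr>"
  interpret H: group ?H by (rule subgroup_imp_group) simp
  let ?o = "order ?H"
  have "?o > 0" using fin one_multiples by (auto simp: order_def card_gt_0_iff)
  moreover have "x [^] (n * ?o) = \<one>" if "x \<in> carrier G" for x
  proof -
    have "x [^] n \<in> carrier ?H" using that by (simp add: multiples_def)
    hence "(x [^] n) [^]\<^bsub>?H\<^esub> ?o = \<one>" using H.pow_order_eq_1 by simp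
    hence "(x [^] n) [^] ?o = \<one>" by (metis nat_pow_consistent)
    thus ?thesis using that by (simp add: nat_pow_pow)
  qed
  ultimately have "bounded_exp G" unfolding bounded_exp_def using assms(2) by (intro exI[of _ "n * ?o"]) auto
  thus False using assms(1) by simp
qed

lemma idx_trivial_infinite:
  assumes "H \<subseteq> carrier G" "infinite H" shows "idx G H {\<one>} = \<infinity>"
proof -
  have "{\<one>} #> x = {\<one>} #> y \<longleftrightarrow> x = y" if "x \<in> H" "y \<in> H" for x y
    using that assms(1) by (auto simp: r_coset_def subset_iff)
  hence "inj_on (\<lambda>x. {\<one>} #> x) H" by (auto intro: inj_onI)
  thus ?thesis using assms by (simp add: idx_def ecard_infinite_iff finite_image_iff)
qed

lemma sol_contains_multiples:
  assumes "finite L" "\<And>a. (0, a) \<in> L \<Longrightarrow> a = 0"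
  shows "\<exists>n>0. multiples G n \<subseteq> sol G L"
  using assms
proof (induction L rule: finite_induct)
  case empty thus ?case using multiples_carrier by auto
next
  case (insert na L)
  obtain m a where na: "na = (m, a)" by (cases na)
  obtain n where n: "n > 0" "multiples G n \<subseteq> sol G L" using insert by auto
  have "\<exists>k>0. \<forall>x\<in>multiples G k. x [^] a \<in> multiples G m"
  proof (cases "m = 0")
    case True
    hence "a = 0" using insert.prems na by auto
    thus ?thesis by (intro exI[of _ 1]) (auto simp: one_multiples)
  next
    case False
    thus ?thesis using pow_in_multiples by (intro exI[of _ m]) auto
  qed
  then obtain k where k: "k > 0" "\<forall>x\<in>multiples G k. x [^] a \<in> multiples G m" by blast
  have "multiples G (n * k) \<subseteq> sol G (insert na L)"
  proof
    fix x assume "x \<in> multiples G (n * k)"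
    hence "x \<in> multiples G n" "x \<in> multiples G k" using multiples_dvd[of n "n * k"] multiples_dvd[of k "n * k"] by auto
    thus "x \<in> sol G (insert na L)" using n(2) k(2) na by (auto simp: sol_def)
  qed
  thus ?case using n(1) k(1) by (intro exI[of _ "n * k"]) auto
qed

end

locale same_invariants = M: comm_group M + N: comm_group N
  for M :: "('m, 'e) monoid_scheme" (structure) and N :: "('n, 'f) monoid_scheme" (structure) +
  assumes ulm_eq: "\<And>p k. prime p \<Longrightarrow> ulm M p k = ulm N p k"
    and tfree_eq: "\<And>p k. prime p \<Longrightarrow> tfree M p k = tfree N p k"
    and tsize_eq: "\<And>p k. prime p \<Longrightarrow> tsize M p k = tsize N p k"
    and bounded_eq: "bounded_exp M \<longleftrightarrow> bounded_exp N"
begin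

lemma idx_tors_pre_eq:
  assumes "prime p"
  shows "idx M (tors M (p ^ b)) (M.pre p (p ^ k)) = idx N (tors N (p ^ b)) (N.pre p (p ^ k))"
proof (induction b)
  case 0 thus ?case using M.idx_tors_pre_le[of 0 k p] N.idx_tors_pre_le[of 0 k p] by simp
next
  case (Suc b)
  show ?case
  proof (cases "k \<le> b")
    case True
    thus ?thesis using M.idx_tors_pre_Suc[of k b p] N.idx_tors_pre_Suc[of k b p] Suc ulm_eq[OF assms] by simp
  next
    case False
    thus ?thesis using M.idx_tors_pre_le[of "Suc b" k p] N.idx_tors_pre_le[of "Suc b" k p] by simp
  qed
qed

text \<open>
  The index depends on the solution set only through its least critical exponent, which is the
  same in both groups because it is read off the conditions.
\<close>

lemma idx_sol_pre_eq:
  assumes "finite L" "prime p" "n > 0"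
  shows "idx M (sol M L) (M.pre p n) = idx N (sol N L) (N.pre p n)"
proof -
  obtain k n' where n: "n = p ^ k * n'" "\<not> p dvd n'" using prime_dvd_coprime_part[OF assms(2,3)] .
  show ?thesis
    unfolding M.idx_sol_pre[OF assms(1,2)] N.idx_sol_pre[OF assms(1,2)] n(1)
      M.pre_coprime_part[OF assms(2) n(2)] N.pre_coprime_part[OF assms(2) n(2)]
    by (simp add: M.idx_carrier_pre N.idx_carrier_pre tfree_eq[OF assms(2)] idx_tors_pre_eq[OF assms(2)])
qed

text \<open>The prime factors of \<open>m\<close> are removed one at a time.\<close>

lemma idx_sol_multiples_eq:
  assumes "m > 0" "finite L"
  shows "idx M (sol M L) (multiples M m) = idx N (sol N L) (multiples N m)"
  using assms
proof (induction m rule: less_induct)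
  case (less m)
  show ?case
  proof (cases "m = 1")
    case True
    have "idx M (sol M L) (multiples M m) = 1"
      using True M.idx_eq_1_iff[OF M.sol_subgroup M.multiples_subgroup, of L m] M.sol_carrier[of L] by simp
    moreover have "idx N (sol N L) (multiples N m) = 1"
      using True N.idx_eq_1_iff[OF N.sol_subgroup N.multiples_subgroup, of L m] N.sol_carrier[of L] by simp
    ultimately show ?thesis by simp
  next
    case False
    then obtain p where p: "prime p" "p dvd m" using prime_factor_nat by blast
    then obtain n where n: "m = n * p" by (metis dvd_def mult.commute)
    have "n > 0" "n < m" using n less.prems(1) p(1) prime_gt_1_nat[OF p(1)] by auto
    hence IH: "idx M (sol M L) (multiples M n) = idx N (sol N L) (multiples N n)"
      using less.IH[of n] less.prems by simp
    have "idx M (sol M ((\<lambda>(m, a). (m, a * int n)) ` L)) (M.pre p n) = idx N (sol N ((\<lambda>(m, a). (m, a * int n)) ` L)) (N.pre p n)"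
      by (rule idx_sol_pre_eq[OF _ p(1) \<open>n > 0\<close>]) (use less.prems in simp)
    thus ?thesis unfolding n M.idx_sol_multiples_Suc N.idx_sol_multiples_Suc IH by (simp only:)
  qed
qed

lemma ptor_exists:
  assumes "prime p" "finite L"
  shows "\<exists>d. tors M p \<inter> sol M L = M.ptor p d \<and> tors N p \<inter> sol N L = N.ptor p d"
  using assms(2)
proof (induction L rule: finite_induct)
  case empty
  have "tors M p \<inter> sol M {} = M.ptor p (Some 0)" "tors N p \<inter> sol N {} = N.ptor p (Some 0)"
    by (auto simp: M.ptor_def N.ptor_def torsion_part_def)
  thus ?case by blast
next
  case (insert na L)
  obtain n a where na: "na = (n, a)" by (cases na)
  obtain d where d: "tors M p \<inter> sol M L = M.ptor p d" "tors N p \<inter> sol N L = N.ptor p d" using insert.IH by blast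
  have "tors M p \<inter> sol M (insert na L) = M.ptor p d \<inter> sol M {(n, a)}"
    using d(1) na by (auto simp: sol_def)
  moreover have "tors N p \<inter> sol N (insert na L) = N.ptor p d \<inter> sol N {(n, a)}"
    using d(2) na by (auto simp: sol_def)
  ultimately show ?case unfolding M.ptor_step[OF assms(1)] N.ptor_step[OF assms(1)] by blast
qed

lemma idx_ptor_eq:
  assumes "prime p" shows "idx M (M.ptor p d) {\<one>\<^bsub>M\<^esub>} = idx N (N.ptor p d) {\<one>\<^bsub>N\<^esub>}"
proof (cases d)
  case None
  thus ?thesis using M.idx_eq_1[of "{\<one>\<^bsub>M\<^esub>}" "{\<one>\<^bsub>M\<^esub>}"] N.idx_eq_1[of "{\<one>\<^bsub>N\<^esub>}" "{\<one>\<^bsub>N\<^esub>}"]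
    by (simp add: M.ptor_def N.ptor_def M.triv_subgroup N.triv_subgroup)
next
  case (Some s)
  thus ?thesis using tsize_eq[OF assms, of s] by (simp add: M.ptor_def N.ptor_def tsize_def)
qed

end

text \<open>Multiplication by \<open>p\<close> has the kernel \<open>G[p]\<close>, and its image consists of \<open>d\<close>-torsion elements.\<close>

lemma (in comm_group) idx_torsion_step:
  assumes "finite L"
  shows "idx G (sol G L \<inter> tors G (p * d)) {\<one>} =
    idx G (sol G (img_conds (insert (0, int (p * d)) L) (int p)) \<inter> tors G d) {\<one>} * idx G (tors G p \<inter> sol G L) {\<one>}"
proof -
  let ?L = "insert (0, int (p * d)) L"
  have H: "sol G L \<inter> tors G (p * d) = sol G ?L" by (auto simp: sol_def tors_iff)
  have "idx G (sol G ?L) {\<one>} = idx G (sol G ?L) (tors G p \<inter> {\<one>})"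
    using subgroup.one_closed[OF tors_subgroup[of p]] by (simp add: Int_insert_right)
  also have "\<dots> = idx G (sol G ?L) (tors G p) * idx G (sol G ?L \<inter> tors G p) {\<one>}"
    by (rule idx_Int) (auto simp: triv_subgroup)
  also have "idx G (sol G ?L) (tors G p) = idx G ((\<lambda>x. x [^] int p) ` sol G ?L) {\<one>}"
  proof -
    have "tors G p = {x \<in> carrier G. x [^] int p \<in> {\<one>}}" by (auto simp: tors_iff)
    thus ?thesis using idx_pow[OF sol_carrier[of ?L] triv_subgroup, of "int p"] by simp
  qed
  also have "(\<lambda>x. x [^] int p) ` sol G ?L = sol G (img_conds ?L (int p))"
    using img_conds_sol[of ?L "int p"] assms by simp
  also have "sol G (img_conds ?L (int p)) = sol G (img_conds ?L (int p)) \<inter> tors G d"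
  proof -
    have "sol G (img_conds ?L (int p)) \<subseteq> tors G d"
    proof
      fix x assume "x \<in> sol G (img_conds ?L (int p))"
      hence "x \<in> (\<lambda>x. x [^] int p) ` sol G ?L" using img_conds_sol[of ?L "int p"] assms by simp
      then obtain z where z: "x = z [^] int p" "z \<in> sol G ?L" by (rule imageE)
      have "z \<in> carrier G" "z [^] int (p * d) = \<one>" using z(2) by (auto simp: sol_def)
      thus "x \<in> tors G d" using z(1) by (simp add: tors_iff int_pow_pow)
    qed
    thus ?thesis by blast
  qed
  also have "sol G ?L \<inter> tors G p = tors G p \<inter> sol G L"
    using H tors_dvd[of p "p * d"] by auto
  finally show ?thesis unfolding H .
qed

context same_invariants begin

lemma idx_torsion_eq:
  assumes "d > 0" "finite L"
  shows "idx M (sol M L \<inter> tors M d) {\<one>\<^bsub>M\<^esub>} = idx N (sol N L \<inter> tors N d) {\<one>\<^bsub>N\<^esub>}"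
  using assms
proof (induction d arbitrary: L rule: less_induct)
  case (less d L)
  show ?case
  proof (cases "d = 1")
    case True
    have "sol M L \<inter> tors M d = {\<one>\<^bsub>M\<^esub>}" "sol N L \<inter> tors N d = {\<one>\<^bsub>N\<^esub>}"
      using True subgroup.one_closed[OF M.sol_subgroup] subgroup.one_closed[OF N.sol_subgroup]
      by (auto simp: M.tors_iff N.tors_iff)
    thus ?thesis using M.idx_eq_1[of "{\<one>\<^bsub>M\<^esub>}" "{\<one>\<^bsub>M\<^esub>}"] N.idx_eq_1[of "{\<one>\<^bsub>N\<^esub>}" "{\<one>\<^bsub>N\<^esub>}"]
      by (simp add: M.triv_subgroup N.triv_subgroup)
  next
    case False
    then obtain p where p: "prime p" "p dvd d" using prime_factor_nat by blast
    then obtain d' where d: "d = p * d'" by (auto simp: dvd_def)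
    have "d' > 0" "d' < d" using d less.prems(1) p(1) prime_gt_1_nat[OF p(1)] by auto
    moreover have "idx M (tors M p \<inter> sol M L) {\<one>\<^bsub>M\<^esub>} = idx N (tors N p \<inter> sol N L) {\<one>\<^bsub>N\<^esub>}"
      using ptor_exists[OF p(1) less.prems(2)] idx_ptor_eq[OF p(1)] by metis
    ultimately show ?thesis
      unfolding d M.idx_torsion_step[OF less.prems(2)] N.idx_torsion_step[OF less.prems(2)]
      using less.IH[of d'] finite_img_conds less.prems(2) d by simp
  qed
qed

text \<open>
  If the conditions include a nontrivial equation, or if the exponents are bounded, then the
  solutions are torsion elements of a fixed order and \<open>idx_torsion_eq\<close> applies.
  Otherwise the solution set contains \<open>n G\<close> for some \<open>n > 0\<close> and is
  infinite in both groups.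
\<close>

lemma idx_sol_trivial_eq:
  assumes "finite L"
  shows "idx M (sol M L) {\<one>\<^bsub>M\<^esub>} = idx N (sol N L) {\<one>\<^bsub>N\<^esub>}"
proof -
  have red: ?thesis if "sol M L \<subseteq> tors M d" "sol N L \<subseteq> tors N d" "d > 0" for d
    using idx_torsion_eq[OF that(3) assms] that(1,2) by (simp add: Int_absorb2)
  consider (eq) a where "(0, a) \<in> L" "a \<noteq> 0" | (bdd) "bounded_exp M" "bounded_exp N"
    | (unb) "\<And>a. (0, a) \<in> L \<Longrightarrow> a = 0" "\<not> bounded_exp M" "\<not> bounded_exp N"
    using bounded_eq by blast
  thus ?thesis
  proof cases
    case eq
    have abs: "x [^]\<^bsub>G\<^esub> \<bar>a\<bar> = \<one>\<^bsub>G\<^esub>" if "comm_group G" "x \<in> carrier G" "x [^]\<^bsub>G\<^esub> a = \<one>\<^bsub>G\<^esub>"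
      for x and G :: "('z, 'y) monoid_scheme"
    proof -
      interpret comm_group G by fact
      show ?thesis using that by (auto simp: abs_if int_pow_neg)
    qed
    show ?thesis
    proof (rule red)
      show "sol M L \<subseteq> tors M (nat \<bar>a\<bar>)" 
        using eq(1) M.multiples_0 abs[OF M.comm_group_axioms] by (auto simp: sol_def M.tors_iff)
      show "sol N L \<subseteq> tors N (nat \<bar>a\<bar>)"
        using eq(1) N.multiples_0 abs[OF N.comm_group_axioms] by (auto simp: sol_def N.tors_iff)
      show "nat \<bar>a\<bar> > 0" using eq(2) by simp
    qed
  next
    case bdd
    obtain e where e: "e > 0" "\<forall>x\<in>carrier M. x [^]\<^bsub>M\<^esub> (e::nat) = \<one>\<^bsub>M\<^esub>" using bdd(1) by (auto simp: bounded_exp_def)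
    obtain f where f: "f > 0" "\<forall>x\<in>carrier N. x [^]\<^bsub>N\<^esub> (f::nat) = \<one>\<^bsub>N\<^esub>" using bdd(2) by (auto simp: bounded_exp_def)
    show ?thesis
    proof (rule red)
      show "sol M L \<subseteq> tors M (e * f)"
        using e(2) by (auto simp: sol_def torsion_part_def M.nat_pow_pow[symmetric])
      show "sol N L \<subseteq> tors N (e * f)"
        using f(2) by (auto simp: sol_def torsion_part_def mult.commute[of e] N.nat_pow_pow[symmetric])
      show "e * f > 0" using e f by simp
    qed
  next
    case unb
    have "infinite (sol M L)"
      using M.sol_contains_multiples[OF assms unb(1)] M.unbounded_multiples_infinite[OF unb(2)] infinite_super by blast
    moreover have "infinite (sol N L)"
      using N.sol_contains_multiples[OF assms unb(1)] N.unbounded_multiples_infinite[OF unb(3)] infinite_super by blast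
    ultimately show ?thesis
      using M.idx_trivial_infinite[OF M.sol_carrier] N.idx_trivial_infinite[OF N.sol_carrier] by simp
  qed
qed

text \<open>
  The conditions of \<open>L'\<close> are added one at a time. A single condition \<open>(n,
  a)\<close> reduces, under multiplication by \<open>a\<close>, to the index of an image over
  \<open>n G\<close>.
\<close>

lemma idx_sol_eq:
  assumes "finite L'" "finite L"
  shows "sidx M L L' = sidx N L L'"
  using assms
proof (induction L' arbitrary: L rule: finite_induct)
  case empty
  have "idx M (sol M L) (carrier M) = 1" "idx N (sol N L) (carrier N) = 1"
    using M.idx_eq_1_iff[OF M.sol_subgroup M.subgroup_self] N.idx_eq_1_iff[OF N.sol_subgroup N.subgroup_self]
      M.sol_carrier N.sol_carrier by auto
  thus ?case by simp
next
  case (insert na L')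
  obtain n a where na: "na = (n, a)" by (cases na)
  have MS: "sol M (insert na L') = sol M {na} \<inter> sol M L'" "sol M L \<inter> sol M {na} = sol M (insert na L)" by (auto simp: sol_def)
  have NS: "sol N (insert na L') = sol N {na} \<inter> sol N L'" "sol N L \<inter> sol N {na} = sol N (insert na L)" by (auto simp: sol_def)
  have "sidx M L {na} = sidx N L {na}"
    unfolding na M.idx_sol_pow[OF insert.prems] N.idx_sol_pow[OF insert.prems]
  proof (cases "n = 0")
    case True
    thus "idx M (sol M (img_conds L a)) (multiples M n) = idx N (sol N (img_conds L a)) (multiples N n)"
      using idx_sol_trivial_eq finite_img_conds[OF insert.prems] by simp
  next
    case False
    thus "idx M (sol M (img_conds L a)) (multiples M n) = idx N (sol N (img_conds L a)) (multiples N n)"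
      using idx_sol_multiples_eq finite_img_conds[OF insert.prems] by simp
  qed
  moreover have "sidx M (insert na L) L' = sidx N (insert na L) L'"
    using insert by simp
  ultimately show ?case
    unfolding MS(1) NS(1)
    using M.idx_Int[OF M.sol_subgroup M.sol_subgroup M.sol_subgroup, of L "{na}" L']
      N.idx_Int[OF N.sol_subgroup N.sol_subgroup N.sol_subgroup, of L "{na}" L'] MS(2) NS(2) by simp
qed

theorem elem_equiv: "elem_equiv M N"
proof (rule same_idx_elem_equiv)
  show "comm_group M" by (rule M.comm_group_axioms)
  show "comm_group N" by (rule N.comm_group_axioms)
  show "same_idx M N" unfolding same_idx_def
  proof (intro allI impI)
    fix \<phi> \<psi> assume "pp \<phi>" "pp \<psi>"
    then obtain D E where D: "ppnf \<phi> D" and E: "ppnf \<psi> E" using ppnf_exists by metis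
    have "finite (conds1 D)" "finite (conds1 E)" unfolding conds1_def using D E ppnf_finite by auto
    thus "idx M (ppsub M \<phi>) (ppsub M \<psi>) = idx N (ppsub N \<phi>) (ppsub N \<psi>)"
      unfolding M.ppsub_eq_sol[OF D] M.ppsub_eq_sol[OF E] N.ppsub_eq_sol[OF D] N.ppsub_eq_sol[OF E]
      using idx_sol_eq by blast
  qed
qed

end

section \<open>Monochromatic boxes\<close>

lemma large_fibre:
  fixes L :: nat
  assumes "finite A" "finite C" "C \<noteq> {}" "g ` A \<subseteq> C" "L * card C \<le> card A"
  shows "\<exists>c\<in>C. \<exists>S. S \<subseteq> {a \<in> A. g a = c} \<and> card S = L"
proof -
  have "\<exists>c\<in>C. L \<le> card {a \<in> A. g a = c}"
  proof (rule ccontr)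
    assume "\<not> ?thesis"
    hence lt: "card {a \<in> A. g a = c} < L" if "c \<in> C" for c using that by force
    have "card A = (\<Sum>c\<in>C. card {a \<in> A. g a = c})"
      using sum.group[of A C g "\<lambda>_. 1::nat"] assms by simp
    also have "\<dots> < (\<Sum>c\<in>C. L)" using lt assms(2,3) by (intro sum_strict_mono) auto
    finally show False using assms(5) by (simp add: mult.commute)
  qed
  then obtain c where "c \<in> C" "L \<le> card {a \<in> A. g a = c}" by (rule bexE)
  then obtain S where "S \<subseteq> {a \<in> A. g a = c}" "card S = L" using obtain_subset_with_card_n by blast
  thus ?thesis using \<open>c \<in> C\<close> by blast
qed

text \<open>
  The value 0 outside \<open>F\<close> makes a box over the empty set a single function.
\<close>

definition box :: "'i set \<Rightarrow> ('i \<Rightarrow> nat set) \<Rightarrow> ('i \<Rightarrow> nat) set" where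
  "box F N = {\<eta>. (\<forall>\<alpha>\<in>F. \<eta> \<alpha> \<in> N \<alpha>) \<and> (\<forall>\<alpha>. \<alpha> \<notin> F \<longrightarrow> \<eta> \<alpha> = 0)}"

text \<open>
  Induction on \<open>F\<close>: a function \<open>\<eta>\<close> on the smaller set is coloured
  by the list of the colours of \<open>\<eta>(a := i)\<close> for \<open>i < R\<close>. On a box
  where this list is constant the colour depends on \<open>i\<close> alone, and \<open>R\<close>
  is large enough for \<open>L\<close> of the values \<open>i\<close> to have the same colour.
\<close>

lemma monochromatic_box:
  fixes c :: "('i \<Rightarrow> nat) \<Rightarrow> nat"
  assumes "finite F" "finite (range c)" "L \<ge> 1"
  shows "\<exists>N col. (\<forall>\<alpha>\<in>F. card (N \<alpha>) = L) \<and> (\<forall>\<eta>\<in>box F N. c \<eta> = col)"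
  using assms(1,2)
proof (induction F arbitrary: c rule: finite_induct)
  case empty
  have "box {} N = {\<lambda>_. 0}" for N :: "'i \<Rightarrow> nat set" by (auto simp: box_def)
  thus ?case by simp
next
  case (insert a F c)
  define R where "R = L * card (range c)"
  \<comment> \<open>The encoding of lists as numbers keeps the type of colours fixed in the induction.\<close>
  define c' where "c' = (\<lambda>\<eta>. list_encode (map (\<lambda>i. c (\<eta>(a := i))) [0..<R]))"
  have "range c' \<subseteq> list_encode ` {xs. set xs \<subseteq> range c \<and> length xs = R}"
  proof (rule image_subsetI)
    fix \<eta> show "c' \<eta> \<in> list_encode ` {xs. set xs \<subseteq> range c \<and> length xs = R}"
      unfolding c'_def by (rule imageI) auto
  qed
  hence "finite (range c')" by (rule finite_surj[OF finite_lists_length_eq[OF insert.prems]])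
  then obtain N col' where N: "\<forall>\<alpha>\<in>F. card (N \<alpha>) = L" "\<forall>\<eta>\<in>box F N. c' \<eta> = col'" using insert.IH by blast
  define e where "e = (\<lambda>\<alpha>. if \<alpha> \<in> F then SOME i. i \<in> N \<alpha> else 0)"
  have "e \<in> box F N"
  proof -
    have "N \<alpha> \<noteq> {}" if "\<alpha> \<in> F" for \<alpha> using N(1) that assms(3) by fastforce
    thus ?thesis by (auto simp: box_def e_def some_in_eq)
  qed
  have col: "c (\<eta>(a := i)) = c (e(a := i))" if "\<eta> \<in> box F N" "i < R" for \<eta> i
  proof -
    have "c' \<eta> = c' e" using N(2) that \<open>e \<in> box F N\<close> by simp
    hence "map (\<lambda>i. c (\<eta>(a := i))) [0..<R] = map (\<lambda>i. c (e(a := i))) [0..<R]"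
      unfolding c'_def by (simp only: list_encode_eq)
    thus ?thesis using that(2) by simp
  qed
  obtain k S where S: "S \<subseteq> {i \<in> {..<R}. c (e(a := i)) = k}" "card S = L"
    using large_fibre[of "{..<R}" "range c" "\<lambda>i. c (e(a := i))" L] insert.prems by (auto simp: R_def)
  have "c \<eta> = k" if \<eta>: "\<eta> \<in> box (insert a F) (N(a := S))" for \<eta>
  proof -
    have 1: "\<eta>(a := 0) \<in> box F N" using \<eta> insert.hyps by (auto simp: box_def)
    have 2: "\<eta> a \<in> S" using \<eta> by (simp add: box_def)
    hence "c ((\<eta>(a := 0))(a := \<eta> a)) = c (e(a := \<eta> a))" using S(1) by (intro col[OF 1]) auto
    also have "\<dots> = k" using 2 S(1) by auto
    finally show ?thesis by simp
  qed
  moreover have "\<forall>\<alpha>\<in>insert a F. card ((N(a := S)) \<alpha>) = L" using N(1) S(2) insert.hyps by auto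
  ultimately show ?case by blast
qed

section \<open>An inp-pattern yields independent positive primitive subgroups\<close>

context comm_group begin

lemma idx_infinite_restrict:
  assumes "subgroup H G" "subgroup H' G" "subgroup K G" "H' \<subseteq> H" "idx G H H' \<noteq> \<infinity>" "idx G H K = \<infinity>"
  shows "idx G H' K = \<infinity>"
proof (rule ccontr)
  assume "idx G H' K \<noteq> \<infinity>"
  moreover have "H \<inter> H' = H'" using assms(4) by blast
  ultimately have "idx G H (H' \<inter> K) \<noteq> \<infinity>" using idx_Int[OF assms(1-3)] assms(5) by (simp add: imult_is_infinity)
  moreover have "idx G H K \<le> idx G H (H' \<inter> K)"
    by (intro idx_right_antimono subgroup.subset[OF assms(1)] subgroup_Int assms(2,3)) auto
  ultimately show False using assms(6) by simp
qed

text \<open>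
  Elements \<open>x i\<close> of one coset of \<open>H\<close> realize a formula at parameters
  \<open>b i\<close>. The determining formulas with subgroups containing \<open>H\<close> have the
  same truth value on the whole coset; those of infinite index are false at \<open>x i\<close>,
  and by the lemma of Neumann there is a point of the coset where all of them stay false. The
  determining formulas cannot distinguish this point from \<open>x i\<close>, for any
  \<open>i\<close>.
\<close>

lemma realizers_combine:
  assumes P: "subgroup H G" "x ` S \<subseteq> carrier G" "finite S" "S \<noteq> {}"
    and b: "\<And>i. i \<in> S \<Longrightarrow> range (b i) \<subseteq> carrier G"
    and close: "\<And>i j. i \<in> S \<Longrightarrow> j \<in> S \<Longrightarrow> x i \<otimes> inv (x j) \<in> H"
    and small: "\<And>\<psi>. \<psi> \<in> det \<phi> \<Longrightarrow> idx G H (ppsub G \<psi>) \<noteq> \<infinity> \<Longrightarrow> H \<subseteq> ppsub G \<psi>"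
    and large: "\<And>\<psi> i. i \<in> S \<Longrightarrow> \<psi> \<in> det \<phi> \<Longrightarrow> idx G H (ppsub G \<psi>) = \<infinity> \<Longrightarrow> \<not> sat G (case_nat (x i) (b i)) \<psi>"
    and sat: "\<And>i. i \<in> S \<Longrightarrow> sat G (case_nat (x i) (b i)) \<phi>"
  shows "\<exists>y\<in>carrier G. \<forall>i\<in>S. sat G (case_nat y (b i)) \<phi>"
proof -
  obtain j where j: "j \<in> S" using P(4) by blast
  have xc: "x i \<in> carrier G" if "i \<in> S" for i using P(2) that by blast
  define E where "E = (\<lambda>(\<psi>, i). (\<psi>, b i)) ` ({\<psi> \<in> det \<phi>. idx G H (ppsub G \<psi>) = \<infinity>} \<times> S)"
  have "\<exists>h\<in>H. \<forall>(\<psi>, v) \<in> E. \<not> sat G (case_nat (h \<otimes> x j) v) \<psi>"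
  proof (rule pp_avoid[OF _ P(1) xc[OF j]])
    show "finite E" using det_finite P(3) by (simp add: E_def)
    fix \<psi> v assume "(\<psi>, v) \<in> E"
    then obtain i where "\<psi> \<in> det \<phi>" "idx G H (ppsub G \<psi>) = \<infinity>" "i \<in> S" "v = b i" by (auto simp: E_def)
    thus "pp \<psi> \<and> range v \<subseteq> carrier G \<and> idx G H (ppsub G \<psi>) = \<infinity>" using det_pp b by simp
  qed
  then obtain h where h: "h \<in> H" and avoid: "\<forall>(\<psi>, v) \<in> E. \<not> sat G (case_nat (h \<otimes> x j) v) \<psi>" by (rule bexE)
  have hc: "h \<in> carrier G" by (rule subgroup.mem_carrier[OF P(1) h])
  let ?y = "h \<otimes> x j"
  have yc: "?y \<in> carrier G" using hc xc[OF j] by simp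
  have same: "same_idx G G" by (simp add: same_idx_def)
  have "sat G (case_nat ?y (b i)) \<phi>" if i: "i \<in> S" for i
  proof -
    have "sat G (case_nat (x i) (b i)) \<phi> \<longleftrightarrow> sat G (case_nat ?y (b i)) \<phi>"
    proof (rule baur_monk[OF comm_group_axioms comm_group_axioms same
          range_case_nat[OF xc[OF i] b[OF i]] range_case_nat[OF yc b[OF i]]])
      fix \<psi> assume \<psi>: "\<psi> \<in> det \<phi>"
      have p: "pp \<psi>" using det_pp[OF \<psi>] .
      show "sat G (case_nat (x i) (b i)) \<psi> \<longleftrightarrow> sat G (case_nat ?y (b i)) \<psi>"
      proof (cases "idx G H (ppsub G \<psi>) = \<infinity>")
        case True
        have "(\<psi>, b i) \<in> E" unfolding E_def using \<psi> True i by (intro image_eqI[of _ _ "(\<psi>, i)"]) auto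
        hence "\<not> sat G (case_nat ?y (b i)) \<psi>" using bspec[OF avoid] by fastforce
        thus ?thesis using large[OF i \<psi> True] by blast
      next
        case False
        have "?y \<otimes> inv (x i) = h \<otimes> (x j \<otimes> inv (x i))" using hc xc[OF i] xc[OF j] by (simp add: m_assoc)
        hence yx: "?y \<otimes> inv (x i) \<in> H" using subgroup.m_closed[OF P(1) h close[OF j i]] by simp
        have "inv (?y \<otimes> inv (x i)) = x i \<otimes> inv ?y" using yc xc[OF i] by (simp add: inv_mult_group)
        hence xy: "x i \<otimes> inv ?y \<in> H" using subgroup.m_inv_closed[OF P(1) yx] by simp
        show ?thesis
          using pp_coset[OF p b[OF i] xc[OF i] yc] pp_coset[OF p b[OF i] yc xc[OF i]]
            subsetD[OF small[OF \<psi> False] yx] subsetD[OF small[OF \<psi> False] xy] by blast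
      qed
    qed
    thus ?thesis using sat[OF i] by simp
  qed
  thus ?thesis using yc by blast
qed

definition co_inter :: "'i set \<Rightarrow> ('i \<Rightarrow> 'a set) \<Rightarrow> 'i \<Rightarrow> 'a set" where
  "co_inter F H \<alpha> = carrier G \<inter> (\<Inter>\<beta>\<in>F - {\<alpha>}. H \<beta>)"

lemma co_inter_subgroup:
  assumes "finite F" "\<And>\<beta>. \<beta> \<in> F \<Longrightarrow> subgroup (H \<beta>) G" shows "subgroup (co_inter F H \<alpha>) G"
proof -
  have "subgroup (carrier G \<inter> \<Inter>(H ` A)) G" if "finite A" "A \<subseteq> F" for A
    using that
  proof (induction A rule: finite_induct)
    case empty thus ?case using subgroup_self by simp
  next
    case (insert a A)
    have "carrier G \<inter> \<Inter>(H ` insert a A) = (carrier G \<inter> \<Inter>(H ` A)) \<inter> H a" by auto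
    thus ?case using insert assms(2) by (auto intro: subgroup_Int)
  qed
  thus ?thesis unfolding co_inter_def using assms(1) by simp
qed

lemma co_inter_least:
  assumes "x \<in> carrier G" "\<And>\<beta>. \<beta> \<in> F \<Longrightarrow> \<beta> \<noteq> \<alpha> \<Longrightarrow> x \<in> H \<beta>" shows "x \<in> co_inter F H \<alpha>"
  using assms by (auto simp: co_inter_def)

text \<open>
  A subgroup of finite index in \<open>H\<close> over which each determining subgroup is either everything or of
  infinite index.
\<close>

definition fin_core :: "'a set \<Rightarrow> ag_form \<Rightarrow> 'a set" where
  "fin_core H \<phi> = H \<inter> (carrier G \<inter> \<Inter>(ppsub G ` {\<psi> \<in> det \<phi>. idx G H (ppsub G \<psi>) \<noteq> \<infinity>}))"

lemma fin_core:
  assumes "subgroup H G"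
  shows "subgroup (fin_core H \<phi>) G" "idx G H (fin_core H \<phi>) \<noteq> \<infinity>" "fin_core H \<phi> \<subseteq> H"
    "\<And>\<psi>. \<psi> \<in> det \<phi> \<Longrightarrow> idx G H (ppsub G \<psi>) \<noteq> \<infinity> \<Longrightarrow> fin_core H \<phi> \<subseteq> ppsub G \<psi>"
proof -
  have *: "subgroup (carrier G \<inter> \<Inter>(ppsub G ` {\<psi> \<in> det \<phi>. idx G H (ppsub G \<psi>) \<noteq> \<infinity>})) G \<and>
      idx G H (carrier G \<inter> \<Inter>(ppsub G ` {\<psi> \<in> det \<phi>. idx G H (ppsub G \<psi>) \<noteq> \<infinity>})) \<noteq> \<infinity>"
    by (rule idx_Inter_finite) (use assms det_finite det_pp ppsub_subgroup in auto)
  show "subgroup (fin_core H \<phi>) G" unfolding fin_core_def using * assms subgroup_Int by blast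
  show "idx G H (fin_core H \<phi>) \<noteq> \<infinity>" unfolding fin_core_def using * idx_Int_left[OF assms] by metis
  show "fin_core H \<phi> \<subseteq> H" by (auto simp: fin_core_def)
  show "fin_core H \<phi> \<subseteq> ppsub G \<psi>" if "\<psi> \<in> det \<phi>" "idx G H (ppsub G \<psi>) \<noteq> \<infinity>" for \<psi>
    unfolding fin_core_def using that by blast
qed

lemma path_elements:
  assumes "\<And>\<eta>. consistent G (x_eq_x G \<union> (\<lambda>\<alpha>. (\<phi> \<alpha>, b \<alpha> (\<eta> \<alpha>))) ` I)" "finite F" "F \<subseteq> I"
  shows "\<exists>x. \<forall>\<eta>. x \<eta> \<in> carrier G \<and> (\<forall>\<alpha>\<in>F. sat G (case_nat (x \<eta>) (b \<alpha> (\<eta> \<alpha>))) (\<phi> \<alpha>))"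
proof -
  have "\<exists>x. x \<in> carrier G \<and> (\<forall>\<alpha>\<in>F. sat G (case_nat x (b \<alpha> (\<eta> \<alpha>))) (\<phi> \<alpha>))" for \<eta>
  proof -
    let ?D = "(\<lambda>\<alpha>. (\<phi> \<alpha>, b \<alpha> (\<eta> \<alpha>))) ` F"
    have "?D \<subseteq> x_eq_x G \<union> (\<lambda>\<alpha>. (\<phi> \<alpha>, b \<alpha> (\<eta> \<alpha>))) ` I" using assms(3) by blast
    hence "realized G ?D" using assms(1)[of \<eta>] assms(2) unfolding consistent_def by (meson finite_imageI)
    thus ?thesis unfolding realized_def holds_at_def by auto
  qed
  hence "\<forall>\<eta>. \<exists>x. x \<in> carrier G \<and> (\<forall>\<alpha>\<in>F. sat G (case_nat x (b \<alpha> (\<eta> \<alpha>))) (\<phi> \<alpha>))" by (rule allI)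
  thus ?thesis by (rule choice)
qed

text \<open>
  Each path is coloured by the determining formulas that its realisation satisfies, and a
  monochromatic box with sides of length \<open>L\<close> is chosen. Along row
  \<open>\<alpha>\<close> of the box the realisations satisfy the same formulas \<open>P
  \<beta>\<close> with the same parameters for \<open>\<beta> \<noteq> \<alpha>\<close>, hence
  they differ by elements of the intersection of the other groups. Suppose that the group of
  \<open>P \<alpha>\<close> has finite index over this intersection. Then the determining formulas
  of infinite index do not belong to \<open>P \<alpha>\<close> and are false at the realisations,
  and the others contain a subgroup of finite index. As \<open>L\<close> is large,
  \<open>k\<close> of the realisations lie in one coset of this subgroup and can be combined by
  \<open>realizers_combine\<close>, contradicting the inconsistency of the row.
\<close>

lemma inp_pattern_independent:
  fixes I :: "'i set"
  assumes b: "\<And>\<alpha> i. \<alpha> \<in> I \<Longrightarrow> range (b \<alpha> i) \<subseteq> carrier G"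
    and inc: "\<And>\<alpha>. \<alpha> \<in> I \<Longrightarrow> k_inconsistent G (k \<alpha>) (\<lambda>i::nat. (\<phi> \<alpha>, b \<alpha> i))"
    and con: "\<And>\<eta>. consistent G (x_eq_x G \<union> (\<lambda>\<alpha>. (\<phi> \<alpha>, b \<alpha> (\<eta> \<alpha>))) ` I)"
    and F: "finite F" "F \<subseteq> I"
  shows "\<exists>P. (\<forall>\<alpha>\<in>F. P \<alpha> \<subseteq> det (\<phi> \<alpha>)) \<and>
    (\<forall>\<alpha>\<in>F. idx G (co_inter F (\<lambda>\<beta>. ppsub G (cj (P \<beta>))) \<alpha>) (ppsub G (cj (P \<alpha>))) = \<infinity>)"
proof -
  obtain x where x: "\<And>\<eta>. x \<eta> \<in> carrier G"
    and xs: "\<And>\<eta> \<alpha>. \<alpha> \<in> F \<Longrightarrow> sat G (case_nat (x \<eta>) (b \<alpha> (\<eta> \<alpha>))) (\<phi> \<alpha>)"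
  proof -
    obtain x where "\<forall>\<eta>. x \<eta> \<in> carrier G \<and> (\<forall>\<alpha>\<in>F. sat G (case_nat (x \<eta>) (b \<alpha> (\<eta> \<alpha>))) (\<phi> \<alpha>))"
      using path_elements[OF con F] by (rule exE)
    thus ?thesis by (intro that[of x]) simp_all
  qed
  define pat where "pat = (\<lambda>\<eta> \<alpha>. if \<alpha> \<in> F then {\<psi> \<in> det (\<phi> \<alpha>). sat G (case_nat (x \<eta>) (b \<alpha> (\<eta> \<alpha>))) \<psi>} else {})"
  have patdet: "pat \<eta> \<alpha> \<subseteq> det (\<phi> \<alpha>)" for \<eta> \<alpha> by (auto simp: pat_def)
  have fpat: "finite (pat \<eta> \<alpha>)" for \<eta> \<alpha> by (rule finite_subset[OF patdet det_finite])
  have ppat: "pp \<psi>" if "\<psi> \<in> pat \<eta> \<alpha>" for \<psi> \<eta> \<alpha> by (rule det_pp[OF subsetD[OF patdet that]])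
  have fin_pat: "finite (range pat)"
  proof (rule finite_subset)
    show "range pat \<subseteq> {f. \<forall>\<alpha>. (\<alpha> \<in> F \<longrightarrow> f \<alpha> \<in> Pow (\<Union>\<alpha>\<in>F. det (\<phi> \<alpha>))) \<and> (\<alpha> \<notin> F \<longrightarrow> f \<alpha> = {})}"
      by (auto simp: pat_def)
    show "finite {f. \<forall>\<alpha>. (\<alpha> \<in> F \<longrightarrow> f \<alpha> \<in> Pow (\<Union>\<alpha>\<in>F. det (\<phi> \<alpha>))) \<and> (\<alpha> \<notin> F \<longrightarrow> f \<alpha> = {})}"
      by (rule finite_set_of_finite_funs) (use F(1) det_finite in auto)
  qed
  define H where "H = (\<lambda>P (\<beta>::'i). ppsub G (cj (P \<beta>)))"
  define H' where "H' = (\<lambda>P. co_inter F (H P))"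
  define G0 where "G0 = (\<lambda>P \<alpha>. fin_core (H' P \<alpha>) (\<phi> \<alpha>))"
  define m where "m = (\<lambda>P \<alpha>. card ((\<lambda>z. G0 P \<alpha> #> z) ` H' P \<alpha>))"
  have sH: "subgroup (H P \<beta>) G" if "P \<in> range pat" for P \<beta>
    unfolding H_def using that by (intro ppsub_subgroup pp_cj) (auto intro: fpat ppat)
  have sH': "subgroup (H' P \<alpha>) G" if "P \<in> range pat" for P \<alpha>
    unfolding H'_def by (rule co_inter_subgroup) (use F sH that in auto)
  \<comment> \<open>The side length has to work for all possible colours, since it is fixed before the box is found.\<close>
  have "finite ((\<lambda>(P, \<alpha>). k \<alpha> * m P \<alpha>) ` (range pat \<times> F))" using fin_pat F by simp
  then obtain L0 where L0: "\<And>P \<alpha>. P \<in> range pat \<Longrightarrow> \<alpha> \<in> F \<Longrightarrow> k \<alpha> * m P \<alpha> \<le> L0"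
  proof -
    obtain B where B: "\<forall>n\<in>(\<lambda>(P, \<alpha>). k \<alpha> * m P \<alpha>) ` (range pat \<times> F). n \<le> B"
      using \<open>finite ((\<lambda>(P, \<alpha>). k \<alpha> * m P \<alpha>) ` (range pat \<times> F))\<close> finite_nat_set_iff_bounded_le by blast
    have "k \<alpha> * m P \<alpha> \<le> B" if "P \<in> range pat" "\<alpha> \<in> F" for P \<alpha>
      using bspec[OF B, of "k \<alpha> * m P \<alpha>"] that by force
    thus ?thesis by (rule that)
  qed
  define L where "L = Suc L0"
  obtain enc :: "('i \<Rightarrow> ag_form set) \<Rightarrow> nat" where enc: "inj_on enc (range pat)"
    using finite_imp_inj_to_nat_seg[OF fin_pat] by blast
  have "finite (range (\<lambda>\<eta>. enc (pat \<eta>)))" using finite_imageI[OF fin_pat, of enc] by (simp add: image_image)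
  then obtain N col where N: "\<And>\<alpha>. \<alpha> \<in> F \<Longrightarrow> card (N \<alpha>) = L" "\<And>\<eta>. \<eta> \<in> box F N \<Longrightarrow> enc (pat \<eta>) = col"
    using monochromatic_box[OF F(1), of "\<lambda>\<eta>. enc (pat \<eta>)" L] by (auto simp: L_def)
  define e where "e = (\<lambda>\<alpha>. if \<alpha> \<in> F then SOME i. i \<in> N \<alpha> else 0)"
  have Nne: "N \<alpha> \<noteq> {}" "finite (N \<alpha>)" if "\<alpha> \<in> F" for \<alpha>
    using N(1)[OF that] by (auto simp: L_def intro: card_ge_0_finite)
  have e: "e \<in> box F N" using Nne by (auto simp: box_def e_def some_in_eq)
  define P where "P = pat e"
  have Pr: "P \<in> range pat" by (simp add: P_def)
  have patP: "pat \<eta> = P" if "\<eta> \<in> box F N" for \<eta>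
    using N(2)[OF that] N(2)[OF e] inj_onD[OF enc, of "pat \<eta>" "pat e"] by (simp add: P_def)
  have inf: "idx G (H' P \<alpha>) (H P \<alpha>) = \<infinity>" if \<alpha>: "\<alpha> \<in> F" for \<alpha>
  proof (rule ccontr)
    assume fin: "idx G (H' P \<alpha>) (H P \<alpha>) \<noteq> \<infinity>"
    define y where "y = (\<lambda>i. x (e(\<alpha> := i)))"
    have boxi: "e(\<alpha> := i) \<in> box F N" if "i \<in> N \<alpha>" for i
      using e that \<alpha> by (auto simp: box_def)
    have yc: "y i \<in> carrier G" for i by (simp add: y_def x)
    have ysat: "sat G (case_nat (y i) (b \<alpha> i)) (\<phi> \<alpha>)" for i
      using xs[OF \<alpha>, of "e(\<alpha> := i)"] by (simp add: y_def)
    have ypat: "sat G (case_nat (y i) (b \<alpha> i)) \<psi> \<longleftrightarrow> \<psi> \<in> P \<alpha>" if "i \<in> N \<alpha>" "\<psi> \<in> det (\<phi> \<alpha>)" for i \<psi>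
    proof -
      have "\<psi> \<in> pat (e(\<alpha> := i)) \<alpha> \<longleftrightarrow> sat G (case_nat (y i) (b \<alpha> i)) \<psi>"
        using \<alpha> that(2) by (simp add: pat_def y_def)
      thus ?thesis using patP[OF boxi[OF that(1)]] by simp
    qed
    have diff: "y i \<otimes> inv (y j) \<in> H' P \<alpha>" if "i \<in> N \<alpha>" "j \<in> N \<alpha>" for i j
      unfolding H'_def
    proof (rule co_inter_least)
      show "y i \<otimes> inv (y j) \<in> carrier G" using yc by simp
      fix \<beta> assume \<beta>: "\<beta> \<in> F" "\<beta> \<noteq> \<alpha>"
      have ppP: "pp (cj (P \<beta>))" "finite (P \<beta>)"
        unfolding P_def by (auto intro!: pp_cj intro: fpat ppat)
      have s: "sat G (case_nat (y i) (b \<beta> (e \<beta>))) (cj (P \<beta>))" if "i \<in> N \<alpha>" for i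
      proof -
        have "pat (e(\<alpha> := i)) \<beta> = P \<beta>" using patP[OF boxi[OF that]] by simp
        hence "P \<beta> = {\<psi> \<in> det (\<phi> \<beta>). sat G (case_nat (y i) (b \<beta> (e \<beta>))) \<psi>}"
          using \<beta> unfolding pat_def y_def by simp
        thus ?thesis using ppP(2) by simp
      qed
      have r: "range (b \<beta> (e \<beta>)) \<subseteq> carrier G" using b \<beta> F by blast
      show "y i \<otimes> inv (y j) \<in> H P \<beta>"
        unfolding H_def using pp_coset[OF ppP(1) r yc yc s[OF that(2)]] s[OF that(1)] by simp
    qed
    note sH'P = sH'[OF Pr, of \<alpha>]
    have G0: "subgroup (G0 P \<alpha>) G" "idx G (H' P \<alpha>) (G0 P \<alpha>) \<noteq> \<infinity>" "G0 P \<alpha> \<subseteq> H' P \<alpha>"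
      using fin_core[OF sH'P] by (auto simp: G0_def)
    have finQ: "finite ((\<lambda>z. G0 P \<alpha> #> z) ` H' P \<alpha>)" using G0(2) by (metis idx_def ecard_infinite_iff)
    obtain j where j: "j \<in> N \<alpha>" using Nne[OF \<alpha>] by blast
    have "\<exists>c\<in>(\<lambda>z. G0 P \<alpha> #> z) ` H' P \<alpha>. \<exists>S. S \<subseteq> {i \<in> N \<alpha>. G0 P \<alpha> #> (y i \<otimes> inv (y j)) = c} \<and> card S = k \<alpha>"
    proof (rule large_fibre)
      show "finite (N \<alpha>)" using Nne \<alpha> by simp
      show "(\<lambda>z. G0 P \<alpha> #> z) ` H' P \<alpha> \<noteq> {}" using diff[OF j j] by blast
      show "(\<lambda>i. G0 P \<alpha> #> (y i \<otimes> inv (y j))) ` N \<alpha> \<subseteq> (\<lambda>z. G0 P \<alpha> #> z) ` H' P \<alpha>" using diff j by blast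
      show "k \<alpha> * card ((\<lambda>z. G0 P \<alpha> #> z) ` H' P \<alpha>) \<le> card (N \<alpha>)"
        using L0[OF Pr \<alpha>] N(1)[OF \<alpha>] by (simp add: m_def L_def)
    qed (rule finQ)
    then obtain c S where S: "S \<subseteq> {i \<in> N \<alpha>. G0 P \<alpha> #> (y i \<otimes> inv (y j)) = c}" "card S = k \<alpha>" by blast
    have SN: "S \<subseteq> N \<alpha>" "finite S" using S(1) Nne[OF \<alpha>] by (auto intro: finite_subset)
    have "\<exists>z\<in>carrier G. \<forall>i\<in>S. sat G (case_nat z (b \<alpha> i)) (\<phi> \<alpha>)"
    proof (cases "S = {}")
      case False
      show ?thesis
      proof (rule realizers_combine[OF G0(1) _ SN(2) False])
        show "y ` S \<subseteq> carrier G" using yc by blast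
        show "range (b \<alpha> i) \<subseteq> carrier G" if "i \<in> S" for i using b \<alpha> F by blast
        show "y i \<otimes> inv (y i') \<in> G0 P \<alpha>" if "i \<in> S" "i' \<in> S" for i i'
        proof -
          have "G0 P \<alpha> #> (y i \<otimes> inv (y j)) = c" "G0 P \<alpha> #> (y i' \<otimes> inv (y j)) = c"
            using S(1) that by auto
          hence "G0 P \<alpha> #> (y i \<otimes> inv (y j)) = G0 P \<alpha> #> (y i' \<otimes> inv (y j))" by simp
          hence "(y i \<otimes> inv (y j)) \<otimes> inv (y i' \<otimes> inv (y j)) \<in> G0 P \<alpha>"
            using rcos_eq_iff[OF G0(1)] yc by simp
          moreover have "(y i \<otimes> inv (y j)) \<otimes> inv (y i' \<otimes> inv (y j)) = y i \<otimes> inv (y i')"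
          proof -
            have "inv (y i' \<otimes> inv (y j)) = y j \<otimes> inv (y i')" using yc by (simp add: inv_mult_group)
            moreover have "inv (y j) \<otimes> (y j \<otimes> inv (y i')) = inv (y i')" using yc by (simp add: m_assoc[symmetric])
            ultimately show ?thesis using yc by (simp add: m_assoc)
          qed
          ultimately show ?thesis by simp
        qed
        fix \<psi> assume \<psi>: "\<psi> \<in> det (\<phi> \<alpha>)"
        have sp: "subgroup (ppsub G \<psi>) G" using ppsub_subgroup[OF det_pp[OF \<psi>]] .
        have inf: "idx G (H' P \<alpha>) (ppsub G \<psi>) = \<infinity> \<longleftrightarrow> idx G (G0 P \<alpha>) (ppsub G \<psi>) = \<infinity>"
          using idx_infinite_restrict[OF sH'P G0(1) sp G0(3,2)] idx_left_mono[OF G0(3), of "ppsub G \<psi>"]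
          by (metis enat_ord_simps(5))
        show "G0 P \<alpha> \<subseteq> ppsub G \<psi>" if "idx G (G0 P \<alpha>) (ppsub G \<psi>) \<noteq> \<infinity>"
          unfolding G0_def using fin_core(4)[OF sH'P \<psi>] inf that by simp
        show "\<not> sat G (case_nat (y i) (b \<alpha> i)) \<psi>" if "i \<in> S" "idx G (G0 P \<alpha>) (ppsub G \<psi>) = \<infinity>" for i
        proof
          assume "sat G (case_nat (y i) (b \<alpha> i)) \<psi>"
          hence "\<psi> \<in> P \<alpha>" using ypat[of i \<psi>] that(1) SN(1) \<psi> by blast
          moreover have "finite (P \<alpha>)" unfolding P_def using patdet det_finite finite_subset by blast
          ultimately have "H P \<alpha> \<subseteq> ppsub G \<psi>" unfolding H_def ppsub_def by auto
          hence "idx G (H' P \<alpha>) (ppsub G \<psi>) \<le> idx G (H' P \<alpha>) (H P \<alpha>)"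
            by (rule idx_right_antimono[OF subgroup.subset[OF sH'P] sH[OF Pr] sp])
          thus False using inf that(2) fin by simp
        qed
      next
        fix i assume "i \<in> S"
        show "sat G (case_nat (y i) (b \<alpha> i)) (\<phi> \<alpha>)" by (rule ysat)
      qed
    qed auto
    hence "realized G ((\<lambda>i. (\<phi> \<alpha>, b \<alpha> i)) ` S)" by (auto simp: realized_def holds_at_def)
    hence "consistent G ((\<lambda>i. (\<phi> \<alpha>, b \<alpha> i)) ` S)" unfolding consistent_def realized_def by blast
    thus False using inc[of \<alpha>] \<alpha> F(2) S(2) SN(2) unfolding k_inconsistent_def by blast
  qed
  have "\<forall>\<alpha>\<in>F. P \<alpha> \<subseteq> det (\<phi> \<alpha>)" using patdet unfolding P_def by blast
  moreover have "\<forall>\<alpha>\<in>F. idx G (co_inter F (\<lambda>\<beta>. ppsub G (cj (P \<beta>))) \<alpha>) (ppsub G (cj (P \<alpha>))) = \<infinity>"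
    using inf unfolding H'_def H_def by blast
  ultimately show ?thesis by blast
qed

end

section \<open>Independent families are finite\<close>

context comm_group begin

lemma multiples_coprime:
  assumes "coprime m n" shows "multiples G (m * n) = multiples G m \<inter> multiples G n"
proof
  show "multiples G (m * n) \<subseteq> multiples G m \<inter> multiples G n"
    using multiples_dvd[of m "m * n"] multiples_dvd[of n "m * n"] by auto
  show "multiples G m \<inter> multiples G n \<subseteq> multiples G (m * n)"
  proof
    fix x assume x: "x \<in> multiples G m \<inter> multiples G n"
    obtain y where y: "y \<in> carrier G" "x = y [^] int m" using IntD1[OF x] unfolding multiples_iff by (rule bexE)
    obtain z where z: "z \<in> carrier G" "x = z [^] int n" using IntD2[OF x] unfolding multiples_iff by (rule bexE)
    obtain u v where uv: "u * int m + v * int n = 1"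
      using bezout_int[of "int m" "int n"] assms by (metis coprime_int_iff coprime_imp_gcd_eq_1)
    have xc: "x \<in> carrier G" using y by simp
    have "x = x [^] (u * int m + v * int n)" using uv xc by simp
    also have "\<dots> = x [^] (u * int m) \<otimes> x [^] (v * int n)" using xc by (simp add: int_pow_mult)
    also have "x [^] (u * int m) = z [^] (int (m * n) * u)" unfolding z(2) using z(1) by (simp add: int_pow_pow ac_simps)
    also have "x [^] (v * int n) = y [^] (int (m * n) * v)" unfolding y(2) using y(1) by (simp add: int_pow_pow ac_simps)
    also have "z [^] (int (m * n) * u) \<otimes> y [^] (int (m * n) * v) \<in> multiples G (m * n)"
      by (intro subgroup.m_closed[OF multiples_subgroup] pow_mult_in_multiples y z) simp_all
    finally show "x \<in> multiples G (m * n)" .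
  qed
qed

lemma sol1_iff: "x \<in> sol G {(n, a)} \<longleftrightarrow> x \<in> carrier G \<and> x [^] a \<in> multiples G n"
  by (simp add: sol_def)

lemma idx_subset_finite:
  assumes "subgroup H G" "subgroup K G" "H \<subseteq> K" shows "idx G H K \<noteq> \<infinity>"
  using idx_eq_1_iff[OF assms(1,2)] assms(3) by (simp add: one_enat_def)

text \<open>
  A group \<open>n G\<close> is the intersection of the groups \<open>q G\<close> for the prime
  powers \<open>q\<close> that exactly divide \<open>n\<close>, and a finite intersection of
  finite index conditions has finite index.
\<close>

lemma prime_power_condition:
  assumes H: "subgroup H G" and "n > 0" "idx G H (sol G {(n, a)}) = \<infinity>"
  shows "\<exists>p k. prime p \<and> p ^ k dvd n \<and> idx G H (sol G {(p ^ k, a)}) = \<infinity>"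
  using assms(2,3)
proof (induction n rule: less_induct)
  case (less n)
  have one: "idx G H (sol G {(1, a)}) = 1"
  proof -
    have "sol G {(1, a)} = carrier G" by (auto simp: sol_def)
    thus ?thesis using idx_eq_1_iff[OF H subgroup_self] subgroup.subset[OF H] by simp
  qed
  have "n \<noteq> 1" using less.prems one by auto
  then obtain p where p: "prime p" "p dvd n" using prime_factor_nat by blast
  obtain k n' where n: "n = p ^ k * n'" "\<not> p dvd n'" using prime_dvd_coprime_part[OF p(1) less.prems(1)] .
  have "k > 0" using n p(2) by (cases k) auto
  hence pk: "p ^ k > 1" by (rule one_less_power[OF prime_gt_1_nat[OF p(1)]])
  have n': "n' > 0" using less.prems(1) n(1) by (cases n') auto
  hence "n' < n" using n(1) pk by simp
  have "coprime (p ^ k) n'" using p(1) n(2) by (simp add: prime_imp_coprime)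
  hence "multiples G n = multiples G (p ^ k) \<inter> multiples G n'" unfolding n(1) by (rule multiples_coprime)
  hence S: "sol G {(n, a)} = sol G {(p ^ k, a)} \<inter> sol G {(n', a)}" by (auto simp: sol1_iff)
  show ?case
  proof (cases "idx G H (sol G {(p ^ k, a)}) = \<infinity>")
    case True thus ?thesis using p(1) n(1) by (intro exI[of _ p] exI[of _ k]) simp
  next
    case False
    have "idx G H (sol G {(n', a)}) = \<infinity>"
    proof (rule ccontr)
      assume "idx G H (sol G {(n', a)}) \<noteq> \<infinity>"
      hence "idx G H (sol G {(p ^ k, a)} \<inter> sol G {(n', a)}) \<noteq> \<infinity>"
        by (rule idx_Int_finite[OF H sol_subgroup sol_subgroup False])
      thus False using less.prems(2) unfolding S by blast
    qed
    then obtain q l where "prime q" "q ^ l dvd n'" "idx G H (sol G {(q ^ l, a)}) = \<infinity>"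
      using less.IH[OF \<open>n' < n\<close> n'] by blast
    thus ?thesis using n(1) by (intro exI[of _ q] exI[of _ l]) auto
  qed
qed

text \<open>
  The part of \<open>a\<close> prime to \<open>p\<close> acts invertibly modulo
  \<open>p^k\<close>.
\<close>

lemma prime_power_condition_unit:
  assumes p: "prime p" and d: "\<not> int p ^ k dvd a"
  shows "\<exists>j<k. sol G {(p ^ k, a)} = sol G {(p ^ k, int p ^ j)}"
proof -
  obtain j where j: "j < k" "int p ^ j dvd a" "\<not> int p ^ Suc j dvd a" using prime_power_exact[OF d] .
  obtain a' where a': "a = int p ^ j * a'" using j(2) by (auto simp: dvd_def)
  have pa: "\<not> int p dvd a'"
  proof
    assume "int p dvd a'"
    hence "int p ^ j * int p dvd a" unfolding a' by (rule mult_dvd_mono[OF dvd_refl])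
    thus False using j(3) by (simp add: mult.commute)
  qed
  have "coprime a' (int p ^ k)"
    using prime_imp_coprime[of "int p" a'] p pa by (simp add: coprime_commute)
  then obtain u v where uv: "u * a' + v * int p ^ k = 1"
    using bezout_int[of a' "int p ^ k"] by (metis coprime_imp_gcd_eq_1)
  have "x [^] a \<in> multiples G (p ^ k) \<longleftrightarrow> x [^] (int p ^ j) \<in> multiples G (p ^ k)" if x: "x \<in> carrier G" for x
  proof
    let ?y = "x [^] (int p ^ j)"
    have yc: "?y \<in> carrier G" using x by simp
    assume "x [^] a \<in> multiples G (p ^ k)"
    hence h: "?y [^] a' \<in> multiples G (p ^ k)" unfolding a' using x by (simp add: int_pow_pow)
    have "?y = ?y [^] (a' * u + v * int p ^ k)" using uv yc by (simp add: mult.commute)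
    also have "\<dots> = (?y [^] a') [^] u \<otimes> ?y [^] (v * int p ^ k)" using yc by (simp only: int_pow_mult int_pow_pow)
    also have "\<dots> \<in> multiples G (p ^ k)"
      by (intro subgroup.m_closed[OF multiples_subgroup] pow_in_multiples[OF h] pow_mult_in_multiples[OF yc]) simp
    finally show "?y \<in> multiples G (p ^ k)" .
  next
    assume h: "x [^] (int p ^ j) \<in> multiples G (p ^ k)"
    show "x [^] a \<in> multiples G (p ^ k)"
      using pow_in_multiples[OF h, of a'] x unfolding a' by (simp add: int_pow_pow)
  qed
  hence "sol G {(p ^ k, a)} = sol G {(p ^ k, int p ^ j)}" by (auto simp: sol1_iff)
  thus ?thesis using j(1) by blast
qed

lemma sol_zero: "sol G {(0, a)} = tors G (nat \<bar>a\<bar>)"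
proof -
  have "x [^] \<bar>a\<bar> = \<one> \<longleftrightarrow> x [^] a = \<one>" if "x \<in> carrier G" for x
    using that by (auto simp: abs_if int_pow_neg)
  thus ?thesis by (auto simp: sol1_iff tors_iff)
qed

lemma multiples_power_finite:
  assumes "idx G (carrier G) (multiples G p) \<noteq> \<infinity>"
  shows "idx G (carrier G) (multiples G (p ^ k)) \<noteq> \<infinity>"
proof (induction k)
  case 0
  have "idx G (carrier G) (carrier G) = 1" using idx_eq_1_iff[OF subgroup_self subgroup_self] by simp
  thus ?case by simp
next
  case (Suc k)
  have "idx G (carrier G) (pre p (p ^ k)) \<le> idx G (carrier G) (multiples G p)"
    by (rule idx_right_antimono) (auto simp: multiples_pre)
  hence "idx G (carrier G) (pre p (p ^ k)) \<noteq> \<infinity>" using assms by (metis enat_ord_simps(5))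
  moreover have "idx G (carrier G) (multiples G (p ^ k * p)) =
      idx G (carrier G) (multiples G (p ^ k)) * idx G (carrier G) (pre p (p ^ k))"
    using idx_sol_multiples_Suc[of "{}" "p ^ k" p] by simp
  ultimately show ?case using Suc by (simp add: imult_is_infinity mult.commute)
qed

lemma sol_prime_finite:
  assumes "idx G (carrier G) (multiples G p) \<noteq> \<infinity>"
  shows "idx G (carrier G) (sol G {(p ^ k, a)}) \<noteq> \<infinity>"
proof -
  have "multiples G (p ^ k) \<subseteq> sol G {(p ^ k, a)}"
    using pow_in_multiples multiples_carrier[of "p ^ k"] by (auto simp: sol1_iff)
  hence "idx G (carrier G) (sol G {(p ^ k, a)}) \<le> idx G (carrier G) (multiples G (p ^ k))"
    by (intro idx_right_antimono) auto
  thus ?thesis using multiples_power_finite[OF assms, of k] by (metis enat_ord_simps(5))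
qed

text \<open>
  Each increment of \<open>s\<close> costs at most one Ulm quotient, since multiplication by \<open>p^j\<close> maps the
  elements in question into \<open>(p^(s+j) G)[p]\<close>.
\<close>

lemma tors_height_finite:
  assumes "\<And>i. i \<ge> j \<Longrightarrow> ulm G p i \<noteq> \<infinity>"
  shows "idx G (tors G (p ^ Suc j)) (sol G {(p ^ (s + j), int p ^ j)}) \<noteq> \<infinity>"
proof (induction s)
  case 0
  have "tors G (p ^ Suc j) \<subseteq> sol G {(p ^ (0 + j), int p ^ j)}"
    by (auto simp: sol1_iff tors_iff intro!: pow_mult_in_multiples)
  thus ?case by (rule idx_subset_finite[OF tors_subgroup sol_subgroup])
next
  case (Suc s)
  let ?P = "\<lambda>s. sol G {(p ^ (s + j), int p ^ j)}"
  let ?T = "tors G (p ^ Suc j)"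
  have sub: "?P (Suc s) \<subseteq> ?P s"
    using multiples_dvd[of "p ^ (s + j)" "p ^ (Suc s + j)"] by (auto simp: sol1_iff le_imp_power_dvd)
  have "idx G ?T (?P (Suc s)) = idx G ?T (?P s \<inter> ?P (Suc s))" using sub by (simp add: Int_absorb1)
  also have "\<dots> = idx G ?T (?P s) * idx G (?T \<inter> ?P s) (?P (Suc s))" by (rule idx_Int) auto
  finally have e: "idx G ?T (?P (Suc s)) = idx G ?T (?P s) * idx G (?T \<inter> ?P s) (?P (Suc s))" .
  have P: "?P (Suc s) = {x \<in> carrier G. x [^] (int p ^ j) \<in> multiples G (p ^ (Suc s + j))}" by (auto simp: sol1_iff)
  have "idx G (?T \<inter> ?P s) (?P (Suc s)) = idx G ((\<lambda>x. x [^] (int p ^ j)) ` (?T \<inter> ?P s)) (multiples G (p ^ (Suc s + j)))"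
    unfolding P by (rule idx_pow[symmetric]) (auto simp: tors_iff)
  also have "\<dots> \<le> ulm G p (s + j)"
  proof -
    have "(\<lambda>x. x [^] (int p ^ j)) ` (?T \<inter> ?P s) \<subseteq> torsion_part G (multiples G (p ^ (s + j))) p"
    proof (rule image_subsetI)
      fix x assume x: "x \<in> ?T \<inter> ?P s"
      hence "x \<in> carrier G" "x [^] (int p ^ j * int p) = \<one>" by (auto simp: tors_iff mult.commute)
      thus "x [^] (int p ^ j) \<in> torsion_part G (multiples G (p ^ (s + j))) p"
        using x by (auto simp: torsion_part_iff sol1_iff int_pow_pow)
    qed
    thus ?thesis unfolding ulm_def by (simp add: idx_left_mono)
  qed
  finally have "idx G (?T \<inter> ?P s) (?P (Suc s)) \<noteq> \<infinity>" using assms[of "s + j"] by (metis enat_ord_simps(5) le_add2)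
  thus ?case unfolding e using Suc by (simp add: imult_is_infinity)
qed

text \<open>The group \<open>{x. p^(m+j) | p^j x}\<close> is \<open>p^m G + G[p^j]\<close>.\<close>

lemma prime_condition_split:
  assumes "x \<in> sol G {(p ^ (m + j), int p ^ j)}"
  obtains z where "z \<in> carrier G" "x \<otimes> inv (z [^] int (p ^ m)) \<in> tors G (p ^ j)"
    "x \<otimes> inv (x \<otimes> inv (z [^] int (p ^ m))) = z [^] int (p ^ m)"
proof -
  have xc: "x \<in> carrier G" and "x [^] (int p ^ j) \<in> multiples G (p ^ (m + j))" using assms(1) by (auto simp: sol1_iff)
  then obtain z where z: "z \<in> carrier G" "x [^] (int p ^ j) = z [^] int (p ^ (m + j))"
    unfolding multiples_iff by (elim bexE)
  let ?w = "z [^] int (p ^ m)"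
  have "?w [^] (int p ^ j) = z [^] int (p ^ (m + j))" using z(1) by (simp add: int_pow_pow power_add)
  hence "(x \<otimes> inv ?w) [^] (int p ^ j) = \<one>" using xc z by (simp add: int_pow_diff_distrib)
  hence "x \<otimes> inv ?w \<in> tors G (p ^ j)" using xc z(1) by (simp add: tors_iff)
  moreover have "x \<otimes> inv (x \<otimes> inv ?w) = ?w" by (rule diff_diff) (use xc z(1) in simp_all)
  ultimately show ?thesis using that[OF z(1)] by blast
qed

text \<open>
  From the level on where all Ulm quotients are finite, a group \<open>p^(k-j) G + G[p^j]\<close> absorbs all
  \<open>p\<close>-power torsion up to finite index.
\<close>

lemma tors_absorbed:
  assumes "\<And>i. i \<ge> j \<Longrightarrow> ulm G p i \<noteq> \<infinity>" "j \<le> j'" "j \<le> k"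
  shows "idx G (tors G (p ^ j')) (sol G {(p ^ k, int p ^ j)}) \<noteq> \<infinity>"
  using assms(2)
proof (induction j' rule: dec_induct)
  case base
  have "tors G (p ^ j) \<subseteq> sol G {(p ^ k, int p ^ j)}"
    using one_multiples by (auto simp: sol1_iff tors_iff)
  thus ?case by (rule idx_subset_finite[OF tors_subgroup sol_subgroup])
next
  case (step i)
  let ?T = "tors G (p ^ Suc i)"
  let ?f = "sol G {(p ^ k, int p ^ j)}"
  let ?P = "sol G {(p ^ (k - j + i), int p ^ i)}"
  have 1: "idx G ?T ?P \<noteq> \<infinity>" by (rule tors_height_finite) (use assms(1) step.hyps in auto)
  have "idx G (?T \<inter> ?P) ?f = idx G (tors G (p ^ i)) ?f"
  proof (rule idx_absorb)
    show "tors G (p ^ i) \<subseteq> ?T \<inter> ?P"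
      using tors_dvd[of "p ^ i" "p ^ Suc i"] one_multiples
      by (auto simp: sol1_iff tors_iff)
    show "?T \<inter> ?P \<subseteq> carrier G" by (auto simp: sol1_iff)
    fix x assume x: "x \<in> ?T \<inter> ?P"
    obtain z where z: "z \<in> carrier G" "x \<otimes> inv (z [^] int (p ^ (k - j))) \<in> tors G (p ^ i)"
      "x \<otimes> inv (x \<otimes> inv (z [^] int (p ^ (k - j)))) = z [^] int (p ^ (k - j))"
      using IntD2[OF x] by (rule prime_condition_split)
    let ?w = "z [^] int (p ^ (k - j))"
    have "?w [^] (int p ^ j) = z [^] int (p ^ k)"
      using z(1) assms(3) by (simp add: int_pow_pow power_add[symmetric])
    hence w: "?w \<in> ?f" using z(1) by (auto simp: sol1_iff multiples_iff)
    show "\<exists>h\<in>tors G (p ^ i). x \<otimes> inv h \<in> ?f" by (rule bexI[OF _ z(2)]) (unfold z(3), rule w)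
  qed simp
  hence "idx G ?T (?P \<inter> ?f) \<noteq> \<infinity>"
    using idx_Int[OF tors_subgroup sol_subgroup sol_subgroup, of "p ^ Suc i"] 1 step.IH by (simp add: imult_is_infinity)
  moreover have "idx G ?T ?f \<le> idx G ?T (?P \<inter> ?f)"
    by (intro idx_right_antimono subgroup_Int) (auto simp: tors_iff)
  ultimately show ?case by (metis enat_ord_simps(5))
qed

text \<open>
  The two groups are \<open>p^(k-j) G + G[p^j]\<close> and \<open>p^(k'-j') G + G[p^j']\<close>.
  If \<open>k' - j' \<le> k - j\<close>, the first is contained in the second. Otherwise
  \<open>p^(k'-j') G\<close> is contained in the first group, and \<open>G[p^j']\<close> is
  absorbed by it up to finite index.
\<close>

lemma prime_conditions_comparable:
  assumes j: "j \<le> j'" "j < k" "j' < k'" and d: "j = j' \<or> (\<forall>i\<ge>j. ulm G p i \<noteq> \<infinity>)"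
  shows "sidx G {(p ^ k, int p ^ j)} {(p ^ k', int p ^ j')} \<noteq> \<infinity> \<or>
         sidx G {(p ^ k', int p ^ j')} {(p ^ k, int p ^ j)} \<noteq> \<infinity>"
proof (cases "k' + j \<le> k + j'")
  case True
  have "sol G {(p ^ k, int p ^ j)} \<subseteq> sol G {(p ^ k', int p ^ j')}"
  proof
    fix x assume x: "x \<in> sol G {(p ^ k, int p ^ j)}"
    hence xc: "x \<in> carrier G" and "x [^] (int p ^ j) \<in> multiples G (p ^ k)" by (auto simp: sol1_iff)
    then obtain z where z: "z \<in> carrier G" "x [^] (int p ^ j) = z [^] int (p ^ k)"
      unfolding multiples_iff by (elim bexE)
    have "x [^] (int p ^ j') = (x [^] (int p ^ j)) [^] (int p ^ (j' - j))"
      using xc j(1) by (simp add: int_pow_pow power_add[symmetric])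
    also have "\<dots> = z [^] int (p ^ (k + (j' - j)))" unfolding z(2) using z(1) by (simp add: int_pow_pow power_add)
    also have "\<dots> \<in> multiples G (p ^ k')"
      using True j by (intro pow_mult_in_multiples z(1)) (simp add: le_imp_power_dvd)
    finally show "x \<in> sol G {(p ^ k', int p ^ j')}" using xc by (simp add: sol1_iff)
  qed
  thus ?thesis using idx_subset_finite[OF sol_subgroup sol_subgroup] by blast
next
  case False
  let ?f = "sol G {(p ^ k, int p ^ j)}" and ?g = "sol G {(p ^ k', int p ^ j')}"
  have "idx G ?g ?f = idx G (tors G (p ^ j')) ?f"
  proof (rule idx_absorb)
    show "tors G (p ^ j') \<subseteq> ?g"
      using one_multiples by (auto simp: sol1_iff tors_iff)
    show "?g \<subseteq> carrier G" by (auto simp: sol1_iff)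
    fix x assume x: "x \<in> ?g"
    have "x \<in> sol G {(p ^ (k' - j' + j'), int p ^ j')}" using x j(3) by simp
    then obtain z where z: "z \<in> carrier G" "x \<otimes> inv (z [^] int (p ^ (k' - j'))) \<in> tors G (p ^ j')"
      "x \<otimes> inv (x \<otimes> inv (z [^] int (p ^ (k' - j')))) = z [^] int (p ^ (k' - j'))"
      by (rule prime_condition_split)
    let ?w = "z [^] int (p ^ (k' - j'))"
    have "?w [^] (int p ^ j) = z [^] (int p ^ (k' - j' + j))" using z(1) by (simp add: int_pow_pow power_add)
    moreover have "z [^] (int p ^ (k' - j' + j)) \<in> multiples G (p ^ k)"
      using False j by (intro pow_mult_in_multiples z(1)) (simp add: le_imp_power_dvd)
    ultimately have w: "?w \<in> ?f" using z(1) by (simp add: sol1_iff)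
    show "\<exists>h\<in>tors G (p ^ j'). x \<otimes> inv h \<in> ?f" by (rule bexI[OF _ z(2)]) (unfold z(3), rule w)
  qed simp
  moreover have "idx G (tors G (p ^ j')) ?f \<noteq> \<infinity>"
  proof (cases "j = j'")
    case True
    have "tors G (p ^ j') \<subseteq> ?f"
      unfolding True using one_multiples by (auto simp: sol1_iff tors_iff)
    thus ?thesis by (rule idx_subset_finite[OF tors_subgroup sol_subgroup])
  next
    case False
    hence "ulm G p i \<noteq> \<infinity>" if "i \<ge> j" for i using d that by blast
    thus ?thesis by (rule tors_absorbed) (use j in simp_all)
  qed
  ultimately have "idx G ?g ?f \<noteq> \<infinity>" by simp
  thus ?thesis by (rule disjI2)
qed

lemma tors_gcd: "tors G m \<inter> tors G n = tors G (gcd m n)"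
proof
  show "tors G (gcd m n) \<subseteq> tors G m \<inter> tors G n" using tors_dvd[of "gcd m n" m] tors_dvd[of "gcd m n" n] by auto
  show "tors G m \<inter> tors G n \<subseteq> tors G (gcd m n)"
  proof
    fix x assume x: "x \<in> tors G m \<inter> tors G n"
    have xc: "x \<in> carrier G" using x by (auto simp: tors_iff)
    obtain u v where "u * int m + v * int n = gcd (int m) (int n)" using bezout_int by blast
    hence g: "int (gcd m n) = u * int m + v * int n" by simp
    have "x [^] int (gcd m n) = x [^] (u * int m) \<otimes> x [^] (v * int n)" unfolding g using xc by (rule int_pow_mult)
    also have "x [^] (u * int m) = \<one>" using x by (intro tors_pow_dvd[of x m]) auto
    also have "x [^] (v * int n) = \<one>" using x by (intro tors_pow_dvd[of x n]) auto
    finally show "x \<in> tors G (gcd m n)" using xc by (simp add: tors_iff)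
  qed
qed

text \<open>
  The groups \<open>S \<alpha>\<close> are enlargements of an independent family \<open>H\<close>
  that preserve the infinite indices.
\<close>

definition indep :: "'i set \<Rightarrow> ('i \<Rightarrow> 'a set) \<Rightarrow> ('i \<Rightarrow> 'a set) \<Rightarrow> bool" where
  "indep F H S \<longleftrightarrow> (\<forall>\<alpha>\<in>F. subgroup (H \<alpha>) G \<and> subgroup (S \<alpha>) G \<and> H \<alpha> \<subseteq> S \<alpha> \<and> idx G (co_inter F H \<alpha>) (S \<alpha>) = \<infinity>)"

lemma indep_pair:
  assumes "indep F H S" "\<alpha> \<in> F" "\<beta> \<in> F" "\<alpha> \<noteq> \<beta>" shows "idx G (S \<beta>) (S \<alpha>) = \<infinity>"
proof -
  have "co_inter F H \<alpha> \<subseteq> S \<beta>" using assms by (auto simp: co_inter_def indep_def)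
  hence "idx G (co_inter F H \<alpha>) (S \<alpha>) \<le> idx G (S \<beta>) (S \<alpha>)" by (rule idx_left_mono)
  thus ?thesis using assms by (simp add: indep_def)
qed

definition prime_type :: "'a set \<Rightarrow> nat \<Rightarrow> nat \<Rightarrow> nat \<Rightarrow> bool" where
  "prime_type S p k j \<longleftrightarrow> prime p \<and> j < k \<and> S = sol G {(p ^ k, int p ^ j)}"

text \<open>
  Members of an independent family have infinite index over one another, so they are pairwise
  incomparable up to finite index. Two conditions for the same prime can only be so if their
  exponents \<open>j\<close> are distinct and not both at least \<open>B p\<close>. Thus the prime
  and the truncated exponent determine the member, and the prime is one with infinite
  \<open>G/pG\<close>.
\<close>

lemma indep_prime_card:
  assumes F: "finite F" and ind: "indep F H S"
    and fin: "finite Ps" "\<And>p. prime p \<Longrightarrow> p \<notin> Ps \<Longrightarrow> idx G (carrier G) (multiples G p) \<noteq> \<infinity>"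
    and B: "\<And>p i. prime p \<Longrightarrow> B p \<le> i \<Longrightarrow> ulm G p i \<noteq> \<infinity>"
  shows "card {\<alpha> \<in> F. \<exists>p k j. prime_type (S \<alpha>) p k j} \<le> card (Sigma Ps (\<lambda>p. {..B p}))"
proof -
  define Q where "Q = {\<alpha> \<in> F. \<exists>p k j. prime_type (S \<alpha>) p k j}"
  have "\<forall>\<alpha>\<in>Q. \<exists>p k j. prime_type (S \<alpha>) p k j" by (simp add: Q_def)
  then obtain p k j where pt: "\<And>\<alpha>. \<alpha> \<in> Q \<Longrightarrow> prime_type (S \<alpha>) (p \<alpha>) (k \<alpha>) (j \<alpha>)" by metis
  define f where "f = (\<lambda>\<alpha>. (p \<alpha>, min (j \<alpha>) (B (p \<alpha>))))"
  have "inj_on f Q"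
  proof (rule inj_onI, rule ccontr)
    fix \<alpha> \<beta> assume h: "\<alpha> \<in> Q" "\<beta> \<in> Q" "f \<alpha> = f \<beta>" "\<alpha> \<noteq> \<beta>"
    have F': "\<alpha> \<in> F" "\<beta> \<in> F" using h by (auto simp: Q_def)
    have inf: "idx G (S \<beta>) (S \<alpha>) = \<infinity>" "idx G (S \<alpha>) (S \<beta>) = \<infinity>"
      using indep_pair[OF ind F' h(4)] indep_pair[OF ind F'(2,1)] h(4) by auto
    have pp: "p \<beta> = p \<alpha>" and jj: "min (j \<alpha>) (B (p \<alpha>)) = min (j \<beta>) (B (p \<alpha>))" using h(3) by (auto simp: f_def)
    have a: "prime (p \<alpha>)" "j \<alpha> < k \<alpha>" "S \<alpha> = sol G {(p \<alpha> ^ k \<alpha>, int (p \<alpha>) ^ j \<alpha>)}"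
      and b: "j \<beta> < k \<beta>" "S \<beta> = sol G {(p \<alpha> ^ k \<beta>, int (p \<alpha>) ^ j \<beta>)}"
      using pt[OF h(1)] pt[OF h(2)] pp by (auto simp: prime_type_def)
    have fin: "j \<alpha> = j \<beta> \<or> (\<forall>i\<ge>min (j \<alpha>) (j \<beta>). ulm G (p \<alpha>) i \<noteq> \<infinity>)"
    proof (cases "j \<alpha> = j \<beta>")
      case False
      hence "B (p \<alpha>) \<le> min (j \<alpha>) (j \<beta>)" using jj by (auto simp: min_def split: if_splits)
      hence "\<forall>i\<ge>min (j \<alpha>) (j \<beta>). ulm G (p \<alpha>) i \<noteq> \<infinity>" using B[OF a(1)] le_trans by blast
      thus ?thesis by (rule disjI2)
    qed simp
    show False
    proof (cases "j \<alpha> \<le> j \<beta>")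
      case True
      thus False using prime_conditions_comparable[of "j \<alpha>" "j \<beta>" "k \<alpha>" "k \<beta>" "p \<alpha>"] a b fin inf by auto
    next
      case False
      thus False using prime_conditions_comparable[of "j \<beta>" "j \<alpha>" "k \<beta>" "k \<alpha>" "p \<alpha>"] a b fin inf by auto
    qed
  qed
  moreover have "f ` Q \<subseteq> Sigma Ps (\<lambda>p. {..B p})"
  proof (rule image_subsetI)
    fix \<alpha> assume \<alpha>: "\<alpha> \<in> Q"
    have "p \<alpha> \<in> Ps"
    proof (rule ccontr)
      assume "p \<alpha> \<notin> Ps"
      hence "idx G (carrier G) (S \<alpha>) \<noteq> \<infinity>" using pt[OF \<alpha>] fin(2) sol_prime_finite by (simp add: prime_type_def)
      moreover have "co_inter F H \<alpha> \<subseteq> carrier G" by (auto simp: co_inter_def)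
      hence "idx G (co_inter F H \<alpha>) (S \<alpha>) \<le> idx G (carrier G) (S \<alpha>)" by (rule idx_left_mono)
      ultimately show False using ind \<alpha> by (auto simp: indep_def Q_def)
    qed
    thus "f \<alpha> \<in> Sigma Ps (\<lambda>p. {..B p})" by (simp add: f_def)
  qed
  ultimately have "card Q \<le> card (Sigma Ps (\<lambda>p. {..B p}))" using fin(1) by (intro card_inj_on_le) auto
  thus ?thesis by (simp add: Q_def)
qed

text \<open>
  As \<open>G[d] \<inter> G[d0]\<close> is \<open>G[gcd d d0]\<close>, two members with the same
  greatest common divisor with \<open>d0\<close> would contradict independence, and there are at
  most \<open>d0\<close> such divisors.
\<close>

lemma indep_tors_card:
  assumes F: "finite F" and ind: "indep F H S" and \<alpha>0: "\<alpha>0 \<in> F" "S \<alpha>0 = tors G d0" "d0 > 0"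
  shows "card {\<alpha> \<in> F. \<exists>d. S \<alpha> = tors G d} \<le> Suc d0"
proof -
  define Q where "Q = {\<alpha> \<in> F. \<exists>d. S \<alpha> = tors G d}"
  have "\<forall>\<alpha>\<in>Q. \<exists>d. S \<alpha> = tors G d" by (simp add: Q_def)
  then obtain d where d: "\<And>\<alpha>. \<alpha> \<in> Q \<Longrightarrow> S \<alpha> = tors G (d \<alpha>)" by metis
  have "inj_on (\<lambda>\<alpha>. gcd (d \<alpha>) d0) (Q - {\<alpha>0})"
  proof (rule inj_onI, rule ccontr)
    fix \<alpha> \<beta> assume h: "\<alpha> \<in> Q - {\<alpha>0}" "\<beta> \<in> Q - {\<alpha>0}" "gcd (d \<alpha>) d0 = gcd (d \<beta>) d0" "\<alpha> \<noteq> \<beta>"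
    have m: "\<alpha> \<in> F" "\<beta> \<in> F" "\<alpha> \<in> Q" "\<beta> \<in> Q" "\<alpha>0 \<noteq> \<alpha>" using h by (auto simp: Q_def)
    have "H \<beta> \<subseteq> S \<beta>" "H \<alpha>0 \<subseteq> S \<alpha>0" using ind m \<alpha>0(1) by (auto simp: indep_def)
    moreover have "co_inter F H \<alpha> \<subseteq> H \<beta> \<inter> H \<alpha>0" using m h(4) \<alpha>0(1) by (auto simp: co_inter_def)
    ultimately have "co_inter F H \<alpha> \<subseteq> tors G (d \<beta>) \<inter> tors G d0" using d[OF m(4)] \<alpha>0(2) by blast
    also have "\<dots> = tors G (gcd (d \<alpha>) d0)" unfolding tors_gcd h(3) ..
    also have "\<dots> \<subseteq> S \<alpha>" using d[OF m(3)] tors_dvd[of "gcd (d \<alpha>) d0" "d \<alpha>"] by simp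
    finally have "co_inter F H \<alpha> \<subseteq> S \<alpha>" .
    moreover have "subgroup (co_inter F H \<alpha>) G"
      by (rule co_inter_subgroup[OF F]) (use ind in \<open>simp add: indep_def\<close>)
    ultimately have "idx G (co_inter F H \<alpha>) (S \<alpha>) = 1" using idx_eq_1_iff ind m(1) unfolding indep_def by blast
    thus False using ind m(1) unfolding indep_def by (metis enat.distinct(1) one_enat_def)
  qed
  moreover have "(\<lambda>\<alpha>. gcd (d \<alpha>) d0) ` (Q - {\<alpha>0}) \<subseteq> {1..d0}"
    using \<alpha>0(3) by (auto simp: Suc_le_eq intro: gcd_le2_nat)
  ultimately have "card (Q - {\<alpha>0}) \<le> card {1..d0}" by (intro card_inj_on_le) auto
  moreover have "card Q \<le> Suc (card (Q - {\<alpha>0}))"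
  proof -
    have "finite Q" using F by (simp add: Q_def)
    hence "card Q \<le> card (insert \<alpha>0 (Q - {\<alpha>0}))" by (intro card_mono) auto
    moreover have "card (insert \<alpha>0 (Q - {\<alpha>0})) = Suc (card (Q - {\<alpha>0}))"
      using \<open>finite Q\<close> by (intro card_insert_disjoint) auto
    ultimately show ?thesis by simp
  qed
  ultimately show ?thesis by (simp add: Q_def)
qed

definition nf :: "ag_form \<Rightarrow> (nat \<times> int) set" where
  "nf \<psi> = conds1 (SOME D. ppnf \<psi> D)"

lemma nf: assumes "pp \<psi>" shows "ppsub G \<psi> = sol G (nf \<psi>)" "finite (nf \<psi>)"
proof -
  have *: "ppnf \<psi> (SOME D. ppnf \<psi> D)" using ppnf_exists[OF assms] by (rule someI_ex)
  show "ppsub G \<psi> = sol G (nf \<psi>)" unfolding nf_def by (rule ppsub_eq_sol[OF *])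
  show "finite (nf \<psi>)" unfolding nf_def conds1_def using ppnf_finite[OF *] by simp
qed

lemma infinite_condition:
  assumes "subgroup H G" "finite L" "idx G H (sol G L) = \<infinity>"
  shows "\<exists>n a. (n, a) \<in> L \<and> idx G H (sol G {(n, a)}) = \<infinity>"
proof (rule ccontr)
  assume neg: "\<not> ?thesis"
  have "subgroup (carrier G \<inter> \<Inter>((\<lambda>na. sol G {na}) ` L)) G \<and> idx G H (carrier G \<inter> \<Inter>((\<lambda>na. sol G {na}) ` L)) \<noteq> \<infinity>"
    by (rule idx_Inter_finite[OF assms(2,1)]) (use neg in auto)
  moreover have "carrier G \<inter> \<Inter>((\<lambda>na. sol G {na}) ` L) = sol G L" by (auto simp: sol_def)
  ultimately show False using assms(3) by simp
qed

text \<open>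
  If all conditions that define a group had finite index, so would the group. One condition of
  infinite index is kept, reduced to a prime power.
\<close>

lemma basic_condition:
  assumes H: "subgroup H G" and P: "finite P" "\<And>\<psi>. \<psi> \<in> P \<Longrightarrow> pp \<psi>" and inf: "idx G H (ppsub G (cj P)) = \<infinity>"
  shows "\<exists>S. subgroup S G \<and> ppsub G (cj P) \<subseteq> S \<and> idx G H S = \<infinity> \<and>
     ((\<exists>p k j. prime_type S p k j) \<or> (\<exists>\<psi>\<in>P. \<exists>a. (0, a) \<in> nf \<psi> \<and> a \<noteq> 0 \<and> S = tors G (nat \<bar>a\<bar>)))"
proof -
  define L where "L = (\<Union>\<psi>\<in>P. nf \<psi>)"
  have eq: "ppsub G (cj P) = sol G L"
    unfolding ppsub_cj[OF P(1)] L_def using nf(1)[OF P(2)] by (auto simp: sol_def)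
  have "finite L" using P nf(2) by (simp add: L_def)
  then obtain n a where na: "(n, a) \<in> L" "idx G H (sol G {(n, a)}) = \<infinity>"
    using infinite_condition[OF H, of L] inf unfolding eq by blast
  have sub: "ppsub G (cj P) \<subseteq> sol G {(n, a)}" unfolding eq using na(1) by (auto simp: sol_def)
  have ne: "\<not> H \<subseteq> S" if "idx G H S = \<infinity>" "subgroup S G" for S
    using idx_eq_1_iff[OF H that(2)] that(1) by (auto simp: one_enat_def)
  have Hc: "H \<subseteq> carrier G" by (rule subgroup.subset[OF H])
  show ?thesis
  proof (cases "n = 0")
    case True
    have "a \<noteq> 0"
    proof
      assume "a = 0"
      hence "sol G {(n, a)} = carrier G" using one_multiples by (auto simp: sol1_iff)
      thus False using ne[OF na(2) sol_subgroup] Hc by simp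
    qed
    moreover obtain \<psi> where "\<psi> \<in> P" "(0, a) \<in> nf \<psi>" using na(1) True by (auto simp: L_def)
    ultimately show ?thesis using na(2) sub True sol_zero[of a] sol_subgroup
      by (intro exI[of _ "sol G {(n, a)}"]) auto
  next
    case False
    then obtain p k where pk: "prime p" "p ^ k dvd n" "idx G H (sol G {(p ^ k, a)}) = \<infinity>"
      using prime_power_condition[OF H _ na(2)] by auto
    have "\<not> int p ^ k dvd a"
    proof
      assume "int p ^ k dvd a"
      hence "sol G {(p ^ k, a)} = carrier G" using pow_mult_in_multiples by (auto simp: sol1_iff)
      thus False using ne[OF pk(3) sol_subgroup] Hc by simp
    qed
    then obtain j where j: "j < k" "sol G {(p ^ k, a)} = sol G {(p ^ k, int p ^ j)}"
      using prime_power_condition_unit[OF pk(1)] by blast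
    have "sol G {(n, a)} \<subseteq> sol G {(p ^ k, a)}" using multiples_dvd[OF pk(2)] by (auto simp: sol1_iff)
    hence "ppsub G (cj P) \<subseteq> sol G {(p ^ k, a)}" using sub by blast
    moreover have "prime_type (sol G {(p ^ k, a)}) p k j" using pk(1) j by (simp add: prime_type_def)
    ultimately show ?thesis using pk(3) sol_subgroup by (intro exI[of _ "sol G {(p ^ k, a)}"]) blast
  qed
qed

text \<open>
  An independent family contains at most \<open>n1\<close> conditions modulo prime powers. Among
  \<open>n1 + 1\<close> rows of the pattern, one therefore contributes a torsion group
  \<open>G[d0]\<close>, where \<open>d0 \<le> d\<close> for a bound \<open>d\<close> that is known
  from the formulas of these rows. With \<open>d + 1\<close> further rows, the family would have
  more torsion groups than the \<open>d0 + 1\<close> that are possible.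
\<close>

theorem finite_width_no_inp_pattern:
  assumes fin: "finite {p. prime p \<and> idx G (carrier G) (multiples G p) = \<infinity>}"
    and U: "\<And>p. prime p \<Longrightarrow> finite {n. ulm G p n = \<infinity>}"
    and I: "infinite I"
  shows "\<not> inp_pattern G (x_eq_x G) I \<phi> k"
proof
  assume "inp_pattern G (x_eq_x G) I \<phi> k"
  then obtain b where b': "(\<forall>\<alpha>\<in>I. \<forall>i. range (b \<alpha> i) \<subseteq> carrier G) \<and>
      (\<forall>\<alpha>\<in>I. k_inconsistent G (k \<alpha>) (\<lambda>i::nat. (\<phi> \<alpha>, b \<alpha> i))) \<and>
      (\<forall>\<eta>. consistent G (x_eq_x G \<union> (\<lambda>\<alpha>. (\<phi> \<alpha>, b \<alpha> (\<eta> \<alpha>))) ` I))"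
    unfolding inp_pattern_def by (rule exE)
  have b: "\<And>\<alpha> i. \<alpha> \<in> I \<Longrightarrow> range (b \<alpha> i) \<subseteq> carrier G"
    "\<And>\<alpha>. \<alpha> \<in> I \<Longrightarrow> k_inconsistent G (k \<alpha>) (\<lambda>i::nat. (\<phi> \<alpha>, b \<alpha> i))"
    "\<And>\<eta>. consistent G (x_eq_x G \<union> (\<lambda>\<alpha>. (\<phi> \<alpha>, b \<alpha> (\<eta> \<alpha>))) ` I)"
    using b' by simp_all
  define Ps where "Ps = {p. prime p \<and> idx G (carrier G) (multiples G p) = \<infinity>}"
  have "\<exists>B. \<forall>i\<ge>B. ulm G p i \<noteq> \<infinity>" if p: "prime p" for p
  proof -
    obtain B where "\<forall>n\<in>{n. ulm G p n = \<infinity>}. n < B" using U[OF p] finite_nat_set_iff_bounded by blast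
    thus ?thesis by (intro exI[of _ B]) force
  qed
  then obtain B where B: "\<And>p i. prime p \<Longrightarrow> B p \<le> i \<Longrightarrow> ulm G p i \<noteq> \<infinity>" by metis
  define n1 where "n1 = card (Sigma Ps (\<lambda>p. {..B p}))"
  \<comment> \<open>The possible orders of the torsion groups contributed by the row \<open>\<alpha>\<close>.\<close>
  define \<Delta> where "\<Delta> = (\<lambda>\<alpha>. (\<lambda>a. nat \<bar>a\<bar>) ` {a. \<exists>\<psi>\<in>det (\<phi> \<alpha>). (0, a) \<in> nf \<psi>})"
  have fin\<Delta>: "finite (\<Delta> \<alpha>)" for \<alpha>
  proof -
    have "{a. \<exists>\<psi>\<in>det (\<phi> \<alpha>). (0, a) \<in> nf \<psi>} \<subseteq> snd ` (\<Union>\<psi>\<in>det (\<phi> \<alpha>). nf \<psi>)" by force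
    moreover have "finite (\<Union>\<psi>\<in>det (\<phi> \<alpha>). nf \<psi>)" using det_finite nf(2) det_pp by blast
    ultimately show ?thesis unfolding \<Delta>_def by (intro finite_imageI) (meson finite_imageI finite_subset)
  qed
  obtain F1 where F1: "F1 \<subseteq> I" "finite F1" "card F1 = Suc n1" using infinite_arbitrarily_large[OF I] by blast
  have "finite (\<Union>\<alpha>\<in>F1. \<Delta> \<alpha>)" using F1 fin\<Delta> by simp
  then obtain d where d: "\<And>\<alpha> x. \<alpha> \<in> F1 \<Longrightarrow> x \<in> \<Delta> \<alpha> \<Longrightarrow> x \<le> d"
    unfolding finite_nat_set_iff_bounded_le by blast
  obtain F2 where F2: "F2 \<subseteq> I - F1" "finite F2" "card F2 = Suc d"
    using infinite_arbitrarily_large[of "I - F1"] I F1(2) by (meson Diff_infinite_finite)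
  define F where "F = F1 \<union> F2"
  have F: "finite F" "F \<subseteq> I" "card F = Suc n1 + Suc d"
    using F1 F2 card_Un_disjoint[of F1 F2] by (auto simp: F_def)
  obtain P where P: "\<forall>\<alpha>\<in>F. P \<alpha> \<subseteq> det (\<phi> \<alpha>)"
    "\<forall>\<alpha>\<in>F. idx G (co_inter F (\<lambda>\<beta>. ppsub G (cj (P \<beta>))) \<alpha>) (ppsub G (cj (P \<alpha>))) = \<infinity>"
    using inp_pattern_independent[OF b F(1,2)] by blast
  define H where "H = (\<lambda>\<beta>. ppsub G (cj (P \<beta>)))"
  have fP: "finite (P \<alpha>)" "\<And>\<psi>. \<psi> \<in> P \<alpha> \<Longrightarrow> pp \<psi>" if "\<alpha> \<in> F" for \<alpha>
    using P(1) that det_finite det_pp finite_subset by blast+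
  have sH: "subgroup (H \<alpha>) G" if "\<alpha> \<in> F" for \<alpha>
    unfolding H_def using fP[OF that] by (intro ppsub_subgroup pp_cj)
  have sC: "subgroup (co_inter F H \<alpha>) G" for \<alpha> by (rule co_inter_subgroup[OF F(1) sH])
  have "\<exists>S. subgroup S G \<and> H \<alpha> \<subseteq> S \<and> idx G (co_inter F H \<alpha>) S = \<infinity> \<and>
     ((\<exists>p k j. prime_type S p k j) \<or> (\<exists>\<psi>\<in>P \<alpha>. \<exists>a. (0, a) \<in> nf \<psi> \<and> a \<noteq> 0 \<and> S = tors G (nat \<bar>a\<bar>)))" if "\<alpha> \<in> F" for \<alpha>
    unfolding H_def by (rule basic_condition) (use sC[of \<alpha>] fP[OF that] P(2) that in \<open>simp_all add: H_def\<close>)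
  then obtain S where S: "\<And>\<alpha>. \<alpha> \<in> F \<Longrightarrow> subgroup (S \<alpha>) G \<and> H \<alpha> \<subseteq> S \<alpha> \<and> idx G (co_inter F H \<alpha>) (S \<alpha>) = \<infinity>"
    and type: "\<And>\<alpha>. \<alpha> \<in> F \<Longrightarrow> (\<exists>p k j. prime_type (S \<alpha>) p k j) \<or>
      (\<exists>\<psi>\<in>P \<alpha>. \<exists>a. (0, a) \<in> nf \<psi> \<and> a \<noteq> 0 \<and> S \<alpha> = tors G (nat \<bar>a\<bar>))" by metis
  have ind: "indep F H S" using S sH unfolding indep_def by blast
  define F' where "F' = {\<alpha> \<in> F. \<exists>p k j. prime_type (S \<alpha>) p k j}"
  define F'' where "F'' = {\<alpha> \<in> F. \<exists>d. S \<alpha> = tors G d}"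
  have c1: "card F' \<le> n1"
    unfolding F'_def n1_def by (rule indep_prime_card[OF F(1) ind]) (use fin B in \<open>auto simp: Ps_def\<close>)
  have "\<not> F1 \<subseteq> F'" using card_mono[of F' F1] F(1) F1(3) c1 by (auto simp: F'_def)
  then obtain \<alpha>0 where \<alpha>0: "\<alpha>0 \<in> F1" "\<alpha>0 \<notin> F'" by blast
  have \<alpha>0F: "\<alpha>0 \<in> F" using \<alpha>0(1) by (simp add: F_def)
  then obtain \<psi> a where a: "\<psi> \<in> P \<alpha>0" "(0, a) \<in> nf \<psi>" "a \<noteq> 0" "S \<alpha>0 = tors G (nat \<bar>a\<bar>)"
    using type[OF \<alpha>0F] \<alpha>0(2) unfolding F'_def by blast
  have "nat \<bar>a\<bar> \<in> \<Delta> \<alpha>0" using a(1,2) P(1) \<alpha>0F unfolding \<Delta>_def by blast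
  hence "nat \<bar>a\<bar> \<le> d" using d \<alpha>0(1) by blast
  moreover have "card F'' \<le> Suc (nat \<bar>a\<bar>)"
    unfolding F''_def by (rule indep_tors_card[OF F(1) ind \<alpha>0F a(4)]) (use a(3) in simp)
  ultimately have c2: "card F'' \<le> Suc d" by simp
  have "F \<subseteq> F' \<union> F''" using type unfolding F'_def F''_def by blast
  hence "card F \<le> card (F' \<union> F'')" using F(1) by (intro card_mono) (auto simp: F'_def F''_def)
  also have "\<dots> \<le> card F' + card F''" by (rule card_Un_le)
  finally show False using c1 c2 F(3) by simp
qed

end

section \<open>Ultrapowers\<close>

text \<open>Nonprincipal ultrafilters, as all members are infinite.\<close>

definition ultrafilter :: "nat set set \<Rightarrow> bool" where
  "ultrafilter U \<longleftrightarrow> (\<forall>X. X \<in> U \<longleftrightarrow> - X \<notin> U) \<and> (\<forall>X\<in>U. \<forall>Y\<in>U. X \<inter> Y \<in> U) \<and> (\<forall>X\<in>U. infinite X)"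

text \<open>
  A maximal family of sets all of whose finite intersections are infinite. A set outside the
  family has finite intersection with some such intersection, which cannot happen for both a set
  and its complement.
\<close>

lemma ultrafilter_exists: "\<exists>U. ultrafilter U"
proof -
  define fip :: "nat set set \<Rightarrow> bool" where "fip A \<longleftrightarrow> (\<forall>B\<subseteq>A. finite B \<longrightarrow> infinite (\<Inter>B))" for A
  have "\<exists>U\<in>{A. fip A}. \<forall>X\<in>{A. fip A}. U \<subseteq> X \<longrightarrow> X = U"
  proof (rule subset_Zorn)
    fix C assume C: "subset.chain {A. fip A} C"
    show "\<exists>U\<in>{A. fip A}. \<forall>X\<in>C. X \<subseteq> U"
    proof (cases "C = {}")
      case True
      have "fip {}" by (simp add: fip_def)
      thus ?thesis using True by blast
    next
      case False
      have "infinite (\<Inter>B)" if B: "B \<subseteq> \<Union>C" "finite B" for B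
      proof -
        obtain A where "A \<in> C" "B \<subseteq> A" using finite_subset_Union_chain[OF B(2,1) False C] .
        moreover have "fip A" using C \<open>A \<in> C\<close> unfolding subset_chain_def by blast
        ultimately show ?thesis using B(2) unfolding fip_def by blast
      qed
      hence "fip (\<Union>C)" by (simp add: fip_def)
      thus ?thesis by blast
    qed
  qed
  then obtain U where U: "fip U" and max: "\<And>X. fip X \<Longrightarrow> U \<subseteq> X \<Longrightarrow> X = U" by auto
  have out: "\<exists>B\<subseteq>U. finite B \<and> finite (\<Inter>B \<inter> X)" if "X \<notin> U" for X
  proof -
    have "\<not> fip (insert X U)" using max[of "insert X U"] that by blast
    then obtain B where B: "B \<subseteq> insert X U" "finite B" "finite (\<Inter>B)" unfolding fip_def by blast
    have "\<Inter>(B - {X}) \<inter> X \<subseteq> \<Inter>B" by blast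
    thus ?thesis using B finite_subset by (intro exI[of _ "B - {X}"]) auto
  qed
  have pair: "infinite (X \<inter> Y)" if "X \<in> U" "Y \<in> U" for X Y
    using U that unfolding fip_def by (metis Inter_insert cInf_singleton empty_subsetI finite.emptyI finite.insertI insert_subset)
  have compl: "X \<in> U \<longleftrightarrow> - X \<notin> U" for X
  proof
    assume "X \<in> U" thus "- X \<notin> U" using pair[of X "- X"] by auto
  next
    assume n: "- X \<notin> U"
    show "X \<in> U"
    proof (rule ccontr)
      assume "X \<notin> U"
      then obtain B where B: "B \<subseteq> U" "finite B" "finite (\<Inter>B \<inter> X)" using out by blast
      obtain B' where B': "B' \<subseteq> U" "finite B'" "finite (\<Inter>B' \<inter> - X)" using out n by blast
      have "\<Inter>(B \<union> B') \<subseteq> (\<Inter>B \<inter> X) \<union> (\<Inter>B' \<inter> - X)" by blast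
      hence "finite (\<Inter>(B \<union> B'))" using B(3) B'(3) by (meson finite_UnI finite_subset)
      moreover have "B \<union> B' \<subseteq> U" "finite (B \<union> B')" using B B' by auto
      ultimately show False using U unfolding fip_def by blast
    qed
  qed
  have "X \<inter> Y \<in> U" if "X \<in> U" "Y \<in> U" for X Y
  proof (rule ccontr)
    assume "X \<inter> Y \<notin> U"
    hence "- (X \<inter> Y) \<in> U" using compl by blast
    hence "{X, Y, - (X \<inter> Y)} \<subseteq> U" using that by simp
    hence "infinite (\<Inter>{X, Y, - (X \<inter> Y)})" using U unfolding fip_def by blast
    moreover have "\<Inter>{X, Y, - (X \<inter> Y)} = {}" by blast
    ultimately show False by simp
  qed
  moreover have "infinite X" if "X \<in> U" for X using pair[OF that that] by simp
  ultimately have "ultrafilter U" using compl unfolding ultrafilter_def by blast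
  thus ?thesis by blast
qed

lemma
  assumes "ultrafilter U"
  shows ultra_compl: "- X \<in> U \<longleftrightarrow> X \<notin> U"
    and ultra_Int: "X \<inter> Y \<in> U \<longleftrightarrow> X \<in> U \<and> Y \<in> U"
    and ultra_mono: "X \<in> U \<Longrightarrow> X \<subseteq> Y \<Longrightarrow> Y \<in> U"
    and ultra_cofinite: "finite (- X) \<Longrightarrow> X \<in> U"
    and ultra_UNIV: "UNIV \<in> U"
proof -
  note u = assms[unfolded ultrafilter_def]
  show c: "- X \<in> U \<longleftrightarrow> X \<notin> U" for X using u by blast
  show cof: "X \<in> U" if "finite (- X)" for X using u that by blast
  show "UNIV \<in> U" by (rule cof) simp
  have i: "X \<inter> Y \<in> U" if "X \<in> U" "Y \<in> U" for X Y using u that by blast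
  show m: "Y \<in> U" if "X \<in> U" "X \<subseteq> Y" for X Y
  proof (rule ccontr)
    assume "Y \<notin> U"
    hence "X \<inter> - Y \<in> U" using i that(1) c by blast
    moreover have "X \<inter> - Y = {}" using that(2) by blast
    ultimately show False using u by (metis finite.emptyI)
  qed
  show "X \<inter> Y \<in> U \<longleftrightarrow> X \<in> U \<and> Y \<in> U" using i m[of "X \<inter> Y" X] m[of "X \<inter> Y" Y] by blast
qed

instance ag_term :: countable by countable_datatype
instance ag_form :: countable by countable_datatype

lemma term_val_below: "term_below n t \<Longrightarrow> (\<And>j. j < n \<Longrightarrow> v j = w j) \<Longrightarrow> term_val M v t = term_val M w t"
  by (induction t) auto

lemma sat_below: "form_below n \<phi> \<Longrightarrow> (\<And>j. j < n \<Longrightarrow> v j = w j) \<Longrightarrow> sat M v \<phi> \<longleftrightarrow> sat M w \<phi>"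
proof (induction \<phi> arbitrary: n v w)
  case (Equal s t)
  have "term_val M v s = term_val M w s" "term_val M v t = term_val M w t"
    using Equal by (auto intro: term_val_below)
  thus ?case by simp
next
  case (Exists \<phi>)
  have "sat M (case_nat a v) \<phi> \<longleftrightarrow> sat M (case_nat a w) \<phi>" for a
    by (rule Exists.IH[of "Suc n"]) (use Exists.prems in \<open>auto split: nat.splits\<close>)
  thus ?case by simp
next
  case (Conj \<phi> \<psi>)
  have "sat M v \<phi> \<longleftrightarrow> sat M w \<phi>" using Conj.prems by (intro Conj.IH(1)) auto
  moreover have "sat M v \<psi> \<longleftrightarrow> sat M w \<psi>" using Conj.prems by (intro Conj.IH(2)) auto
  ultimately show ?case by simp
next
  case (Negation \<phi>)
  have "sat M v \<phi> \<longleftrightarrow> sat M w \<phi>" using Negation.prems by (intro Negation.IH) auto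
  thus ?case by simp
qed

lemma term_below_mono: "term_below n t \<Longrightarrow> n \<le> m \<Longrightarrow> term_below m t"
  by (induction t) auto

lemma form_below_mono: "form_below n \<phi> \<Longrightarrow> n \<le> m \<Longrightarrow> form_below m \<phi>"
proof (induction \<phi> arbitrary: n m)
  case (Exists \<phi>)
  thus ?case using Exists.IH[of "Suc n" "Suc m"] by simp
next
  case (Equal s t)
  thus ?case using term_below_mono[of n s m] term_below_mono[of n t m] by simp
next
  case (Conj \<phi> \<psi>)
  thus ?case using Conj.IH(1)[of n m] Conj.IH(2)[of n m] by simp
next
  case (Negation \<phi>)
  thus ?case using Negation.IH[of n m] by simp
qed

lemma term_below_exists: "\<exists>n. term_below n t"
proof (induction t)
  case (Plus s t)
  then obtain m n where "term_below m s" "term_below n t" by blast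
  hence "term_below (max m n) (Plus s t)" using term_below_mono[of m s "max m n"] term_below_mono[of n t "max m n"] by simp
  thus ?case by blast
qed auto

lemma form_below_exists: "\<exists>n. form_below n \<phi>"
proof (induction \<phi>)
  case (Equal s t)
  then obtain m n where "term_below m s" "term_below n t" using term_below_exists by metis
  hence "form_below (max m n) (Equal s t)" using term_below_mono[of m s "max m n"] term_below_mono[of n t "max m n"] by simp
  thus ?case by blast
next
  case (Conj \<phi> \<psi>)
  then obtain m n where "form_below m \<phi>" "form_below n \<psi>" by blast
  hence "form_below (max m n) (Conj \<phi> \<psi>)" using form_below_mono[of m \<phi> "max m n"] form_below_mono[of n \<psi> "max m n"] by simp
  thus ?case by blast
next
  case (Exists \<phi>)
  then obtain n where "form_below n \<phi>" by blast
  hence "form_below n (Exists \<phi>)" using form_below_mono[of n \<phi> "Suc n"] by simp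
  thus ?case by blast
next
  case (Negation \<phi>) thus ?case by simp
qed

locale ultrapower = comm_group A for A :: "'a monoid" (structure) +
  fixes U assumes U: "ultrafilter U"
begin

definition seqs :: "(nat \<Rightarrow> 'a) set" where "seqs = {f. range f \<subseteq> carrier A}"

text \<open>
  The elements of the ultrapower are the equivalence classes themselves, so its carrier type is
  the type of sets of sequences.
\<close>

definition cls :: "(nat \<Rightarrow> 'a) \<Rightarrow> (nat \<Rightarrow> 'a) set" where
  "cls f = {g \<in> seqs. {i. f i = g i} \<in> U}"

definition rep :: "(nat \<Rightarrow> 'a) set \<Rightarrow> nat \<Rightarrow> 'a" where
  "rep X = (SOME f. f \<in> seqs \<and> cls f = X)"

definition upow :: "(nat \<Rightarrow> 'a) set monoid" where
  "upow = \<lparr>carrier = cls ` seqs, monoid.mult = (\<lambda>X Y. cls (\<lambda>i. rep X i \<otimes> rep Y i)), one = cls (\<lambda>_. \<one>)\<rparr>"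

lemma seqsD: "f \<in> seqs \<Longrightarrow> f i \<in> carrier A" by (auto simp: seqs_def)

lemma cls_eq: assumes "f \<in> seqs" "g \<in> seqs" shows "cls f = cls g \<longleftrightarrow> {i. f i = g i} \<in> U"
proof
  assume "cls f = cls g"
  moreover have "g \<in> cls g" using assms ultra_UNIV[OF U] by (simp add: cls_def)
  ultimately have "g \<in> cls f" by simp
  thus "{i. f i = g i} \<in> U" by (simp add: cls_def)
next
  assume fg: "{i. f i = g i} \<in> U"
  have "{i. f i = h i} \<in> U \<longleftrightarrow> {i. g i = h i} \<in> U" for h
  proof
    assume "{i. f i = h i} \<in> U"
    hence "{i. f i = g i} \<inter> {i. f i = h i} \<in> U" using fg ultra_Int[OF U] by blast
    thus "{i. g i = h i} \<in> U" by (rule ultra_mono[OF U]) auto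
  next
    assume "{i. g i = h i} \<in> U"
    hence "{i. f i = g i} \<inter> {i. g i = h i} \<in> U" using fg ultra_Int[OF U] by blast
    thus "{i. f i = h i} \<in> U" by (rule ultra_mono[OF U]) auto
  qed
  thus "cls f = cls g" by (simp add: cls_def)
qed

lemma rep: assumes "X \<in> carrier upow" shows "rep X \<in> seqs" "cls (rep X) = X"
proof -
  have "\<exists>f. f \<in> seqs \<and> cls f = X" using assms by (auto simp: upow_def)
  from someI_ex[OF this] show "rep X \<in> seqs" "cls (rep X) = X" by (auto simp: rep_def)
qed

lemma cls_carrier: "f \<in> seqs \<Longrightarrow> cls f \<in> carrier upow" by (simp add: upow_def)

lemma rep_cls: assumes "f \<in> seqs" shows "{i. rep (cls f) i = f i} \<in> U"
  using rep[OF cls_carrier[OF assms]] cls_eq[OF _ assms] by blast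

lemma mult_cls:
  assumes "f \<in> seqs" "g \<in> seqs" shows "cls f \<otimes>\<^bsub>upow\<^esub> cls g = cls (\<lambda>i. f i \<otimes> g i)"
proof -
  have "cls (\<lambda>i. rep (cls f) i \<otimes> rep (cls g) i) = cls (\<lambda>i. f i \<otimes> g i)"
  proof (subst cls_eq)
    show "(\<lambda>i. rep (cls f) i \<otimes> rep (cls g) i) \<in> seqs"
      using rep(1)[OF cls_carrier[OF assms(1)]] rep(1)[OF cls_carrier[OF assms(2)]] by (auto simp: seqs_def)
    show "(\<lambda>i. f i \<otimes> g i) \<in> seqs" using assms by (auto simp: seqs_def)
    have "{i. rep (cls f) i = f i} \<inter> {i. rep (cls g) i = g i} \<in> U" using rep_cls assms ultra_Int[OF U] by blast
    thus "{i. rep (cls f) i \<otimes> rep (cls g) i = f i \<otimes> g i} \<in> U" by (rule ultra_mono[OF U]) auto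
  qed
  thus ?thesis by (simp add: upow_def)
qed

lemma one_upow: "\<one>\<^bsub>upow\<^esub> = cls (\<lambda>_. \<one>)" by (simp add: upow_def)

lemma seqs_one [simp]: "(\<lambda>_. \<one>) \<in> seqs" by (auto simp: seqs_def)

lemma seqs_mult: "f \<in> seqs \<Longrightarrow> g \<in> seqs \<Longrightarrow> (\<lambda>i. f i \<otimes> g i) \<in> seqs" by (auto simp: seqs_def)

lemma seqs_inv: "f \<in> seqs \<Longrightarrow> (\<lambda>i. inv f i) \<in> seqs" by (auto simp: seqs_def)

lemma comm_group_upow: "comm_group upow"
proof (rule comm_groupI)
  show "\<one>\<^bsub>upow\<^esub> \<in> carrier upow" by (simp add: one_upow cls_carrier)
next
  fix x y assume x: "x \<in> carrier upow" "y \<in> carrier upow"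
  obtain f g where fg: "f \<in> seqs" "x = cls f" "g \<in> seqs" "y = cls g" using x rep by metis
  show "x \<otimes>\<^bsub>upow\<^esub> y \<in> carrier upow" using fg by (simp add: mult_cls cls_carrier seqs_mult)
  have "(\<lambda>i. f i \<otimes> g i) = (\<lambda>i. g i \<otimes> f i)" using fg by (auto simp: m_comm seqsD)
  thus "x \<otimes>\<^bsub>upow\<^esub> y = y \<otimes>\<^bsub>upow\<^esub> x" using fg by (simp add: mult_cls)
  fix z assume "z \<in> carrier upow"
  then obtain h where h: "h \<in> seqs" "z = cls h" using rep by metis
  have "(\<lambda>i. f i \<otimes> g i \<otimes> h i) = (\<lambda>i. f i \<otimes> (g i \<otimes> h i))" using fg h by (auto simp: m_assoc seqsD)
  thus "x \<otimes>\<^bsub>upow\<^esub> y \<otimes>\<^bsub>upow\<^esub> z = x \<otimes>\<^bsub>upow\<^esub> (y \<otimes>\<^bsub>upow\<^esub> z)" using fg h by (simp add: mult_cls seqs_mult)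
next
  fix x assume x: "x \<in> carrier upow"
  obtain f where f: "f \<in> seqs" "x = cls f" using x rep by metis
  have "(\<lambda>i. \<one> \<otimes> f i) = f" using f by (auto simp: seqsD)
  thus "\<one>\<^bsub>upow\<^esub> \<otimes>\<^bsub>upow\<^esub> x = x" using f by (simp add: one_upow mult_cls)
  have "(\<lambda>i. inv f i \<otimes> f i) = (\<lambda>_. \<one>)" using f by (auto simp: seqsD)
  hence "cls (\<lambda>i. inv f i) \<otimes>\<^bsub>upow\<^esub> x = \<one>\<^bsub>upow\<^esub>" using f by (simp add: one_upow mult_cls seqs_inv)
  thus "\<exists>y\<in>carrier upow. y \<otimes>\<^bsub>upow\<^esub> x = \<one>\<^bsub>upow\<^esub>" using f cls_carrier seqs_inv by blast
qed

sublocale M: comm_group upow by (rule comm_group_upow)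

lemma inv_cls: assumes "f \<in> seqs" shows "inv\<^bsub>upow\<^esub> (cls f) = cls (\<lambda>i. inv f i)"
proof (rule M.inv_equality)
  have "(\<lambda>i. inv f i \<otimes> f i) = (\<lambda>_. \<one>)" using assms by (auto simp: seqsD)
  thus "cls (\<lambda>i. inv f i) \<otimes>\<^bsub>upow\<^esub> cls f = \<one>\<^bsub>upow\<^esub>" using assms by (simp add: one_upow mult_cls seqs_inv)
qed (use assms in \<open>auto intro: cls_carrier seqs_inv\<close>)

lemma term_val_cls:
  assumes "\<And>j. v j \<in> seqs"
  shows "term_val upow (\<lambda>j. cls (v j)) t = cls (\<lambda>i. term_val A (\<lambda>j. v j i) t)"
    and "(\<lambda>i. term_val A (\<lambda>j. v j i) t) \<in> seqs"
proof -
  have r: "range (\<lambda>j. v j i) \<subseteq> carrier A" for i using assms by (auto simp: seqs_def)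
  have s: "(\<lambda>i. term_val A (\<lambda>j. v j i) t) \<in> seqs" for t using term_val_closed[OF r] by (auto simp: seqs_def)
  show "(\<lambda>i. term_val A (\<lambda>j. v j i) t) \<in> seqs" by (rule s)
  show "term_val upow (\<lambda>j. cls (v j)) t = cls (\<lambda>i. term_val A (\<lambda>j. v j i) t)"
    by (induction t) (simp_all add: one_upow mult_cls inv_cls s)
qed

theorem los:
  assumes "\<And>j. v j \<in> seqs"
  shows "sat upow (\<lambda>j. cls (v j)) \<phi> \<longleftrightarrow> {i. sat A (\<lambda>j. v j i) \<phi>} \<in> U"
  using assms
proof (induction \<phi> arbitrary: v)
  case (Equal s t)
  thus ?case by (simp add: term_val_cls cls_eq)
next
  case (Negation \<phi>)
  have "{i. \<not> sat A (\<lambda>j. v j i) \<phi>} = - {i. sat A (\<lambda>j. v j i) \<phi>}" by auto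
  thus ?case using Negation ultra_compl[OF U] by simp
next
  case (Conj \<phi> \<psi>)
  have "{i. sat A (\<lambda>j. v j i) \<phi> \<and> sat A (\<lambda>j. v j i) \<psi>} = {i. sat A (\<lambda>j. v j i) \<phi>} \<inter> {i. sat A (\<lambda>j. v j i) \<psi>}" by auto
  thus ?case using Conj ultra_Int[OF U] by simp
next
  case (Exists \<phi>)
  have c1: "case_nat (cls f) (\<lambda>j. cls (v j)) = (\<lambda>j. cls (case_nat f v j))" for f by (auto split: nat.splits)
  have c2: "(\<lambda>j. case_nat f v j i) = case_nat (f i) (\<lambda>j. v j i)" for f :: "nat \<Rightarrow> 'a" and i by (auto split: nat.splits)
  have s: "case_nat f v j \<in> seqs" if "f \<in> seqs" for f j using that Exists.prems by (auto split: nat.splits)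
  have IH: "sat upow (case_nat (cls f) (\<lambda>j. cls (v j))) \<phi> \<longleftrightarrow> {i. sat A (case_nat (f i) (\<lambda>j. v j i)) \<phi>} \<in> U"
    if "f \<in> seqs" for f
    unfolding c1 using Exists.IH[of "case_nat f v", OF s[OF that]] unfolding c2 .
  let ?X = "{i. \<exists>a\<in>carrier A. sat A (case_nat a (\<lambda>j. v j i)) \<phi>}"
  have "sat upow (\<lambda>j. cls (v j)) (Exists \<phi>) \<longleftrightarrow> (\<exists>f\<in>seqs. {i. sat A (case_nat (f i) (\<lambda>j. v j i)) \<phi>} \<in> U)"
    using IH by (simp add: upow_def)
  also have "\<dots> \<longleftrightarrow> ?X \<in> U"
  proof
    assume "\<exists>f\<in>seqs. {i. sat A (case_nat (f i) (\<lambda>j. v j i)) \<phi>} \<in> U"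
    then obtain f where f: "f \<in> seqs" "{i. sat A (case_nat (f i) (\<lambda>j. v j i)) \<phi>} \<in> U" by (rule bexE)
    show "?X \<in> U" by (rule ultra_mono[OF U f(2)]) (use f(1) seqsD in blast)
  next
    assume X: "?X \<in> U"
    define f where "f = (\<lambda>i. if i \<in> ?X then SOME a. a \<in> carrier A \<and> sat A (case_nat a (\<lambda>j. v j i)) \<phi> else \<one>)"
    have f: "f i \<in> carrier A \<and> sat A (case_nat (f i) (\<lambda>j. v j i)) \<phi>" if "i \<in> ?X" for i
    proof -
      have ex: "\<exists>a. a \<in> carrier A \<and> sat A (case_nat a (\<lambda>j. v j i)) \<phi>" using that by blast
      have "f i = (SOME a. a \<in> carrier A \<and> sat A (case_nat a (\<lambda>j. v j i)) \<phi>)" using that by (simp add: f_def)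
      thus ?thesis using someI_ex[OF ex] by simp
    qed
    have "f i \<in> carrier A" for i
    proof (cases "i \<in> ?X")
      case True thus ?thesis using f by blast
    next
      case False
      have "f i = \<one>" unfolding f_def by (rule if_not_P[OF False])
      thus ?thesis by simp
    qed
    hence "f \<in> seqs" by (auto simp: seqs_def)
    moreover have "{i. sat A (case_nat (f i) (\<lambda>j. v j i)) \<phi>} \<in> U"
      by (rule ultra_mono[OF U X]) (use f in blast)
    ultimately show "\<exists>f\<in>seqs. {i. sat A (case_nat (f i) (\<lambda>j. v j i)) \<phi>} \<in> U" by (intro bexI[of _ f])
  qed
  finally show ?case by simp
qed

lemma elem_equiv_upow: "elem_equiv A upow"
proof -
  have "models upow \<phi> \<longleftrightarrow> models A \<phi>" for \<phi>
  proof -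
    have "models upow \<phi> \<longleftrightarrow> {i::nat. models A \<phi>} \<in> U"
      unfolding models_def one_upow using los[of "\<lambda>_ _. \<one>" \<phi>] by simp
    moreover have "{} \<notin> U" using U unfolding ultrafilter_def by blast
    ultimately show ?thesis using ultra_UNIV[OF U] by (cases "models A \<phi>") auto
  qed
  thus ?thesis by (simp add: elem_equiv_def)
qed

text \<open>
  At coordinate \<open>i\<close>, choose an element that satisfies as many of the first
  \<open>i\<close> formulas as possible, in the given order. By finite satisfiability the first
  \<open>m\<close> formulas can be satisfied jointly at almost all coordinates, and almost all
  coordinates exceed \<open>m\<close>, so the chosen sequence satisfies each formula almost
  everywhere.
\<close>

lemma saturated_sequence:
  assumes b: "\<And>m j. b m j \<in> carrier upow"
    and fin: "\<And>n. \<exists>x\<in>carrier upow. \<forall>m\<le>n. sat upow (case_nat x (b m)) (\<phi> m)"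
  shows "\<exists>x\<in>carrier upow. \<forall>m::nat. sat upow (case_nat x (b m)) (\<phi> m)"
proof -
  define r where "r = (\<lambda>m j. rep (b m j))"
  have r: "r m j \<in> seqs" "b m j = cls (r m j)" for m j using rep[OF b] by (auto simp: r_def)
  have los': "sat upow (case_nat (cls f) (b m)) (\<phi> m) \<longleftrightarrow> {i. sat A (case_nat (f i) (\<lambda>j. r m j i)) (\<phi> m)} \<in> U"
    if "f \<in> seqs" for f m
  proof -
    have c1: "case_nat (cls f) (b m) = (\<lambda>j. cls (case_nat f (r m) j))" by (auto split: nat.splits simp: r(2))
    have c2: "(\<lambda>j. case_nat f (r m) j i) = case_nat (f i) (\<lambda>j. r m j i)" for i by (auto split: nat.splits)
    have "case_nat f (r m) j \<in> seqs" for j using that r(1) by (auto split: nat.splits)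
    thus ?thesis unfolding c1 using los[of "case_nat f (r m)" "\<phi> m"] unfolding c2 by simp
  qed
  define X where "X = (\<lambda>n. {i. \<exists>a\<in>carrier A. \<forall>m\<le>n. sat A (case_nat a (\<lambda>j. r m j i)) (\<phi> m)})"
  have XU: "X n \<in> U" for n
  proof -
    obtain x where x: "x \<in> carrier upow" "\<forall>m\<le>n. sat upow (case_nat x (b m)) (\<phi> m)" using fin[of n] by (rule bexE)
    have rx: "rep x \<in> seqs" "cls (rep x) = x" using rep[OF x(1)] .
    have "(\<Inter>m\<in>{..k}. {i. sat A (case_nat (rep x i) (\<lambda>j. r m j i)) (\<phi> m)}) \<in> U" if "k \<le> n" for k
      using that
    proof (induction k)
      case 0 thus ?case using los'[OF rx(1), of 0] x(2) rx(2) by simp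
    next
      case (Suc k)
      have "{i. sat A (case_nat (rep x i) (\<lambda>j. r (Suc k) j i)) (\<phi> (Suc k))} \<in> U"
        using los'[OF rx(1), of "Suc k"] x(2) rx(2) Suc.prems by simp
      thus ?case using Suc ultra_Int[OF U] by (simp add: atMost_Suc)
    qed
    from this[OF order_refl] show ?thesis
      by (rule ultra_mono[OF U]) (use seqsD[OF rx(1)] in \<open>auto simp: X_def\<close>)
  qed
  have Xmono: "i \<in> X n \<Longrightarrow> m \<le> n \<Longrightarrow> i \<in> X m" for i m n unfolding X_def by (auto intro: order_trans)
  \<comment> \<open>The numbers of formulas that are jointly satisfiable at coordinate \<open>i\<close>, cut off at \<open>i\<close> to have a maximum.\<close>
  define K where "K = (\<lambda>i. {n. n \<le> i \<and> i \<in> X n})"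
  define f where "f = (\<lambda>i. if K i = {} then \<one> else
    SOME a. a \<in> carrier A \<and> (\<forall>m\<le>Max (K i). sat A (case_nat a (\<lambda>j. r m j i)) (\<phi> m)))"
  have f: "f i \<in> carrier A \<and> (\<forall>m\<le>Max (K i). sat A (case_nat (f i) (\<lambda>j. r m j i)) (\<phi> m))" if "K i \<noteq> {}" for i
  proof -
    have "finite (K i)" by (simp add: K_def)
    hence "Max (K i) \<in> K i" using that by (rule Max_in)
    hence ex: "\<exists>a. a \<in> carrier A \<and> (\<forall>m\<le>Max (K i). sat A (case_nat a (\<lambda>j. r m j i)) (\<phi> m))"
      unfolding K_def X_def by blast
    have "f i = (SOME a. a \<in> carrier A \<and> (\<forall>m\<le>Max (K i). sat A (case_nat a (\<lambda>j. r m j i)) (\<phi> m)))"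
      unfolding f_def by (rule if_not_P[OF that])
    thus ?thesis using someI_ex[OF ex] by simp
  qed
  have "f i \<in> carrier A" for i
  proof (cases "K i = {}")
    case True
    have "f i = \<one>" unfolding f_def by (rule if_P[OF True])
    thus ?thesis by simp
  next
    case False thus ?thesis using f by blast
  qed
  hence fs: "f \<in> seqs" by (auto simp: seqs_def)
  have "sat upow (case_nat (cls f) (b m)) (\<phi> m)" for m
  proof -
    have "- {i. m \<le> i} = {..<m}" by auto
    hence "{i. m \<le> i} \<in> U" by (intro ultra_cofinite[OF U]) simp
    hence "X m \<inter> {i. m \<le> i} \<in> U" using XU ultra_Int[OF U] by blast
    hence "{i. sat A (case_nat (f i) (\<lambda>j. r m j i)) (\<phi> m)} \<in> U"
    proof (rule ultra_mono[OF U], intro subsetI CollectI)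
      fix i assume "i \<in> X m \<inter> {i. m \<le> i}"
      hence m: "m \<in> K i" by (simp add: K_def)
      have "finite (K i)" by (simp add: K_def)
      hence "m \<le> Max (K i)" using m by (rule Max_ge)
      thus "sat A (case_nat (f i) (\<lambda>j. r m j i)) (\<phi> m)" using f[of i] m by blast
    qed
    thus ?thesis using los'[OF fs] by simp
  qed
  thus ?thesis using cls_carrier[OF fs] by blast
qed

text \<open>
  A type over a countable set consists of countably many formulas once the parameters that do not
  occur are replaced by zero, so it can be listed as a sequence.
\<close>

theorem aleph1_saturated_upow: "aleph1_saturated upow"
  unfolding aleph1_saturated_def
proof (intro allI impI, elim conjE)
  fix C :: "(nat \<Rightarrow> 'a) set set" and \<Gamma> :: "(nat \<Rightarrow> 'a) set pform set"
  assume C: "C \<subseteq> carrier upow" "countable C" and \<Gamma>: "\<forall>\<theta>\<in>\<Gamma>. range (snd \<theta>) \<subseteq> C" and con: "consistent upow \<Gamma>"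
  \<comment> \<open>A bound on the variables of a formula; \<open>tr\<close> resets the parameters beyond this bound.\<close>
  define bd where "bd = (\<lambda>\<phi>. SOME n. form_below n \<phi>)"
  have bd: "form_below (bd \<phi>) \<phi>" for \<phi> unfolding bd_def using form_below_exists by (rule someI_ex)
  define tr :: "(nat \<Rightarrow> 'a) set pform \<Rightarrow> (nat \<Rightarrow> 'a) set pform" where
    "tr = (\<lambda>\<theta>. (fst \<theta>, \<lambda>j. if j < bd (fst \<theta>) then snd \<theta> j else \<one>\<^bsub>upow\<^esub>))"
  have tr: "holds_at upow x (tr \<theta>) \<longleftrightarrow> holds_at upow x \<theta>" for x \<theta>
    unfolding holds_at_def tr_def fst_conv snd_conv
    by (rule sat_below[OF bd]) (auto split: nat.splits)
  have "tr ` \<Gamma> \<subseteq> (\<lambda>(\<phi>, l). (\<phi>, \<lambda>j. if j < length l then l ! j else \<one>\<^bsub>upow\<^esub>)) ` (UNIV \<times> lists C)"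
  proof (rule image_subsetI)
    fix \<theta> assume \<theta>: "\<theta> \<in> \<Gamma>"
    let ?l = "map (snd \<theta>) [0..<bd (fst \<theta>)]"
    have "tr \<theta> = (case (fst \<theta>, ?l) of (\<phi>, l) \<Rightarrow> (\<phi>, \<lambda>j. if j < length l then l ! j else \<one>\<^bsub>upow\<^esub>))"
      by (auto simp: tr_def fun_eq_iff)
    moreover have "(fst \<theta>, ?l) \<in> UNIV \<times> lists C" using bspec[OF \<Gamma> \<theta>] by (auto simp: image_subset_iff)
    ultimately show "tr \<theta> \<in> (\<lambda>(\<phi>, l). (\<phi>, \<lambda>j. if j < length l then l ! j else \<one>\<^bsub>upow\<^esub>)) ` (UNIV \<times> lists C)"
      by (rule image_eqI)
  qed
  moreover have "countable ((\<lambda>(\<phi>::ag_form, l). (\<phi>, \<lambda>j. if j < length l then l ! j else \<one>\<^bsub>upow\<^esub>)) ` (UNIV \<times> lists C))"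
    by (intro countable_image countable_SIGMA countable_lists C(2)) auto
  ultimately have cnt: "countable (tr ` \<Gamma>)" by (rule countable_subset)
  show "realized upow \<Gamma>"
  proof (cases "\<Gamma> = {}")
    case True thus ?thesis using M.one_closed unfolding realized_def by blast
  next
    case False
    define \<theta> where "\<theta> = from_nat_into (tr ` \<Gamma>)"
    have \<theta>: "range \<theta> = tr ` \<Gamma>" unfolding \<theta>_def using False cnt by (simp add: range_from_nat_into)
    have bc: "snd (\<theta> m) j \<in> carrier upow" for m j
    proof -
      have "\<theta> m \<in> tr ` \<Gamma>" using \<theta> by blast
      then obtain \<theta>' where "\<theta>' \<in> \<Gamma>" "\<theta> m = tr \<theta>'" by blast
      moreover have "snd \<theta>' j \<in> carrier upow" using \<Gamma> \<open>\<theta>' \<in> \<Gamma>\<close> C(1) by blast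
      ultimately show ?thesis by (simp add: tr_def)
    qed
    have "\<exists>x\<in>carrier upow. \<forall>m::nat. sat upow (case_nat x (snd (\<theta> m))) (fst (\<theta> m))"
    proof (rule saturated_sequence[OF bc])
      fix n
      have "\<theta> ` {..n} \<subseteq> tr ` \<Gamma>" using \<theta> by blast
      then obtain \<Delta> where \<Delta>: "\<Delta> \<subseteq> \<Gamma>" "finite \<Delta>" "\<theta> ` {..n} = tr ` \<Delta>"
        using finite_subset_image[of "\<theta> ` {..n}" tr \<Gamma>] by blast
      then obtain x where x: "x \<in> carrier upow" "\<forall>\<theta>\<in>\<Delta>. holds_at upow x \<theta>"
        using con unfolding consistent_def realized_def by blast
      have "holds_at upow x (\<theta> m)" if "m \<le> n" for m
      proof -
        have "\<theta> m \<in> tr ` \<Delta>" using \<Delta>(3) that by blast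
        then obtain \<theta>' where "\<theta> m = tr \<theta>'" "\<theta>' \<in> \<Delta>" by (rule imageE)
        thus ?thesis using x(2) tr by simp
      qed
      thus "\<exists>x\<in>carrier upow. \<forall>m\<le>n. sat upow (case_nat x (snd (\<theta> m))) (fst (\<theta> m))"
        using x(1) unfolding holds_at_def by blast
    qed
    then obtain x where x: "x \<in> carrier upow" "\<forall>m. holds_at upow x (\<theta> m)" unfolding holds_at_def by (rule bexE)
    have "holds_at upow x \<theta>'" if "\<theta>' \<in> \<Gamma>" for \<theta>'
    proof -
      have "tr \<theta>' \<in> range \<theta>" using \<theta> that by blast
      then obtain m where "tr \<theta>' = \<theta> m" by (rule rangeE)
      thus ?thesis using x(2) tr by metis
    qed
    thus ?thesis using x(1) unfolding realized_def by blast
  qed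
qed

end

theorem saturated_model_exists:
  fixes A :: "'a monoid"
  assumes "comm_group A"
  shows "\<exists>M :: (nat \<Rightarrow> 'a) set monoid. comm_group M \<and> elem_equiv A M \<and> aleph1_saturated M"
proof -
  obtain U where "ultrafilter U" using ultrafilter_exists by blast
  then interpret ultrapower A U using assms by (simp add: ultrapower_def ultrapower_axioms_def)
  show ?thesis using comm_group_upow elem_equiv_upow aleph1_saturated_upow by blast
qed

section \<open>Indices are elementary invariants\<close>

lemma term_below_lift: "term_below n t \<Longrightarrow> term_below (Suc n) (lift t)"
  by (induction t) auto

lemma form_below_fdivt: "term_below n t \<Longrightarrow> form_below n (fdivt m t)"
  by (simp add: fdivt_def term_below_lift)

lemma sat_Exists_funpow:
  "sat M v ((Exists ^^ n) \<phi>) \<longleftrightarrow>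
    (\<exists>xs. length xs = n \<and> set xs \<subseteq> carrier M \<and> sat M (\<lambda>i. if i < n then xs ! i else v (i - n)) \<phi>)"
proof (induction n arbitrary: v)
  case 0 thus ?case by simp
next
  case (Suc n)
  have e: "(\<lambda>i. if i < n then xs ! i else case_nat a v (i - n)) = (\<lambda>i. if i < Suc n then (xs @ [a]) ! i else v (i - Suc n))"
    if "length xs = n" for xs a
  proof
    fix i show "(if i < n then xs ! i else case_nat a v (i - n)) = (if i < Suc n then (xs @ [a]) ! i else v (i - Suc n))"
    proof (cases "i \<le> n")
      case True thus ?thesis using that by (cases "i = n") (auto simp: nth_append)
    next
      case False
      then obtain d where "i = Suc n + d" using less_iff_Suc_add[of n i] by auto
      thus ?thesis by (simp add: Suc_diff_le)
    qed
  qed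
  let ?P = "\<lambda>ys. length ys = Suc n \<and> set ys \<subseteq> carrier M \<and> sat M (\<lambda>i. if i < Suc n then ys ! i else v (i - Suc n)) \<phi>"
  have "sat M v ((Exists ^^ Suc n) \<phi>) \<longleftrightarrow> (\<exists>a\<in>carrier M. \<exists>xs. length xs = n \<and> set xs \<subseteq> carrier M \<and>
      sat M (\<lambda>i. if i < n then xs ! i else case_nat a v (i - n)) \<phi>)"
    using Suc by simp
  also have "\<dots> \<longleftrightarrow> (\<exists>a\<in>carrier M. \<exists>xs. length xs = n \<and> set xs \<subseteq> carrier M \<and>
      sat M (\<lambda>i. if i < Suc n then (xs @ [a]) ! i else v (i - Suc n)) \<phi>)"
    by (intro bex_cong refl ex_cong1 conj_cong) (simp only: e)
  also have "\<dots> \<longleftrightarrow> (\<exists>ys. ?P ys)"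
  proof
    assume "\<exists>a\<in>carrier M. \<exists>xs. length xs = n \<and> set xs \<subseteq> carrier M \<and>
      sat M (\<lambda>i. if i < Suc n then (xs @ [a]) ! i else v (i - Suc n)) \<phi>"
    then obtain a xs where h: "a \<in> carrier M" "length xs = n" "set xs \<subseteq> carrier M"
      "sat M (\<lambda>i. if i < Suc n then (xs @ [a]) ! i else v (i - Suc n)) \<phi>" by (elim bexE exE conjE)
    show "\<exists>ys. ?P ys" using h by (intro exI[of _ "xs @ [a]"]) simp
  next
    assume "\<exists>ys. ?P ys"
    then obtain ys where h: "length ys = Suc n" "set ys \<subseteq> carrier M"
      "sat M (\<lambda>i. if i < Suc n then ys ! i else v (i - Suc n)) \<phi>" by (elim exE conjE)
    obtain xs a where ys: "ys = xs @ [a]" using h(1) by (metis length_Suc_conv_rev)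
    show "\<exists>a\<in>carrier M. \<exists>xs. length xs = n \<and> set xs \<subseteq> carrier M \<and>
      sat M (\<lambda>i. if i < Suc n then (xs @ [a]) ! i else v (i - Suc n)) \<phi>"
      using h unfolding ys by (intro bexI[of _ a] exI[of _ xs]) simp_all
  qed
  finally show ?case .
qed

lemma form_below_Exists_funpow: "form_below (n + m) \<phi> \<Longrightarrow> form_below m ((Exists ^^ n) \<phi>)"
  by (induction n arbitrary: m) simp_all

lemma form_below_cj: assumes "finite S" "\<And>\<psi>. \<psi> \<in> S \<Longrightarrow> form_below n \<psi>" shows "form_below n (cj S)"
proof -
  have "(\<forall>\<psi>\<in>set xs. form_below n \<psi>) \<Longrightarrow> form_below n (foldr Conj xs (Equal Zero Zero))" for xs
    by (induction xs) auto
  thus ?thesis unfolding cj_def using set_some_list[OF assms(1)] assms(2) by blast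
qed

definition in_form :: "(nat \<times> int) set \<Rightarrow> ag_term \<Rightarrow> ag_form" where
  "in_form L t = cj ((\<lambda>(n, a). fdivt n (smul a t)) ` L)"

lemma (in comm_group) sat_in_form:
  assumes "range v \<subseteq> carrier G" "finite L" shows "sat G v (in_form L t) \<longleftrightarrow> term_val G v t \<in> sol G L"
proof -
  have "term_val G v t \<in> carrier G" using assms(1) by blast
  thus ?thesis unfolding in_form_def using assms by (auto simp: sat_fdivt sol_def)
qed

lemma form_below_in_form: "finite L \<Longrightarrow> term_below n t \<Longrightarrow> form_below n (in_form L t)"
  unfolding in_form_def by (rule form_below_cj) (auto intro: form_below_fdivt)

text \<open>
  There are \<open>N\<close> solutions of \<open>L\<close> that are pairwise incongruent modulo
  the solutions of \<open>K\<close>.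
\<close>

definition index_form :: "nat \<Rightarrow> (nat \<times> int) set \<Rightarrow> (nat \<times> int) set \<Rightarrow> ag_form" where
  "index_form N L K = (Exists ^^ N) (Conj (cj ((\<lambda>i. in_form L (Var i)) ` {..<N}))
     (cj ((\<lambda>(i, j). Negation (in_form K (Plus (Var i) (Minus (Var j))))) ` {(i, j). i < N \<and> j < i})))"

lemma finite_pairs: "finite {(i, j). i < (N::nat) \<and> j < i}"
  by (rule finite_subset[of _ "{..<N} \<times> {..<N}"]) auto

lemma sentence_index_form:
  assumes "finite L" "finite K" shows "sentence (index_form N L K)"
  unfolding index_form_def
proof (rule form_below_Exists_funpow)
  have "form_below N (cj ((\<lambda>i. in_form L (Var i)) ` {..<N}))"
    by (rule form_below_cj) (auto intro!: form_below_in_form assms)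
  moreover have "form_below N (cj ((\<lambda>(i, j). Negation (in_form K (Plus (Var i) (Minus (Var j))))) ` {(i, j). i < N \<and> j < i}))"
    by (rule form_below_cj) (auto intro!: form_below_in_form assms finite_imageI finite_pairs)
  ultimately show "form_below (N + 0) (Conj (cj ((\<lambda>i. in_form L (Var i)) ` {..<N}))
     (cj ((\<lambda>(i, j). Negation (in_form K (Plus (Var i) (Minus (Var j))))) ` {(i, j). i < N \<and> j < i})))" by simp
qed

lemma ecard_image_ge:
  "enat N \<le> ecard (f ` H) \<longleftrightarrow> (\<exists>xs. length xs = N \<and> set xs \<subseteq> H \<and> (\<forall>i<N. \<forall>j<i. f (xs ! i) \<noteq> f (xs ! j)))"
proof
  assume "enat N \<le> ecard (f ` H)"
  hence "\<exists>S. S \<subseteq> f ` H \<and> finite S \<and> card S = N"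
  proof (cases "finite (f ` H)")
    case True
    hence "N \<le> card (f ` H)" using \<open>enat N \<le> ecard (f ` H)\<close> by (simp add: ecard_def)
    then obtain S where "S \<subseteq> f ` H" "card S = N" "finite S" using obtain_subset_with_card_n by blast
    thus ?thesis by blast
  next
    case False
    show ?thesis using infinite_arbitrarily_large[OF False, of N] by blast
  qed
  then obtain S where S: "S \<subseteq> f ` H" "finite S" "card S = N" by blast
  obtain ys where ys: "set ys = S" "distinct ys" using finite_distinct_list[OF S(2)] by blast
  define g where "g = inv_into H f"
  have g: "g y \<in> H" "f (g y) = y" if "y \<in> S" for y
    using that S(1) unfolding g_def by (auto intro: inv_into_into f_inv_into_f)
  have len: "length ys = N" using ys S(3) distinct_card by metis
  have "f (map g ys ! i) \<noteq> f (map g ys ! j)" if "i < N" "j < i" for i j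
  proof -
    have "ys ! i \<noteq> ys ! j" using ys(2) that len by (simp add: nth_eq_iff_index_eq)
    moreover have "ys ! i \<in> S" "ys ! j \<in> S" using ys(1) that len by (auto intro: nth_mem)
    ultimately show ?thesis using g(2) that len by simp
  qed
  thus "\<exists>xs. length xs = N \<and> set xs \<subseteq> H \<and> (\<forall>i<N. \<forall>j<i. f (xs ! i) \<noteq> f (xs ! j))"
    using len g(1) ys(1) by (intro exI[of _ "map g ys"]) auto
next
  assume "\<exists>xs. length xs = N \<and> set xs \<subseteq> H \<and> (\<forall>i<N. \<forall>j<i. f (xs ! i) \<noteq> f (xs ! j))"
  then obtain xs where xs: "length xs = N" "set xs \<subseteq> H" "\<And>i j. i < N \<Longrightarrow> j < i \<Longrightarrow> f (xs ! i) \<noteq> f (xs ! j)" by blast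
  have "f (xs ! i) \<noteq> f (xs ! j)" if "i < N" "j < N" "i \<noteq> j" for i j
    using xs(3)[of i j] xs(3)[of j i] that by (metis nat_neq_iff)
  hence "inj_on (\<lambda>i. f (xs ! i)) {..<N}" by (intro inj_onI) auto
  hence "ecard ((\<lambda>i. f (xs ! i)) ` {..<N}) = enat N" by (simp add: ecard_def card_image)
  moreover have "(\<lambda>i. f (xs ! i)) ` {..<N} \<subseteq> f ` H" using xs(1,2) by (auto intro!: imageI subsetD[OF xs(2)])
  ultimately show "enat N \<le> ecard (f ` H)" by (metis ecard_mono)
qed

lemma (in comm_group) models_index_form:
  assumes "finite L" "finite K"
  shows "models G (index_form N L K) \<longleftrightarrow> enat N \<le> sidx G L K"
proof -
  have "models G (index_form N L K) \<longleftrightarrow> (\<exists>xs. length xs = N \<and> set xs \<subseteq> carrier G \<and>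
      (\<forall>i<N. xs ! i \<in> sol G L) \<and> (\<forall>i<N. \<forall>j<i. xs ! i \<otimes> inv (xs ! j) \<notin> sol G K))"
    unfolding models_def index_form_def sat_Exists_funpow
  proof (intro ex_cong1 conj_cong refl)
    fix xs assume xs: "length xs = N" "set xs \<subseteq> carrier G"
    let ?v = "\<lambda>i. if i < N then xs ! i else \<one>"
    have r: "range ?v \<subseteq> carrier G"
    proof (rule image_subsetI)
      fix i
      have "i < N \<Longrightarrow> xs ! i \<in> carrier G" using nth_mem[of i xs] xs by blast
      thus "?v i \<in> carrier G" by simp
    qed
    have f: "finite ((\<lambda>(i, j). Negation (in_form K (Plus (Var i) (Minus (Var j))))) ` {(i, j). i < N \<and> j < i})"
      by (intro finite_imageI finite_pairs)
    show "sat G ?v (Conj (cj ((\<lambda>i. in_form L (Var i)) ` {..<N}))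
       (cj ((\<lambda>(i, j). Negation (in_form K (Plus (Var i) (Minus (Var j))))) ` {(i, j). i < N \<and> j < i}))) \<longleftrightarrow>
      (\<forall>i<N. xs ! i \<in> sol G L) \<and> (\<forall>i<N. \<forall>j<i. xs ! i \<otimes> inv (xs ! j) \<notin> sol G K)"
      using f by (auto simp: sat_in_form[OF r assms(1)] sat_in_form[OF r assms(2)])
  qed
  also have "\<dots> \<longleftrightarrow> (\<exists>xs. length xs = N \<and> set xs \<subseteq> sol G L \<and> (\<forall>i<N. \<forall>j<i. sol G K #> (xs ! i) \<noteq> sol G K #> (xs ! j)))"
  proof (rule ex_cong1)
    fix xs :: "'a list"
    have "(\<forall>i<N. \<forall>j<i. xs ! i \<otimes> inv (xs ! j) \<notin> sol G K) \<longleftrightarrow> (\<forall>i<N. \<forall>j<i. sol G K #> (xs ! i) \<noteq> sol G K #> (xs ! j))"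
      if "length xs = N" "set xs \<subseteq> carrier G"
    proof -
      have "xs ! i \<in> carrier G" if "i < N" for i using that \<open>length xs = N\<close> \<open>set xs \<subseteq> carrier G\<close> by auto
      thus ?thesis using rcos_eq_iff[OF sol_subgroup[of K]] by (meson less_trans)
    qed
    moreover have "set xs \<subseteq> sol G L \<longleftrightarrow> set xs \<subseteq> carrier G \<and> (\<forall>i<N. xs ! i \<in> sol G L)" if "length xs = N"
      using that sol_carrier[of L] by (auto simp: in_set_conv_nth subset_iff)
    ultimately show "(length xs = N \<and> set xs \<subseteq> carrier G \<and> (\<forall>i<N. xs ! i \<in> sol G L) \<and> (\<forall>i<N. \<forall>j<i. xs ! i \<otimes> inv (xs ! j) \<notin> sol G K)) \<longleftrightarrow>
      (length xs = N \<and> set xs \<subseteq> sol G L \<and> (\<forall>i<N. \<forall>j<i. sol G K #> (xs ! i) \<noteq> sol G K #> (xs ! j)))" by blast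
  qed
  finally show ?thesis unfolding idx_def ecard_image_ge .
qed

text \<open>
  The sentences \<open>index_form N L K\<close> bound the index from below by each natural number.
\<close>

theorem elem_equiv_idx:
  assumes "comm_group M" "comm_group N" "elem_equiv M N" "finite L" "finite K"
  shows "sidx M L K = sidx N L K"
proof -
  have "enat n \<le> sidx M L K \<longleftrightarrow> enat n \<le> sidx N L K" for n
    using assms(3) sentence_index_form[OF assms(4,5), of n]
      comm_group.models_index_form[OF assms(1,4,5), of n] comm_group.models_index_form[OF assms(2,4,5), of n]
    unfolding elem_equiv_def by blast
  moreover have "x = y" if "\<And>n. enat n \<le> x \<longleftrightarrow> enat n \<le> y" for x y :: enat
  proof (cases x; cases y)
    fix m assume "x = enat m" "y = \<infinity>" thus ?thesis using that[of "Suc m"] by simp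
  next
    fix m assume "x = \<infinity>" "y = enat m" thus ?thesis using that[of "Suc m"] by simp
  next
    fix m n assume "x = enat m" "y = enat n" thus ?thesis using that[of m] that[of n] by simp
  qed simp
  ultimately show ?thesis by blast
qed

context comm_group begin

lemma multiples_sol: "multiples G n = sol G {(n, 1)}"
  using multiples_carrier[of n] by (auto simp: sol_def)

lemma carrier_sol: "carrier G = sol G {}" by simp

lemma torsion_sol: "torsion_part G (multiples G n) p = sol G {(n, 1), (0, int p)}"
  using multiples_carrier[of n] by (auto simp: sol_def torsion_part_iff)

lemma infinite_FactGroup_iff: "infinite (carrier (G Mod multiples G p)) \<longleftrightarrow> idx G (carrier G) (multiples G p) = \<infinity>"
  by (simp add: idx_def ecard_infinite_iff carrier_FactGroup)

lemma infinite_ulm_quotient_iff: "infinite (carrier (ulm_quotient G p n)) \<longleftrightarrow> ulm G p n = \<infinity>"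
proof -
  let ?T = "torsion_part G (multiples G (p ^ n)) p" and ?K = "torsion_part G (multiples G (p ^ (n + 1))) p"
  have K: "?K = ?T \<inter> multiples G (p ^ (n + 1))"
    using multiples_dvd[of "p ^ n" "p ^ (n + 1)"] by (auto simp: torsion_part_def)
  have "carrier (ulm_quotient G p n) = (\<lambda>x. ?K #> x) ` ?T"
    unfolding ulm_quotient_def carrier_FactGroup by (simp add: r_coset_def)
  hence "infinite (carrier (ulm_quotient G p n)) \<longleftrightarrow> idx G ?T ?K = \<infinity>" by (simp add: idx_def ecard_infinite_iff)
  also have "idx G ?T ?K = ulm G p n" unfolding K ulm_def by (rule idx_Int_left) auto
  finally show ?thesis .
qed

end

lemma (in comm_group) ulm_sol: "ulm G p n = sidx G {(p ^ n, 1), (0, int p)} {(p ^ (n + 1), 1)}"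
  unfolding ulm_def torsion_sol by (simp only: multiples_sol[of "p ^ (n + 1)"])

definition finite_conditions :: "('a, 'b) monoid_scheme \<Rightarrow> bool" where
  "finite_conditions G \<longleftrightarrow> finite {p. prime p \<and> idx G (carrier G) (multiples G p) = \<infinity>} \<and>
     (\<forall>p. prime p \<longrightarrow> finite {n. ulm G p n = \<infinity>})"

lemma elem_equiv_ulm:
  assumes "comm_group M" "comm_group N" "elem_equiv M N" shows "ulm M p n = ulm N p n"
  unfolding comm_group.ulm_sol[OF assms(1)] comm_group.ulm_sol[OF assms(2)]
  by (rule elem_equiv_idx[OF assms]) auto

lemma elem_equiv_index_multiples:
  assumes "comm_group M" "comm_group N" "elem_equiv M N"
  shows "idx M (carrier M) (multiples M p) = idx N (carrier N) (multiples N p)"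
  unfolding comm_group.carrier_sol[OF assms(1)] comm_group.carrier_sol[OF assms(2)]
    comm_group.multiples_sol[OF assms(1)] comm_group.multiples_sol[OF assms(2)]
  by (rule elem_equiv_idx[OF assms]) auto

lemma elem_equiv_finite_conditions:
  assumes "comm_group M" "comm_group N" "elem_equiv M N"
  shows "finite_conditions M \<longleftrightarrow> finite_conditions N"
  unfolding finite_conditions_def
  using elem_equiv_ulm[OF assms] elem_equiv_index_multiples[OF assms] by simp

section \<open>inp-patterns of infinite depth\<close>

text \<open>
  The condition that \<open>n\<close> divides \<open>a (x - y)\<close>, with the parameter
  \<open>y\<close> as variable 1.
\<close>

definition cong_form :: "nat \<Rightarrow> int \<Rightarrow> ag_form" where
  "cong_form n a = fdivt n (smul a (Plus (Var 0) (Minus (Var 1))))"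

context comm_group begin

lemma sat_cong_form:
  assumes "x \<in> carrier G" "e \<in> carrier G"
  shows "sat G (case_nat x (\<lambda>_. e)) (cong_form n a) \<longleftrightarrow> x \<otimes> inv e \<in> sol G {(n, a)}"
proof -
  have r: "range (case_nat x (\<lambda>_. e)) \<subseteq> carrier G" using assms by (intro range_case_nat) auto
  show ?thesis unfolding cong_form_def sat_fdivt[OF r] using assms r by (simp add: sol1_iff)
qed

text \<open>
  The instances of a congruence at pairwise incongruent parameters define disjoint cosets, so any
  two formulas of a row are inconsistent. Paths are consistent by the simultaneous solvability of
  finitely many congruences.
\<close>

lemma congruences_inp_pattern:
  fixes n :: "nat \<Rightarrow> nat" and e :: "nat \<Rightarrow> nat \<Rightarrow> 'a"
  assumes e: "\<And>\<alpha> i. \<alpha> \<in> I \<Longrightarrow> e \<alpha> i \<in> carrier G"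
    and distinct: "\<And>\<alpha> i j. \<alpha> \<in> I \<Longrightarrow> i \<noteq> j \<Longrightarrow> e \<alpha> i \<otimes> inv (e \<alpha> j) \<notin> sol G {(n \<alpha>, a \<alpha>)}"
    and solve: "\<And>F \<eta>. finite F \<Longrightarrow> F \<subseteq> I \<Longrightarrow> \<exists>x\<in>carrier G. \<forall>\<alpha>\<in>F. x \<otimes> inv (e \<alpha> (\<eta> \<alpha>)) \<in> sol G {(n \<alpha>, a \<alpha>)}"
  shows "inp_pattern G (x_eq_x G) I (\<lambda>\<alpha>. cong_form (n \<alpha>) (a \<alpha>)) (\<lambda>_. 2)"
  unfolding inp_pattern_def
proof (intro exI[of _ "\<lambda>\<alpha> i (_::nat). e \<alpha> i"] conjI ballI allI)
  fix \<alpha> i assume "\<alpha> \<in> I" thus "range (\<lambda>_::nat. e \<alpha> i) \<subseteq> carrier G" using e by auto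
next
  fix \<alpha> assume \<alpha>: "\<alpha> \<in> I"
  show "k_inconsistent G 2 (\<lambda>i. (cong_form (n \<alpha>) (a \<alpha>), \<lambda>_. e \<alpha> i))"
    unfolding k_inconsistent_def
  proof (intro allI impI notI)
    fix S :: "nat set" assume S: "finite S \<and> card S = 2"
      and con: "consistent G ((\<lambda>i. (cong_form (n \<alpha>) (a \<alpha>), \<lambda>_. e \<alpha> i)) ` S)"
    obtain i j where ij: "S = {i, j}" "i \<noteq> j" using S card_2_iff by metis
    have "realized G ((\<lambda>i. (cong_form (n \<alpha>) (a \<alpha>), \<lambda>_. e \<alpha> i)) ` S)"
      using con S unfolding consistent_def by blast
    then obtain x where x: "x \<in> carrier G" "sat G (case_nat x (\<lambda>_. e \<alpha> i)) (cong_form (n \<alpha>) (a \<alpha>))"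
      "sat G (case_nat x (\<lambda>_. e \<alpha> j)) (cong_form (n \<alpha>) (a \<alpha>))"
      unfolding realized_def holds_at_def ij by auto
    have c: "e \<alpha> i \<in> carrier G" "e \<alpha> j \<in> carrier G" using e \<alpha> by auto
    have "x \<otimes> inv (e \<alpha> i) \<in> sol G {(n \<alpha>, a \<alpha>)}" "x \<otimes> inv (e \<alpha> j) \<in> sol G {(n \<alpha>, a \<alpha>)}"
      using x sat_cong_form c by auto
    hence "inv (x \<otimes> inv (e \<alpha> i)) \<otimes> (x \<otimes> inv (e \<alpha> j)) \<in> sol G {(n \<alpha>, a \<alpha>)}"
      using subgroup.m_closed[OF sol_subgroup] subgroup.m_inv_closed[OF sol_subgroup] by blast
    moreover have "inv (x \<otimes> inv (e \<alpha> i)) \<otimes> (x \<otimes> inv (e \<alpha> j)) = e \<alpha> i \<otimes> inv (e \<alpha> j)"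
    proof -
      have "inv (x \<otimes> inv (e \<alpha> i)) = e \<alpha> i \<otimes> inv x" using x c by (simp add: inv_mult_group)
      moreover have "e \<alpha> i \<otimes> inv x \<otimes> (x \<otimes> inv (e \<alpha> j)) = (e \<alpha> i \<otimes> inv (e \<alpha> j)) \<otimes> (x \<otimes> inv x)"
        using x c by (simp only: m_ac m_closed inv_closed)
      ultimately show ?thesis using x c by simp
    qed
    ultimately show False using distinct[OF \<alpha> ij(2)] by simp
  qed
next
  fix \<eta>
  let ?f = "\<lambda>\<alpha>. (cong_form (n \<alpha>) (a \<alpha>), \<lambda>_::nat. e \<alpha> (\<eta> \<alpha>))"
  show "consistent G (x_eq_x G \<union> ?f ` I)"
    unfolding consistent_def
  proof (intro allI impI)
    fix \<Delta> assume \<Delta>: "\<Delta> \<subseteq> x_eq_x G \<union> ?f ` I" "finite \<Delta>"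
    have "\<exists>F\<subseteq>I. finite F \<and> \<Delta> \<inter> ?f ` I = ?f ` F"
      by (rule finite_subset_image) (use \<Delta>(2) in simp_all)
    then obtain F where F: "F \<subseteq> I" "finite F" "\<Delta> \<inter> ?f ` I = ?f ` F" by (elim exE conjE)
    obtain x where x: "x \<in> carrier G" "\<forall>\<alpha>\<in>F. x \<otimes> inv (e \<alpha> (\<eta> \<alpha>)) \<in> sol G {(n \<alpha>, a \<alpha>)}"
      using solve[OF F(2,1)] by (rule bexE)
    have "holds_at G x \<theta>" if "\<theta> \<in> \<Delta>" for \<theta>
    proof (cases "\<theta> \<in> ?f ` I")
      case True
      hence "\<theta> \<in> ?f ` F" using that F(3) by blast
      then obtain \<alpha> where \<alpha>: "\<theta> = ?f \<alpha>" "\<alpha> \<in> F" by (rule imageE)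
      have "e \<alpha> (\<eta> \<alpha>) \<in> carrier G" using e \<alpha>(2) F(1) by blast
      thus ?thesis unfolding \<alpha>(1) holds_at_def fst_conv snd_conv using sat_cong_form[OF x(1)] x(2) \<alpha>(2) by blast
    next
      case False
      hence "\<theta> \<in> x_eq_x G" using \<Delta>(1) that by blast
      thus ?thesis by (auto simp: x_eq_x_def holds_at_def)
    qed
    thus "realized G \<Delta>" unfolding realized_def using x(1) by blast
  qed
qed

lemma infinite_index_sequence:
  assumes "idx G H K = \<infinity>" "subgroup K G" "H \<subseteq> carrier G"
  shows "\<exists>e :: nat \<Rightarrow> 'a. (\<forall>i. e i \<in> H) \<and> (\<forall>i j. i \<noteq> j \<longrightarrow> e i \<otimes> inv (e j) \<notin> K)"
proof -
  have "infinite ((\<lambda>x. K #> x) ` H)" using assms(1) by (simp add: idx_def ecard_infinite_iff)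
  then obtain f :: "nat \<Rightarrow> 'a set" where f: "inj f" "range f \<subseteq> (\<lambda>x. K #> x) ` H"
    using infinite_countable_subset by blast
  have "\<forall>i. \<exists>x. x \<in> H \<and> f i = K #> x" using f(2) by blast
  then obtain e where e: "\<And>i. e i \<in> H \<and> f i = K #> e i" by metis
  have "e i \<otimes> inv (e j) \<notin> K" if "i \<noteq> j" for i j
  proof
    assume "e i \<otimes> inv (e j) \<in> K"
    hence "K #> e i = K #> e j" using rcos_eq_iff[OF assms(2)] e assms(3) by blast
    hence "f i = f j" using e by simp
    thus False using f(1) that by (simp add: inj_eq)
  qed
  thus ?thesis using e by blast
qed

text \<open>
  A solution for \<open>F\<close> is corrected by a multiple of \<open>N = \<Prod>F\<close>, which
  is invertible modulo the new prime.
\<close>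

lemma chinese_remainder:
  assumes "finite F" "\<And>p. p \<in> F \<Longrightarrow> prime p \<and> e p \<in> carrier G"
  shows "\<exists>x\<in>carrier G. \<forall>p\<in>F. x \<otimes> inv (e p) \<in> multiples G p"
  using assms
proof (induction F rule: finite_induct)
  case empty thus ?case by (intro bexI[of _ \<one>]) auto
next
  case (insert q F)
  obtain x where x: "x \<in> carrier G" "\<forall>p\<in>F. x \<otimes> inv (e p) \<in> multiples G p" using insert by auto
  have q: "prime q" "e q \<in> carrier G" using insert.prems by auto
  define N where "N = \<Prod>F"
  have "coprime q N" unfolding N_def
  proof (rule prod_coprime_right)
    fix p assume "p \<in> F"
    hence "prime p" "p \<noteq> q" using insert by auto
    thus "coprime q p" using q(1) primes_coprime by blast
  qed
  then obtain u v where uv: "u * int q + v * int N = 1"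
    using bezout_int[of "int q" "int N"] by (metis coprime_int_iff coprime_imp_gcd_eq_1)
  define d where "d = e q \<otimes> inv x"
  have dc: "d \<in> carrier G" using q x by (simp add: d_def)
  let ?y = "x \<otimes> d [^] (v * int N)"
  have yc: "?y \<in> carrier G" using x dc by simp
  have swap: "?y \<otimes> inv z = (x \<otimes> inv z) \<otimes> d [^] (v * int N)" if "z \<in> carrier G" for z
    using x(1) dc that by (simp add: m_ac)
  have "?y \<otimes> inv (e p) \<in> multiples G p" if p: "p \<in> F" for p
  proof -
    have "p dvd N" unfolding N_def using p insert.hyps by (intro dvd_prodI) auto
    hence "d [^] (v * int N) \<in> multiples G p" using dc by (intro pow_mult_in_multiples) simp_all
    thus ?thesis using swap[of "e p"] x(2) p insert.prems subgroup.m_closed[OF multiples_subgroup] by auto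
  qed
  moreover have "?y \<otimes> inv (e q) \<in> multiples G q"
  proof -
    have vN: "v * int N = 1 + (- u) * int q" using uv by simp
    have "d [^] (v * int N) = d \<otimes> d [^] ((- u) * int q)" unfolding vN using dc by (simp only: int_pow_mult int_pow_1)
    hence "?y \<otimes> inv (e q) = (x \<otimes> inv (e q)) \<otimes> d \<otimes> d [^] ((- u) * int q)"
      using swap[OF q(2)] x(1) q(2) dc by (simp add: m_assoc)
    also have "(x \<otimes> inv (e q)) \<otimes> d = \<one>"
    proof -
      have "(x \<otimes> inv (e q)) \<otimes> (e q \<otimes> inv x) = (x \<otimes> inv x) \<otimes> (e q \<otimes> inv (e q))"
        using x(1) q(2) by (simp only: m_ac m_closed inv_closed)
      thus ?thesis using x(1) q(2) by (simp add: d_def)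
    qed
    also have "\<one> \<otimes> d [^] ((- u) * int q) = d [^] ((- u) * int q)" using dc by simp
    also have "\<dots> \<in> multiples G q" using dc by (intro pow_mult_in_multiples) simp_all
    finally show ?thesis .
  qed
  ultimately show ?case using yc by (intro bexI[of _ ?y]) auto
qed

lemma infinitely_many_primes_pattern:
  fixes I :: "nat set"
  assumes I: "I = {p. prime p \<and> idx G (carrier G) (multiples G p) = \<infinity>}"
  shows "\<exists>\<phi> k. inp_pattern G (x_eq_x G) I \<phi> k"
proof -
  have "\<forall>p\<in>I. \<exists>e :: nat \<Rightarrow> 'a. (\<forall>i. e i \<in> carrier G) \<and> (\<forall>i j. i \<noteq> j \<longrightarrow> e i \<otimes> inv (e j) \<notin> multiples G p)"
    unfolding I using infinite_index_sequence multiples_subgroup by blast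
  then obtain e where e': "\<forall>p\<in>I. (\<forall>i::nat. e p i \<in> carrier G) \<and> (\<forall>i j. i \<noteq> j \<longrightarrow> e p i \<otimes> inv (e p j) \<notin> multiples G p)"
    by (rule bchoice[THEN exE])
  have e: "\<And>p i. p \<in> I \<Longrightarrow> e p i \<in> carrier G"
    "\<And>p i j. p \<in> I \<Longrightarrow> i \<noteq> j \<Longrightarrow> e p i \<otimes> inv (e p j) \<notin> multiples G p" using e' by simp_all
  have "inp_pattern G (x_eq_x G) I (\<lambda>p. cong_form (id p) 1) (\<lambda>_. 2)"
  proof (rule congruences_inp_pattern[where e = e])
    show "\<exists>x\<in>carrier G. \<forall>p\<in>F. x \<otimes> inv (e p (\<eta> p)) \<in> sol G {(id p, 1)}" if "finite F" "F \<subseteq> I" for F \<eta>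
      unfolding multiples_sol[symmetric] id_apply
      by (rule chinese_remainder[OF that(1)]) (use that(2) e(1) I in blast)
  qed (use e in \<open>simp_all add: multiples_sol[symmetric]\<close>)
  thus ?thesis by blast
qed

text \<open>
  The sum of the elements \<open>e l\<close> over \<open>F\<close>, each of which is invisible to
  the other groups.
\<close>

lemma orthogonal_solution:
  assumes "finite F" "\<And>l. e l \<in> carrier G" "\<And>l. subgroup (S l) G" "\<And>l l'. l \<noteq> l' \<Longrightarrow> e l \<in> S l'"
  shows "\<exists>x\<in>carrier G. (\<forall>l\<in>F. x \<otimes> inv (e l) \<in> S l) \<and> (\<forall>l. l \<notin> F \<longrightarrow> x \<in> S l)"
  using assms(1)
proof (induction F rule: finite_induct)
  case empty
  thus ?case using subgroup.one_closed[OF assms(3)] by (intro bexI[of _ \<one>]) auto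
next
  case (insert l F)
  obtain x where x: "x \<in> carrier G" "\<And>l. l \<in> F \<Longrightarrow> x \<otimes> inv (e l) \<in> S l" "\<And>l. l \<notin> F \<Longrightarrow> x \<in> S l" using insert.IH by blast
  let ?y = "x \<otimes> e l"
  have "?y \<otimes> inv (e l') \<in> S l'" if "l' \<in> insert l F" for l'
  proof (cases "l' = l")
    case True
    have "?y \<otimes> inv (e l) = x" using x(1) assms(2) by (simp add: m_assoc)
    thus ?thesis using x(3) insert.hyps True by simp
  next
    case False
    have "?y \<otimes> inv (e l') = (x \<otimes> inv (e l')) \<otimes> e l" using x(1) assms(2) by (simp add: m_ac)
    moreover have "x \<otimes> inv (e l') \<in> S l'" using x(2) that False by blast
    ultimately show ?thesis using subgroup.m_closed[OF assms(3)] assms(4)[of l l'] False by metis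
  qed
  moreover have "?y \<in> S l'" if "l' \<notin> insert l F" for l'
    using x(3)[of l'] assms(4)[of l l'] that subgroup.m_closed[OF assms(3)] by blast
  ultimately show ?case using x(1) assms(2) by (intro bexI[of _ ?y]) auto
qed

text \<open>
  Let \<open>n l\<close> enumerate levels with infinite Ulm quotients, so far apart that \<open>n
  l - l\<close> increases strictly. Representatives \<open>c l i\<close> of distinct classes of
  the \<open>n l\<close>-th quotient are written as \<open>p^(n l) y l i\<close>, and row
  \<open>l\<close> says that \<open>p^(n l + 1)\<close> divides \<open>p^(n l - l) (x - e l
  i)\<close> with \<open>e l i = p^l y l i\<close>. Multiplied by \<open>p^(n l - l)\<close>, the
  parameters of row \<open>l\<close> become the incongruent elements \<open>c l i\<close>. The
  parameters of any other row satisfy the homogeneous condition: a later row because its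
  parameters are divisible by a sufficiently high power of \<open>p\<close>, an earlier row
  because the multiplication annihilates them.
\<close>

lemma infinitely_many_ulm_pattern:
  assumes p: "prime p" and inf: "infinite {n. ulm G p n = \<infinity>}" (is "infinite ?X")
  shows "\<exists>\<phi> k. inp_pattern G (x_eq_x G) (UNIV :: nat set) \<phi> k"
proof -
  \<comment> \<open>Every other level is taken, so that consecutive levels differ by at least 2.\<close>
  define n where "n = (\<lambda>l. enumerate ?X (2 * l))"
  have nX: "ulm G p (n l) = \<infinity>" for l using enumerate_in_set[OF inf, of "2 * l"] by (simp add: n_def)
  have step: "n l + 2 \<le> n (Suc l)" for l
    using enumerate_step[OF inf, of "2 * l"] enumerate_step[OF inf, of "Suc (2 * l)"] by (simp add: n_def)
  have gap: "n l + 2 * d \<le> n (l + d)" for l d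
  proof (induction d)
    case (Suc d) thus ?case using step[of "l + d"] by simp
  qed simp
  have nl: "l \<le> n l" for l using gap[of 0 l] by simp
  have "\<exists>c :: nat \<Rightarrow> 'a. (\<forall>i. c i \<in> torsion_part G (multiples G (p ^ n l)) p) \<and>
      (\<forall>i j. i \<noteq> j \<longrightarrow> c i \<otimes> inv (c j) \<notin> multiples G (p ^ (n l + 1)))" for l
    by (rule infinite_index_sequence)
       (use nX[of l] multiples_carrier in \<open>auto simp: ulm_def torsion_part_def\<close>)
  hence "\<forall>l. \<exists>c :: nat \<Rightarrow> 'a. (\<forall>i. c i \<in> torsion_part G (multiples G (p ^ n l)) p) \<and>
      (\<forall>i j. i \<noteq> j \<longrightarrow> c i \<otimes> inv (c j) \<notin> multiples G (p ^ (n l + 1)))" by (rule allI)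
  then obtain c :: "nat \<Rightarrow> nat \<Rightarrow> 'a" where c': "\<forall>l. (\<forall>i. c l i \<in> torsion_part G (multiples G (p ^ n l)) p) \<and>
      (\<forall>i j. i \<noteq> j \<longrightarrow> c l i \<otimes> inv (c l j) \<notin> multiples G (p ^ (n l + 1)))"
    by (rule choice[THEN exE])
  have c: "\<And>l i. c l i \<in> torsion_part G (multiples G (p ^ n l)) p"
    "\<And>l i j. i \<noteq> j \<Longrightarrow> c l i \<otimes> inv (c l j) \<notin> multiples G (p ^ (n l + 1))" using c' by blast+
  have "\<exists>y. y \<in> carrier G \<and> c l i = y [^] int (p ^ n l)" for l i
    using c(1)[of l i] by (auto simp: torsion_part_iff multiples_iff)
  then obtain y where y: "\<And>l i. y l i \<in> carrier G" "\<And>l i. c l i = y l i [^] int (p ^ n l)" by metis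
  define e where "e = (\<lambda>l i. y l i [^] int (p ^ l))"
  have ec: "e l i \<in> carrier G" for l i by (simp add: e_def y)
  define S where "S = (\<lambda>l. sol G {(p ^ (n l + 1), int (p ^ (n l - l)))})"
  have pe: "e l i [^] int (p ^ m) = y l i [^] int (p ^ (l + m))" for l i m
    unfolding e_def using y(1) by (simp add: int_pow_pow power_add)
  have zero: "y l i [^] int (p ^ m) = \<one>" if "m > n l" for l i m
  proof (rule tors_pow_dvd)
    have "(y l i [^] int (p ^ n l)) [^] int p = \<one>" using c(1)[of l i] y(2) by (simp add: torsion_part_iff)
    thus "y l i \<in> tors G (p ^ Suc (n l))" using y(1) by (simp add: tors_iff int_pow_pow mult.commute)
    show "int (p ^ Suc (n l)) dvd int (p ^ m)" using that by (simp only: int_dvd_int_iff le_imp_power_dvd Suc_le_eq)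
  qed
  have cross: "e l i \<in> S l'" if "l \<noteq> l'" for l l' i
  proof -
    have "e l i [^] int (p ^ (n l' - l')) \<in> multiples G (p ^ (n l' + 1))"
    proof (cases "l' < l")
      case True
      hence "n l' + 1 \<le> l + (n l' - l')" using nl[of l'] by simp
      thus ?thesis unfolding pe using y(1)
        by (intro pow_mult_in_multiples) (simp_all only: int_dvd_int_iff le_imp_power_dvd)
    next
      case False
      hence "n l + 2 * (l' - l) \<le> n l'" using gap[of l "l' - l"] that by simp
      hence "n l < l + (n l' - l')" using nl[of l] False that by simp
      hence "e l i [^] int (p ^ (n l' - l')) = \<one>" unfolding pe by (rule zero)
      thus ?thesis using one_multiples by simp
    qed
    thus ?thesis using ec by (simp add: S_def sol1_iff)
  qed
  have "inp_pattern G (x_eq_x G) (UNIV :: nat set) (\<lambda>l. cong_form (p ^ (n l + 1)) (int (p ^ (n l - l)))) (\<lambda>_. 2)"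
  proof (rule congruences_inp_pattern[where e = e])
    show "e l i \<in> carrier G" for l i by (rule ec)
    show "e l i \<otimes> inv (e l j) \<notin> sol G {(p ^ (n l + 1), int (p ^ (n l - l)))}" if "i \<noteq> j" for l i j
    proof -
      have "(e l i \<otimes> inv (e l j)) [^] int (p ^ (n l - l)) = e l i [^] int (p ^ (n l - l)) \<otimes> inv (e l j [^] int (p ^ (n l - l)))"
        using ec by (simp only: int_pow_diff_distrib)
      also have "\<dots> = c l i \<otimes> inv (c l j)" unfolding pe y(2) using nl[of l] by simp
      finally show ?thesis using c(2)[OF that, of l] by (simp only: sol1_iff) simp
    qed
    show "\<exists>x\<in>carrier G. \<forall>l\<in>F. x \<otimes> inv (e l (\<eta> l)) \<in> sol G {(p ^ (n l + 1), int (p ^ (n l - l)))}"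
      if "finite F" for F \<eta>
    proof -
      have "\<exists>x\<in>carrier G. (\<forall>l\<in>F. x \<otimes> inv (e l (\<eta> l)) \<in> S l) \<and> (\<forall>l. l \<notin> F \<longrightarrow> x \<in> S l)"
        by (rule orthogonal_solution[OF that ec]) (simp add: S_def, rule cross)
      thus ?thesis unfolding S_def by blast
    qed
  qed
  thus ?thesis by blast
qed

end

text \<open>
  Strength quantifies over the saturated models of the theory, but the finiteness conditions pass
  between models, and they exclude patterns in every group that satisfies them.
\<close>

theorem strong_iff_finite_conditions:
  fixes A :: "'a monoid"
  assumes A: "comm_group A"
  shows "strong A \<longleftrightarrow> finite_conditions A"
proof
  assume st: "strong A"
  obtain M :: "(nat \<Rightarrow> 'a) set monoid" where M: "comm_group M" "elem_equiv A M" "aleph1_saturated M"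
    using saturated_model_exists[OF A] by blast
  have no: "\<not> inp_pattern M (x_eq_x M) I \<phi> k" if "infinite I" for I :: "nat set" and \<phi> k
    using st M that unfolding strong_def by blast
  have "finite_conditions M" unfolding finite_conditions_def
    using no comm_group.infinitely_many_primes_pattern[OF M(1) refl]
      comm_group.infinitely_many_ulm_pattern[OF M(1)] infinite_UNIV_nat by blast
  thus "finite_conditions A" using elem_equiv_finite_conditions[OF A M(1,2)] by simp
next
  assume fc: "finite_conditions A"
  show "strong A" unfolding strong_def
  proof (intro notI, elim exE conjE)
    fix M :: "(nat \<Rightarrow> 'a) set monoid" and I :: "nat set" and \<phi> k
    assume M: "comm_group M" "elem_equiv A M" "infinite I" "inp_pattern M (x_eq_x M) I \<phi> k"
    have "finite_conditions M" using fc elem_equiv_finite_conditions[OF A M(1,2)] by simp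
    thus False using comm_group.finite_width_no_inp_pattern[OF M(1) _ _ M(3)] M(4)
      unfolding finite_conditions_def by blast
  qed
qed

section \<open>Indices in direct sums\<close>

lemma comm_group_DirProd:
  assumes "comm_group G" "comm_group H" shows "comm_group (G \<times>\<times> H)"
proof -
  interpret G: comm_group G by fact
  interpret H: comm_group H by fact
  interpret P: group "G \<times>\<times> H" using DirProd_group[OF G.is_group H.is_group] .
  show ?thesis by (rule P.group_comm_groupI) (auto simp: G.m_comm H.m_comm)
qed

lemma comm_group_sum:
  assumes "\<And>i. i \<in> I \<Longrightarrow> comm_group (G i)" shows "comm_group (sum_group I G)"
proof -
  have g: "group (G i)" if "i \<in> I" for i using assms[OF that] by (simp add: comm_group_def)
  interpret P: group "sum_group I G" using g by simp
  show ?thesis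
  proof (rule P.group_comm_groupI)
    fix x y assume "x \<in> carrier (sum_group I G)" "y \<in> carrier (sum_group I G)"
    hence "x i \<otimes>\<^bsub>G i\<^esub> y i = y i \<otimes>\<^bsub>G i\<^esub> x i" if "i \<in> I" for i
      using that comm_monoid.m_comm[OF comm_group.axioms(1)[OF assms[OF that]]]
      by (auto simp: carrier_sum_group[OF g] PiE_iff)
    thus "x \<otimes>\<^bsub>sum_group I G\<^esub> y = y \<otimes>\<^bsub>sum_group I G\<^esub> x" by (auto intro!: restrict_ext)
  qed
qed

lemma comm_group_copies: "comm_group G \<Longrightarrow> comm_group (copies G \<alpha>)"
  unfolding copies_def by (rule comm_group_sum)

lemma int_pow_hom:
  assumes "comm_group G" "comm_group H" "h \<in> hom G H" "x \<in> carrier G"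
  shows "h (x [^]\<^bsub>G\<^esub> (a::int)) = h x [^]\<^bsub>H\<^esub> a"
  using hom_int_pow[of h G H x a] assms by (simp add: comm_group_def)

lemma int_pow_DirProd:
  assumes "comm_group G" "comm_group H" "x \<in> carrier G" "y \<in> carrier H"
  shows "(x, y) [^]\<^bsub>G \<times>\<times> H\<^esub> (a::int) = (x [^]\<^bsub>G\<^esub> a, y [^]\<^bsub>H\<^esub> a)"
proof -
  have "fst \<in> hom (G \<times>\<times> H) G" "snd \<in> hom (G \<times>\<times> H) H" by (auto simp: hom_def)
  thus ?thesis
    using int_pow_hom[OF comm_group_DirProd[OF assms(1,2)] assms(1), of fst "(x, y)" a]
      int_pow_hom[OF comm_group_DirProd[OF assms(1,2)] assms(2), of snd "(x, y)" a] assms(3,4)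
    by (metis SigmaI carrier_DirProd fst_conv prod.collapse snd_conv)
qed

lemma sol_DirProd:
  assumes G: "comm_group G" and H: "comm_group H"
  shows "sol (G \<times>\<times> H) L = sol G L \<times> sol H L"
proof -
  interpret G: comm_group G by fact
  interpret H: comm_group H by fact
  interpret P: comm_group "G \<times>\<times> H" by (rule comm_group_DirProd[OF G H])
  have m: "multiples (G \<times>\<times> H) n = multiples G n \<times> multiples H n" for n
    by (force simp: P.multiples_iff G.multiples_iff H.multiples_iff int_pow_DirProd[OF G H])
  show ?thesis by (auto simp: sol_def int_pow_DirProd[OF G H] m)
qed

lemma idx_DirProd:
  assumes G: "comm_group G" and H: "comm_group H"
  shows "sidx (G \<times>\<times> H) L K = sidx G L K * sidx H L K"
proof -
  interpret G: comm_group G by fact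
  interpret H: comm_group H by fact
  interpret P: comm_group "G \<times>\<times> H" by (rule comm_group_DirProd[OF G H])
  let ?f = "\<lambda>z. (sol G K #>\<^bsub>G\<^esub> fst z, sol H K #>\<^bsub>H\<^esub> snd z)"
  have "sidx (G \<times>\<times> H) L K = ecard (?f ` sol (G \<times>\<times> H) L)"
    unfolding idx_def
  proof (rule ecard_image_cong)
    fix x y assume "x \<in> sol (G \<times>\<times> H) L" "y \<in> sol (G \<times>\<times> H) L"
    then obtain a b c d where ab: "x = (a, b)" "y = (c, d)" "a \<in> carrier G" "b \<in> carrier H" "c \<in> carrier G" "d \<in> carrier H"
      unfolding sol_DirProd[OF G H] sol_def by auto
    have "(a, b) \<otimes>\<^bsub>G \<times>\<times> H\<^esub> inv\<^bsub>G \<times>\<times> H\<^esub> (c, d) = (a \<otimes>\<^bsub>G\<^esub> inv\<^bsub>G\<^esub> c, b \<otimes>\<^bsub>H\<^esub> inv\<^bsub>H\<^esub> d)"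
      using ab by (simp add: inv_DirProd G.is_group H.is_group)
    thus "(sol (G \<times>\<times> H) K #>\<^bsub>G \<times>\<times> H\<^esub> x = sol (G \<times>\<times> H) K #>\<^bsub>G \<times>\<times> H\<^esub> y) = (?f x = ?f y)"
      using P.rcos_eq_iff[OF P.sol_subgroup, of x y K] G.rcos_eq_iff[OF G.sol_subgroup, of a c K]
        H.rcos_eq_iff[OF H.sol_subgroup, of b d K] ab by (simp add: sol_DirProd[OF G H])
  qed
  also have "?f ` sol (G \<times>\<times> H) L = ((\<lambda>x. sol G K #>\<^bsub>G\<^esub> x) ` sol G L) \<times> ((\<lambda>x. sol H K #>\<^bsub>H\<^esub> x) ` sol H L)"
    unfolding sol_DirProd[OF G H] by force
  also have "ecard \<dots> = sidx G L K * sidx H L K"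
    unfolding idx_def using subgroup.one_closed[OF G.sol_subgroup] subgroup.one_closed[OF H.sol_subgroup]
    by (intro ecard_Times) blast+
  finally show ?thesis .
qed

locale direct_sum =
  fixes I :: "'i set" and G :: "'i \<Rightarrow> ('a, 'b) monoid_scheme"
  assumes G: "\<And>i. i \<in> I \<Longrightarrow> comm_group (G i)"
begin

abbreviation S where "S \<equiv> sum_group I G"

lemma grp: "i \<in> I \<Longrightarrow> group (G i)" using G by (simp add: comm_group_def)

lemma mon: "i \<in> I \<Longrightarrow> monoid (G i)" using grp by (simp add: group.is_monoid)

lemma comm_S: "comm_group S" by (rule comm_group_sum) (rule G)

sublocale S: comm_group S by (rule comm_S)

lemma carrier_S: "carrier S = {x \<in> \<Pi>\<^sub>E i\<in>I. carrier (G i). finite {i \<in> I. x i \<noteq> \<one>\<^bsub>G i\<^esub>}}"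
  by (rule carrier_sum_group) (rule grp)

lemma coord: "x \<in> carrier S \<Longrightarrow> i \<in> I \<Longrightarrow> x i \<in> carrier (G i)"
  by (auto simp: carrier_S)

lemma int_pow_coord:
  assumes "x \<in> carrier S" "i \<in> I" shows "(x [^]\<^bsub>S\<^esub> (a::int)) i = x i [^]\<^bsub>G i\<^esub> a"
proof -
  have "(\<lambda>x. x i) \<in> hom S (G i)" using assms(2) by (auto simp: hom_def coord)
  thus ?thesis using int_pow_hom[OF comm_S G[OF assms(2)] _ assms(1), of "\<lambda>x. x i" a] by simp
qed

lemma carrier_eqI: "x \<in> carrier S \<Longrightarrow> y \<in> carrier S \<Longrightarrow> (\<And>i. i \<in> I \<Longrightarrow> x i = y i) \<Longrightarrow> x = y"
  by (auto simp: carrier_S intro: PiE_ext)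

lemma multiples_coord:
  assumes "x \<in> carrier S"
  shows "x \<in> multiples S n \<longleftrightarrow> (\<forall>i\<in>I. x i \<in> multiples (G i) n)"
proof
  assume "x \<in> multiples S n"
  then obtain y where y: "y \<in> carrier S" "x = y [^]\<^bsub>S\<^esub> int n" unfolding S.multiples_iff by (rule bexE)
  show "\<forall>i\<in>I. x i \<in> multiples (G i) n"
  proof
    fix i assume i: "i \<in> I"
    have "x i = y i [^]\<^bsub>G i\<^esub> int n" unfolding y(2) by (rule int_pow_coord[OF y(1) i])
    thus "x i \<in> multiples (G i) n" using coord[OF y(1) i] comm_group.multiples_iff[OF G[OF i]] by blast
  qed
next
  assume h: "\<forall>i\<in>I. x i \<in> multiples (G i) n"
  define y where "y = (\<lambda>i\<in>I. if x i = \<one>\<^bsub>G i\<^esub> then \<one>\<^bsub>G i\<^esub> else SOME z. z \<in> carrier (G i) \<and> x i = z [^]\<^bsub>G i\<^esub> int n)"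
  have y: "y i \<in> carrier (G i) \<and> x i = y i [^]\<^bsub>G i\<^esub> int n" if i: "i \<in> I" for i
  proof (cases "x i = \<one>\<^bsub>G i\<^esub>")
    case True
    interpret Gi: comm_group "G i" by (rule G[OF i])
    show ?thesis using True i by (simp add: y_def)
  next
    case False
    have ex: "\<exists>z. z \<in> carrier (G i) \<and> x i = z [^]\<^bsub>G i\<^esub> int n"
      using h i comm_group.multiples_iff[OF G[OF i]] by blast
    thus ?thesis using someI_ex[OF ex] False i by (simp add: y_def)
  qed
  have "{i \<in> I. y i \<noteq> \<one>\<^bsub>G i\<^esub>} \<subseteq> {i \<in> I. x i \<noteq> \<one>\<^bsub>G i\<^esub>}" by (auto simp: y_def)
  hence "finite {i \<in> I. y i \<noteq> \<one>\<^bsub>G i\<^esub>}" using assms finite_subset by (auto simp: carrier_S)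
  moreover have "y \<in> (\<Pi>\<^sub>E i\<in>I. carrier (G i))" using y by (auto simp: y_def)
  ultimately have yS: "y \<in> carrier S" by (simp add: carrier_S)
  have "x = y [^]\<^bsub>S\<^esub> int n"
    by (rule carrier_eqI) (use assms yS y int_pow_coord[OF yS] in auto)
  thus "x \<in> multiples S n" using yS S.multiples_iff by blast
qed

lemma sol_coord:
  assumes x: "x \<in> carrier S"
  shows "x \<in> sol S L \<longleftrightarrow> (\<forall>i\<in>I. x i \<in> sol (G i) L)"
proof -
  have "x [^]\<^bsub>S\<^esub> a \<in> multiples S n \<longleftrightarrow> (\<forall>i\<in>I. x i [^]\<^bsub>G i\<^esub> a \<in> multiples (G i) n)" for n and a :: int
    using multiples_coord[of "x [^]\<^bsub>S\<^esub> a" n] x int_pow_coord[OF x] by simp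
  thus ?thesis using x coord[OF x] unfolding sol_def by blast
qed

lemma sol_coordD: assumes "x \<in> sol S L" "i \<in> I" shows "x i \<in> sol (G i) L"
proof -
  have "x \<in> carrier S" by (rule subsetD[OF S.sol_carrier assms(1)])
  thus ?thesis using sol_coord assms by blast
qed

lemma sol_coordI: "x \<in> carrier S \<Longrightarrow> (\<And>i. i \<in> I \<Longrightarrow> x i \<in> sol (G i) L) \<Longrightarrow> x \<in> sol S L"
  using sol_coord by blast

lemma diff_coord:
  assumes "x \<in> carrier S" "y \<in> carrier S" "i \<in> I"
  shows "(x \<otimes>\<^bsub>S\<^esub> inv\<^bsub>S\<^esub> y) i = x i \<otimes>\<^bsub>G i\<^esub> inv\<^bsub>G i\<^esub> (y i)"
  using assms inv_sum_group[OF grp assms(2)] by simp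

lemma coset_eq_iff:
  assumes "x \<in> carrier S" "y \<in> carrier S"
  shows "sol S K #>\<^bsub>S\<^esub> x = sol S K #>\<^bsub>S\<^esub> y \<longleftrightarrow> (\<forall>i\<in>I. sol (G i) K #>\<^bsub>G i\<^esub> x i = sol (G i) K #>\<^bsub>G i\<^esub> y i)"
proof -
  have star: "sol (G i) K #>\<^bsub>G i\<^esub> x i = sol (G i) K #>\<^bsub>G i\<^esub> y i \<longleftrightarrow> (x \<otimes>\<^bsub>S\<^esub> inv\<^bsub>S\<^esub> y) i \<in> sol (G i) K" if i: "i \<in> I" for i
    using comm_group.rcos_eq_iff[OF G[OF i] comm_group.sol_subgroup[OF G[OF i]] coord[OF assms(1) i] coord[OF assms(2) i]]
      diff_coord[OF assms i] by simp
  have d: "x \<otimes>\<^bsub>S\<^esub> inv\<^bsub>S\<^esub> y \<in> carrier S" using assms by (intro S.m_closed S.inv_closed)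
  show ?thesis unfolding S.rcos_eq_iff[OF S.sol_subgroup assms] sol_coord[OF d]
    by (intro ball_cong refl) (simp only: star)
qed

definition single :: "'i \<Rightarrow> 'a \<Rightarrow> 'i \<Rightarrow> 'a" where
  "single i h = (\<lambda>j\<in>I. if j = i then h else \<one>\<^bsub>G j\<^esub>)"

lemma single_carrier:
  assumes "i \<in> I" "h \<in> carrier (G i)" shows "single i h \<in> carrier S"
proof -
  have "single i h \<in> (\<Pi>\<^sub>E i\<in>I. carrier (G i))" using assms mon by (auto simp: single_def monoid.one_closed)
  moreover have "{j \<in> I. single i h j \<noteq> \<one>\<^bsub>G j\<^esub>} \<subseteq> {i}" by (auto simp: single_def)
  ultimately show ?thesis using finite_subset by (auto simp: carrier_S)
qed

lemma single_sol:
  assumes "i \<in> I" "h \<in> sol (G i) L" shows "single i h \<in> sol S L"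
proof -
  have "h \<in> carrier (G i)" using assms(2) by (simp add: sol_def)
  hence c: "single i h \<in> carrier S" by (rule single_carrier[OF assms(1)])
  have "single i h j \<in> sol (G j) L" if "j \<in> I" for j
    using that assms subgroup.one_closed[OF comm_group.sol_subgroup[OF G[OF that]]] by (simp add: single_def)
  thus ?thesis using sol_coord[OF c] by blast
qed

lemma idx_sum_trivial:
  assumes "\<And>i. i \<in> I \<Longrightarrow> sidx (G i) L K = 1"
  shows "sidx S L K = 1"
proof -
  have "sol (G i) L \<subseteq> sol (G i) K" if "i \<in> I" for i
    using assms[OF that] comm_group.idx_eq_1_iff[OF G[OF that] comm_group.sol_subgroup[OF G[OF that]] comm_group.sol_subgroup[OF G[OF that]]] by simp
  hence "sol S L \<subseteq> sol S K"
    by (intro subsetI sol_coordI) (auto dest: sol_coordD intro: subsetD[OF S.sol_carrier])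
  thus ?thesis using S.idx_eq_1_iff[OF S.sol_subgroup S.sol_subgroup] by simp
qed

lemma idx_sum_single:
  assumes i: "i \<in> I" and t: "\<And>j. j \<in> I \<Longrightarrow> j \<noteq> i \<Longrightarrow> sidx (G j) L K = 1"
  shows "sidx S L K = sidx (G i) L K"
proof -
  have sub: "sol (G j) L \<subseteq> sol (G j) K" if "j \<in> I" "j \<noteq> i" for j
    using t[OF that] comm_group.idx_eq_1_iff[OF G[OF that(1)] comm_group.sol_subgroup[OF G[OF that(1)]] comm_group.sol_subgroup[OF G[OF that(1)]]] by simp
  have same: "sol (G j) K #>\<^bsub>G j\<^esub> a = sol (G j) K #>\<^bsub>G j\<^esub> b" if "j \<in> I" "j \<noteq> i" "a \<in> sol (G j) L" "b \<in> sol (G j) L" for j a b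
  proof -
    interpret Gj: comm_group "G j" by (rule G[OF that(1)])
    have "a \<otimes>\<^bsub>G j\<^esub> inv\<^bsub>G j\<^esub> b \<in> sol (G j) K"
      using that sub[OF that(1,2)] subgroup.m_closed[OF Gj.sol_subgroup] subgroup.m_inv_closed[OF Gj.sol_subgroup] by blast
    thus ?thesis using Gj.rcos_eq_iff[OF Gj.sol_subgroup] that(3,4) Gj.sol_carrier by blast
  qed
  have "sidx S L K = ecard ((\<lambda>x. sol (G i) K #>\<^bsub>G i\<^esub> x i) ` sol S L)"
    unfolding idx_def
  proof (rule ecard_image_cong)
    fix x y assume h: "x \<in> sol S L" "y \<in> sol S L"
    hence c: "x \<in> carrier S" "y \<in> carrier S" using S.sol_carrier by blast+
    show "(sol S K #>\<^bsub>S\<^esub> x = sol S K #>\<^bsub>S\<^esub> y) = (sol (G i) K #>\<^bsub>G i\<^esub> x i = sol (G i) K #>\<^bsub>G i\<^esub> y i)"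
      unfolding coset_eq_iff[OF c] using i same h sol_coord[OF c(1)] sol_coord[OF c(2)] by blast
  qed
  also have "(\<lambda>x. sol (G i) K #>\<^bsub>G i\<^esub> x i) ` sol S L = (\<lambda>h. sol (G i) K #>\<^bsub>G i\<^esub> h) ` ((\<lambda>x. x i) ` sol S L)"
    by (simp add: image_image)
  also have "(\<lambda>x. x i) ` sol S L = sol (G i) L"
  proof
    show "(\<lambda>x. x i) ` sol S L \<subseteq> sol (G i) L" using sol_coord S.sol_carrier i by blast
    show "sol (G i) L \<subseteq> (\<lambda>x. x i) ` sol S L"
    proof
      fix h assume h: "h \<in> sol (G i) L"
      have "single i h i = h" using i by (simp add: single_def)
      thus "h \<in> (\<lambda>x. x i) ` sol S L" using single_sol[OF i h] by (metis imageI)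
    qed
  qed
  finally show ?thesis unfolding idx_def .
qed

lemma idx_sum_finite:
  assumes "finite I" "\<And>i. i \<in> I \<Longrightarrow> sidx (G i) L K = enat c"
  shows "sidx S L K = enat (c ^ card I)"
proof -
  let ?Q = "\<lambda>i. (\<lambda>h. sol (G i) K #>\<^bsub>G i\<^esub> h) ` sol (G i) L"
  let ?f = "\<lambda>x. \<lambda>i\<in>I. sol (G i) K #>\<^bsub>G i\<^esub> x i"
  have "sidx S L K = ecard (?f ` sol S L)"
    unfolding idx_def
  proof (rule ecard_image_cong)
    fix x y assume h: "x \<in> sol S L" "y \<in> sol S L"
    hence c: "x \<in> carrier S" "y \<in> carrier S" using S.sol_carrier by blast+
    show "(sol S K #>\<^bsub>S\<^esub> x = sol S K #>\<^bsub>S\<^esub> y) = (?f x = ?f y)"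
      unfolding coset_eq_iff[OF c] by (auto simp: fun_eq_iff restrict_def)
  qed
  also have "?f ` sol S L = (\<Pi>\<^sub>E i\<in>I. ?Q i)"
  proof
    show "?f ` sol S L \<subseteq> (\<Pi>\<^sub>E i\<in>I. ?Q i)" by (rule image_subsetI) (auto dest: sol_coordD)
    show "(\<Pi>\<^sub>E i\<in>I. ?Q i) \<subseteq> ?f ` sol S L"
    proof
      fix q assume q: "q \<in> (\<Pi>\<^sub>E i\<in>I. ?Q i)"
      hence "\<forall>i\<in>I. \<exists>h. h \<in> sol (G i) L \<and> q i = sol (G i) K #>\<^bsub>G i\<^esub> h" by (auto simp: PiE_iff)
      then obtain h where h: "\<forall>i\<in>I. h i \<in> sol (G i) L \<and> q i = sol (G i) K #>\<^bsub>G i\<^esub> h i" by (rule bchoice[THEN exE])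
      let ?x = "restrict h I"
      have x: "?x \<in> carrier S" using h assms(1) by (auto simp: carrier_S sol_def)
      have "?x \<in> sol S L" unfolding sol_coord[OF x] using h by simp
      moreover have "q = ?f ?x" by (rule PiE_ext[OF q]) (use h in auto)
      ultimately show "q \<in> ?f ` sol S L" by (intro image_eqI)
    qed
  qed
  also have "ecard (\<Pi>\<^sub>E i\<in>I. ?Q i) = enat (c ^ card I)"
  proof -
    have Q: "finite (?Q i)" "card (?Q i) = c" if "i \<in> I" for i
      using assms(2)[OF that] by (auto simp: idx_def ecard_def split: if_splits)
    have "card (\<Pi>\<^sub>E i\<in>I. ?Q i) = (\<Prod>i\<in>I. card (?Q i))" by (rule card_PiE[OF assms(1)])
    also have "\<dots> = c ^ card I" using Q by simp
    finally show ?thesis using finite_PiE[OF assms(1), of ?Q] Q by (simp add: ecard_def)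
  qed
  finally show ?thesis .
qed

lemma idx_sum_infinite:
  assumes "infinite I" "\<And>i. i \<in> I \<Longrightarrow> sidx (G i) L K \<noteq> 1"
  shows "sidx S L K = \<infinity>"
proof -
  have "\<exists>h. h \<in> sol (G i) L \<and> h \<notin> sol (G i) K" if "i \<in> I" for i
    using assms(2)[OF that] comm_group.idx_eq_1_iff[OF G[OF that] comm_group.sol_subgroup[OF G[OF that]] comm_group.sol_subgroup[OF G[OF that]]] by blast
  hence "\<forall>i\<in>I. \<exists>h. h \<in> sol (G i) L \<and> h \<notin> sol (G i) K" by blast
  then obtain h where h: "\<forall>i\<in>I. h i \<in> sol (G i) L \<and> h i \<notin> sol (G i) K" by (rule bchoice[THEN exE])
  have hc: "h i \<in> carrier (G i)" if "i \<in> I" for i using h that by (auto simp: sol_def)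
  have "inj_on (\<lambda>i. sol S K #>\<^bsub>S\<^esub> single i (h i)) I"
  proof (rule inj_onI, rule ccontr)
    fix i j assume ij: "i \<in> I" "j \<in> I" "sol S K #>\<^bsub>S\<^esub> single i (h i) = sol S K #>\<^bsub>S\<^esub> single j (h j)" "i \<noteq> j"
    interpret Gi: comm_group "G i" by (rule G[OF ij(1)])
    have "sol (G i) K #>\<^bsub>G i\<^esub> single i (h i) i = sol (G i) K #>\<^bsub>G i\<^esub> single j (h j) i"
      using ij(3) coset_eq_iff[OF single_carrier[OF ij(1) hc[OF ij(1)]] single_carrier[OF ij(2) hc[OF ij(2)]]] ij(1) by blast
    hence "sol (G i) K #>\<^bsub>G i\<^esub> h i = sol (G i) K #>\<^bsub>G i\<^esub> \<one>\<^bsub>G i\<^esub>" using ij by (simp add: single_def)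
    hence "h i \<in> sol (G i) K" using Gi.rcos_eq_iff[OF Gi.sol_subgroup hc[OF ij(1)] Gi.one_closed] hc[OF ij(1)] by simp
    thus False using h ij(1) by blast
  qed
  hence "infinite ((\<lambda>i. sol S K #>\<^bsub>S\<^esub> single i (h i)) ` I)" using assms(1) finite_image_iff by blast
  moreover have "(\<lambda>i. sol S K #>\<^bsub>S\<^esub> single i (h i)) ` I \<subseteq> (\<lambda>x. sol S K #>\<^bsub>S\<^esub> x) ` sol S L"
    using single_sol h by blast
  ultimately show ?thesis unfolding idx_def ecard_infinite_iff using infinite_super by blast
qed

end

text \<open>The cardinality of a vector space of the given dimension over the field with \<open>p\<close> elements.\<close>

definition pw :: "nat \<Rightarrow> enat \<Rightarrow> enat" where
  "pw p d = (case d of enat n \<Rightarrow> enat (p ^ n) | \<infinity> \<Rightarrow> \<infinity>)"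

lemma pw_0 [simp]: "pw p 0 = 1" by (simp add: pw_def zero_enat_def one_enat_def)

lemma pw_infinite [simp]: "pw p d = \<infinity> \<longleftrightarrow> d = \<infinity>" by (simp add: pw_def split: enat.splits)

lemma pw_inject: "p \<ge> 2 \<Longrightarrow> pw p d = pw p e \<longleftrightarrow> d = e"
  by (auto simp: pw_def power_inject_exp split: enat.splits)

lemma pw_eq_1: "p \<ge> 2 \<Longrightarrow> pw p d = 1 \<longleftrightarrow> d = 0"
  using pw_inject[of p d 0] by simp

lemma idx_copies_trivial:
  assumes "comm_group G" "\<alpha> = 0 \<or> sidx G L K = 1"
  shows "sidx (copies G \<alpha>) L K = 1"
proof -
  interpret direct_sum "{i. enat i < \<alpha>}" "\<lambda>_. G" by (rule direct_sum.intro) (rule assms(1))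
  show ?thesis unfolding copies_def by (rule idx_sum_trivial) (use assms(2) in auto)
qed

lemma idx_copies:
  assumes "comm_group G" "sidx G L K = enat p" "p \<ge> 2"
  shows "sidx (copies G \<alpha>) L K = pw p \<alpha>"
proof -
  interpret direct_sum "{i. enat i < \<alpha>}" "\<lambda>_. G" by (rule direct_sum.intro) (rule assms(1))
  show ?thesis
  proof (cases \<alpha>)
    case (enat n)
    have "finite {i. enat i < \<alpha>}" "card {i. enat i < \<alpha>} = n"
      using enat by (simp_all add: lessThan_def[symmetric])
    thus ?thesis using idx_sum_finite[of L K p] assms(2) enat by (simp add: copies_def pw_def)
  next
    case infinity
    hence "infinite {i. enat i < \<alpha>}" by simp
    thus ?thesis using idx_sum_infinite[of L K] assms(2,3) infinity by (simp add: copies_def pw_def one_enat_def)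
  qed
qed

section \<open>Primes acting bijectively\<close>

text \<open>
  Multiplication by \<open>q\<close> is bijective. Surjectivity and injectivity are stated by
  solution sets because these are computed coordinatewise in sums.
\<close>

definition unit_prime :: "nat \<Rightarrow> ('a, 'b) monoid_scheme \<Rightarrow> bool" where
  "unit_prime q G \<longleftrightarrow> carrier G \<subseteq> sol G {(q, 1)} \<and> sol G {(0, int q)} \<subseteq> {\<one>\<^bsub>G\<^esub>}"

lemma unit_prime_DirProd:
  assumes "comm_group G" "comm_group H" "unit_prime q G" "unit_prime q H"
  shows "unit_prime q (G \<times>\<times> H)"
  using assms(3,4) unfolding unit_prime_def sol_DirProd[OF assms(1,2)] by auto

lemma (in direct_sum) unit_prime_sum:
  assumes "\<And>i. i \<in> I \<Longrightarrow> unit_prime q (G i)" shows "unit_prime q S"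
  unfolding unit_prime_def
proof
  show "carrier S \<subseteq> sol S {(q, 1)}"
    using sol_coord assms coord unfolding unit_prime_def by blast
  show "sol S {(0, int q)} \<subseteq> {\<one>\<^bsub>S\<^esub>}"
  proof
    fix x assume x: "x \<in> sol S {(0, int q)}"
    hence xc: "x \<in> carrier S" using S.sol_carrier by blast
    have "x i = \<one>\<^bsub>S\<^esub> i" if "i \<in> I" for i
      using sol_coord[OF xc] x assms[OF that] that unfolding unit_prime_def by auto
    thus "x \<in> {\<one>\<^bsub>S\<^esub>}" using carrier_eqI[OF xc S.one_closed] by blast
  qed
qed

lemma unit_prime_copies:
  assumes "comm_group G" "unit_prime q G" shows "unit_prime q (copies G \<alpha>)"
proof -
  interpret direct_sum "{i. enat i < \<alpha>}" "\<lambda>_. G" by (rule direct_sum.intro) (rule assms(1))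
  show ?thesis unfolding copies_def by (rule unit_prime_sum) (rule assms(2))
qed

context comm_group begin

lemma tfree_sol: "tfree G p k = sidx G {(p ^ k, 1)} {(p ^ (k + 1), 1)}"
  by (simp only: tfree_def multiples_sol)

lemma one_sol: "{\<one>} = sol G {(0, 1)}" by (auto simp: sol_def)

lemma tsize_sol: "tsize G p k = sidx G {(p ^ k, 1), (0, int p)} {(0, 1)}"
  by (simp only: tsize_def torsion_sol one_sol)

lemma divisible_multiples: "carrier G \<subseteq> multiples G q \<Longrightarrow> carrier G \<subseteq> multiples G (q ^ k)"
proof (induction k)
  case (Suc k)
  show ?case
  proof
    fix x assume "x \<in> carrier G"
    then obtain y where y: "y \<in> carrier G" "x = y [^] int q" using Suc.prems multiples_iff by blast
    then obtain z where z: "z \<in> carrier G" "y = z [^] int (q ^ k)" using Suc multiples_iff by blast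
    have "x = z [^] int (q ^ Suc k)" unfolding y(2) z(2) using z(1) by (simp add: int_pow_pow mult.commute)
    thus "x \<in> multiples G (q ^ Suc k)" using z(1) multiples_iff by blast
  qed
qed simp

lemma divisible_invariants:
  assumes "carrier G \<subseteq> multiples G q" shows "ulm G q k = 1" "tfree G q k = 1"
proof -
  have c: "carrier G \<subseteq> multiples G (q ^ (k + 1))" by (rule divisible_multiples[OF assms])
  have 1: "torsion_part G (multiples G (q ^ k)) q \<subseteq> multiples G (q ^ (k + 1))"
    "multiples G (q ^ k) \<subseteq> multiples G (q ^ (k + 1))"
    using c multiples_carrier[of "q ^ k"] by (auto simp: torsion_part_def)
  show "ulm G q k = 1" unfolding ulm_def using 1(1) idx_eq_1_iff[OF torsion_part_multiples_subgroup multiples_subgroup] by simp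
  show "tfree G q k = 1" unfolding tfree_def using 1(2) idx_eq_1_iff[OF multiples_subgroup multiples_subgroup] by simp
qed

lemma torsionfree_invariants:
  assumes "tors G q \<subseteq> {\<one>}" shows "ulm G q k = 1" "tsize G q k = 1"
proof -
  have t: "torsion_part G (multiples G (q ^ k)) q \<subseteq> {\<one>}"
    using assms multiples_carrier[of "q ^ k"] by (auto simp: torsion_part_def)
  hence 1: "torsion_part G (multiples G (q ^ k)) q \<subseteq> multiples G (q ^ (k + 1))"
    using one_multiples by blast
  show "ulm G q k = 1" unfolding ulm_def using 1 idx_eq_1_iff[OF torsion_part_multiples_subgroup multiples_subgroup] by simp
  show "tsize G q k = 1" unfolding tsize_def using t idx_eq_1_iff[OF torsion_part_multiples_subgroup triv_subgroup] by simp
qed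

lemma unit_prime_iff: "unit_prime q G \<longleftrightarrow> carrier G \<subseteq> multiples G q \<and> tors G q \<subseteq> {\<one>}"
  using sol_zero[of "int q"] by (simp add: unit_prime_def multiples_sol)

lemma unit_prime_invariants:
  assumes "unit_prime q G" shows "ulm G q k = 1" "tfree G q k = 1" "tsize G q k = 1"
  using assms divisible_invariants[of q k] torsionfree_invariants[of q k] by (simp_all add: unit_prime_iff)

text \<open>
  On an element of order prime to \<open>q\<close>, multiplication by \<open>q\<close> is inverted
  by an integer.
\<close>

lemma unit_prime_coprime_torsion:
  assumes q: "prime q" and t: "\<And>x. x \<in> carrier G \<Longrightarrow> \<exists>m. \<not> q dvd m \<and> x [^] int m = \<one>"
  shows "unit_prime q G"
  unfolding unit_prime_iff
proof
  have key: "\<exists>u. x = (x [^] (u::int)) [^] int q" if x: "x \<in> carrier G" for x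
  proof -
    obtain m where m: "\<not> q dvd m" "x [^] int m = \<one>" using t[OF x] by blast
    obtain u v where uv: "u * int m + v * int q = 1" using bezout_prime[of q "int m"] q m(1) by auto
    have "x = x [^] (int m * u + v * int q)" using uv x by (simp add: mult.commute)
    also have "\<dots> = (x [^] int m) [^] u \<otimes> (x [^] v) [^] int q" using x by (simp only: int_pow_mult int_pow_pow)
    also have "\<dots> = (x [^] v) [^] int q" using m(2) x by simp
    finally show ?thesis by blast
  qed
  show "carrier G \<subseteq> multiples G q"
  proof
    fix x assume x: "x \<in> carrier G"
    then obtain u :: int where "x = (x [^] u) [^] int q" using key by blast
    moreover have "x [^] u \<in> carrier G" using x by simp
    ultimately show "x \<in> multiples G q" unfolding multiples_iff by (rule bexI)
  qed
  show "tors G q \<subseteq> {\<one>}"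
  proof
    fix x assume x: "x \<in> tors G q"
    hence xc: "x \<in> carrier G" "x [^] int q = \<one>" by (simp_all add: tors_iff)
    then obtain u :: int where "x = (x [^] u) [^] int q" using key by blast
    also have "\<dots> = (x [^] int q) [^] u" using xc(1) by (simp add: int_pow_pow mult.commute)
    also have "\<dots> = \<one>" using xc(2) by simp
    finally show "x \<in> {\<one>}" by simp
  qed
qed

end

section \<open>Recurrences between the invariants\<close>

context comm_group begin

text \<open>
  The subgroup \<open>(p^(k+1) G)[p]\<close> of \<open>(p^k G)[p]\<close> has the Ulm quotient as
  its cofactor.
\<close>

lemma tsize_rec: "tsize G p k = ulm G p k * tsize G p (Suc k)"
proof -
  let ?T = "torsion_part G (multiples G (p ^ k)) p"
  have "{\<one>} = multiples G (p ^ (k + 1)) \<inter> {\<one>}" using one_multiples by blast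
  hence "tsize G p k = idx G ?T (multiples G (p ^ (k + 1)) \<inter> {\<one>})" by (simp only: tsize_def)
  also have "\<dots> = idx G ?T (multiples G (p ^ (k + 1))) * idx G (?T \<inter> multiples G (p ^ (k + 1))) {\<one>}"
    by (rule idx_Int) (auto simp: triv_subgroup)
  also have "?T \<inter> multiples G (p ^ (k + 1)) = torsion_part G (multiples G (p ^ Suc k)) p"
    using multiples_dvd[of "p ^ k" "p ^ Suc k"] by (auto simp: torsion_part_def)
  finally show ?thesis by (simp add: ulm_def tsize_def)
qed

text \<open>
  Multiplication by \<open>p\<close> maps \<open>p^k G/p^(k+1) G\<close> onto \<open>p^(k+1)
  G/p^(k+2) G\<close>, with the Ulm quotient as kernel.
\<close>

lemma tfree_rec: "tfree G p k = ulm G p k * tfree G p (Suc k)"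
proof -
  let ?W = "{x \<in> carrier G. x [^] int p \<in> multiples G (p ^ (Suc k + 1))}"
  let ?A = "multiples G (p ^ k)" and ?B = "multiples G (p ^ (k + 1))"
  have W: "subgroup ?W G" by (rule subgroup_pow_vimage[OF multiples_subgroup])
  have "?B \<subseteq> ?W"
  proof
    fix x assume "x \<in> ?B"
    then obtain y where y: "y \<in> carrier G" "x = y [^] int (p ^ (k + 1))" unfolding multiples_iff by (rule bexE)
    have "x [^] int p = y [^] int (p ^ (Suc k + 1))" unfolding y(2) using y(1) by (simp add: int_pow_pow ac_simps)
    thus "x \<in> ?W" using y by (auto simp: multiples_iff)
  qed
  hence "tfree G p k = idx G ?A (?W \<inter> ?B)" unfolding tfree_def by (simp only: Int_absorb1)
  also have "\<dots> = idx G ?A ?W * idx G (?A \<inter> ?W) ?B"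
    by (rule idx_Int[OF multiples_subgroup W multiples_subgroup])
  also have "idx G ?A ?W = idx G ((\<lambda>x. x [^] int p) ` ?A) (multiples G (p ^ (Suc k + 1)))"
    by (rule idx_pow[symmetric]) (auto simp: multiples_carrier)
  also have "(\<lambda>x. x [^] int p) ` ?A = multiples G (p ^ Suc k)"
  proof -
    have "(y [^] int (p ^ k)) [^] int p = y [^] int (p ^ Suc k)" if "y \<in> carrier G" for y
      using that by (simp add: int_pow_pow ac_simps)
    thus ?thesis unfolding pow_image_carrier[symmetric] image_image by (intro image_cong refl)
  qed
  also have "idx G (?A \<inter> ?W) ?B = idx G (torsion_part G ?A p) ?B"
  proof (rule idx_absorb)
    show "torsion_part G ?A p \<subseteq> ?A \<inter> ?W"
      using multiples_carrier[of "p ^ k"] one_multiples by (auto simp: torsion_part_iff)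
    show "?A \<inter> ?W \<subseteq> carrier G" using multiples_carrier by blast
    fix x assume x: "x \<in> ?A \<inter> ?W"
    hence xc: "x \<in> carrier G" and "x [^] int p \<in> multiples G (p ^ (Suc k + 1))" by auto
    then obtain z where z: "z \<in> carrier G" "x [^] int p = z [^] int (p ^ (Suc k + 1))" unfolding multiples_iff by (elim bexE)
    let ?w = "z [^] int (p ^ (k + 1))"
    have w: "?w \<in> ?B" using z(1) by (auto simp: multiples_iff)
    have wA: "?w \<in> ?A" using w multiples_dvd[of "p ^ k" "p ^ (k + 1)"] by auto
    have "?w [^] int p = x [^] int p" unfolding z(2) using z(1) by (simp add: int_pow_pow ac_simps)
    hence "(x \<otimes> inv ?w) [^] int p = \<one>" using xc z(1) by (simp add: int_pow_diff_distrib)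
    moreover have "x \<otimes> inv ?w \<in> ?A" using x wA subgroup.m_closed[OF multiples_subgroup] subgroup.m_inv_closed[OF multiples_subgroup] by blast
    ultimately have t: "x \<otimes> inv ?w \<in> torsion_part G ?A p" by (simp add: torsion_part_iff)
    have "x \<otimes> inv (x \<otimes> inv ?w) = ?w" by (rule diff_diff) (use xc z(1) in simp_all)
    thus "\<exists>h\<in>torsion_part G ?A p. x \<otimes> inv h \<in> ?B" using t w by (intro bexI[of _ "x \<otimes> inv ?w"]) simp_all
  qed simp
  finally show ?thesis by (simp only: ulm_def tfree_def) (simp only: mult.commute)
qed

lemma invariants_ge_1: "ulm G p k \<ge> 1" "tfree G p k \<ge> 1" "tsize G p k \<ge> 1"
  unfolding ulm_def tfree_def tsize_def
  using one_multiples subgroup.one_closed[OF torsion_part_multiples_subgroup]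
  by (intro idx_ge_1; blast)+

end

text \<open>
  Both \<open>tfree\<close> and \<open>tsize\<close> satisfy this recurrence, with \<open>ulm\<close> as \<open>U\<close>. It reduces the comparison
  of two groups to their Ulm invariants and the behaviour of \<open>T\<close> at large arguments.
\<close>

locale ulm_recurrence =
  fixes U T :: "nat \<Rightarrow> enat"
  assumes rec: "\<And>k. T k = U k * T (Suc k)" and U1: "\<And>k. U k \<ge> 1" and T1: "\<And>k. T k \<ge> 1"
begin

lemma T_antimono: "T (k + d) \<le> T k"
proof (induction d)
  case (Suc d)
  have "1 * T (k + Suc d) \<le> U (k + d) * T (k + Suc d)" by (rule mult_right_mono) (use U1 in auto)
  thus ?case using rec[of "k + d"] Suc by simp
qed simp

lemma T_eventually_constant: "\<exists>k0. \<forall>k\<ge>k0. T k = T k0"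
proof -
  obtain k0 where k0: "T k0 = (LEAST t. t \<in> range T)" using LeastI[of "\<lambda>t. t \<in> range T" "T 0"] by (metis rangeE rangeI)
  have "T k = T k0" if "k \<ge> k0" for k
  proof (rule antisym)
    show "T k \<le> T k0" using T_antimono[of k0 "k - k0"] that by simp
    show "T k0 \<le> T k" unfolding k0 by (rule Least_le) simp
  qed
  thus ?thesis by blast
qed

text \<open>
  A decreasing sequence of extended natural numbers is eventually constant, and a finite positive
  value cannot stay constant while factors other than 1 keep occurring.
\<close>

lemma T_infinite:
  assumes "infinite {k. U k \<noteq> 1}" shows "T k = \<infinity>"
proof (rule ccontr)
  assume k: "T k \<noteq> \<infinity>"
  obtain k0 where k0: "\<And>k. k \<ge> k0 \<Longrightarrow> T k = T k0" using T_eventually_constant by blast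
  obtain m where "m > max k k0" "m \<in> {k. U k \<noteq> 1}" using assms unfolding infinite_nat_iff_unbounded by blast
  hence m: "m > max k k0" "U m \<noteq> 1" by simp_all
  have "T m \<le> T k" using T_antimono[of k "m - k"] m(1) by simp
  then obtain t where t: "T m = enat t" using k by (metis enat_ord_simps(5) not_infinity_eq)
  have "T (Suc m) = enat t" using k0[of m] k0[of "Suc m"] m(1) t by simp
  hence e: "enat t = U m * enat t" using rec[of m] t by simp
  have "t \<ge> 1" using T1[of m] t by (simp add: one_enat_def)
  have "U m \<noteq> \<infinity>"
  proof
    assume "U m = \<infinity>"
    hence "U m * enat t = \<infinity>" using \<open>t \<ge> 1\<close> by (simp add: imult_is_infinity zero_enat_def)
    thus False using e by simp
  qed
  then obtain u where u: "U m = enat u" by auto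
  have "u = 1" using e \<open>t \<ge> 1\<close> unfolding u by simp
  thus False using m(2) u by (simp add: one_enat_def)
qed

lemma T_finite:
  assumes "\<And>k. U k \<noteq> \<infinity>" "T k0 \<noteq> \<infinity>" shows "T 0 \<noteq> \<infinity>"
  using assms(2)
proof (induction k0)
  case (Suc k)
  have "T k \<noteq> \<infinity>" using rec[of k] assms(1)[of k] Suc.prems by (simp add: imult_is_infinity)
  thus ?case by (rule Suc.IH)
qed simp

end

text \<open>
  If the factors differ from 1 infinitely often, both sequences are constantly infinite. Otherwise
  they agree eventually by assumption, and the recurrence is run backwards.
\<close>

lemma ulm_recurrence_unique:
  assumes "ulm_recurrence U T" "ulm_recurrence U T'"
    and tail: "\<And>k0. (\<And>k. k \<ge> k0 \<Longrightarrow> U k = 1) \<Longrightarrow> \<exists>m. T m = T' m \<and> (\<forall>k\<ge>m. T k = T' k)"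
  shows "T k = T' k"
proof (cases "infinite {k. U k \<noteq> 1}")
  case True
  thus ?thesis using ulm_recurrence.T_infinite[OF assms(1)] ulm_recurrence.T_infinite[OF assms(2)] by simp
next
  case False
  then obtain k0 where "\<forall>k\<in>{k. U k \<noteq> 1}. k < k0" using finite_nat_set_iff_bounded by blast
  hence "U k = 1" if "k \<ge> k0" for k using that by (meson leD mem_Collect_eq)
  then obtain m where m: "\<forall>k\<ge>m. T k = T' k" using tail by blast
  show ?thesis
  proof (cases "k \<ge> m")
    case True thus ?thesis using m by simp
  next
    case False
    hence "k \<le> m" by simp
    thus ?thesis
    proof (induction k rule: inc_induct)
      case base thus ?case using m by simp
    next
      case (step k) thus ?case using ulm_recurrence.rec[OF assms(1), of k] ulm_recurrence.rec[OF assms(2), of k] by simp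
    qed
  qed
qed

lemma (in comm_group) tfree_recurrence: "ulm_recurrence (ulm G p) (tfree G p)"
  by (rule ulm_recurrence.intro) (rule tfree_rec invariants_ge_1)+

lemma (in comm_group) tsize_recurrence: "ulm_recurrence (ulm G p) (tsize G p)"
  by (rule ulm_recurrence.intro) (rule tsize_rec invariants_ge_1)+

section \<open>The standard groups\<close>

lemma (in comm_group) idx_trivial: assumes "H \<subseteq> carrier G" shows "idx G H {\<one>} = ecard H"
proof -
  have "ecard ((\<lambda>x. {\<one>} #> x) ` H) = ecard (id ` H)"
  proof (rule ecard_image_cong)
    fix x y assume "x \<in> H" "y \<in> H"
    hence "x \<in> carrier G" "y \<in> carrier G" using assms by auto
    thus "({\<one>} #> x = {\<one>} #> y) = (id x = id y)" by (simp add: r_coset_def)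
  qed
  thus ?thesis by (simp add: idx_def)
qed

subsection \<open>Groups of rationals\<close>

lemma rat_int_pow:
  assumes "comm_group \<lparr>carrier = C, monoid.mult = (+), one = (0::rat)\<rparr>" (is "comm_group ?G") and x: "x \<in> C"
  shows "x [^]\<^bsub>\<lparr>carrier = C, monoid.mult = (+), one = (0::rat)\<rparr>\<^esub> (a::int) = of_int a * x"
proof -
  interpret G: comm_group ?G by fact
  have n: "x [^]\<^bsub>?G\<^esub> (k::nat) = of_nat k * x" for k
    by (induction k) (simp_all add: algebra_simps)
  have i: "inv\<^bsub>?G\<^esub> y = - y" if "y \<in> C" for y
  proof -
    have "inv\<^bsub>?G\<^esub> y + y = 0" using G.l_inv[of y] that by simp
    thus ?thesis by (simp add: eq_neg_iff_add_eq_0)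
  qed
  have c: "x [^]\<^bsub>?G\<^esub> (k::nat) \<in> C" for k using G.nat_pow_closed[of x k] x by simp
  show ?thesis
  proof (cases "a \<ge> 0")
    case True
    then obtain k where "a = int k" using nonneg_int_cases by blast
    thus ?thesis using n[of k] by (simp add: int_pow_int)
  next
    case False
    then obtain k where "a = - int k" by (metis neg_int_cases linorder_not_le)
    thus ?thesis using n[of k] i[OF c[of k]] x by (simp add: G.int_pow_neg int_pow_int)
  qed
qed

lemma rat_group_comm: "comm_group rat_group"
  unfolding rat_group_def by (rule comm_groupI) (auto simp: add.assoc add.commute intro: exI[of _ "- _"])

lemma rat_group_pow: "x [^]\<^bsub>rat_group\<^esub> (a::int) = of_int a * x"
  using rat_int_pow[of UNIV x a] rat_group_comm by (simp add: rat_group_def)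

lemma rat_group_unit_prime: assumes "prime q" shows "unit_prime q rat_group"
proof -
  interpret G: comm_group rat_group by (rule rat_group_comm)
  have q: "(of_nat q :: rat) \<noteq> 0" using assms by (simp add: prime_gt_0_nat)
  show ?thesis unfolding G.unit_prime_iff
  proof
    show "carrier rat_group \<subseteq> multiples rat_group q"
    proof
      fix x :: rat
      have "x = (x / of_nat q) [^]\<^bsub>rat_group\<^esub> int q" using q by (simp add: rat_group_pow)
      thus "x \<in> multiples rat_group q" unfolding G.multiples_iff by (rule bexI) (simp add: rat_group_def)
    qed
    show "tors rat_group q \<subseteq> {\<one>\<^bsub>rat_group\<^esub>}"
      using q by (auto simp: G.tors_iff rat_group_pow) (simp_all add: rat_group_def)
  qed
qed

lemma Z_localized_iff:
  assumes "prime p"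
  shows "x \<in> carrier (Z_localized p) \<longleftrightarrow> (\<exists>a b. \<not> int p dvd b \<and> x = of_int a / of_int b)"
proof
  assume x: "x \<in> carrier (Z_localized p)"
  obtain a b where ab: "quotient_of x = (a, b)" by (cases "quotient_of x")
  have "x = of_int a / of_int b" using quotient_of_div[OF ab] .
  moreover have "\<not> int p dvd b" using x ab by (simp add: Z_localized_def)
  ultimately show "\<exists>a b. \<not> int p dvd b \<and> x = of_int a / of_int b" by blast
next
  assume "\<exists>a b. \<not> int p dvd b \<and> x = of_int a / of_int b"
  then obtain a b where ab: "\<not> int p dvd b" "x = of_int a / of_int b" by blast
  obtain c d where cd: "quotient_of x = (c, d)" by (cases "quotient_of x")
  have b: "b \<noteq> 0" using ab(1) by auto
  have d: "d > 0" using quotient_of_denom_pos[OF cd] .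
  have "of_int a / of_int b = (of_int c / of_int d :: rat)" using quotient_of_div[OF cd] ab(2) by simp
  hence "(of_int (a * d) :: rat) = of_int (c * b)" using b d by (simp add: field_simps)
  hence "a * d = c * b" by (simp only: of_int_eq_iff)
  hence "d dvd c * b" by (metis dvd_triv_right)
  moreover have "coprime d c" using quotient_of_coprime[OF cd] by (simp add: coprime_commute)
  ultimately have "d dvd b" by (simp add: coprime_dvd_mult_right_iff)
  hence "\<not> int p dvd d" using ab(1) dvd_trans by blast
  thus "x \<in> carrier (Z_localized p)" using cd by (simp add: Z_localized_def)
qed

lemma Z_localized_comm: assumes "prime p" shows "comm_group (Z_localized p)"
proof -
  note iff = Z_localized_iff[OF assms]
  have ip: "prime (int p)" using assms by simp
  have add: "x + y \<in> carrier (Z_localized p)" if xy: "x \<in> carrier (Z_localized p)" "y \<in> carrier (Z_localized p)" for x y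
  proof -
    obtain a b where ab: "\<not> int p dvd b" "x = of_int a / of_int b" using xy(1) iff by blast
    obtain c d where cd: "\<not> int p dvd d" "y = of_int c / of_int d" using xy(2) iff by blast
    have nz: "b \<noteq> 0" "d \<noteq> 0" using ab cd by auto
    have "x + y = of_int (a * d + c * b) / of_int (b * d)" using nz ab(2) cd(2) by (simp add: field_simps)
    moreover have "\<not> int p dvd b * d" using ab(1) cd(1) ip by (simp add: prime_dvd_mult_iff)
    ultimately show ?thesis using iff by blast
  qed
  have neg: "- x \<in> carrier (Z_localized p)" if "x \<in> carrier (Z_localized p)" for x
  proof -
    obtain a b where "\<not> int p dvd b" "x = of_int a / of_int b" using \<open>x \<in> carrier (Z_localized p)\<close> iff by blast
    hence "- x = of_int (- a) / of_int b" "\<not> int p dvd b" by simp_all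
    thus ?thesis using iff by blast
  qed
  have zero: "0 \<in> carrier (Z_localized p)"
  proof -
    have "\<not> int p dvd 1" using ip not_prime_unit by blast
    moreover have "(0::rat) = of_int 0 / of_int 1" by simp
    ultimately show ?thesis using iff by blast
  qed
  show ?thesis
  proof (rule comm_groupI)
    show "\<one>\<^bsub>Z_localized p\<^esub> \<in> carrier (Z_localized p)" using zero by (simp add: Z_localized_def)
    show "x \<otimes>\<^bsub>Z_localized p\<^esub> y \<in> carrier (Z_localized p)"
      if "x \<in> carrier (Z_localized p)" "y \<in> carrier (Z_localized p)" for x y
      using add[OF that] by (simp add: Z_localized_def)
    show "\<exists>y\<in>carrier (Z_localized p). y \<otimes>\<^bsub>Z_localized p\<^esub> x = \<one>\<^bsub>Z_localized p\<^esub>"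
      if "x \<in> carrier (Z_localized p)" for x
      using neg[OF that] by (intro bexI[of _ "- x"]) (simp_all add: Z_localized_def)
  qed (simp_all add: Z_localized_def add.assoc add.commute)
qed

lemma Z_localized_pow:
  assumes "prime p" "x \<in> carrier (Z_localized p)"
  shows "x [^]\<^bsub>Z_localized p\<^esub> (a::int) = of_int a * x"
  using rat_int_pow[of "carrier (Z_localized p)" x a] Z_localized_comm[OF assms(1)] assms(2)
  by (simp add: Z_localized_def)

lemma Z_localized_torsionfree:
  assumes p: "prime p" and q: "q > 0" shows "tors (Z_localized p) q \<subseteq> {\<one>\<^bsub>Z_localized p\<^esub>}"
proof -
  interpret G: comm_group "Z_localized p" by (rule Z_localized_comm[OF p])
  show ?thesis
  proof
    fix x assume "x \<in> tors (Z_localized p) q"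
    hence "x \<in> carrier (Z_localized p)" "x [^]\<^bsub>Z_localized p\<^esub> int q = \<one>\<^bsub>Z_localized p\<^esub>" by (simp_all add: G.tors_iff)
    hence "of_nat q * x = 0" using Z_localized_pow[OF p] by (simp add: Z_localized_def)
    thus "x \<in> {\<one>\<^bsub>Z_localized p\<^esub>}" using q by (simp add: Z_localized_def)
  qed
qed

lemma Z_localized_unit_prime:
  assumes p: "prime p" and q: "prime q" "q \<noteq> p" shows "unit_prime q (Z_localized p)"
proof -
  interpret G: comm_group "Z_localized p" by (rule Z_localized_comm[OF p])
  have "carrier (Z_localized p) \<subseteq> multiples (Z_localized p) q"
  proof
    fix x assume "x \<in> carrier (Z_localized p)"
    then obtain a b where ab: "\<not> int p dvd b" "x = of_int a / of_int b" using Z_localized_iff[OF p] by blast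
    have "\<not> p dvd q" using p q primes_dvd_imp_eq by blast
    hence "\<not> int p dvd b * int q" using ab(1) p by (simp add: prime_dvd_mult_iff)
    hence y: "of_int a / of_int (b * int q) \<in> carrier (Z_localized p)" using Z_localized_iff[OF p] by blast
    have "x = (of_int a / of_int (b * int q)) [^]\<^bsub>Z_localized p\<^esub> int q"
      unfolding Z_localized_pow[OF p y] using ab(2) q(1) by (simp add: prime_gt_0_nat)
    thus "x \<in> multiples (Z_localized p) q" unfolding G.multiples_iff using y by blast
  qed
  thus ?thesis using Z_localized_torsionfree[OF p, of q] q(1) by (simp add: G.unit_prime_iff prime_gt_0_nat)
qed

text \<open>
  Every element of \<open>Z_localized p\<close> is congruent modulo \<open>p\<close> to exactly
  one of \<open>0, \<dots>, p - 1\<close>, and torsion-free groups have the same quotient at all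
  levels.
\<close>

lemma Z_localized_tfree:
  assumes p: "prime p" shows "tfree (Z_localized p) p k = enat p"
proof -
  interpret G: comm_group "Z_localized p" by (rule Z_localized_comm[OF p])
  let ?G = "Z_localized p"
  have p0: "(of_nat p :: rat) \<noteq> 0" using p by (simp add: prime_gt_0_nat)
  have ints: "of_int i \<in> carrier ?G" for i :: int
  proof -
    have "\<not> int p dvd 1" using p by (metis not_prime_unit of_nat_1 int_dvd_int_iff)
    moreover have "(of_int i :: rat) = of_int i / of_int 1" by simp
    ultimately show ?thesis using Z_localized_iff[OF p] by blast
  qed
  have mult: "x \<in> multiples ?G p \<longleftrightarrow> (\<exists>y\<in>carrier ?G. x = of_nat p * y)" for x
    unfolding G.multiples_iff using Z_localized_pow[OF p] by auto
  have diff: "x \<otimes>\<^bsub>?G\<^esub> inv\<^bsub>?G\<^esub> y = x - y" if "y \<in> carrier ?G" for x y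
  proof -
    have "y \<otimes>\<^bsub>?G\<^esub> inv\<^bsub>?G\<^esub> y = \<one>\<^bsub>?G\<^esub>" using that by simp
    hence "y + inv\<^bsub>?G\<^esub> y = 0" by (simp add: Z_localized_def)
    hence "inv\<^bsub>?G\<^esub> y = - y" by (simp add: eq_neg_iff_add_eq_0 add.commute)
    thus ?thesis by (simp add: Z_localized_def)
  qed
  have pre: "G.pre p (p ^ k) = multiples ?G p"
  proof
    show "multiples ?G p \<subseteq> G.pre p (p ^ k)" by (rule G.multiples_pre)
    show "G.pre p (p ^ k) \<subseteq> multiples ?G p"
    proof
      fix x assume "x \<in> G.pre p (p ^ k)"
      then obtain z where z: "x \<in> carrier ?G" "z \<in> carrier ?G" "x [^]\<^bsub>?G\<^esub> int (p ^ k) = z [^]\<^bsub>?G\<^esub> int (p ^ k * p)"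
        unfolding G.pre_def G.multiples_iff by blast
      hence "of_nat (p ^ k) * x = of_nat (p ^ k) * (of_nat p * z)" using Z_localized_pow[OF p] by simp
      hence "x = of_nat p * z" using p0 by simp
      thus "x \<in> multiples ?G p" using mult z(2) by blast
    qed
  qed
  let ?f = "\<lambda>i. multiples ?G p #>\<^bsub>?G\<^esub> (of_int i :: rat)"
  have "(\<lambda>x. multiples ?G p #>\<^bsub>?G\<^esub> x) ` carrier ?G = ?f ` {0..<int p}"
  proof
    show "?f ` {0..<int p} \<subseteq> (\<lambda>x. multiples ?G p #>\<^bsub>?G\<^esub> x) ` carrier ?G" using ints by blast
    show "(\<lambda>x. multiples ?G p #>\<^bsub>?G\<^esub> x) ` carrier ?G \<subseteq> ?f ` {0..<int p}"
    proof (rule image_subsetI)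
      fix x assume x: "x \<in> carrier ?G"
      then obtain a b where ab: "\<not> int p dvd b" "x = of_int a / of_int b" using Z_localized_iff[OF p] by blast
      have b: "b \<noteq> 0" using ab(1) by auto
      obtain u v where uv: "u * b + v * int p = 1" using bezout_prime[OF p ab(1)] .
      define i where "i = (a * u) mod int p"
      have "int p dvd (a * u) - i" unfolding i_def by (simp add: dvd_minus_mod)
      hence "int p dvd ((a * u) - i) * b" by (rule dvd_mult2)
      moreover have "a - i * b = ((a * u) - i) * b + a * v * int p"
      proof -
        have "a = a * (u * b + v * int p)" using uv by simp
        thus ?thesis by (simp add: algebra_simps)
      qed
      ultimately have "int p dvd a - i * b" by simp
      then obtain c where c: "a - i * b = int p * c" by (auto simp: dvd_def)
      have "x - of_int i = of_int (a - i * b) / of_int b" using ab(2) b by (simp add: field_simps)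
      also have "\<dots> = of_nat p * (of_int c / of_int b)" unfolding c by simp
      finally have "x - of_int i = of_nat p * (of_int c / of_int b)" .
      moreover have "of_int c / of_int b \<in> carrier ?G" using ab(1) Z_localized_iff[OF p] by blast
      ultimately have "x - of_int i \<in> multiples ?G p" using mult by blast
      hence "multiples ?G p #>\<^bsub>?G\<^esub> x = ?f i"
        using G.rcos_eq_iff[OF G.multiples_subgroup x ints] diff[OF ints] by simp
      moreover have "i \<in> {0..<int p}" using p by (simp add: i_def prime_gt_0_nat)
      ultimately show "multiples ?G p #>\<^bsub>?G\<^esub> x \<in> ?f ` {0..<int p}" by blast
    qed
  qed
  moreover have "inj_on ?f {0..<int p}"
  proof (rule inj_onI)
    fix i j assume ij: "i \<in> {0..<int p}" "j \<in> {0..<int p}" "?f i = ?f j"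
    have "of_int i - of_int j \<in> multiples ?G p"
      using ij(3) G.rcos_eq_iff[OF G.multiples_subgroup ints ints] diff[OF ints] by simp
    then obtain y where y: "y \<in> carrier ?G" "of_int i - of_int j = of_nat p * y" using mult by blast
    obtain a b where ab: "\<not> int p dvd b" "y = of_int a / of_int b" using y(1) Z_localized_iff[OF p] by blast
    have b: "b \<noteq> 0" using ab(1) by auto
    have "(of_int ((i - j) * b) :: rat) = of_int (int p * a)" using y(2) ab(2) b by (simp add: field_simps)
    hence "(i - j) * b = int p * a" by (simp only: of_int_eq_iff)
    hence "int p dvd (i - j) * b" by simp
    hence "int p dvd i - j" using ab(1) p by (simp add: prime_dvd_mult_iff)
    moreover have "\<bar>i - j\<bar> < int p" using ij(1,2) by auto
    ultimately have "i - j = 0" using zdvd_not_zless[of "\<bar>i - j\<bar>" "int p"] by (cases "i - j = 0") auto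
    thus "i = j" by simp
  qed
  ultimately have "idx ?G (carrier ?G) (multiples ?G p) = enat p" by (simp add: idx_def ecard_def card_image)
  thus ?thesis using G.idx_carrier_pre[of p k] pre by simp
qed

subsection \<open>Pruefer groups\<close>

lemma pruefer_comm: assumes "prime p" shows "comm_group (pruefer_group p)"
proof (rule comm_groupI)
  have "(1::complex) ^ (p ^ 0) = 1" by simp
  hence "(1::complex) \<in> carrier (pruefer_group p)" unfolding pruefer_group_def by auto
  thus "\<one>\<^bsub>pruefer_group p\<^esub> \<in> carrier (pruefer_group p)" by (simp add: pruefer_group_def)
next
  fix x y assume xy: "x \<in> carrier (pruefer_group p)" "y \<in> carrier (pruefer_group p)"
  then obtain m n where mn: "x ^ (p ^ m) = 1" "y ^ (p ^ n) = 1" unfolding pruefer_group_def by auto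
  have "x ^ (p ^ (m + n)) = (x ^ (p ^ m)) ^ (p ^ n)" by (simp only: power_add power_mult)
  moreover have "y ^ (p ^ (m + n)) = (y ^ (p ^ n)) ^ (p ^ m)" by (simp only: add.commute[of m n] power_add power_mult)
  ultimately have "x ^ (p ^ (m + n)) = 1" "y ^ (p ^ (m + n)) = 1" using mn by simp_all
  hence "(x * y) ^ (p ^ (m + n)) = 1" by (simp only: power_mult_distrib mult_1)
  thus "x \<otimes>\<^bsub>pruefer_group p\<^esub> y \<in> carrier (pruefer_group p)" unfolding pruefer_group_def by auto
next
  fix x assume "x \<in> carrier (pruefer_group p)"
  then obtain n where n: "x ^ (p ^ n) = 1" unfolding pruefer_group_def by auto
  show "\<exists>y\<in>carrier (pruefer_group p). y \<otimes>\<^bsub>pruefer_group p\<^esub> x = \<one>\<^bsub>pruefer_group p\<^esub>"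
  proof -
    have "p ^ n > 0" using assms by (simp add: prime_gt_0_nat)
    hence "x \<noteq> 0" using n by (metis power_0_left neq0_conv zero_neq_one)
    moreover have "(inverse x) ^ (p ^ n) = 1" using n by (simp add: power_inverse)
    ultimately show ?thesis unfolding pruefer_group_def by (intro bexI[of _ "inverse x"]) auto
  qed
qed (auto simp: pruefer_group_def)

lemma pruefer_pow: "x [^]\<^bsub>pruefer_group p\<^esub> int n = x ^ n"
proof -
  have "x [^]\<^bsub>pruefer_group p\<^esub> n = x ^ n"
    by (induction n) (simp_all add: pruefer_group_def nat_pow_def mult.commute)
  thus ?thesis by (simp add: int_pow_int)
qed

lemma pruefer_divisible:
  assumes "prime p" shows "carrier (pruefer_group p) \<subseteq> multiples (pruefer_group p) p"
proof
  interpret G: comm_group "pruefer_group p" by (rule pruefer_comm[OF assms])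
  fix x assume "x \<in> carrier (pruefer_group p)"
  then obtain n where n: "x ^ (p ^ n) = 1" unfolding pruefer_group_def by auto
  have p: "p > 0" using assms by (rule prime_gt_0_nat)
  have "x \<noteq> 0" using n p by (metis power_0_left power_eq_0_iff zero_neq_one neq0_conv)
  hence "card {w. w ^ p = x} = p" using card_nth_roots[of x p] p by simp
  hence "{w. w ^ p = x} \<noteq> {}" using p by (metis card.empty neq0_conv)
  then obtain w where w: "w ^ p = x" by blast
  have "w ^ (p ^ Suc n) = 1" using n unfolding w[symmetric] by (simp add: power_mult[symmetric])
  hence "w \<in> carrier (pruefer_group p)" unfolding pruefer_group_def partial_object.simps by blast
  moreover have "x = w [^]\<^bsub>pruefer_group p\<^esub> int p" using w by (simp add: pruefer_pow)
  ultimately show "x \<in> multiples (pruefer_group p) p" using G.multiples_iff by blast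
qed

text \<open>
  The group is divisible, so what is counted are the \<open>p\<close>-th roots of unity.
\<close>

lemma pruefer_tsize:
  assumes "prime p" shows "tsize (pruefer_group p) p k = enat p"
proof -
  interpret G: comm_group "pruefer_group p" by (rule pruefer_comm[OF assms])
  have p: "p > 0" using assms by (rule prime_gt_0_nat)
  have c: "carrier (pruefer_group p) \<subseteq> multiples (pruefer_group p) (p ^ k)"
    by (rule G.divisible_multiples[OF pruefer_divisible[OF assms]])
  have "torsion_part (pruefer_group p) (multiples (pruefer_group p) (p ^ k)) p = {z. z ^ p = 1}"
  proof
    show "torsion_part (pruefer_group p) (multiples (pruefer_group p) (p ^ k)) p \<subseteq> {z. z ^ p = 1}"
      by (auto simp: G.torsion_part_iff pruefer_pow) (simp add: pruefer_group_def)
    show "{z. z ^ p = 1} \<subseteq> torsion_part (pruefer_group p) (multiples (pruefer_group p) (p ^ k)) p"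
    proof
      fix z :: complex assume "z \<in> {z. z ^ p = 1}"
      hence z: "z ^ p = 1" by simp
      hence "z ^ (p ^ 1) = 1" by simp
      hence "z \<in> carrier (pruefer_group p)" unfolding pruefer_group_def partial_object.simps by blast
      thus "z \<in> torsion_part (pruefer_group p) (multiples (pruefer_group p) (p ^ k)) p"
        using c z by (auto simp: G.torsion_part_iff pruefer_pow) (simp add: pruefer_group_def)
    qed
  qed
  moreover have "finite {z::complex. z ^ p = 1}" "card {z::complex. z ^ p = 1} = p"
    using card_roots_unity_eq[of p] p card_ge_0_finite[of "{z::complex. z ^ p = 1}"] by simp_all
  moreover have "torsion_part (pruefer_group p) (multiples (pruefer_group p) (p ^ k)) p \<subseteq> carrier (pruefer_group p)"
    by (rule subgroup.subset) simp
  ultimately show ?thesis using G.idx_trivial by (simp add: tsize_def ecard_def)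
qed

lemma pruefer_unit_prime:
  assumes p: "prime p" and q: "prime q" "q \<noteq> p" shows "unit_prime q (pruefer_group p)"
proof -
  interpret G: comm_group "pruefer_group p" by (rule pruefer_comm[OF p])
  show ?thesis
  proof (rule G.unit_prime_coprime_torsion[OF q(1)])
    fix x assume "x \<in> carrier (pruefer_group p)"
    then obtain n where n: "x ^ (p ^ n) = 1" unfolding pruefer_group_def by auto
    have "\<not> q dvd p ^ n" using p q by (metis prime_dvd_power primes_dvd_imp_eq)
    moreover have "x [^]\<^bsub>pruefer_group p\<^esub> int (p ^ n) = \<one>\<^bsub>pruefer_group p\<^esub>"
      unfolding pruefer_pow n by (simp add: pruefer_group_def)
    ultimately show "\<exists>m. \<not> q dvd m \<and> x [^]\<^bsub>pruefer_group p\<^esub> int m = \<one>\<^bsub>pruefer_group p\<^esub>" by blast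
  qed
qed

subsection \<open>Finite cyclic groups\<close>

lemma cyclic_unit_prime:
  assumes p: "prime p" and q: "prime q" "q \<noteq> p" shows "unit_prime q (integer_mod_group (p ^ n))"
proof -
  interpret G: comm_group "integer_mod_group (p ^ n)" by simp
  show ?thesis
  proof (rule G.unit_prime_coprime_torsion[OF q(1)])
    fix x :: int
    have "\<not> q dvd p ^ n" using p q by (metis prime_dvd_power primes_dvd_imp_eq)
    moreover have "x [^]\<^bsub>integer_mod_group (p ^ n)\<^esub> int (p ^ n) = \<one>\<^bsub>integer_mod_group (p ^ n)\<^esub>"
      unfolding int_pow_integer_mod_group by simp
    ultimately show "\<exists>m. \<not> q dvd m \<and> x [^]\<^bsub>integer_mod_group (p ^ n)\<^esub> int m = \<one>\<^bsub>integer_mod_group (p ^ n)\<^esub>" by blast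
  qed
qed

lemma multiples_below:
  assumes "(a::int) > 0" shows "{x \<in> {0..<a * b}. a dvd x} = (\<lambda>i. a * i) ` {0..<b}"
  using assms by (auto simp: dvd_def zero_le_mult_iff)

lemma cyclic_exponent: "x [^]\<^bsub>integer_mod_group n\<^esub> int n = \<one>\<^bsub>integer_mod_group n\<^esub>"
  unfolding int_pow_integer_mod_group by simp

context
  fixes p n :: nat assumes p: "prime p" and n: "n > 0"
begin

abbreviation Cyc :: "int monoid" where "Cyc \<equiv> integer_mod_group (p ^ n)"

lemma cyclic_carrier: "carrier Cyc = {0..<int p ^ n}"
  using p by (simp add: carrier_integer_mod_group prime_gt_0_nat)

lemma cyclic_multiples:
  assumes "k \<le> n" shows "x \<in> multiples Cyc (p ^ k) \<longleftrightarrow> x \<in> {0..<int p ^ n} \<and> int p ^ k dvd x"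
proof -
  interpret G: comm_group "Cyc" by simp
  have pk: "int p ^ k dvd int p ^ n" using assms by (rule le_imp_power_dvd)
  have pos: "int p ^ n > 0" "int p ^ k > 0" using p by (simp_all add: prime_gt_0_nat)
  show ?thesis
  proof
    assume "x \<in> multiples Cyc (p ^ k)"
    then obtain y where y: "y \<in> carrier Cyc" "x = (int (p ^ k) * y) mod int (p ^ n)"
      unfolding G.multiples_iff int_pow_integer_mod_group by blast
    have "int p ^ k dvd x" unfolding y(2) using pk by (simp add: dvd_mod)
    thus "x \<in> {0..<int p ^ n} \<and> int p ^ k dvd x" unfolding y(2) using pos(1) by simp
  next
    assume x: "x \<in> {0..<int p ^ n} \<and> int p ^ k dvd x"
    then obtain y where y: "x = int p ^ k * y" by (auto simp: dvd_def)
    have "0 \<le> y" using x y pos(2) by (simp add: zero_le_mult_iff)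
    moreover have "y \<le> x"
    proof -
      have "1 \<le> int p ^ k" using pos(2) by linarith
      hence "1 * y \<le> int p ^ k * y" using \<open>0 \<le> y\<close> by (rule mult_right_mono)
      thus ?thesis using y by simp
    qed
    ultimately have "y \<in> carrier Cyc" using x by (simp add: cyclic_carrier)
    moreover have "x = (int (p ^ k) * y) mod int (p ^ n)" using x y by simp
    ultimately show "x \<in> multiples Cyc (p ^ k)" unfolding G.multiples_iff int_pow_integer_mod_group by blast
  qed
qed

lemma cyclic_multiples_trivial:
  assumes "n \<le> k" shows "multiples Cyc (p ^ k) = {\<one>\<^bsub>Cyc\<^esub>}"
proof -
  interpret G: comm_group "Cyc" by simp
  have "multiples Cyc (p ^ k) \<subseteq> multiples Cyc (p ^ n)" using assms by (intro G.multiples_dvd le_imp_power_dvd)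
  also have "\<dots> \<subseteq> {\<one>\<^bsub>Cyc\<^esub>}"
  proof
    fix x assume "x \<in> multiples Cyc (p ^ n)"
    then obtain y where "x = y [^]\<^bsub>Cyc\<^esub> int (p ^ n)" unfolding G.multiples_iff by blast
    thus "x \<in> {\<one>\<^bsub>Cyc\<^esub>}" by (simp only: cyclic_exponent singletonI)
  qed
  finally show ?thesis using G.one_multiples by blast
qed

lemma cyclic_invariants_trivial:
  assumes "n \<le> k" shows "tfree Cyc p k = 1" "tsize Cyc p k = 1"
    "ulm Cyc p k = 1"
proof -
  interpret G: comm_group "Cyc" by simp
  have t: "torsion_part Cyc (multiples Cyc (p ^ k)) p \<subseteq> {\<one>\<^bsub>Cyc\<^esub>}"
    using cyclic_multiples_trivial[OF assms] by (auto simp: torsion_part_def)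
  show "tfree Cyc p k = 1"
    unfolding tfree_def cyclic_multiples_trivial[OF assms]
    using G.idx_eq_1_iff[OF G.triv_subgroup G.multiples_subgroup] G.one_multiples by simp
  show "tsize Cyc p k = 1"
    unfolding tsize_def using t G.idx_eq_1_iff[OF G.torsion_part_multiples_subgroup G.triv_subgroup] by simp
  have "torsion_part Cyc (multiples Cyc (p ^ k)) p \<subseteq> multiples Cyc (p ^ (k + 1))"
    using t G.one_multiples by blast
  thus "ulm Cyc p k = 1"
    unfolding ulm_def using G.idx_eq_1_iff[OF G.torsion_part_multiples_subgroup G.multiples_subgroup] by simp
qed

lemma cyclic_torsion: "x \<in> tors Cyc p \<longleftrightarrow> x \<in> {0..<int p ^ n} \<and> int p ^ (n - 1) dvd x"
proof -
  interpret G: comm_group "Cyc" by simp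
  have pn: "int p ^ n = int p * int p ^ (n - 1)" using n by (cases n) auto
  have "x [^]\<^bsub>Cyc\<^esub> int p = \<one>\<^bsub>Cyc\<^esub> \<longleftrightarrow> int p * int p ^ (n - 1) dvd int p * x"
    unfolding int_pow_integer_mod_group using pn by (simp add: mod_eq_0_iff_dvd)
  also have "\<dots> \<longleftrightarrow> int p ^ (n - 1) dvd x" using p by (simp add: prime_gt_0_nat)
  finally have t: "x [^]\<^bsub>Cyc\<^esub> int p = \<one>\<^bsub>Cyc\<^esub> \<longleftrightarrow> int p ^ (n - 1) dvd x" .
  have "x \<in> carrier Cyc \<longleftrightarrow> x \<in> {0..<int p ^ n}" by (simp only: cyclic_carrier)
  thus ?thesis using t G.tors_iff[of x p] by blast
qed

text \<open>
  The elements of order \<open>p\<close> are the multiples of \<open>p^(n-1)\<close>: all of them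
  are divisible by \<open>p^k\<close> for \<open>k < n\<close>, and only zero is for \<open>k
  \<ge> n\<close>.
\<close>

lemma cyclic_ulm: "ulm Cyc p k = (if Suc k = n then enat p else 1)"
proof -
  interpret G: comm_group "Cyc" by simp
  have tt: "torsion_part Cyc (multiples Cyc m) p = multiples Cyc m \<inter> tors Cyc p" for m
    using G.multiples_carrier[of m] by (auto simp: torsion_part_def)
  consider "n \<le> k" | "Suc k < n" | "Suc k = n" by linarith
  thus ?thesis
  proof cases
    case 1 thus ?thesis using cyclic_invariants_trivial(3)[of k] by simp
  next
    case 2
    have "tors Cyc p \<subseteq> multiples Cyc (p ^ (k + 1))"
    proof
      fix x assume "x \<in> tors Cyc p"
      hence x: "x \<in> {0..<int p ^ n}" "int p ^ (n - 1) dvd x" using cyclic_torsion by auto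
      have "int p ^ (k + 1) dvd int p ^ (n - 1)" using 2 by (intro le_imp_power_dvd) simp
      hence "int p ^ (k + 1) dvd x" using x(2) dvd_trans by blast
      thus "x \<in> multiples Cyc (p ^ (k + 1))" using cyclic_multiples[of "k + 1" x] x(1) 2 by simp
    qed
    hence "torsion_part Cyc (multiples Cyc (p ^ k)) p \<subseteq> multiples Cyc (p ^ (k + 1))" unfolding tt by blast
    thus ?thesis using 2 G.idx_eq_1_iff[OF G.torsion_part_multiples_subgroup G.multiples_subgroup] by (simp add: ulm_def)
  next
    case 3
    have k: "n - 1 = k" using 3 by simp
    have eq: "torsion_part Cyc (multiples Cyc (p ^ k)) p = (\<lambda>i. int p ^ k * i) ` {0..<int p}"
    proof -
      have pos: "int p ^ k > 0" using p by (simp add: prime_gt_0_nat)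
      have pn: "int p ^ n = int p ^ k * int p" using 3 by auto
      have "torsion_part Cyc (multiples Cyc (p ^ k)) p = {x \<in> {0..<int p ^ n}. int p ^ k dvd x}"
        unfolding tt using cyclic_torsion cyclic_multiples[of k] k 3 by auto
      also have "\<dots> = (\<lambda>i. int p ^ k * i) ` {0..<int p}"
        unfolding pn by (rule multiples_below[OF pos])
      finally show ?thesis .
    qed
    have "inj_on (\<lambda>i. int p ^ k * i) {0..<int p}" using p by (intro inj_onI) (simp add: prime_gt_0_nat)
    hence "ecard (torsion_part Cyc (multiples Cyc (p ^ k)) p) = enat p" unfolding eq by (simp add: ecard_def card_image)
    moreover have "multiples Cyc (p ^ (k + 1)) = {\<one>\<^bsub>Cyc\<^esub>}" using cyclic_multiples_trivial[of "k + 1"] 3 by simp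
    moreover have "torsion_part Cyc (multiples Cyc (p ^ k)) p \<subseteq> carrier Cyc" by (rule subgroup.subset) simp
    ultimately show ?thesis using 3 G.idx_trivial by (simp add: ulm_def)
  qed
qed

end

section \<open>Invariants of the Szmielew groups\<close>

text \<open>
  The three invariants as indices between solution sets, collected in one predicate so that sums
  are treated once for all of them.
\<close>

inductive invariant_pair :: "nat \<Rightarrow> (nat \<times> int) set \<Rightarrow> (nat \<times> int) set \<Rightarrow> bool" for p where
  ulm_pair: "invariant_pair p {(p ^ k, 1), (0, int p)} {(p ^ (k + 1), 1)}"
| tfree_pair: "invariant_pair p {(p ^ k, 1)} {(p ^ (k + 1), 1)}"
| tsize_pair: "invariant_pair p {(p ^ k, 1), (0, int p)} {(0, 1)}"

lemma unit_prime_pair: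
  assumes "comm_group G" "unit_prime p G" "invariant_pair p L K" shows "sidx G L K = 1"
proof -
  interpret comm_group G by fact
  show ?thesis using assms(3)
  proof cases
    case (ulm_pair k) thus ?thesis using unit_prime_invariants(1)[OF assms(2), of k] by (simp only: ulm_sol)
  next
    case (tfree_pair k) thus ?thesis using unit_prime_invariants(2)[OF assms(2), of k] by (simp only: tfree_sol)
  next
    case (tsize_pair k) thus ?thesis using unit_prime_invariants(3)[OF assms(2), of k] by (simp only: tsize_sol)
  qed
qed

definition cyclic_part :: "(nat \<Rightarrow> nat \<Rightarrow> enat) \<Rightarrow> nat \<Rightarrow> (nat \<Rightarrow> nat \<Rightarrow> int) monoid" where
  "cyclic_part \<alpha> p = sum_group {n. n > 0} (\<lambda>n. copies (integer_mod_group (p ^ n)) (\<alpha> p n))"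

definition primary_part ::
  "(nat \<Rightarrow> nat \<Rightarrow> enat) \<Rightarrow> (nat \<Rightarrow> enat) \<Rightarrow> (nat \<Rightarrow> enat) \<Rightarrow> nat \<Rightarrow>
    ((nat \<Rightarrow> nat \<Rightarrow> int) \<times> (nat \<Rightarrow> rat) \<times> (nat \<Rightarrow> complex)) monoid" where
  "primary_part \<alpha> \<beta> \<gamma> p = cyclic_part \<alpha> p \<times>\<times> copies (Z_localized p) (\<beta> p) \<times>\<times> copies (pruefer_group p) (\<gamma> p)"

lemma szmielew_group_eq:
  "szmielew_group \<alpha> \<beta> \<gamma> \<delta> = sum_group {p. prime p} (primary_part \<alpha> \<beta> \<gamma>) \<times>\<times> copies rat_group \<delta>"
  by (simp add: szmielew_group_def primary_part_def[abs_def] cyclic_part_def)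

lemma cyclic_part_sum: "direct_sum {n. n > 0} (\<lambda>n. copies (integer_mod_group (p ^ n)) (\<alpha> p n))"
  by (rule direct_sum.intro) (rule comm_group_copies, simp)

lemma cyclic_part_comm: "comm_group (cyclic_part \<alpha> p)"
  unfolding cyclic_part_def by (rule comm_group_sum) (rule comm_group_copies, simp)

lemma localized_part_comm: "prime p \<Longrightarrow> comm_group (copies (Z_localized p) b)"
  by (intro comm_group_copies Z_localized_comm)

lemma pruefer_part_comm: "prime p \<Longrightarrow> comm_group (copies (pruefer_group p) c)"
  by (intro comm_group_copies pruefer_comm)

lemma primary_part_comm: "prime p \<Longrightarrow> comm_group (primary_part \<alpha> \<beta> \<gamma> p)"
  unfolding primary_part_def
  by (intro comm_group_DirProd cyclic_part_comm localized_part_comm pruefer_part_comm)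

lemma primary_sum: "direct_sum {p. prime p} (primary_part \<alpha> \<beta> \<gamma>)"
  by (rule direct_sum.intro) (rule primary_part_comm, simp)

lemma primary_sum_comm: "comm_group (sum_group {p. prime p} (primary_part \<alpha> \<beta> \<gamma>))"
  by (rule comm_group_sum) (rule primary_part_comm, simp)

lemma szmielew_comm: "comm_group (szmielew_group \<alpha> \<beta> \<gamma> \<delta>)"
  unfolding szmielew_group_eq
  by (intro comm_group_DirProd primary_sum_comm comm_group_copies rat_group_comm)

lemma primary_part_unit_prime:
  assumes p: "prime p" and q: "prime q" "q \<noteq> p" shows "unit_prime q (primary_part \<alpha> \<beta> \<gamma> p)"
  unfolding primary_part_def
proof (intro unit_prime_DirProd comm_group_DirProd cyclic_part_comm localized_part_comm pruefer_part_comm p)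
  show "unit_prime q (cyclic_part \<alpha> p)"
    unfolding cyclic_part_def
    by (rule direct_sum.unit_prime_sum[OF cyclic_part_sum]) (intro unit_prime_copies cyclic_unit_prime p q, simp)
  show "unit_prime q (copies (Z_localized p) (\<beta> p))"
    by (intro unit_prime_copies Z_localized_comm Z_localized_unit_prime p q)
  show "unit_prime q (copies (pruefer_group p) (\<gamma> p))"
    by (intro unit_prime_copies pruefer_comm pruefer_unit_prime p q)
qed

text \<open>
  Multiplication by \<open>p\<close> is bijective on the primary parts of the other primes and on
  the rationals, so only the primary part of \<open>p\<close> contributes.
\<close>

lemma idx_szmielew:
  assumes p: "prime p" and LK: "invariant_pair p L K"
  shows "sidx (szmielew_group \<alpha> \<beta> \<gamma> \<delta>) L K =
    sidx (cyclic_part \<alpha> p) L K *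
    (sidx (copies (Z_localized p) (\<beta> p)) L K *
     sidx (copies (pruefer_group p) (\<gamma> p)) L K)"
proof -
  define S C Z P where S_def: "S = szmielew_group \<alpha> \<beta> \<gamma> \<delta>" and C_def: "C = cyclic_part \<alpha> p"
    and Z_def: "Z = copies (Z_localized p) (\<beta> p)" and P_def: "P = copies (pruefer_group p) (\<gamma> p)"
  let ?R = "primary_part \<alpha> \<beta> \<gamma>"
  let ?A = "sum_group {p. prime p} ?R" and ?Q = "copies rat_group \<delta>"
  have "sidx S L K = sidx ?A L K * sidx ?Q L K"
    unfolding S_def szmielew_group_eq
    by (rule idx_DirProd) (intro primary_sum_comm comm_group_copies rat_group_comm)+
  also have "sidx ?Q L K = 1"
    by (rule unit_prime_pair[OF _ _ LK]) (intro comm_group_copies unit_prime_copies rat_group_comm rat_group_unit_prime p)+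
  also have "sidx ?A L K = sidx (?R p) L K"
  proof (rule direct_sum.idx_sum_single[OF primary_sum])
    show "p \<in> {p. prime p}" using p by simp
    fix q assume "q \<in> {p. prime p}" "q \<noteq> p"
    hence q: "prime q" "p \<noteq> q" by auto
    show "sidx (?R q) L K = 1"
      by (rule unit_prime_pair[OF primary_part_comm[OF q(1)] primary_part_unit_prime[OF q(1) p q(2)] LK])
  qed
  also have "\<dots> = sidx C L K * (sidx Z L K * sidx P L K)"
  proof -
    have c: "comm_group C" "comm_group Z" "comm_group P"
      unfolding C_def Z_def P_def by (intro cyclic_part_comm localized_part_comm[OF p] pruefer_part_comm[OF p])+
    have R: "?R p = C \<times>\<times> Z \<times>\<times> P" by (simp add: primary_part_def C_def Z_def P_def)
    show ?thesis unfolding R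
      by (simp add: idx_DirProd[OF c(1) comm_group_DirProd[OF c(2,3)]] idx_DirProd[OF c(2,3)])
  qed
  finally show ?thesis by (simp add: S_def C_def Z_def P_def)
qed

context
  fixes p :: nat assumes p: "prime p"
begin

lemma p_ge_2: "p \<ge> 2" using p by (rule prime_ge_2_nat)

text \<open>
  Only the cyclic groups of order \<open>p^(k+1)\<close> have a nontrivial \<open>k\<close>-th Ulm
  quotient, and it has order \<open>p\<close>.
\<close>

lemma szmielew_ulm: "ulm (szmielew_group \<alpha> \<beta> \<gamma> \<delta>) p k = pw p (\<alpha> p (Suc k))"
proof -
  let ?L = "{(p ^ k, 1::int), (0, int p)}" and ?K = "{(p ^ (k + 1), 1::int)}"
  let ?c = "\<lambda>n. copies (integer_mod_group (p ^ n)) (\<alpha> p n)"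
  have "sidx (cyclic_part \<alpha> p) ?L ?K = sidx (?c (Suc k)) ?L ?K"
    unfolding cyclic_part_def
  proof (rule direct_sum.idx_sum_single[OF cyclic_part_sum])
    fix n assume n: "n \<in> {n. 0 < n}" "n \<noteq> Suc k"
    interpret G: comm_group "integer_mod_group (p ^ n)" by simp
    have "ulm (integer_mod_group (p ^ n)) p k = 1" using cyclic_ulm[OF p, of n k] n by simp
    thus "sidx (?c n) ?L ?K = 1"
      unfolding G.ulm_sol by (intro idx_copies_trivial disjI2) simp_all
  qed simp
  also have "\<dots> = pw p (\<alpha> p (Suc k))"
  proof (rule idx_copies)
    interpret G: comm_group "integer_mod_group (p ^ Suc k)" by simp
    show "sidx (integer_mod_group (p ^ Suc k)) ?L ?K = enat p"
      unfolding G.ulm_sol[symmetric] using cyclic_ulm[OF p, of "Suc k" k] by simp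
  qed (use p_ge_2 in simp_all)
  finally have C: "sidx (cyclic_part \<alpha> p) ?L ?K = pw p (\<alpha> p (Suc k))" .
  interpret Zl: comm_group "Z_localized p" by (rule Z_localized_comm[OF p])
  interpret Pr: comm_group "pruefer_group p" by (rule pruefer_comm[OF p])
  have Z: "sidx (copies (Z_localized p) (\<beta> p)) ?L ?K = 1"
    by (rule idx_copies_trivial[OF Zl.comm_group_axioms])
       (use Zl.torsionfree_invariants(1)[OF Z_localized_torsionfree[OF p], of p k] p_ge_2 in \<open>simp only: Zl.ulm_sol, simp\<close>)
  have P: "sidx (copies (pruefer_group p) (\<gamma> p)) ?L ?K = 1"
    by (rule idx_copies_trivial[OF Pr.comm_group_axioms])
       (use Pr.divisible_invariants(1)[OF pruefer_divisible[OF p], of k] in \<open>simp only: Pr.ulm_sol, simp\<close>)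
  show ?thesis
    unfolding comm_group.ulm_sol[OF szmielew_comm] idx_szmielew[OF p ulm_pair] C Z P by simp
qed

lemma cyclic_part_trivial:
  assumes "\<And>n. n > k \<Longrightarrow> \<alpha> p n = 0"
    and "\<And>n. n > 0 \<Longrightarrow> n \<le> k \<Longrightarrow> sidx (integer_mod_group (p ^ n)) L K = 1"
  shows "sidx (cyclic_part \<alpha> p) L K = 1"
  unfolding cyclic_part_def
proof (rule direct_sum.idx_sum_trivial[OF cyclic_part_sum])
  fix n :: nat assume "n \<in> {n. 0 < n}"
  hence "\<alpha> p n = 0 \<or> sidx (integer_mod_group (p ^ n)) L K = 1"
    using assms by (cases "n > k") auto
  thus "idx (copies (integer_mod_group (p ^ n)) (\<alpha> p n)) (sol (copies (integer_mod_group (p ^ n)) (\<alpha> p n)) L)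
      (sol (copies (integer_mod_group (p ^ n)) (\<alpha> p n)) K) = 1"
    by (intro idx_copies_trivial) simp
qed

text \<open>
  Cyclic groups of order at most \<open>p^k\<close> and divisible groups do not contribute.
\<close>

lemma szmielew_tfree:
  assumes "\<And>n. n > k \<Longrightarrow> \<alpha> p n = 0"
  shows "tfree (szmielew_group \<alpha> \<beta> \<gamma> \<delta>) p k = pw p (\<beta> p)"
proof -
  let ?L = "{(p ^ k, 1::int)}" and ?K = "{(p ^ (k + 1), 1::int)}"
  have C: "sidx (cyclic_part \<alpha> p) ?L ?K = 1"
  proof (rule cyclic_part_trivial[of k \<alpha>, OF assms])
    fix n assume n: "n > 0" "n \<le> k"
    interpret G: comm_group "integer_mod_group (p ^ n)" by simp
    show "sidx (integer_mod_group (p ^ n)) ?L ?K = 1"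
      unfolding G.tfree_sol[symmetric] by (rule cyclic_invariants_trivial(1)[OF p n])
  qed
  interpret Zl: comm_group "Z_localized p" by (rule Z_localized_comm[OF p])
  interpret Pr: comm_group "pruefer_group p" by (rule pruefer_comm[OF p])
  have Z: "sidx (copies (Z_localized p) (\<beta> p)) ?L ?K = pw p (\<beta> p)"
    by (rule idx_copies[OF Zl.comm_group_axioms _ p_ge_2])
       (use Z_localized_tfree[OF p, of k] in \<open>simp only: Zl.tfree_sol\<close>)
  have P: "sidx (copies (pruefer_group p) (\<gamma> p)) ?L ?K = 1"
    by (rule idx_copies_trivial[OF Pr.comm_group_axioms])
       (use Pr.divisible_invariants(2)[OF pruefer_divisible[OF p], of k] in \<open>simp only: Pr.tfree_sol, simp\<close>)
  show ?thesis
    unfolding comm_group.tfree_sol[OF szmielew_comm] idx_szmielew[OF p tfree_pair] C Z P by simp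
qed

text \<open>
  Cyclic groups of order at most \<open>p^k\<close> and torsion-free groups do not contribute.
\<close>

lemma szmielew_tsize:
  assumes "\<And>n. n > k \<Longrightarrow> \<alpha> p n = 0"
  shows "tsize (szmielew_group \<alpha> \<beta> \<gamma> \<delta>) p k = pw p (\<gamma> p)"
proof -
  let ?L = "{(p ^ k, 1::int), (0, int p)}" and ?K = "{(0::nat, 1::int)}"
  have C: "sidx (cyclic_part \<alpha> p) ?L ?K = 1"
  proof (rule cyclic_part_trivial[of k \<alpha>, OF assms])
    fix n assume n: "n > 0" "n \<le> k"
    interpret G: comm_group "integer_mod_group (p ^ n)" by simp
    show "sidx (integer_mod_group (p ^ n)) ?L ?K = 1"
      unfolding G.tsize_sol[symmetric] by (rule cyclic_invariants_trivial(2)[OF p n])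
  qed
  interpret Zl: comm_group "Z_localized p" by (rule Z_localized_comm[OF p])
  interpret Pr: comm_group "pruefer_group p" by (rule pruefer_comm[OF p])
  have Z: "sidx (copies (Z_localized p) (\<beta> p)) ?L ?K = 1"
    by (rule idx_copies_trivial[OF Zl.comm_group_axioms])
       (use Zl.torsionfree_invariants(2)[OF Z_localized_torsionfree[OF p], of p k] p_ge_2 in \<open>simp only: Zl.tsize_sol, simp\<close>)
  have P: "sidx (copies (pruefer_group p) (\<gamma> p)) ?L ?K = pw p (\<gamma> p)"
    by (rule idx_copies[OF Pr.comm_group_axioms _ p_ge_2])
       (use pruefer_tsize[OF p, of k] in \<open>simp only: Pr.tsize_sol\<close>)
  show ?thesis
    unfolding comm_group.tsize_sol[OF szmielew_comm] idx_szmielew[OF p tsize_pair] C Z P by simp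
qed

end

abbreviation killed :: "nat \<Rightarrow> ('a, 'b) monoid_scheme \<Rightarrow> bool" where
  "killed e G \<equiv> \<forall>x\<in>carrier G. x [^]\<^bsub>G\<^esub> int e = \<one>\<^bsub>G\<^esub>"

lemma power_trivial_DirProd:
  assumes "comm_group G" "comm_group H"
  shows "killed e (G \<times>\<times> H) \<longleftrightarrow>
    killed e G \<and> killed e H"
proof -
  interpret G: comm_group G by fact
  interpret H: comm_group H by fact
  have "\<one>\<^bsub>G\<^esub> \<in> carrier G" "\<one>\<^bsub>H\<^esub> \<in> carrier H" by auto
  thus ?thesis by (auto simp: int_pow_DirProd[OF assms])
qed

lemma (in direct_sum) power_trivial_sum:
  assumes "\<And>i x. i \<in> I \<Longrightarrow> x \<in> carrier (G i) \<Longrightarrow> x [^]\<^bsub>G i\<^esub> int e = \<one>\<^bsub>G i\<^esub>"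
  shows "killed e S"
proof
  fix x assume x: "x \<in> carrier S"
  show "x [^]\<^bsub>S\<^esub> int e = \<one>\<^bsub>S\<^esub>"
  proof (rule carrier_eqI)
    show "x [^]\<^bsub>S\<^esub> int e \<in> carrier S" using x by simp
    show "\<one>\<^bsub>S\<^esub> \<in> carrier S" by (rule S.one_closed)
    fix i assume "i \<in> I"
    thus "(x [^]\<^bsub>S\<^esub> int e) i = \<one>\<^bsub>S\<^esub> i" using assms coord[OF x] int_pow_coord[OF x] by simp
  qed
qed

lemma power_trivial_copies:
  assumes "comm_group G" "\<alpha> = 0 \<or> killed e G"
  shows "killed e (copies G \<alpha>)"
proof -
  interpret direct_sum "{i. enat i < \<alpha>}" "\<lambda>_. G" by (rule direct_sum.intro) (rule assms(1))
  show ?thesis unfolding copies_def by (rule power_trivial_sum) (use assms(2) in auto)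
qed

lemma szmielew_bounded:
  assumes "e > 0" "\<And>p n. prime p \<Longrightarrow> n > 0 \<Longrightarrow> \<alpha> p n \<noteq> 0 \<Longrightarrow> p ^ n dvd e"
    and "\<And>p. prime p \<Longrightarrow> \<beta> p = 0" "\<And>p. prime p \<Longrightarrow> \<gamma> p = 0"
  shows "bounded_exp (szmielew_group \<alpha> \<beta> \<gamma> 0)"
proof -
  have cyc: "killed e (cyclic_part \<alpha> p)" if p: "prime p" for p
    unfolding cyclic_part_def
  proof (rule direct_sum.power_trivial_sum[OF cyclic_part_sum])
    fix n x assume n: "n \<in> {n. 0 < n}" and x: "x \<in> carrier (copies (integer_mod_group (p ^ n)) (\<alpha> p n))"
    have "\<alpha> p n = 0 \<or> killed e (integer_mod_group (p ^ n))"
    proof (cases "\<alpha> p n = 0")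
      case False
      hence "int (p ^ n) dvd int e" using assms(2)[OF p] n by (simp only: int_dvd_int_iff) simp
      hence "(int e * x) mod int (p ^ n) = 0" for x by (intro mod_eq_0_iff_dvd[THEN iffD2] dvd_mult2)
      thus ?thesis by (simp only: int_pow_integer_mod_group one_integer_mod_group) simp
    qed simp
    thus "x [^]\<^bsub>copies (integer_mod_group (p ^ n)) (\<alpha> p n)\<^esub> int e = \<one>\<^bsub>copies (integer_mod_group (p ^ n)) (\<alpha> p n)\<^esub>"
      using power_trivial_copies[of "integer_mod_group (p ^ n)" "\<alpha> p n" e] x by simp
  qed
  have prim: "killed e (primary_part \<alpha> \<beta> \<gamma> p)" if p: "prime p" for p
  proof -
    have b: "killed e (copies (Z_localized p) (\<beta> p))"
      by (rule power_trivial_copies[OF Z_localized_comm[OF p]]) (use assms(3)[OF p] in simp)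
    have c: "killed e (copies (pruefer_group p) (\<gamma> p))"
      by (rule power_trivial_copies[OF pruefer_comm[OF p]]) (use assms(4)[OF p] in simp)
    show ?thesis
      unfolding primary_part_def
        power_trivial_DirProd[OF cyclic_part_comm comm_group_DirProd[OF localized_part_comm[OF p] pruefer_part_comm[OF p]]]
        power_trivial_DirProd[OF localized_part_comm[OF p] pruefer_part_comm[OF p]]
      using cyc[OF p] b c by blast
  qed
  have sum: "killed e (sum_group {p. prime p} (primary_part \<alpha> \<beta> \<gamma>))"
    by (rule direct_sum.power_trivial_sum[OF primary_sum]) (use prim in blast)
  have rat: "killed e (copies rat_group 0)"
    by (rule power_trivial_copies[OF rat_group_comm]) simp
  have "killed e (szmielew_group \<alpha> \<beta> \<gamma> 0)"
    unfolding szmielew_group_eq power_trivial_DirProd[OF primary_sum_comm comm_group_copies[OF rat_group_comm]]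
    using sum rat by blast
  thus ?thesis unfolding bounded_exp_def using assms(1) by (intro exI[of _ e]) (simp only: int_pow_int simp_thms)
qed

text \<open>
  One summand of rationals makes the exponent unbounded. Its invariants at the primes are trivial.
\<close>

lemma szmielew_unbounded: "\<not> bounded_exp (szmielew_group \<alpha> \<beta> \<gamma> 1)"
proof
  let ?A = "sum_group {p. prime p} (primary_part \<alpha> \<beta> \<gamma>)" and ?Q = "copies rat_group 1"
  assume "bounded_exp (szmielew_group \<alpha> \<beta> \<gamma> 1)"
  then obtain e :: nat where e: "e > 0"
    "\<forall>x\<in>carrier (szmielew_group \<alpha> \<beta> \<gamma> 1). x [^]\<^bsub>szmielew_group \<alpha> \<beta> \<gamma> 1\<^esub> e = \<one>\<^bsub>szmielew_group \<alpha> \<beta> \<gamma> 1\<^esub>"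
    unfolding bounded_exp_def by blast
  have "killed e (?A \<times>\<times> ?Q)"
    using e(2) unfolding szmielew_group_eq by (simp only: int_pow_int simp_thms)
  hence Q: "killed e ?Q"
    unfolding power_trivial_DirProd[OF primary_sum_comm comm_group_copies[OF rat_group_comm]] by (rule conjunct2)
  interpret direct_sum "{i. enat i < 1}" "\<lambda>_. rat_group" by (rule direct_sum.intro) (rule rat_group_comm)
  have i: "0 \<in> {i. enat i < 1}" by (simp add: one_enat_def)
  have c: "single 0 (1::rat) \<in> carrier ?Q" unfolding copies_def by (rule single_carrier[OF i]) (simp add: rat_group_def)
  have "(single 0 (1::rat) [^]\<^bsub>?Q\<^esub> int e) 0 = single 0 (1::rat) 0 [^]\<^bsub>rat_group\<^esub> int e"
    using int_pow_coord[OF _ i] c unfolding copies_def by blast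
  also have "\<dots> = of_nat e" using i by (simp add: single_def rat_group_pow)
  finally have "(\<one>\<^bsub>?Q\<^esub>) 0 = (of_nat e :: rat)" using Q c by simp
  moreover have "(\<one>\<^bsub>?Q\<^esub>) 0 = (0::rat)" using i unfolding copies_def one_sum_group by (simp add: rat_group_def)
  ultimately show False using e(1) by simp
qed

section \<open>Every abelian group has the theory of a Szmielew group\<close>

context comm_group begin

text \<open>The group is generated by \<open>K\<close> and \<open>x\<close>; the cosets are those of \<open>i x\<close> for \<open>0 \<le> i < p\<close>.\<close>

lemma adjoin_index:
  assumes p: "prime p" and H: "subgroup H G" and K: "subgroup K G" "K \<subseteq> H"
    and x: "x \<in> H" "x \<notin> K" "x [^] int p \<in> K"
  shows "\<exists>K'. subgroup K' G \<and> K \<subseteq> K' \<and> K' \<subseteq> H \<and> idx G K' K = enat p"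
proof -
  have Kc: "k \<in> carrier G" if "k \<in> K" for k using subgroup.mem_carrier[OF K(1) that] .
  have Hc: "h \<in> carrier G" if "h \<in> H" for h using subgroup.mem_carrier[OF H that] .
  have xc: "x \<in> carrier G" using Hc x(1) .
  define K' where "K' = {k \<otimes> x [^] (i::int) | k i. k \<in> K}"
  have xK: "x [^] (i::int) \<in> K" if i: "int p dvd i" for i
  proof -
    obtain j where "i = int p * j" using i by (rule dvdE)
    hence "x [^] i = (x [^] int p) [^] j" using xc by (simp add: int_pow_pow)
    thus ?thesis using subgroup_int_pow_closed[OF K(1) x(3)] by simp
  qed
  have K'sub: "subgroup K' G"
  proof (rule subgroupI)
    show "K' \<subseteq> carrier G" unfolding K'_def using Kc xc by auto
    have "\<one> \<otimes> x [^] (0::int) \<in> K'" unfolding K'_def using subgroup.one_closed[OF K(1)] by blast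
    thus "K' \<noteq> {}" by blast
  next
    fix a assume "a \<in> K'"
    then obtain k and i :: int where a: "a = k \<otimes> x [^] i" "k \<in> K" unfolding K'_def by blast
    have "inv a = inv k \<otimes> x [^] (- i)" unfolding a(1) using Kc[OF a(2)] xc by (simp add: inv_mult int_pow_neg)
    thus "inv a \<in> K'" unfolding K'_def using subgroup.m_inv_closed[OF K(1) a(2)] by blast
  next
    fix a b assume "a \<in> K'" "b \<in> K'"
    then obtain k l and i j :: int where a: "a = k \<otimes> x [^] i" "k \<in> K" and b: "b = l \<otimes> x [^] j" "l \<in> K" unfolding K'_def by blast
    have "a \<otimes> b = (k \<otimes> l) \<otimes> x [^] (i + j)" unfolding a(1) b(1) using Kc[OF a(2)] Kc[OF b(2)] xc by (simp add: int_pow_mult m_ac)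
    thus "a \<otimes> b \<in> K'" unfolding K'_def using subgroup.m_closed[OF K(1) a(2) b(2)] by blast
  qed
  have KK': "K \<subseteq> K'"
  proof
    fix k assume k: "k \<in> K"
    hence "k = k \<otimes> x [^] (0::int)" using Kc by simp
    thus "k \<in> K'" unfolding K'_def using k by blast
  qed
  have K'H: "K' \<subseteq> H"
    unfolding K'_def using K(2) subgroup.m_closed[OF H] subgroup_int_pow_closed[OF H x(1)] by blast
  let ?f = "\<lambda>i. K #> (x [^] (i::int))"
  have "(\<lambda>z. K #> z) ` K' = ?f ` {0..<int p}"
  proof
    show "?f ` {0..<int p} \<subseteq> (\<lambda>z. K #> z) ` K'"
    proof (rule image_subsetI)
      fix i :: int
      have "\<one> \<otimes> x [^] i \<in> K'" unfolding K'_def using subgroup.one_closed[OF K(1)] by blast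
      hence "x [^] i \<in> K'" using xc by simp
      thus "?f i \<in> (\<lambda>z. K #> z) ` K'" by (rule imageI)
    qed
    show "(\<lambda>z. K #> z) ` K' \<subseteq> ?f ` {0..<int p}"
    proof (rule image_subsetI)
      fix z assume "z \<in> K'"
      then obtain k and i :: int where z: "z = k \<otimes> x [^] i" "k \<in> K" unfolding K'_def by blast
      let ?i = "i mod int p"
      have "z \<otimes> inv (x [^] ?i) = k \<otimes> x [^] (i - ?i)"
        unfolding z(1) using Kc[OF z(2)] xc by (simp add: int_pow_diff m_assoc)
      moreover have "x [^] (i - ?i) \<in> K" by (rule xK) (simp add: dvd_minus_mod)
      ultimately have "z \<otimes> inv (x [^] ?i) \<in> K" using subgroup.m_closed[OF K(1) z(2)] by simp
      hence "K #> z = ?f ?i" using rcos_eq_iff[OF K(1)] z Kc xc by simp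
      moreover have "?i \<in> {0..<int p}" using p by (simp add: prime_gt_0_nat)
      ultimately show "K #> z \<in> ?f ` {0..<int p}" by blast
    qed
  qed
  moreover have "inj_on ?f {0..<int p}"
  proof (rule inj_onI, rule ccontr)
    fix i j assume ij: "i \<in> {0..<int p}" "j \<in> {0..<int p}" "?f i = ?f j" "i \<noteq> j"
    have d: "x [^] (i - j) \<in> K" using ij(3) rcos_eq_iff[OF K(1)] xc by (simp add: int_pow_diff)
    have "\<not> int p dvd i - j"
    proof
      assume "int p dvd i - j"
      moreover have "\<bar>i - j\<bar> < int p" using ij(1,2) by auto
      ultimately have "i - j = 0" using zdvd_not_zless[of "\<bar>i - j\<bar>" "int p"] by (cases "i - j = 0") auto
      thus False using ij(4) by simp
    qed
    then obtain u v where uv: "u * (i - j) + v * int p = 1" using bezout_prime[OF p] by blast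
    have "x = x [^] ((i - j) * u + int p * v)" using uv xc by (simp add: mult.commute)
    also have "\<dots> = (x [^] (i - j)) [^] u \<otimes> (x [^] int p) [^] v" using xc by (simp only: int_pow_mult int_pow_pow)
    also have "\<dots> \<in> K"
      by (intro subgroup.m_closed[OF K(1)] subgroup_int_pow_closed[OF K(1)] d x(3))
    finally show False using x(2) by blast
  qed
  ultimately have "idx G K' K = enat p" by (simp add: idx_def ecard_def card_image)
  thus ?thesis using K'sub KK' K'H by blast
qed

text \<open>
  The quotient is a vector space over the field with \<open>p\<close> elements. A finite index is
  exhausted by adjoining elements of order \<open>p\<close> modulo \<open>K\<close>.
\<close>

lemma elementary_index_pw:
  assumes p: "prime p" and H: "subgroup H G" and K: "subgroup K G" "K \<subseteq> H"
    and e: "\<And>x. x \<in> H \<Longrightarrow> x [^] int p \<in> K"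
  shows "\<exists>d. idx G H K = pw p d"
proof (cases "idx G H K")
  case infinity
  thus ?thesis by (intro exI[of _ \<infinity>]) (simp add: pw_def)
next
  case (enat n)
  thus ?thesis using K e
  proof (induction n arbitrary: K rule: less_induct)
    case (less n K)
    show ?case
    proof (cases "H \<subseteq> K")
      case True
      hence "idx G H K = 1" using idx_eq_1_iff[OF H less.prems(2)] by simp
      thus ?thesis by (intro exI[of _ 0]) simp
    next
      case False
      then obtain x where x: "x \<in> H" "x \<notin> K" by blast
      obtain K' where K': "subgroup K' G" "K \<subseteq> K'" "K' \<subseteq> H" "idx G K' K = enat p"
        using adjoin_index[OF p H less.prems(2,3) x less.prems(4)[OF x(1)]] by blast
      have t: "idx G H K = idx G H K' * enat p" using idx_tower[OF H less.prems(2) K'(1-3)] K'(4) by simp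
      have "p > 1" using p by (rule prime_gt_1_nat)
      have "idx G H K' \<noteq> \<infinity>"
      proof
        assume "idx G H K' = \<infinity>"
        hence "idx G H K = \<infinity>" using t \<open>p > 1\<close> by (simp add: imult_is_infinity zero_enat_def)
        thus False using less.prems(1) by simp
      qed
      then obtain m where m: "idx G H K' = enat m" by auto
      have n: "n = m * p" using t m less.prems(1) by simp
      have "idx G H K' \<ge> 1" using subgroup.one_closed[OF H] by (intro idx_ge_1) blast
      hence "m \<ge> 1" using m by (simp add: one_enat_def)
      hence "m < n" using n \<open>p > 1\<close> by simp
      then obtain d where "idx G H K' = pw p d" using less.IH[OF _ m K'(1,3)] less.prems(4) K'(2) by blast
      hence "enat m = pw p d" using m by simp
      then obtain d' where d': "m = p ^ d'" by (auto simp: pw_def split: enat.splits)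
      have "idx G H K = pw p (enat (Suc d'))" using t m d' by (simp add: pw_def mult.commute)
      thus ?thesis by blast
    qed
  qed
qed

lemma pow_p_multiples:
  assumes "x \<in> multiples G (p ^ k)" shows "x [^] int p \<in> multiples G (p ^ (k + 1))"
proof -
  obtain y where y: "y \<in> carrier G" "x = y [^] int (p ^ k)" using assms unfolding multiples_iff by (rule bexE)
  have "x [^] int p = y [^] int (p ^ (k + 1))" unfolding y(2) using y(1) by (simp add: int_pow_pow ac_simps)
  thus ?thesis using y(1) multiples_iff by blast
qed

lemma invariants_pw:
  assumes p: "prime p"
  shows "\<exists>d. ulm G p k = pw p d" "\<exists>d. tfree G p k = pw p d" "\<exists>d. tsize G p k = pw p d"
proof -
  have one: "\<one> \<in> multiples G n" for n by (rule one_multiples)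
  let ?T = "torsion_part G (multiples G (p ^ k)) p"
  have "\<exists>d. idx G ?T (?T \<inter> multiples G (p ^ (k + 1))) = pw p d"
    by (rule elementary_index_pw[OF p torsion_part_multiples_subgroup subgroup_Int[OF torsion_part_multiples_subgroup multiples_subgroup]])
       (auto simp: torsion_part_iff one)
  thus "\<exists>d. ulm G p k = pw p d" unfolding ulm_def by (simp only: idx_Int_left[OF torsion_part_multiples_subgroup multiples_subgroup])
  show "\<exists>d. tfree G p k = pw p d" unfolding tfree_def
    by (rule elementary_index_pw[OF p multiples_subgroup multiples_subgroup multiples_dvd pow_p_multiples]) simp_all
  show "\<exists>d. tsize G p k = pw p d" unfolding tsize_def
    by (rule elementary_index_pw[OF p torsion_part_multiples_subgroup triv_subgroup]) (auto simp: torsion_part_iff one)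
qed

text \<open>
  Modulo the exponent \<open>e\<close>, the integer \<open>p^(k+1)\<close> generates the same
  ideal as some \<open>p^d\<close> with \<open>d \<le> k\<close>. Hence \<open>p^k G\<close> is
  divisible by \<open>p\<close> and free of \<open>p\<close>-torsion.
\<close>

lemma bounded_invariants:
  assumes e: "\<And>x. x \<in> carrier G \<Longrightarrow> x [^] int e = \<one>" and p: "prime p" and n: "\<not> p ^ Suc k dvd e"
  shows "ulm G p k = 1" "tfree G p k = 1" "tsize G p k = 1"
proof -
  have "gcd (p ^ Suc k) e dvd p ^ Suc k" by simp
  then obtain d where d: "d \<le> Suc k" "gcd (p ^ Suc k) e = p ^ d" using divides_primepow_nat[OF p] by blast
  have "d \<noteq> Suc k" using n d(2) by (metis gcd_dvd2)
  hence "d \<le> k" using d(1) by simp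
  obtain u v where "u * int (p ^ Suc k) + v * int e = gcd (int (p ^ Suc k)) (int e)" using bezout_int by blast
  hence uv: "int (p ^ d) = u * int (p ^ Suc k) + v * int e" using d(2) by (metis gcd_int_int_eq)
  have key: "y [^] int (p ^ d) = (y [^] int (p ^ Suc k)) [^] u" if y: "y \<in> carrier G" for y
  proof -
    have "y [^] int (p ^ d) = y [^] (int (p ^ Suc k) * u) \<otimes> y [^] (int e * v)"
      unfolding uv using y by (simp only: int_pow_mult mult.commute)
    also have "y [^] (int e * v) = \<one>" using y e[OF y] by (simp only: int_pow_pow[symmetric]) simp
    finally show ?thesis using y by (simp only: int_pow_pow r_one int_pow_closed)
  qed
  have pk: "y [^] int (p ^ k) = (y [^] int (p ^ d)) [^] int (p ^ (k - d))" if y: "y \<in> carrier G" for y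
    using y \<open>d \<le> k\<close> by (simp add: int_pow_pow power_add[symmetric])
  have t: "torsion_part G (multiples G (p ^ k)) p \<subseteq> {\<one>}"
  proof
    fix x assume x: "x \<in> torsion_part G (multiples G (p ^ k)) p"
    hence "x \<in> multiples G (p ^ k)" "x [^] int p = \<one>" by (simp_all add: torsion_part_iff)
    then obtain y where y: "y \<in> carrier G" "x = y [^] int (p ^ k)" unfolding multiples_iff by (elim bexE)
    have "y [^] int (p ^ Suc k) = x [^] int p" unfolding y(2) using y(1) by (simp add: int_pow_pow ac_simps)
    hence "y [^] int (p ^ Suc k) = \<one>" using \<open>x [^] int p = \<one>\<close> by simp
    hence "y [^] int (p ^ d) = \<one>" using key[OF y(1)] by (simp only: int_pow_one)
    hence "x = \<one>" unfolding y(2) pk[OF y(1)] by (simp only: int_pow_one)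
    thus "x \<in> {\<one>}" by simp
  qed
  show "ulm G p k = 1" unfolding ulm_def
    using t one_multiples idx_eq_1_iff[OF torsion_part_multiples_subgroup multiples_subgroup] by blast
  show "tsize G p k = 1" unfolding tsize_def using t idx_eq_1_iff[OF torsion_part_multiples_subgroup triv_subgroup] by blast
  have "multiples G (p ^ k) \<subseteq> multiples G (p ^ (k + 1))"
  proof
    fix x assume "x \<in> multiples G (p ^ k)"
    then obtain y where y: "y \<in> carrier G" "x = y [^] int (p ^ k)" unfolding multiples_iff by (rule bexE)
    have "y [^] int (p ^ Suc k) \<in> multiples G (p ^ (k + 1))" using y(1) by (intro pow_mult_in_multiples) simp_all
    hence "y [^] int (p ^ d) \<in> multiples G (p ^ (k + 1))" unfolding key[OF y(1)] by (rule pow_in_multiples)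
    thus "x \<in> multiples G (p ^ (k + 1))" unfolding y(2) pk[OF y(1)] by (rule pow_in_multiples)
  qed
  thus "tfree G p k = 1" unfolding tfree_def using idx_eq_1_iff[OF multiples_subgroup multiples_subgroup] by blast
qed

end

lemma eventual_dimension:
  assumes "ulm_recurrence U T" "\<And>k. \<exists>d. T k = pw p d"
  shows "\<exists>d k0. \<forall>k\<ge>k0. T k = pw p d"
proof -
  obtain k0 where k0: "\<forall>k\<ge>k0. T k = T k0" using ulm_recurrence.T_eventually_constant[OF assms(1)] by (rule exE)
  obtain d where d: "T k0 = pw p d" using assms(2)[of k0] by (rule exE)
  show ?thesis by (intro exI[of _ d] exI[of _ k0] allI impI) (simp only: k0[rule_format] d)
qed

text \<open>
  Read off \<open>\<alpha>\<close> from the Ulm quotients, \<open>\<beta>\<close> and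
  \<open>\<gamma>\<close> from the eventual values of the other two invariants, and let
  \<open>\<delta>\<close> record whether the exponent is bounded. If the Ulm quotients are trivial
  from some level on, the sum has the same eventual values; if not, both invariants are infinite
  at all levels in both groups.
\<close>

theorem szmielew:
  fixes A :: "('a, 'b) monoid_scheme"
  assumes A: "comm_group A"
  shows "\<exists>\<alpha> \<beta> \<gamma> \<delta>. elem_equiv A (szmielew_group \<alpha> \<beta> \<gamma> \<delta>) \<and>
    (\<forall>p k. prime p \<longrightarrow> ulm A p k = pw p (\<alpha> p (Suc k))) \<and>
    (\<forall>p. prime p \<longrightarrow> (\<exists>k0. \<forall>k\<ge>k0. tfree A p k = pw p (\<beta> p)))"
proof -
  interpret A: comm_group A by fact
  have "\<forall>p k. \<exists>d. prime p \<longrightarrow> ulm A p k = pw p d" using A.invariants_pw(1) by blast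
  then obtain a where "\<forall>p k. prime p \<longrightarrow> ulm A p k = pw p (a p k)" by metis
  hence a: "\<And>p k. prime p \<Longrightarrow> ulm A p k = pw p (a p k)" by blast
  define \<alpha> where "\<alpha> = (\<lambda>p n. a p (n - 1))"
  have \<alpha>: "ulm A p k = pw p (\<alpha> p (Suc k))" if "prime p" for p k using a[OF that] by (simp add: \<alpha>_def)
  have "\<forall>p. \<exists>d. prime p \<longrightarrow> (\<exists>k0. \<forall>k\<ge>k0. tfree A p k = pw p d)"
    using eventual_dimension[OF A.tfree_recurrence A.invariants_pw(2)] by blast
  then obtain \<beta> where \<beta>: "\<forall>p. prime p \<longrightarrow> (\<exists>k0. \<forall>k\<ge>k0. tfree A p k = pw p (\<beta> p))" by (rule choice[THEN exE])
  have "\<forall>p. \<exists>d. prime p \<longrightarrow> (\<exists>k0. \<forall>k\<ge>k0. tsize A p k = pw p d)"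
    using eventual_dimension[OF A.tsize_recurrence A.invariants_pw(3)] by blast
  then obtain \<gamma> where \<gamma>: "\<forall>p. prime p \<longrightarrow> (\<exists>k0. \<forall>k\<ge>k0. tsize A p k = pw p (\<gamma> p))" by (rule choice[THEN exE])
  \<comment> \<open>For groups of unbounded exponent, one summand of rationals suffices.\<close>
  define \<delta> :: enat where "\<delta> = (if bounded_exp A then 0 else 1)"
  define S where "S = szmielew_group \<alpha> \<beta> \<gamma> \<delta>"
  interpret S: comm_group S unfolding S_def by (rule szmielew_comm)
  have U: "ulm A p k = ulm S p k" if "prime p" for p k
    unfolding S_def szmielew_ulm[OF that] by (rule \<alpha>[OF that])
  have support: "\<alpha> p n = 0" if h: "prime p" "\<And>k. k \<ge> k0 \<Longrightarrow> ulm A p k = 1" "n > k" "k \<ge> k0" for p n k k0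
  proof -
    have m: "n = Suc (n - 1)" "n - 1 \<ge> k0" using h(3,4) by simp_all
    have "pw p (\<alpha> p (Suc (n - 1))) = 1" using h(2)[OF m(2)] \<alpha>[OF h(1), of "n - 1"] by simp
    hence "pw p (\<alpha> p n) = 1" using m(1) by simp
    thus ?thesis using pw_eq_1[OF prime_ge_2_nat[OF h(1)]] by simp
  qed
  have T: "tfree A p k = tfree S p k" if p: "prime p" for p k
  proof (rule ulm_recurrence_unique[OF A.tfree_recurrence])
    have "ulm S p = ulm A p" using U[OF p] by (simp add: fun_eq_iff)
    thus "ulm_recurrence (ulm A p) (tfree S p)" using S.tfree_recurrence[of p] by simp
    fix k0 assume k0: "\<And>k. k \<ge> k0 \<Longrightarrow> ulm A p k = 1"
    obtain k1 where k1: "\<forall>k\<ge>k1. tfree A p k = pw p (\<beta> p)" using \<beta> p by blast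
    have "tfree A p k = tfree S p k" if "k \<ge> max k0 k1" for k
    proof -
      have "tfree S p k = pw p (\<beta> p)" unfolding S_def
        by (rule szmielew_tfree[OF p]) (use support[OF p k0] that in auto)
      thus ?thesis using k1 that by simp
    qed
    thus "\<exists>m. tfree A p m = tfree S p m \<and> (\<forall>k\<ge>m. tfree A p k = tfree S p k)" by blast
  qed
  have D: "tsize A p k = tsize S p k" if p: "prime p" for p k
  proof (rule ulm_recurrence_unique[OF A.tsize_recurrence])
    have "ulm S p = ulm A p" using U[OF p] by (simp add: fun_eq_iff)
    thus "ulm_recurrence (ulm A p) (tsize S p)" using S.tsize_recurrence[of p] by simp
    fix k0 assume k0: "\<And>k. k \<ge> k0 \<Longrightarrow> ulm A p k = 1"
    obtain k1 where k1: "\<forall>k\<ge>k1. tsize A p k = pw p (\<gamma> p)" using \<gamma> p by blast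
    have "tsize A p k = tsize S p k" if "k \<ge> max k0 k1" for k
    proof -
      have "tsize S p k = pw p (\<gamma> p)" unfolding S_def
        by (rule szmielew_tsize[OF p]) (use support[OF p k0] that in auto)
      thus ?thesis using k1 that by simp
    qed
    thus "\<exists>m. tsize A p m = tsize S p m \<and> (\<forall>k\<ge>m. tsize A p k = tsize S p k)" by blast
  qed
  have B: "bounded_exp A \<longleftrightarrow> bounded_exp S"
  proof (cases "bounded_exp A")
    case False
    thus ?thesis using szmielew_unbounded by (simp add: S_def \<delta>_def)
  next
    case True
    then obtain e :: nat where e: "e > 0" "\<And>x. x \<in> carrier A \<Longrightarrow> x [^]\<^bsub>A\<^esub> e = \<one>\<^bsub>A\<^esub>" unfolding bounded_exp_def by blast
    have e': "x [^]\<^bsub>A\<^esub> int e = \<one>\<^bsub>A\<^esub>" if "x \<in> carrier A" for x using e(2)[OF that] by (simp only: int_pow_int)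
    have big: "\<not> p ^ Suc k dvd e" if "prime p" "k \<ge> e" for p k
    proof
      assume "p ^ Suc k dvd e"
      hence "p ^ Suc k \<le> e" using e(1) by (rule dvd_imp_le)
      moreover have "Suc k < p ^ Suc k" by (rule power_gt_expt) (use prime_gt_1_nat[OF that(1)] in simp)
      ultimately show False using that(2) by simp
    qed
    have "bounded_exp (szmielew_group \<alpha> \<beta> \<gamma> 0)"
    proof (rule szmielew_bounded[OF e(1)])
      fix p n assume h: "prime p" "n > (0::nat)" "\<alpha> p n \<noteq> 0"
      show "p ^ n dvd e"
      proof (rule ccontr)
        assume "\<not> p ^ n dvd e"
        hence "ulm A p (n - 1) = 1" using A.bounded_invariants(1)[OF e' h(1), of "n - 1"] h(2) by simp
        hence "pw p (\<alpha> p n) = 1" using \<alpha>[OF h(1), of "n - 1"] h(2) by simp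
        thus False using h(3) pw_eq_1[OF prime_ge_2_nat[OF h(1)]] by simp
      qed
    next
      fix p :: nat assume p: "prime p"
      obtain k1 where k1: "\<forall>k\<ge>k1. tfree A p k = pw p (\<beta> p)" using \<beta> p by blast
      have "tfree A p (max k1 e) = 1" by (rule A.bounded_invariants(2)[OF e' p big[OF p]]) simp_all
      hence "pw p (\<beta> p) = 1" using k1[rule_format, of "max k1 e"] by simp
      thus "\<beta> p = 0" using pw_eq_1[OF prime_ge_2_nat[OF p]] by simp
      obtain k2 where k2: "\<forall>k\<ge>k2. tsize A p k = pw p (\<gamma> p)" using \<gamma> p by blast
      have "tsize A p (max k2 e) = 1" by (rule A.bounded_invariants(3)[OF e' p big[OF p]]) simp_all
      hence "pw p (\<gamma> p) = 1" using k2[rule_format, of "max k2 e"] by simp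
      thus "\<gamma> p = 0" using pw_eq_1[OF prime_ge_2_nat[OF p]] by simp
    qed
    thus ?thesis using True by (simp add: S_def \<delta>_def)
  qed
  interpret same_invariants A S by unfold_locales (use U T D B in auto)
  show ?thesis using elem_equiv \<alpha> \<beta> unfolding S_def by blast
qed

abbreviation beta_infinite :: "(nat \<Rightarrow> enat) \<Rightarrow> nat set" where
  "beta_infinite \<beta> \<equiv> {p. prime p \<and> \<beta> p = \<infinity>}"

abbreviation alpha_infinite :: "(nat \<Rightarrow> nat \<Rightarrow> enat) \<Rightarrow> (nat \<times> nat) set" where
  "alpha_infinite \<alpha> \<equiv> {(p, n). prime p \<and> n > 0 \<and> \<alpha> p n = \<infinity>}"

abbreviation alpha_unbounded :: "(nat \<Rightarrow> nat \<Rightarrow> enat) \<Rightarrow> nat set" where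
  "alpha_unbounded \<alpha> \<equiv> {p. prime p \<and> infinite {n. n > 0 \<and> \<alpha> p n \<noteq> 0}}"

lemma tfree_0: "comm_group G \<Longrightarrow> tfree G p 0 = idx G (carrier G) (multiples G p)"
  by (simp add: tfree_def comm_group.multiples_1)

text \<open>
  For a prime outside the three exceptional sets, all Ulm quotients are finite and
  \<open>tfree\<close> has a finite value at a level beyond the last cyclic summand, so by the
  recurrence it is finite at level 0.
\<close>

lemma szmielew_finite_conditions:
  assumes "finite (beta_infinite \<beta>)" "finite (alpha_infinite \<alpha>)"
    "finite (alpha_unbounded \<alpha>)"
  shows "finite_conditions (szmielew_group \<alpha> \<beta> \<gamma> \<delta>)"
  unfolding finite_conditions_def
proof (intro conjI allI impI)
  let ?S = "szmielew_group \<alpha> \<beta> \<gamma> \<delta>"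
  interpret S: comm_group ?S by (rule szmielew_comm)
  let ?B = "beta_infinite \<beta> \<union> fst ` alpha_infinite \<alpha> \<union> alpha_unbounded \<alpha>"
  have "{p. prime p \<and> idx ?S (carrier ?S) (multiples ?S p) = \<infinity>} \<subseteq> ?B"
  proof (intro subsetI, rule ccontr)
    fix p assume "p \<in> {p. prime p \<and> idx ?S (carrier ?S) (multiples ?S p) = \<infinity>}" and out: "p \<notin> ?B"
    hence p: "prime p" "tfree ?S p 0 = \<infinity>" by (simp_all add: tfree_0[OF szmielew_comm])
    have "p \<notin> beta_infinite \<beta>" "p \<notin> alpha_unbounded \<alpha>"
      using out by (simp_all only: Un_iff de_Morgan_disj simp_thms)
    hence fin: "finite {n. n > 0 \<and> \<alpha> p n \<noteq> 0}" and b: "\<beta> p \<noteq> \<infinity>" using p(1) by simp_all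
    have al: "\<alpha> p (Suc k) \<noteq> \<infinity>" for k
    proof
      assume "\<alpha> p (Suc k) = \<infinity>"
      hence "(p, Suc k) \<in> alpha_infinite \<alpha>" using p(1) by simp
      hence "p \<in> fst ` alpha_infinite \<alpha>" by (rule rev_image_eqI) simp
      thus False using out by (simp only: Un_iff simp_thms)
    qed
    obtain k where k: "\<forall>n\<in>{n. n > 0 \<and> \<alpha> p n \<noteq> 0}. n \<le> k"
      using fin unfolding finite_nat_set_iff_bounded_le by (rule exE)
    have "tfree ?S p k = pw p (\<beta> p)" 
    proof (rule szmielew_tfree[OF p(1)])
      fix n assume n: "n > k"
      show "\<alpha> p n = 0"
      proof (rule ccontr)
        assume "\<alpha> p n \<noteq> 0"
        hence "n \<le> k" using k n by simp
        thus False using n by simp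
      qed
    qed
    hence "tfree ?S p k \<noteq> \<infinity>" using b by simp
    moreover have "ulm ?S p k \<noteq> \<infinity>" for k using szmielew_ulm[OF p(1), of \<alpha> \<beta> \<gamma> \<delta> k] al by simp
    ultimately have "tfree ?S p 0 \<noteq> \<infinity>" using ulm_recurrence.T_finite[OF S.tfree_recurrence] by blast
    thus False using p(2) by blast
  qed
  moreover have "finite ?B" using assms by simp
  ultimately show "finite {p. prime p \<and> idx ?S (carrier ?S) (multiples ?S p) = \<infinity>}" by (rule finite_subset)
  fix p :: nat assume p: "prime p"
  have "{n. ulm ?S p n = \<infinity>} \<subseteq> (\<lambda>x. snd x - 1) ` alpha_infinite \<alpha>"
  proof
    fix n assume "n \<in> {n. ulm ?S p n = \<infinity>}"
    hence "(p, Suc n) \<in> alpha_infinite \<alpha>" using szmielew_ulm[OF p, of \<alpha> \<beta> \<gamma> \<delta> n] p by simp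
    thus "n \<in> (\<lambda>x. snd x - 1) ` alpha_infinite \<alpha>" by (rule rev_image_eqI) simp
  qed
  thus "finite {n. ulm ?S p n = \<infinity>}" using assms(2) by (meson finite_imageI finite_subset)
qed

text \<open>
  If \<open>G/pG\<close> is finite, then \<open>\<beta> p\<close> and all \<open>\<alpha> p
  n\<close> are finite and only finitely many \<open>\<alpha> p n\<close> are nonzero, since
  otherwise the recurrence makes \<open>tfree\<close> infinite at level 0. For each of the
  finitely many other primes, finiteness of almost all Ulm quotients leaves finitely many infinite
  \<open>\<alpha> p n\<close>.
\<close>

lemma finite_conditions_szmielew:
  assumes A: "comm_group A" and fc: "finite_conditions A"
    and U: "\<And>p k. prime p \<Longrightarrow> ulm A p k = pw p (\<alpha> p (Suc k))"
    and T: "\<And>p. prime p \<Longrightarrow> \<exists>k0. \<forall>k\<ge>k0. tfree A p k = pw p (\<beta> p)"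
  shows "finite (beta_infinite \<beta>)" "finite (alpha_infinite \<alpha>)"
    "finite (alpha_unbounded \<alpha>)"
proof -
  interpret comm_group A by fact
  let ?Q = "{p. prime p \<and> tfree A p 0 = \<infinity>}"
  have Q: "finite ?Q" using fc by (simp add: finite_conditions_def tfree_0[OF A])
  have le: "tfree A p k \<le> tfree A p 0" for p k
    using ulm_recurrence.T_antimono[OF tfree_recurrence, of p 0 k] by simp
  have "beta_infinite \<beta> \<subseteq> ?Q"
  proof
    fix p assume "p \<in> beta_infinite \<beta>"
    hence p: "prime p" "\<beta> p = \<infinity>" by simp_all
    then obtain k where "tfree A p k = pw p (\<beta> p)" using T by blast
    hence "tfree A p k = \<infinity>" using p(2) by simp
    hence "tfree A p 0 = \<infinity>" using le[of p k] by simp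
    thus "p \<in> ?Q" using p(1) by simp
  qed
  thus "finite (beta_infinite \<beta>)" using Q by (rule finite_subset)
  have "alpha_unbounded \<alpha> \<subseteq> ?Q"
  proof
    fix p assume "p \<in> alpha_unbounded \<alpha>"
    hence p: "prime p" "infinite {n. n > 0 \<and> \<alpha> p n \<noteq> 0}" by simp_all
    have "{n. n > 0 \<and> \<alpha> p n \<noteq> 0} \<subseteq> Suc ` {k. ulm A p k \<noteq> 1}"
    proof
      fix n assume "n \<in> {n. n > 0 \<and> \<alpha> p n \<noteq> 0}"
      then obtain m where m: "n = Suc m" "\<alpha> p (Suc m) \<noteq> 0" by (cases n) auto
      have "ulm A p m \<noteq> 1" unfolding U[OF p(1)] using m(2) pw_eq_1[OF prime_ge_2_nat[OF p(1)]] by simp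
      thus "n \<in> Suc ` {k. ulm A p k \<noteq> 1}" using m(1) by blast
    qed
    hence "infinite {k. ulm A p k \<noteq> 1}" using p(2) by (meson finite_imageI finite_subset)
    thus "p \<in> ?Q" using ulm_recurrence.T_infinite[OF tfree_recurrence] p(1) by simp
  qed
  thus "finite (alpha_unbounded \<alpha>)" using Q by (rule finite_subset)
  have "alpha_infinite \<alpha> \<subseteq> (\<lambda>(p, k). (p, Suc k)) ` (Sigma ?Q (\<lambda>p. {k. ulm A p k = \<infinity>}))"
  proof
    fix x assume "x \<in> alpha_infinite \<alpha>"
    then obtain p n where x: "x = (p, n)" "prime p" "n > 0" "\<alpha> p n = \<infinity>" by blast
    then obtain k where k: "n = Suc k" by (cases n) auto
    have u: "ulm A p k = \<infinity>" unfolding U[OF x(2)] using x(4) k by simp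
    have "tfree A p (Suc k) \<ge> 1" by (rule invariants_ge_1)
    hence "tfree A p k = \<infinity>" using tfree_rec[of p k] u by (auto simp: imult_is_infinity)
    hence "tfree A p 0 = \<infinity>" using le[of p k] by simp
    hence "(p, k) \<in> Sigma ?Q (\<lambda>p. {k. ulm A p k = \<infinity>})" using u x(2) by simp
    thus "x \<in> (\<lambda>(p, k). (p, Suc k)) ` (Sigma ?Q (\<lambda>p. {k. ulm A p k = \<infinity>}))" using x(1) k by force
  qed
  moreover have "finite (Sigma ?Q (\<lambda>p. {k. ulm A p k = \<infinity>}))"
    using Q fc by (intro finite_SigmaI) (auto simp: finite_conditions_def)
  ultimately show "finite (alpha_infinite \<alpha>)" by (meson finite_imageI finite_subset)
qed

theorem theorem5p1:
  fixes A :: "'a monoid"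
  assumes "comm_group A"
  shows "(strong A \<longleftrightarrow>
            finite {p. prime p \<and> infinite (carrier (A Mod (multiples A p)))} \<and>
            (\<forall>p. prime p \<longrightarrow> finite {n. infinite (carrier (ulm_quotient A p n))}))
       \<and> (strong A \<longleftrightarrow>
            (\<exists>\<alpha> \<beta> \<gamma> \<delta>.
               elem_equiv A (szmielew_group \<alpha> \<beta> \<gamma> \<delta>) \<and>
               finite {p. prime p \<and> \<beta> p = \<infinity>} \<and>
               finite {(p, n). prime p \<and> n > 0 \<and> \<alpha> p n = \<infinity>} \<and>
               finite {p. prime p \<and> infinite {n. n > 0 \<and> \<alpha> p n \<noteq> 0}}))"
proof
  interpret comm_group A by fact
  show "strong A \<longleftrightarrow>
            finite {p. prime p \<and> infinite (carrier (A Mod (multiples A p)))} \<and>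
            (\<forall>p. prime p \<longrightarrow> finite {n. infinite (carrier (ulm_quotient A p n))})"
    unfolding infinite_FactGroup_iff infinite_ulm_quotient_iff
    using strong_iff_finite_conditions[OF assms] by (simp only: finite_conditions_def)
  show "strong A \<longleftrightarrow>
            (\<exists>\<alpha> \<beta> \<gamma> \<delta>.
               elem_equiv A (szmielew_group \<alpha> \<beta> \<gamma> \<delta>) \<and>
               finite (beta_infinite \<beta>) \<and>
               finite (alpha_infinite \<alpha>) \<and>
               finite (alpha_unbounded \<alpha>))"
  proof
    assume "strong A"
    hence fc: "finite_conditions A" using strong_iff_finite_conditions[OF assms] by blast
    obtain \<alpha> \<beta> \<gamma> \<delta> where s: "elem_equiv A (szmielew_group \<alpha> \<beta> \<gamma> \<delta>)"
      "\<forall>p k. prime p \<longrightarrow> ulm A p k = pw p (\<alpha> p (Suc k))"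
      "\<forall>p. prime p \<longrightarrow> (\<exists>k0. \<forall>k\<ge>k0. tfree A p k = pw p (\<beta> p))"
      using szmielew[OF assms] by (elim exE conjE)
    have "finite (beta_infinite \<beta>)" "finite (alpha_infinite \<alpha>)"
      "finite (alpha_unbounded \<alpha>)"
      using finite_conditions_szmielew[OF assms fc, of \<alpha> \<beta>] s(2,3) by blast+
    thus "\<exists>\<alpha> \<beta> \<gamma> \<delta>.
               elem_equiv A (szmielew_group \<alpha> \<beta> \<gamma> \<delta>) \<and>
               finite (beta_infinite \<beta>) \<and>
               finite (alpha_infinite \<alpha>) \<and>
               finite (alpha_unbounded \<alpha>)" using s(1) by blast
  next
    assume "\<exists>\<alpha> \<beta> \<gamma> \<delta>.
               elem_equiv A (szmielew_group \<alpha> \<beta> \<gamma> \<delta>) \<and>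
               finite (beta_infinite \<beta>) \<and>
               finite (alpha_infinite \<alpha>) \<and>
               finite (alpha_unbounded \<alpha>)"
    then obtain \<alpha> \<beta> \<gamma> \<delta> where s: "elem_equiv A (szmielew_group \<alpha> \<beta> \<gamma> \<delta>)"
      and f: "finite (beta_infinite \<beta>)" "finite (alpha_infinite \<alpha>)"
        "finite (alpha_unbounded \<alpha>)" by (elim exE conjE)
    have "finite_conditions A"
      using szmielew_finite_conditions[OF f, of \<gamma> \<delta>] elem_equiv_finite_conditions[OF assms szmielew_comm s] by blast
    thus "strong A" using strong_iff_finite_conditions[OF assms] by blast
  qed
qed

end
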